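(* Let $(\mathscr P)$ be the Cauchy problem of an arbitrary PDE system in $\mathbb R^d$ which satisfies the following four hypotheses. (Local existence) For any $u_0\in H^1(\mathbb R^d)$ (if some other conditions, such as $\operatorname{div} u=0$, are included in $(\mathscr P)$, then $u_0$ is required to satisfy the same conditions), there exists a unique solution $u$ to $(\mathscr P)$ on $\mathbb R^d\times(0,T_0)$ with initial data $u_0$, and for any $T<T_0$ there hold $$u\in C([0,T];H^1(\mathbb R^d))\cap L^2(0,T;H^2(\mathbb R^d)),\qquad \partial_t u\in L^2(0,T;L^2(\mathbb R^d)),$$ where $T_0$ is a positive number depending only on the upper bound of the initial norm $\|u_0\|_{H^1(\mathbb R^d)}$. (Joint property) For any two solutions $u_1$ and $u_2$ to $(\mathscr P)$ on $\mathbb R^d\times(0,T_1)$ and on $\mathbb R^d\times(T_1,T_2)$, respectively, with initial data $u_0$ and $u_1(T_1)$, respectively, such that $u_1\in C([0,T_1];H^1(\mathbb R^d))$ and $u_2\in C([T_1,T_2);H^1(\mathbb R^d))$, the joint function $u$ defined by $u(x,t)=u_1(x,t)$ for $t\in[0,T_1)$ and $u(x,t)=u_2(x,t)$ for $t\in[T_1,T_2)$ is a solution to $(\mathscr P)$ on $\mathbb R^d\times(0,T_2)$ with initial data $u_0$. (Basic energy) Any solution $u$ to $(\mathscr P)$ on $\mathbb R^d\times(0,T)$ satisfies $\sup_{0\le s\le t}\|u(s)\|_{L^2(\mathbb R^d)}\le\mathcal M(t)$ for any $t\in(0,T)$, where $\mathcal M$ is a continuous nondecreasing function on $[0,\infty)$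 determined by the initial data. (First energy inequality) There are two positive constants $c_1,c_1'$ such that any solution $u$ to $(\mathscr P)$ on $\mathbb R^d\times(0,T)$ satisfies $$\frac{d}{dt}\|\nabla u\|_{L^2(\mathbb R^d)}^2+c_1\|\Delta u\|_{L^2(\mathbb R^d)}^2\le c_1'\int_{\mathbb R^d}|u|^2|\nabla u|^2\,dx,\qquad t\in(0,T).$$ Let $T_*>0$ be given and let $u$ be a solution to $(\mathscr P)$ on $\mathbb R^d\times(0,T_* )$ satisfying $$u\in L^q(0,T_*;B^{-s}_{p,\infty}(\mathbb R^d))$$ for some constants $s,p,q$ such that $$\frac2q+\frac dp=1-s,\qquad p\in\Big(\frac{d}{1-s},\infty\Big],\qquad s\in(0,1).$$ Then the solution $u$ can be extended uniquely beyond $T_*$.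
   Context: Besov spaces: fix nonnegative radial Schwartz functions $\chi,\phi$ on $\mathbb R^d$ supported in $\{|\xi|\le\frac43\}$ and $\{\frac34\le|\xi|\le\frac83\}$ respectively, with $\chi(\xi)+\sum_{j\ge0}\phi(2^{-j}\xi)=1$ for all $\xi\in\mathbb R^d$. Define the Fourier multipliers $\Delta_{-1}f=\chi(D)f$, $\Delta_jf=\phi(2^{-j}D)f$ for $j\ge0$, and $\Delta_jf=0$ for $j\le-2$. For $\sigma\in\mathbb R$ and $1\le p\le\infty$, the inhomogeneous Besov norm is $\|f\|_{B^\sigma_{p,\infty}}=\sup_{j\ge-1}2^{j\sigma}\|\Delta_jf\|_{L^p}$. Conventions on $(\mathscr P)$: the concrete form of the PDE system plays no role; $(\mathscr P)$ is only assumed to have a notion of (possibly vector-valued) solution on $\mathbb R^d\times(T_1,T_2)$ with given initial data at time $T_1$. Solutions on $\mathbb R^d\times(T_1,T_2)$ are understood in the regularity class $u\in C([T_1,T];H^1(\mathbb R^d))\cap L^2(T_1,T;H^2(\mathbb R^d))$, $\partial_tu\in L^2(T_1,T;L^2(\mathbb R^d))$ for every $T\in(T_1,T_2)$. The restriction of a solution to a smaller time interval $(T_1',T_2')$ is a solution there with initial data $u(T_1')$, and at each time a solution satisfies any side conditions (such as $\operatorname{div}u=0$) included in $(\mathscr P)$. The local existence hypothesis and the joint property are understood with any initial time in place of $0$. That $T_0$ depends only on the upper bound of the initial norm means that to each $K>0$ there corresponds $T_0=T_0(K)>0$ such that the local existence and uniqueness statement holds on $(0,T_0(K))$ for all admissible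 data with $\|u_0\|_{H^1}\le K$. "$u$ can be extended uniquely beyond $T_*$" means: there exist $T>T_*$ and a unique solution $\tilde u$ to $(\mathscr P)$ on $\mathbb R^d\times(0,T)$ which coincides with $u$ on $\mathbb R^d\times(0,T_* )$. *)

theory Defs
  imports "HOL-Analysis.Analysis" "HOL-Probability.Essential_Supremum"
begin

text \<open>
  The space \<open>\<real>\<^sup>d\<close> is a type \<open>'a::euclidean_space\<close>, \<open>d = DIM('a)\<close>; functions take values in a
  type \<open>'b::euclidean_space\<close>, so that real and complex vector-valued unknowns are covered.
  Elements of Lebesgue and Sobolev spaces are represented by Borel functions, and equality between
  them is always equality almost everywhere.
\<close>

section \<open>Smooth functions, Schwartz functions and test functions\<close>

definition partial_deriv :: "'e::euclidean_space \<Rightarrow> ('e \<Rightarrow> 'f::real_normed_vector) \<Rightarrow> 'e \<Rightarrow> 'f" where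
  "partial_deriv i f x = frechet_derivative f (at x) i"

definition smooth :: "('e::euclidean_space \<Rightarrow> 'f::real_normed_vector) \<Rightarrow> bool" where
  "smooth f \<longleftrightarrow> (\<forall>is. set is \<subseteq> Basis \<longrightarrow> (\<forall>x. foldr partial_deriv is f differentiable (at x)))"

definition schwartz :: "('e::euclidean_space \<Rightarrow> 'f::real_normed_vector) \<Rightarrow> bool" where
  "schwartz f \<longleftrightarrow> smooth f \<and>
     (\<forall>is n. set is \<subseteq> Basis \<longrightarrow>
        bounded (range (\<lambda>x. (1 + norm x) ^ n *\<^sub>R foldr partial_deriv is f x)))"

definition test_function :: "'e::euclidean_space set \<Rightarrow> ('e \<Rightarrow> real) \<Rightarrow> bool" where
  "test_function \<Omega> \<psi> \<longleftrightarrow> smooth \<psi> \<and>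
     compact (closure {x. \<psi> x \<noteq> 0}) \<and> closure {x. \<psi> x \<noteq> 0} \<subseteq> \<Omega>"

section \<open>Lebesgue and Sobolev spaces\<close>

definition Lp_norm :: "ereal \<Rightarrow> ('a::euclidean_space \<Rightarrow> 'b::euclidean_space) \<Rightarrow> ennreal" where
  "Lp_norm p f =
     (if p = \<infinity> then esssup lborel (\<lambda>x. ennreal (norm (f x)))
      else let r = real_of_ereal p; I = (\<integral>\<^sup>+ x. ennreal (norm (f x) powr r) \<partial>lborel)
           in if I = \<infinity> then \<infinity> else ennreal (enn2real I powr (1 / r)))"

definition L2 :: "('a::euclidean_space \<Rightarrow> 'b::euclidean_space) \<Rightarrow> bool" where
  "L2 f \<longleftrightarrow> f \<in> borel_measurable borel \<and> integrable lborel (\<lambda>x. (norm (f x))\<^sup>2)"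

definition L2_norm :: "('a::euclidean_space \<Rightarrow> 'b::euclidean_space) \<Rightarrow> real" where
  "L2_norm f = sqrt (\<integral>x. (norm (f x))\<^sup>2 \<partial>lborel)"

definition has_weak_deriv ::
    "'a::euclidean_space \<Rightarrow> ('a \<Rightarrow> 'b::euclidean_space) \<Rightarrow> ('a \<Rightarrow> 'b) \<Rightarrow> bool" where
  "has_weak_deriv i f g \<longleftrightarrow>
     (\<forall>\<psi>. test_function UNIV \<psi> \<longrightarrow>
        (\<integral>x. partial_deriv i \<psi> x *\<^sub>R f x \<partial>lborel) = - (\<integral>x. \<psi> x *\<^sub>R g x \<partial>lborel))"

definition weak_deriv ::
    "'a::euclidean_space \<Rightarrow> ('a \<Rightarrow> 'b::euclidean_space) \<Rightarrow> 'a \<Rightarrow> 'b" where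
  "weak_deriv i f = (SOME g. L2 g \<and> has_weak_deriv i f g)"

text \<open>\<open>H\<^sup>k = W\<^sup>k\<^sup>,\<^sup>2\<close>; only \<open>k \<le> 2\<close> is used.\<close>

primrec sobolev :: "nat \<Rightarrow> ('a::euclidean_space \<Rightarrow> 'b::euclidean_space) \<Rightarrow> bool" where
  "sobolev 0 f \<longleftrightarrow> L2 f"
| "sobolev (Suc k) f \<longleftrightarrow> L2 f \<and> (\<forall>i\<in>Basis. \<exists>g. sobolev k g \<and> has_weak_deriv i f g)"

primrec sobolev_norm_sq ::
    "nat \<Rightarrow> ('a::euclidean_space \<Rightarrow> 'b::euclidean_space) \<Rightarrow> real" where
  "sobolev_norm_sq 0 f = (L2_norm f)\<^sup>2"
| "sobolev_norm_sq (Suc k) f =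
     (L2_norm f)\<^sup>2 + (\<Sum>i\<in>Basis. sobolev_norm_sq k (weak_deriv i f))"

definition sobolev_norm :: "nat \<Rightarrow> ('a::euclidean_space \<Rightarrow> 'b::euclidean_space) \<Rightarrow> real" where
  "sobolev_norm k f = sqrt (sobolev_norm_sq k f)"

definition norm_grad :: "('a::euclidean_space \<Rightarrow> 'b::euclidean_space) \<Rightarrow> 'a \<Rightarrow> real" where
  "norm_grad f x = sqrt (\<Sum>i\<in>Basis. (norm (weak_deriv i f x))\<^sup>2)"

definition laplacian :: "('a::euclidean_space \<Rightarrow> 'b::euclidean_space) \<Rightarrow> 'a \<Rightarrow> 'b" where
  "laplacian f x = (\<Sum>i\<in>Basis. weak_deriv i (weak_deriv i f) x)"

section \<open>Besov norms\<close>

definition fourier :: "('a::euclidean_space \<Rightarrow> complex) \<Rightarrow> 'a \<Rightarrow> complex" where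
  "fourier \<psi> \<xi> = (\<integral>x. cis (- (x \<bullet> \<xi>)) * \<psi> x \<partial>lborel)"

definition inv_fourier :: "('a::euclidean_space \<Rightarrow> complex) \<Rightarrow> 'a \<Rightarrow> complex" where
  "inv_fourier \<psi> x =
     complex_of_real (1 / (2 * pi) ^ DIM('a)) * (\<integral>\<xi>. cis (x \<bullet> \<xi>) * \<psi> \<xi> \<partial>lborel)"

text \<open>
  \<open>g = m(D) f = \<F>\<^sup>-\<^sup>1 (m \<F> f)\<close> in the sense of tempered distributions, componentwise in \<open>'b\<close>: since the
  transforms of a tempered distribution are defined by duality, the pairing of
  \<open>\<F>\<^sup>-\<^sup>1 (m \<F> f)\<close> with \<open>\<psi>\<close> is the pairing of \<open>f\<close> with \<open>\<F> (m \<F>\<^sup>-\<^sup>1 \<psi>)\<close>. The symbols \<open>m\<close> used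
  below are radial, so \<open>m(D)\<close> maps real components to real components.
\<close>

definition is_multiplier ::
    "('a::euclidean_space \<Rightarrow> real) \<Rightarrow> ('a \<Rightarrow> 'b::euclidean_space) \<Rightarrow> ('a \<Rightarrow> 'b) \<Rightarrow> bool" where
  "is_multiplier m f g \<longleftrightarrow> g \<in> borel_measurable borel \<and>
     (\<forall>\<psi>. schwartz \<psi> \<longrightarrow> (\<forall>b\<in>Basis.
        let \<psi>' = fourier (\<lambda>\<xi>. complex_of_real (m \<xi>) * inv_fourier \<psi> \<xi>) in
          integrable lborel (\<lambda>x. complex_of_real (g x \<bullet> b) * \<psi> x) \<and>
          integrable lborel (\<lambda>x. complex_of_real (f x \<bullet> b) * \<psi>' x) \<and>
          (\<integral>x. complex_of_real (g x \<bullet> b) * \<psi> x \<partial>lborel) =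
          (\<integral>x. complex_of_real (f x \<bullet> b) * \<psi>' x \<partial>lborel)))"

definition fourier_multiplier ::
    "('a::euclidean_space \<Rightarrow> real) \<Rightarrow> ('a \<Rightarrow> 'b::euclidean_space) \<Rightarrow> 'a \<Rightarrow> 'b" where
  "fourier_multiplier m f = (SOME g. is_multiplier m f g)"

definition littlewood_paley ::
    "('a::euclidean_space \<Rightarrow> real) \<Rightarrow> ('a \<Rightarrow> real) \<Rightarrow> bool" where
  "littlewood_paley chi phi \<longleftrightarrow>
     schwartz chi \<and> schwartz phi \<and>
     (\<forall>\<xi>. 0 \<le> chi \<xi>) \<and> (\<forall>\<xi>. 0 \<le> phi \<xi>) \<and>
     (\<forall>\<xi> \<eta>. norm \<xi> = norm \<eta> \<longrightarrow> chi \<xi> = chi \<eta>) \<and> (\<forall>\<xi> \<eta>. norm \<xi> = norm \<eta> \<longrightarrow> phi \<xi> = phi \<eta>) \<and>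
     (\<forall>\<xi>. chi \<xi> \<noteq> 0 \<longrightarrow> norm \<xi> \<le> 4 / 3) \<and>
     (\<forall>\<xi>. phi \<xi> \<noteq> 0 \<longrightarrow> 3 / 4 \<le> norm \<xi> \<and> norm \<xi> \<le> 8 / 3) \<and>
     (\<forall>\<xi>. summable (\<lambda>j. phi ((1 / 2) ^ j *\<^sub>R \<xi>)) \<and> chi \<xi> + (\<Sum>j. phi ((1 / 2) ^ j *\<^sub>R \<xi>)) = 1)"

definition dyadic_block ::
    "('a::euclidean_space \<Rightarrow> real) \<Rightarrow> ('a \<Rightarrow> real) \<Rightarrow> int \<Rightarrow> ('a \<Rightarrow> 'b::euclidean_space) \<Rightarrow> 'a \<Rightarrow> 'b" where
  "dyadic_block chi phi j f =
     (if j = -1 then fourier_multiplier chi f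
      else if j \<ge> 0 then fourier_multiplier (\<lambda>\<xi>. phi ((2 powi (- j)) *\<^sub>R \<xi>)) f
      else (\<lambda>x. 0))"

definition besov_norm ::
    "('a::euclidean_space \<Rightarrow> real) \<Rightarrow> ('a \<Rightarrow> real) \<Rightarrow> real \<Rightarrow> ereal \<Rightarrow>
     ('a \<Rightarrow> 'b::euclidean_space) \<Rightarrow> ennreal" where
  "besov_norm chi phi \<sigma> p f =
     (SUP j\<in>{-1..}. ennreal (2 powr (real_of_int j * \<sigma>)) * Lp_norm p (dyadic_block chi phi j f))"

section \<open>Time-dependent functions\<close>

text \<open>A function on \<open>\<real>\<^sup>d \<times> I\<close> is a curve \<open>u :: real \<Rightarrow> 'a \<Rightarrow> 'b\<close>, of which only the values at times in
  \<open>I\<close> matter.\<close>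

definition same_on :: "real set \<Rightarrow> (real \<Rightarrow> 'a::euclidean_space \<Rightarrow> 'b::euclidean_space) \<Rightarrow>
    (real \<Rightarrow> 'a \<Rightarrow> 'b) \<Rightarrow> bool" where
  "same_on I u v \<longleftrightarrow> (\<forall>t\<in>I. AE x in lborel. u t x = v t x)"

definition continuous_H1 ::
    "real set \<Rightarrow> (real \<Rightarrow> 'a::euclidean_space \<Rightarrow> 'b::euclidean_space) \<Rightarrow> bool" where
  "continuous_H1 I u \<longleftrightarrow>
     (\<forall>t\<in>I. sobolev 1 (u t)) \<and>
     (\<forall>t\<in>I. ((\<lambda>r. sobolev_norm 1 (\<lambda>x. u r x - u t x)) \<longlongrightarrow> 0) (at t within I))"

text \<open>Where \<open>u\<close> is also continuous into \<open>H\<^sup>1\<close>, the strong measurability that is part of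
  \<open>u \<in> L\<^sup>2(a,b;H\<^sup>2)\<close> is automatic, so only the norm is mentioned.\<close>

definition L2_H2 ::
    "real \<Rightarrow> real \<Rightarrow> (real \<Rightarrow> 'a::euclidean_space \<Rightarrow> 'b::euclidean_space) \<Rightarrow> bool" where
  "L2_H2 a b u \<longleftrightarrow>
     (AE t in lborel. t \<in> {a<..<b} \<longrightarrow> sobolev 2 (u t)) \<and>
     (\<lambda>t. (sobolev_norm 2 (u t))\<^sup>2) absolutely_integrable_on {a<..<b}"

text \<open>\<open>\<partial>\<^sub>t u \<in> L\<^sup>2(a,b;L\<^sup>2)\<close>, the time derivative being taken in the sense of distributions on
  \<open>(a,b) \<times> \<real>\<^sup>d\<close>. The pairing with \<open>u\<close> is an iterated integral because the representatives \<open>u t\<close>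
  are chosen separately for each \<open>t\<close>, so \<open>u\<close> need not be jointly measurable.\<close>

definition time_deriv_L2_L2 ::
    "real \<Rightarrow> real \<Rightarrow> (real \<Rightarrow> 'a::euclidean_space \<Rightarrow> 'b::euclidean_space) \<Rightarrow> bool" where
  "time_deriv_L2_L2 a b u \<longleftrightarrow>
     (\<exists>w :: real \<Rightarrow> 'a \<Rightarrow> 'b.
        (\<lambda>z. w (fst z) (snd z)) \<in> borel_measurable borel \<and>
        set_integrable lborel ({a<..<b} \<times> UNIV) (\<lambda>z. (norm (w (fst z) (snd z)))\<^sup>2) \<and>
        (\<forall>\<psi>. test_function ({a<..<b} \<times> UNIV) \<psi> \<longrightarrow>
           (\<integral>t. (\<integral>x. partial_deriv (1, 0) \<psi> (t, x) *\<^sub>R u t x \<partial>lborel) \<partial>lborel) =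
           - (\<integral>t. (\<integral>x. \<psi> (t, x) *\<^sub>R w t x \<partial>lborel) \<partial>lborel)))"

definition regularity_class ::
    "real \<Rightarrow> real \<Rightarrow> (real \<Rightarrow> 'a::euclidean_space \<Rightarrow> 'b::euclidean_space) \<Rightarrow> bool" where
  "regularity_class T\<^sub>1 T\<^sub>2 u \<longleftrightarrow>
     (\<forall>T\<in>{T\<^sub>1<..<T\<^sub>2}. continuous_H1 {T\<^sub>1..T} u \<and> L2_H2 T\<^sub>1 T u \<and> time_deriv_L2_L2 T\<^sub>1 T u)"

definition Lq_besov ::
    "('a::euclidean_space \<Rightarrow> real) \<Rightarrow> ('a \<Rightarrow> real) \<Rightarrow> real \<Rightarrow> real \<Rightarrow> ereal \<Rightarrow> real \<Rightarrow>
     real \<Rightarrow> (real \<Rightarrow> 'a \<Rightarrow> 'b::euclidean_space) \<Rightarrow> bool" where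
  "Lq_besov chi phi q \<sigma> p a b u \<longleftrightarrow>
     (AE t in lborel. t \<in> {a<..<b} \<longrightarrow> besov_norm chi phi \<sigma> p (u t) < \<infinity>) \<and>
     (\<lambda>t. enn2real (besov_norm chi phi \<sigma> p (u t)) powr q) absolutely_integrable_on {a<..<b}"

section \<open>Abstract Cauchy problems\<close>

text \<open>
  A Cauchy problem is given by the set \<open>A\<close> of functions on \<open>\<real>\<^sup>d\<close> satisfying its side conditions
  (\<open>A = UNIV\<close> if there are none) and a predicate \<open>Sol T\<^sub>1 T\<^sub>2 u\<close>: \<open>u\<close> is a solution on
  \<open>\<real>\<^sup>d \<times> (T\<^sub>1, T\<^sub>2)\<close>. Solutions are continuous into \<open>H\<^sup>1\<close> up to the initial time, and their initial
  data is the value there.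
\<close>

type_synonym ('a, 'b) solutions = "real \<Rightarrow> real \<Rightarrow> (real \<Rightarrow> 'a \<Rightarrow> 'b) \<Rightarrow> bool"

definition solves :: "('a::euclidean_space, 'b::euclidean_space) solutions \<Rightarrow>
    real \<Rightarrow> real \<Rightarrow> ('a \<Rightarrow> 'b) \<Rightarrow> (real \<Rightarrow> 'a \<Rightarrow> 'b) \<Rightarrow> bool" where
  "solves Sol T\<^sub>1 T\<^sub>2 u\<^sub>0 u \<longleftrightarrow> Sol T\<^sub>1 T\<^sub>2 u \<and> (AE x in lborel. u T\<^sub>1 x = u\<^sub>0 x)"

definition cauchy_problem ::
    "('a \<Rightarrow> 'b) set \<Rightarrow> ('a::euclidean_space, 'b::euclidean_space) solutions \<Rightarrow> bool" where
  "cauchy_problem A Sol \<longleftrightarrow>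
     (\<forall>T\<^sub>1 T\<^sub>2 u. Sol T\<^sub>1 T\<^sub>2 u \<longrightarrow>
        T\<^sub>1 < T\<^sub>2 \<and> regularity_class T\<^sub>1 T\<^sub>2 u \<and> (\<forall>t\<in>{T\<^sub>1..<T\<^sub>2}. u t \<in> A) \<and>
        (\<forall>T\<^sub>1' T\<^sub>2'. T\<^sub>1 \<le> T\<^sub>1' \<and> T\<^sub>1' < T\<^sub>2' \<and> T\<^sub>2' \<le> T\<^sub>2 \<longrightarrow> Sol T\<^sub>1' T\<^sub>2' u))"

definition local_existence ::
    "('a \<Rightarrow> 'b) set \<Rightarrow> ('a::euclidean_space, 'b::euclidean_space) solutions \<Rightarrow> bool" where
  "local_existence A Sol \<longleftrightarrow>
     (\<forall>K>0. \<exists>T\<^sub>0>0. \<forall>a\<ge>0. \<forall>u\<^sub>0\<in>A. sobolev 1 u\<^sub>0 \<and> sobolev_norm 1 u\<^sub>0 \<le> K \<longrightarrow>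
        (\<exists>u. solves Sol a (a + T\<^sub>0) u\<^sub>0 u \<and> regularity_class a (a + T\<^sub>0) u \<and>
             (\<forall>v. solves Sol a (a + T\<^sub>0) u\<^sub>0 v \<longrightarrow> same_on {a<..<a + T\<^sub>0} v u)))"

definition joint_property ::
    "('a::euclidean_space, 'b::euclidean_space) solutions \<Rightarrow> bool" where
  "joint_property Sol \<longleftrightarrow>
     (\<forall>a\<ge>0. \<forall>T\<^sub>1 T\<^sub>2 u\<^sub>0 u\<^sub>1 u\<^sub>2. a < T\<^sub>1 \<and> T\<^sub>1 < T\<^sub>2 \<and>
        solves Sol a T\<^sub>1 u\<^sub>0 u\<^sub>1 \<and> solves Sol T\<^sub>1 T\<^sub>2 (u\<^sub>1 T\<^sub>1) u\<^sub>2 \<and>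
        continuous_H1 {a..T\<^sub>1} u\<^sub>1 \<and> continuous_H1 {T\<^sub>1..<T\<^sub>2} u\<^sub>2 \<longrightarrow>
        solves Sol a T\<^sub>2 u\<^sub>0 (\<lambda>t. if t < T\<^sub>1 then u\<^sub>1 t else u\<^sub>2 t))"

definition basic_energy ::
    "('a::euclidean_space, 'b::euclidean_space) solutions \<Rightarrow> bool" where
  "basic_energy Sol \<longleftrightarrow>
     (\<forall>u\<^sub>0. \<exists>M :: real \<Rightarrow> real. continuous_on {0..} M \<and> mono_on {0..} M \<and>
        (\<forall>T u. solves Sol 0 T u\<^sub>0 u \<longrightarrow> (\<forall>t\<in>{0<..<T}. \<forall>r\<in>{0..t}. L2_norm (u r) \<le> M t)))"

text \<open>In the regularity class, \<open>\<parallel>\<nabla>u\<parallel>\<^sup>2\<close> is absolutely continuous and \<open>\<Delta>u(t)\<close> is in \<open>L\<^sup>2\<close> for almost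
  every \<open>t\<close>, so the inequality is one for almost every \<open>t\<close>. Its right-hand side may be infinite.\<close>

definition first_energy_inequality ::
    "('a::euclidean_space, 'b::euclidean_space) solutions \<Rightarrow> bool" where
  "first_energy_inequality Sol \<longleftrightarrow>
     (\<exists>c\<^sub>1>0. \<exists>c\<^sub>1'>0. \<forall>T u. Sol 0 T u \<longrightarrow>
        (AE t in lborel. t \<in> {0<..<T} \<longrightarrow>
           (\<exists>D. ((\<lambda>r. (L2_norm (norm_grad (u r)))\<^sup>2) has_real_derivative D) (at t) \<and>
              ereal (D + c\<^sub>1 * (L2_norm (laplacian (u t)))\<^sup>2) \<le>
              ereal c\<^sub>1' * enn2ereal
                (\<integral>\<^sup>+ x. ennreal ((norm (u t x))\<^sup>2 * (norm_grad (u t) x)\<^sup>2) \<partial>lborel))))"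

end

theory Submission
  imports Defs "HOL-Probability.Probability"
begin

text \<open>
  The only obstruction to extending \<open>u\<close> is growth of its \<open>H\<^sup>1\<close> norm: the local existence time depends
  on a bound for that norm alone, so if the norm stays bounded near \<open>T\<^sub>*\<close>, the solution can be restarted
  so close to \<open>T\<^sub>*\<close> that it lives beyond it. The \<open>L\<^sup>2\<close> part of the norm is bounded by the basic energy
  inequality, and everything hinges on the Dirichlet energy \<open>E(t) = \<parallel>\<nabla>u(t)\<parallel>\<^sup>2\<close>.

  The estimate behind its boundedness concerns a single function \<open>f \<in> H\<^sup>2\<close>. Put
  \<open>\<sigma> = s + d/p\<close> and let \<open>N\<close> be the norm of \<open>f\<close> in \<open>B\<^sup>-\<^sup>s\<^sub>p\<^sub>,\<^sub>\<infinity>\<close>; the condition on the exponents says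
  \<open>\<sigma> < 1\<close> and \<open>q = 2/(1 - \<sigma>)\<close>. Let \<open>S\<^sub>k\<close> be the cut-off to frequencies below about \<open>2\<^sup>k\<close>. Adding up the
  Bernstein inequalities of the blocks gives \<open>\<parallel>S\<^sub>k f\<parallel>\<^sub>\<infinity> \<lesssim> N 2\<^sup>k\<^sup>\<sigma>\<close> (\<open>low_pass_sup_bound\<close>). Write
  \<open>f \<partial>\<^sub>i f\<close> as the limit of \<open>S\<^sub>k f S\<^sub>k \<partial>\<^sub>i f\<close> and telescope from a scale \<open>K\<close> on. Each increment contains a
  dyadic block of \<open>f\<close> or of \<open>\<partial>\<^sub>i f\<close>, which has \<open>L\<^sup>2\<close> norm at most a multiple of
  \<open>2\<^sup>-\<^sup>2\<^sup>k \<parallel>\<Delta>f\<parallel>\<close> or \<open>2\<^sup>-\<^sup>k \<parallel>\<Delta>f\<parallel>\<close> (\<open>dyadic_block_bounds\<close>), so the increments are geometric with ratio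
  \<open>2\<^sup>\<sigma>\<^sup>-\<^sup>1 < 1\<close> and
  \<open>\<parallel>f \<nabla>f\<parallel> \<lesssim> N (2\<^sup>K\<^sup>\<sigma> \<parallel>\<nabla>f\<parallel> + 2\<^sup>K\<^sup>(\<^sup>\<sigma>\<^sup>-\<^sup>1\<^sup>) \<parallel>\<Delta>f\<parallel>)\<close> (\<open>product_estimate\<close>, \<open>spatial_estimate\<close>). With \<open>K\<close> such
  that \<open>N 2\<^sup>K\<^sup>(\<^sup>\<sigma>\<^sup>-\<^sup>1\<^sup>)\<close> is small, the last term is absorbed by the dissipation in the first energy
  inequality, and the other one becomes \<open>(1 + N\<^sup>q) \<parallel>\<nabla>f\<parallel>\<^sup>2\<close> (\<open>absorbed_estimate\<close>).

  Thus \<open>E' \<le> C (1 + N(t)\<^sup>q) E\<close> for almost every \<open>t\<close>, with an integrable coefficient, and Gronwall's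
  argument bounds \<open>E\<close> near \<open>T\<^sub>*\<close>. An inequality for the derivative almost everywhere says nothing about
  the increments of \<open>E\<close> unless \<open>E\<close> is absolutely continuous. This follows from \<open>\<partial>\<^sub>t u \<in> L\<^sup>2L\<^sup>2\<close> and
  \<open>u \<in> L\<^sup>2H\<^sup>2\<close>: an increment of \<open>E\<close> is the pairing of an increment of \<open>u\<close> with \<open>\<Delta>u\<close>
  (\<open>dirichlet_energy_increments\<close>, \<open>increment_le_integral\<close>).

  Uniqueness is only assumed on the short intervals of the local theory. It propagates to
  arbitrary common intervals because the set of times up to which two solutions agree is closed by
  continuity in \<open>H\<^sup>1\<close> and open by local uniqueness (\<open>solution_unique\<close>).
\<close>

section \<open>Smooth functions and bump functions\<close>

text \<open>
  Smoothness quantifies over all lists of directions at once. Counting the number of derivatives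
  makes closure properties provable by induction: the derivatives of a product or of a composition
  are again sums of such expressions with one derivative less to go.
\<close>

primrec ndiff :: "nat \<Rightarrow> ('e::euclidean_space \<Rightarrow> 'f::real_normed_vector) \<Rightarrow> bool" where
  "ndiff 0 f = True"
| "ndiff (Suc n) f = ((\<forall>x. f differentiable at x) \<and> (\<forall>i\<in>Basis. ndiff n (partial_deriv i f)))"

lemma smooth_unfold:
  "smooth f \<longleftrightarrow> (\<forall>x. f differentiable at x) \<and> (\<forall>i\<in>Basis. smooth (partial_deriv i f))"
proof (intro iffI conjI ballI allI)
  assume f: "smooth f"
  show "f differentiable at x" for x
    using f[unfolded smooth_def, rule_format, of "[]"] by simp
  show "smooth (partial_deriv i f)" if "i \<in> Basis" for i
    unfolding smooth_def using f[unfolded smooth_def, rule_format, of "_ @ [i]"] that by simp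
next
  assume f: "(\<forall>x. f differentiable at x) \<and> (\<forall>i\<in>Basis. smooth (partial_deriv i f))"
  show "smooth f"
    unfolding smooth_def
  proof (intro allI impI)
    fix "is" :: "'a list" and x assume "set is \<subseteq> Basis"
    then show "foldr partial_deriv is f differentiable at x"
      using f by (cases "is" rule: rev_cases) (auto simp: smooth_def)
  qed
qed

lemma smooth_iff_ndiff: "smooth f \<longleftrightarrow> (\<forall>n. ndiff n f)"
proof
  have "smooth f \<Longrightarrow> ndiff n f" for n and f :: "'a \<Rightarrow> 'b"
    by (induction n arbitrary: f) (use smooth_unfold in auto)
  then show "smooth f \<Longrightarrow> \<forall>n. ndiff n f" by blast
next
  have "\<forall>x. foldr partial_deriv is f differentiable at x"
    if "set is \<subseteq> Basis" "\<forall>n. ndiff n f" for "is" and f :: "'a \<Rightarrow> 'b"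
    using that
  proof (induction "is" arbitrary: f rule: rev_induct)
    case Nil
    then show ?case by (metis foldr.simps(1) id_apply ndiff.simps(2))
  next
    case (snoc i "is")
    have "\<forall>n. ndiff n (partial_deriv i f)" using snoc.prems by (auto simp del: ndiff.simps) (metis ndiff.simps(2))
    with snoc show ?case by simp
  qed
  then show "\<forall>n. ndiff n f \<Longrightarrow> smooth f" by (auto simp: smooth_def)
qed

lemma smooth_differentiable: "smooth f \<Longrightarrow> f differentiable at x"
  using smooth_unfold by blast

lemma smooth_partial: "smooth f \<Longrightarrow> i \<in> Basis \<Longrightarrow> smooth (partial_deriv i f)"
  using smooth_unfold by blast

lemma smooth_continuous: "smooth f \<Longrightarrow> continuous_on S f"
  by (meson smooth_differentiable differentiable_imp_continuous_within
      continuous_at_imp_continuous_on)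

lemma smooth_borel [measurable_dest]:
  fixes f :: "'e::euclidean_space \<Rightarrow> 'f::real_normed_vector"
  shows "smooth f \<Longrightarrow> f \<in> borel_measurable borel"
  using smooth_continuous by (rule borel_measurable_continuous_onI)

lemma partial_derivI: "(f has_derivative f') (at x) \<Longrightarrow> partial_deriv i f x = f' i"
  unfolding partial_deriv_def by (metis frechet_derivative_at)

lemma has_derivative_frechet: "f differentiable at x \<Longrightarrow> (f has_derivative frechet_derivative f (at x)) (at x)"
  using frechet_derivative_works by blast

lemma partial_deriv_cong_ev:
  assumes "eventually (\<lambda>y. f y = g y) (nhds x)"
  shows "partial_deriv i f x = partial_deriv i g x"
proof -
  obtain S where S: "open S" "x \<in> S" "\<And>y. y \<in> S \<Longrightarrow> f y = g y"
    using assms by (auto simp: eventually_nhds)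
  have "(f has_derivative D) (at x) \<longleftrightarrow> (g has_derivative D) (at x)" for D
    using S has_derivative_transform_within_open[of f D x UNIV S g]
      has_derivative_transform_within_open[of g D x UNIV S f] by auto
  then show ?thesis unfolding partial_deriv_def frechet_derivative_def by simp
qed

lemma partial_deriv_add:
  assumes "f differentiable at x" "g differentiable at x"
  shows "partial_deriv i (\<lambda>x. f x + g x) x = partial_deriv i f x + partial_deriv i g x"
  using partial_derivI[OF has_derivative_add[OF assms[THEN has_derivative_frechet]], of i]
  by (simp add: partial_deriv_def)

lemma partial_deriv_bounded_linear:
  assumes "bounded_linear h" "f differentiable at x"
  shows "partial_deriv i (\<lambda>x. h (f x)) x = h (partial_deriv i f x)"
  using partial_derivI[OF bounded_linear.has_derivative[OF assms(1) has_derivative_frechet[OF assms(2)]], of i]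
  by (simp add: partial_deriv_def)

lemma partial_deriv_scaleR:
  assumes "f differentiable at x" "g differentiable at x"
  shows "partial_deriv i (\<lambda>x. f x *\<^sub>R g x) x = f x *\<^sub>R partial_deriv i g x + partial_deriv i f x *\<^sub>R g x"
  using partial_derivI[OF has_derivative_scaleR[OF assms[THEN has_derivative_frechet]], of i]
  by (simp add: partial_deriv_def)

lemma partial_deriv_affine:
  fixes L :: "'e::euclidean_space \<Rightarrow> 'g::euclidean_space"
  assumes L: "bounded_linear L" and f: "f differentiable at (L x + c)"
  shows "partial_deriv i (\<lambda>x. f (L x + c)) x = (\<Sum>b\<in>Basis. (L i \<bullet> b) *\<^sub>R partial_deriv b f (L x + c))"
proof -
  interpret F: bounded_linear "frechet_derivative f (at (L x + c))"
    using has_derivative_frechet[OF f] by (rule has_derivative_bounded_linear)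
  have 1: "((\<lambda>x. L x + c) has_derivative L) (at x)"
    by (rule has_derivative_add_const[OF bounded_linear_imp_has_derivative[OF L]])
  have "((\<lambda>x. f (L x + c)) has_derivative (\<lambda>y. frechet_derivative f (at (L x + c)) (L y))) (at x)"
    using has_derivative_compose[OF 1 has_derivative_frechet[OF f]] .
  from partial_derivI[OF this, of i]
  have "partial_deriv i (\<lambda>x. f (L x + c)) x = frechet_derivative f (at (L x + c)) (L i)" .
  also have "\<dots> = frechet_derivative f (at (L x + c)) (\<Sum>b\<in>Basis. (L i \<bullet> b) *\<^sub>R b)"
    by (simp add: euclidean_representation)
  also have "\<dots> = (\<Sum>b\<in>Basis. (L i \<bullet> b) *\<^sub>R partial_deriv b f (L x + c))"
    by (simp add: F.sum F.scaleR partial_deriv_def)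
  finally show ?thesis .
qed

lemma ndiff_SucD: "ndiff (Suc n) f \<Longrightarrow> ndiff n f"
proof (induction n arbitrary: f)
  case (Suc n)
  from Suc.prems have "\<And>x. f differentiable at x" by simp
  moreover have "ndiff n (partial_deriv i f)" if "i \<in> Basis" for i
    using Suc.IH[of "partial_deriv i f"] Suc.prems that by (subst (asm) ndiff.simps(2)) blast
  ultimately show ?case by simp
qed simp

lemma ndiff_const: "ndiff n (\<lambda>x. c)"
  by (induction n arbitrary: c) (simp_all add: partial_deriv_def[abs_def])

lemma ndiff_add: "ndiff n f \<Longrightarrow> ndiff n g \<Longrightarrow> ndiff n (\<lambda>x. f x + g x)"
proof (induction n arbitrary: f g)
  case (Suc n)
  then have "partial_deriv i (\<lambda>x. f x + g x) = (\<lambda>x. partial_deriv i f x + partial_deriv i g x)" for i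
    by (intro ext partial_deriv_add) auto
  with Suc show ?case by auto
qed simp

lemma ndiff_bounded_linear: "bounded_linear h \<Longrightarrow> ndiff n f \<Longrightarrow> ndiff n (\<lambda>x. h (f x))"
proof (induction n arbitrary: f)
  case (Suc n)
  then have "partial_deriv i (\<lambda>x. h (f x)) = (\<lambda>x. h (partial_deriv i f x))" for i
    by (intro ext partial_deriv_bounded_linear) auto
  moreover have "(\<lambda>x. h (f x)) differentiable at x" for x
    using Suc.prems unfolding ndiff.simps differentiable_def by (metis bounded_linear.has_derivative)
  ultimately show ?case using Suc by simp
qed simp

lemma ndiff_sum: "finite A \<Longrightarrow> (\<And>a. a \<in> A \<Longrightarrow> ndiff n (f a)) \<Longrightarrow> ndiff n (\<lambda>x. \<Sum>a\<in>A. f a x)"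
  by (induction A rule: finite_induct) (auto intro: ndiff_const ndiff_add)

lemma ndiff_scaleR: "ndiff n f \<Longrightarrow> ndiff n g \<Longrightarrow> ndiff n (\<lambda>x. f x *\<^sub>R g x)"
proof (induction n arbitrary: f g)
  case (Suc n)
  then have "partial_deriv i (\<lambda>x. f x *\<^sub>R g x) =
      (\<lambda>x. f x *\<^sub>R partial_deriv i g x + partial_deriv i f x *\<^sub>R g x)" for i
    by (intro ext partial_deriv_scaleR) auto
  moreover have "(\<lambda>x. f x *\<^sub>R g x) differentiable at x" for x
    using Suc.prems unfolding ndiff.simps differentiable_def by (metis has_derivative_scaleR)
  ultimately show ?case
    using Suc ndiff_SucD[OF Suc.prems(1)] ndiff_SucD[OF Suc.prems(2)] by (auto intro!: ndiff_add Suc.IH)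
qed simp

lemma ndiff_affine:
  fixes L :: "'e::euclidean_space \<Rightarrow> 'g::euclidean_space"
  assumes L: "bounded_linear L"
  shows "ndiff n f \<Longrightarrow> ndiff n (\<lambda>x. f (L x + c))"
proof (induction n arbitrary: f)
  case (Suc n)
  then have "partial_deriv i (\<lambda>x. f (L x + c)) =
      (\<lambda>x. \<Sum>b\<in>Basis. (L i \<bullet> b) *\<^sub>R partial_deriv b f (L x + c))" for i
    by (intro ext partial_deriv_affine L) auto
  moreover have "(\<lambda>x. f (L x + c)) differentiable at x" for x
    using Suc.prems differentiable_compose[of f "\<lambda>x. L x + c" x UNIV] bounded_linear_imp_differentiable[OF L]
    by (auto intro!: differentiable_add)
  ultimately show ?case
    using Suc by (auto intro!: ndiff_sum ndiff_scaleR ndiff_const)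
qed simp

lemma smooth_const: "smooth (\<lambda>x. c)"
  and smooth_add: "smooth f \<Longrightarrow> smooth g \<Longrightarrow> smooth (\<lambda>x. f x + g x)"
  and smooth_bounded_linear: "bounded_linear h \<Longrightarrow> smooth f \<Longrightarrow> smooth (\<lambda>x. h (f x))"
  and smooth_scaleR: "smooth r \<Longrightarrow> smooth f \<Longrightarrow> smooth (\<lambda>x. r x *\<^sub>R f x)"
  by (auto simp: smooth_iff_ndiff intro: ndiff_const ndiff_add ndiff_bounded_linear ndiff_scaleR)

lemma smooth_mult:
  fixes f g :: "_ \<Rightarrow> real"
  shows "smooth f \<Longrightarrow> smooth g \<Longrightarrow> smooth (\<lambda>x. f x * g x)"
  using smooth_scaleR[of f g] by simp

lemma smooth_prod:
  fixes f :: "_ \<Rightarrow> _ \<Rightarrow> real"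
  shows "finite A \<Longrightarrow> (\<And>a. a \<in> A \<Longrightarrow> smooth (f a)) \<Longrightarrow> smooth (\<lambda>x. \<Prod>a\<in>A. f a x)"
  by (induction A rule: finite_induct) (auto intro: smooth_const smooth_mult)

lemma smooth_affine:
  fixes L :: "'e::euclidean_space \<Rightarrow> 'g::euclidean_space"
  shows "bounded_linear L \<Longrightarrow> smooth f \<Longrightarrow> smooth (\<lambda>x. f (L x + c))"
  by (auto simp: smooth_iff_ndiff intro: ndiff_affine)

lemma smooth_shift: "smooth f \<Longrightarrow> smooth (\<lambda>x. f (x - c))"
  using smooth_affine[OF bounded_linear_ident, of f "-c"] by simp

lemma smooth_linear_form:
  assumes "i \<in> Basis" shows "smooth (\<lambda>x::'e::euclidean_space. x \<bullet> i)"
proof -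
  have "ndiff n (\<lambda>x::'e. x \<bullet> i)" for n
  proof (cases n)
    case (Suc m)
    have d: "((\<lambda>x::'e. x \<bullet> i) has_derivative (\<lambda>y. y \<bullet> i)) (at x)" for x
      by (intro bounded_linear_imp_has_derivative bounded_linear_inner_left)
    have "partial_deriv j (\<lambda>x::'e. x \<bullet> i) = (\<lambda>x. j \<bullet> i)" for j
      using partial_derivI[OF d] by auto
    with d show ?thesis by (auto simp: Suc ndiff_const differentiable_def)
  qed simp
  then show ?thesis by (simp add: smooth_iff_ndiff)
qed

lemma partial_deriv_shift:
  assumes "smooth f" "i \<in> Basis"
  shows "partial_deriv i (\<lambda>x. f (x - c)) x = partial_deriv i f (x - c)"
proof -
  have "partial_deriv i (\<lambda>x. f (x + (- c))) x = (\<Sum>b\<in>Basis. (i \<bullet> b) *\<^sub>R partial_deriv b f (x + - c))"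
    by (rule partial_deriv_affine[OF bounded_linear_ident]) (use assms smooth_differentiable in auto)
  also have "\<dots> = (\<Sum>b\<in>Basis. (if b = i then partial_deriv b f (x - c) else 0))"
    by (intro sum.cong) (use assms in \<open>auto simp: inner_Basis\<close>)
  finally show ?thesis using assms by simp
qed

lemma smooth_line_derivative:
  assumes "smooth f"
  shows "((\<lambda>t. f (x + t *\<^sub>R i)) has_vector_derivative partial_deriv i f (x + t *\<^sub>R i)) (at t within S)"
proof -
  interpret F: bounded_linear "frechet_derivative f (at (x + t *\<^sub>R i))"
    using has_derivative_frechet[OF smooth_differentiable[OF assms]] by (rule has_derivative_bounded_linear)
  have 1: "((\<lambda>t. x + t *\<^sub>R i) has_derivative (\<lambda>t. t *\<^sub>R i)) (at t)"
    by (auto intro!: derivative_eq_intros)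
  have "((\<lambda>t. f (x + t *\<^sub>R i)) has_derivative (\<lambda>y. frechet_derivative f (at (x + t *\<^sub>R i)) (y *\<^sub>R i))) (at t)"
    using has_derivative_compose[OF 1 has_derivative_frechet[OF smooth_differentiable[OF assms]]] .
  then have "((\<lambda>t. f (x + t *\<^sub>R i)) has_vector_derivative partial_deriv i f (x + t *\<^sub>R i)) (at t)"
    by (simp add: has_vector_derivative_def F.scaleR partial_deriv_def)
  then show ?thesis by (rule has_vector_derivative_at_within)
qed

subsection \<open>Bump functions of boxes\<close>

text \<open>
  The exponent \<open>n\<close> makes the family closed under differentiation; \<open>flat_exp 0\<close> is the classical
  function \<open>exp (- 1/x)\<close>, smooth across \<open>0\<close>.
\<close>

definition flat_exp :: "nat \<Rightarrow> real \<Rightarrow> real" where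
  "flat_exp n x = (if x > 0 then (1 / x) ^ n * exp (- (1 / x)) else 0)"

lemma flat_exp_has_derivative:
  "(flat_exp n has_real_derivative (- real n * flat_exp (Suc n) x + flat_exp (Suc (Suc n)) x)) (at x)"
proof -
  consider "x > 0" | "x < 0" | "x = 0" by linarith
  then show ?thesis
  proof cases
    case 1
    have "((\<lambda>x. (1 / x) ^ n * exp (- (1 / x))) has_real_derivative
        (- real n * flat_exp (Suc n) x + flat_exp (Suc (Suc n)) x)) (at x)"
    proof -
      have d: "((\<lambda>x. 1 / x) has_real_derivative - ((1 / x) ^ 2)) (at x)"
        using 1 by (auto intro!: derivative_eq_intros simp: power2_eq_square field_simps)
      have e: "((\<lambda>x. exp (- (1 / x))) has_real_derivative exp (- (1 / x)) * (1 / x) ^ 2) (at x)"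
        using 1 by (auto intro!: derivative_eq_intros simp: power2_eq_square)
      have "((\<lambda>x. (1 / x) ^ n) has_real_derivative - real n * (1 / x) ^ Suc n) (at x)"
        by (rule DERIV_cong[OF DERIV_power[OF d, of n]]) (use 1 in \<open>cases n; simp add: power2_eq_square divide_simps; simp add: algebra_simps\<close>)
      from DERIV_mult[OF this e] show ?thesis
        using 1 by (simp add: flat_exp_def power2_eq_square algebra_simps)
    qed
    then show ?thesis
      by (rule has_field_derivative_transform_within_open[of _ _ _ "{0<..}"])
        (use 1 in \<open>auto simp: flat_exp_def\<close>)
  next
    case 2
    have "((\<lambda>x. 0) has_real_derivative 0) (at x)" by simp
    then have "(flat_exp n has_real_derivative 0) (at x)"
      by (rule has_field_derivative_transform_within_open[of _ _ _ "{..<0}"])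
        (use 2 in \<open>auto simp: flat_exp_def\<close>)
    then show ?thesis using 2 by (simp add: flat_exp_def)
  next
    case 3
    have "((\<lambda>y. inverse y ^ (Suc n) / exp (inverse y)) \<longlongrightarrow> (0::real)) (at_right 0)"
      by (rule filterlim_compose[OF tendsto_power_div_exp_0 filterlim_inverse_at_top_right])
    then have "((\<lambda>y. flat_exp n y / y) \<longlongrightarrow> 0) (at_right 0)"
    proof (rule filterlim_cong[THEN iffD1, rotated -1])
      show "\<forall>\<^sub>F y in at_right 0. inverse y ^ (Suc n) / exp (inverse y) = flat_exp n y / y"
        using eventually_at_right_less[of 0]
        by eventually_elim (auto simp: flat_exp_def exp_minus field_simps)
    qed auto
    moreover have "((\<lambda>y. flat_exp n y / y) \<longlongrightarrow> 0) (at_left 0)"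
      by (rule filterlim_cong[THEN iffD2, OF refl refl _ tendsto_const])
        (auto simp: eventually_at_filter flat_exp_def)
    ultimately have "((\<lambda>y. flat_exp n y / y) \<longlongrightarrow> 0) (at 0)"
      by (simp add: filterlim_split_at)
    then show ?thesis using 3 by (simp add: has_field_derivative_iff flat_exp_def)
  qed
qed

lemma smooth_flat_exp: "smooth (flat_exp n)"
proof -
  have "ndiff k (flat_exp n)" for k
  proof (induction k arbitrary: n)
    case (Suc k)
    have "partial_deriv 1 (flat_exp n) = (\<lambda>x. (- real n) *\<^sub>R flat_exp (Suc n) x + flat_exp (Suc (Suc n)) x)"
      using partial_derivI[OF flat_exp_has_derivative[unfolded has_field_derivative_def]] by auto
    moreover have "flat_exp n differentiable at x" for x
      using flat_exp_has_derivative real_differentiable_def by blast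
    ultimately show ?case
      using ndiff_add[OF ndiff_scaleR[OF ndiff_const Suc] Suc, of "- real n" "Suc n" "Suc (Suc n)"] by simp
  qed simp
  then show ?thesis by (simp add: smooth_iff_ndiff)
qed

text \<open>
  Scaling the argument of \<open>flat_exp 0\<close> by \<open>Suc n\<close> pushes every factor up to \<open>1\<close> without enlarging the
  support, so these bumps converge to the indicator of the box from below.
\<close>

definition box_bump :: "'e::euclidean_space \<Rightarrow> 'e \<Rightarrow> nat \<Rightarrow> 'e \<Rightarrow> real" where
  "box_bump a b n x = (\<Prod>i\<in>Basis. flat_exp 0 (real (Suc n) * (x \<bullet> i - a \<bullet> i)) * flat_exp 0 (real (Suc n) * (b \<bullet> i - x \<bullet> i)))"

lemma smooth_box_bump: "smooth (box_bump a b n)"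
proof -
  have "bounded_linear (\<lambda>x::'a. real (Suc n) * (x \<bullet> i))" "bounded_linear (\<lambda>x::'a. - (real (Suc n) * (x \<bullet> i)))" for i
    by (intro bounded_linear_minus bounded_linear_const_mult bounded_linear_inner_left)+
  note bl = this
  have 1: "smooth (\<lambda>x::'a. flat_exp 0 (real (Suc n) * (x \<bullet> i - a \<bullet> i)))"
    and 2: "smooth (\<lambda>x::'a. flat_exp 0 (real (Suc n) * (b \<bullet> i - x \<bullet> i)))" for i
    using smooth_affine[OF bl(1)[of i] smooth_flat_exp, of 0 "- (real (Suc n) * (a \<bullet> i))"]
      smooth_affine[OF bl(2)[of i] smooth_flat_exp, of 0 "(real (Suc n) * (b \<bullet> i))"]
    by (simp_all add: algebra_simps)
  show ?thesis
    unfolding box_bump_def[abs_def] by (intro smooth_prod smooth_mult 1 2) auto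
qed

lemma flat_exp_bounds: "0 \<le> flat_exp 0 x" "flat_exp 0 x \<le> 1" "flat_exp 0 x > 0 \<longleftrightarrow> x > 0"
  by (auto simp: flat_exp_def)

lemma box_bump_pos_iff: "box_bump a b n x \<noteq> 0 \<longleftrightarrow> x \<in> box a b"
proof -
  have [simp]: "flat_exp 0 x = 0 \<longleftrightarrow> x \<le> 0" for x by (simp add: flat_exp_def)
  show ?thesis
    by (auto simp: box_bump_def mem_box mult_le_0_iff not_le)
qed

lemma box_bump_bounds: "0 \<le> box_bump a b n x" "box_bump a b n x \<le> 1"
  unfolding box_bump_def
  by (intro prod_nonneg mult_nonneg_nonneg flat_exp_bounds ballI)
    (intro prod_le_1 conjI mult_nonneg_nonneg mult_le_one flat_exp_bounds)

lemma box_bump_tendsto: "(\<lambda>n. box_bump a b n x) \<longlonglongrightarrow> indicator (box a b) x"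
proof (cases "x \<in> box a b")
  case True
  have *: "(\<lambda>n. flat_exp 0 (real (Suc n) * c)) \<longlonglongrightarrow> 1" if "c > 0" for c :: real
  proof -
    have "(\<lambda>n. exp (- (1 / c * inverse (real (Suc n))))) \<longlonglongrightarrow> exp (- (1 / c * 0))"
      by (intro tendsto_intros LIMSEQ_inverse_real_of_nat)
    then show ?thesis using that by (auto simp: flat_exp_def divide_inverse zero_less_mult_iff mult.commute)
  qed
  have "(\<lambda>n. box_bump a b n x) \<longlonglongrightarrow> (\<Prod>i\<in>(Basis::'a set). 1 * 1)"
    unfolding box_bump_def using True by (intro tendsto_prod tendsto_mult *) (auto simp: mem_box)
  then show ?thesis using True by simp
next
  case False
  then show ?thesis using box_bump_pos_iff[of a b _ x] by simp
qed

lemma test_box_bump: "test_function UNIV (box_bump a b n)"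
proof -
  have "closure {x. box_bump a b n x \<noteq> 0} \<subseteq> cbox a b"
    by (simp add: box_bump_pos_iff box_subset_cbox closed_cbox closure_minimal del: closure_box)
  then have "compact (closure {x. box_bump a b n x \<noteq> 0})"
    by (metis bounded_cbox bounded_subset closed_closure compact_eq_bounded_closed)
  then show ?thesis by (simp add: test_function_def smooth_box_bump)
qed

subsection \<open>Test functions\<close>

lemma test_function_smooth: "test_function \<Omega> \<psi> \<Longrightarrow> smooth \<psi>"
  by (simp add: test_function_def)

lemma partial_deriv_support:
  "{x. partial_deriv i f x \<noteq> 0} \<subseteq> closure {x. f x \<noteq> 0}"
proof -
  have "partial_deriv i f x = 0" if "x \<notin> closure {x. f x \<noteq> 0}" for x
  proof -
    have "open (- closure {x. f x \<noteq> 0})" by blast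
    then have "\<forall>\<^sub>F y in nhds x. y \<in> - closure {x. f x \<noteq> 0}"
      using that eventually_nhds_in_open by blast
    then have "\<forall>\<^sub>F y in nhds x. f y = 0"
      by eventually_elim (use closure_subset[of "{x. f x \<noteq> 0}"] in blast)
    then have "partial_deriv i f x = partial_deriv i (\<lambda>x. 0) x" by (rule partial_deriv_cong_ev)
    then show ?thesis by (simp add: partial_deriv_def)
  qed
  then show ?thesis by blast
qed

lemma test_function_partial:
  assumes "test_function \<Omega> \<psi>" "i \<in> Basis" shows "test_function \<Omega> (partial_deriv i \<psi>)"
proof -
  have "closure {x. partial_deriv i \<psi> x \<noteq> 0} \<subseteq> closure {x. \<psi> x \<noteq> 0}"
    by (rule closure_minimal[OF partial_deriv_support closed_closure])
  with assms show ?thesis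
    unfolding test_function_def
    by (metis bounded_subset closed_closure compact_eq_bounded_closed smooth_partial subset_trans)
qed

lemma test_function_shift:
  assumes "test_function UNIV \<psi>" shows "test_function UNIV (\<lambda>x. \<psi> (x - c))"
proof -
  have "{x. \<psi> (x - c) \<noteq> 0} = (\<lambda>x. c + x) ` {x. \<psi> x \<noteq> 0}"
    by (force simp: image_iff intro: exI[of _ "_ - c"])
  then have "closure {x. \<psi> (x - c) \<noteq> 0} = (\<lambda>x. c + x) ` closure {x. \<psi> x \<noteq> 0}"
    by (simp add: closure_translation)
  with assms show ?thesis
    by (simp add: test_function_def smooth_shift compact_translation)
qed

lemma compact_support_bounded:
  fixes f :: "'e::euclidean_space \<Rightarrow> 'f::real_normed_vector"
  assumes "continuous_on UNIV f" "compact K" "\<And>x. x \<notin> K \<Longrightarrow> f x = 0"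
  obtains C where "C \<ge> 0" "\<And>x. norm (f x) \<le> C"
proof -
  have "compact (f ` K)" using assms by (meson compact_continuous_image continuous_on_subset subset_UNIV)
  then obtain B where B: "\<forall>y\<in>f ` K. norm y \<le> B" by (meson bounded_iff compact_imp_bounded)
  have "norm (f x) \<le> max B 0" for x using B assms(3)[of x] by (cases "x \<in> K") (auto simp: le_max_iff_disj)
  then show thesis by (intro that[of "max B 0"]) auto
qed

lemma test_function_support:
  assumes "test_function \<Omega> \<psi>"
  obtains K where "compact K" "K \<subseteq> \<Omega>" "\<And>x. x \<notin> K \<Longrightarrow> \<psi> x = 0"
proof (rule that)
  show "compact (closure {x. \<psi> x \<noteq> 0})" "closure {x. \<psi> x \<noteq> 0} \<subseteq> \<Omega>"
    using assms by (auto simp: test_function_def)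
  show "\<psi> x = 0" if "x \<notin> closure {x. \<psi> x \<noteq> 0}" for x
    using that closure_subset[of "{x. \<psi> x \<noteq> 0}"] by blast
qed

lemma test_function_bounded:
  assumes "test_function \<Omega> \<psi>"
  obtains C where "C \<ge> 0" "\<And>x. \<bar>\<psi> x\<bar> \<le> C"
proof -
  obtain K where "compact K" "\<And>x. x \<notin> K \<Longrightarrow> \<psi> x = 0"
    using test_function_support[OF assms] by metis
  then obtain C where "C \<ge> 0" "\<And>x. norm (\<psi> x) \<le> C"
    using compact_support_bounded[OF smooth_continuous[OF test_function_smooth[OF assms]]] by metis
  then show thesis by (intro that[of C]) auto
qed

subsection \<open>The fundamental lemma of the calculus of variations\<close>

text \<open>
  Boxes form an intersection-stable generator of the Borel sets, hence on a fixed box the integral of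
  \<open>h\<close> over every Borel subset vanishes.
\<close>

lemma box_integral_zero_AE:
  fixes h :: "'a::euclidean_space \<Rightarrow> 'b::euclidean_space"
  assumes int: "\<And>a b. integrable lborel (\<lambda>x. indicator (box a b) x *\<^sub>R h x)"
    and zero: "\<And>a b. (\<integral>x. indicator (box a b) x *\<^sub>R h x \<partial>lborel) = 0"
  shows "AE x in lborel. h x = 0"
proof -
  have 1: "AE x in lborel. indicator (box c d) x *\<^sub>R h x = 0" for c d
  proof (rule sigma_finite_measure.density_zero[OF sigma_finite_lborel int])
    fix A :: "'a set" assume "A \<in> sets lborel"
    then have "A \<in> sets (sigma UNIV (range (\<lambda>(a, b). box a b :: 'a set)))"
      by (subst borel_eq_box[symmetric]) simp
    then have A: "A \<in> sigma_sets UNIV (range (\<lambda>(a, b). box a b))" by simp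
    have "Int_stable (range (\<lambda>(a, b). box a b :: 'a set))" by (auto simp: Int_stable_def box_Int_box)
    from this subset_UNIV[of "range (\<lambda>(a, b). box a b :: 'a set)", folded Pow_UNIV] A have "set_lebesgue_integral lborel A (\<lambda>x. indicator (box c d) x *\<^sub>R h x) = 0 \<and> A \<in> sets borel"
    proof (induction rule: sigma_sets_induct_disjoint)
      case (basic A)
      then obtain a b where "A = box a b" by auto
      moreover obtain a' b' where "box a b \<inter> box c d = box a' b'" using box_Int_box[of a b c d] by blast
      moreover have "indicat_real (box a b) x *\<^sub>R indicat_real (box c d) x *\<^sub>R h x
          = indicator (box a b \<inter> box c d) x *\<^sub>R h x" for x by (auto simp: indicator_def)
      ultimately show ?case using zero[of a' b'] by (simp add: set_lebesgue_integral_def del: scaleR_scaleR scaleR_cancel_right)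
    next
      case empty
      then show ?case by (simp add: set_lebesgue_integral_def)
    next
      case (compl A)
      have "(\<integral>x. indicat_real (UNIV - A) x *\<^sub>R indicat_real (box c d) x *\<^sub>R h x \<partial>lborel)
        = (\<integral>x. indicat_real (box c d) x *\<^sub>R h x - indicat_real A x *\<^sub>R indicat_real (box c d) x *\<^sub>R h x \<partial>lborel)"
        by (intro Bochner_Integration.integral_cong) (auto simp: indicator_def)
      also have "\<dots> = 0"
        using compl zero[of c d] integrable_mult_indicator[OF _ int, of A c d]
        by (subst Bochner_Integration.integral_diff) (auto simp: set_lebesgue_integral_def int)
      finally show ?case using compl sets.Diff[of UNIV borel A] by (simp add: set_lebesgue_integral_def)
    next
      case (union A)
      have "(LINT x:(\<Union>i. A i)|lborel. indicat_real (box c d) x *\<^sub>R h x) = (\<Sum>i. (LINT x:(A i)|lborel. indicat_real (box c d) x *\<^sub>R h x))"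
      proof (rule lebesgue_integral_countable_add)
        show "set_integrable lborel (\<Union>i. A i) (\<lambda>x. indicat_real (box c d) x *\<^sub>R h x)"
          unfolding set_integrable_def using union by (intro integrable_mult_indicator int sets.countable_UN) auto
      qed (use union in \<open>auto simp: disjoint_family_on_def\<close>)
      moreover have "(\<Union>i. A i) \<in> sets borel" using union by (intro sets.countable_UN) auto
      ultimately show ?case using union by simp
    qed
    then show "set_lebesgue_integral lborel A (\<lambda>x. indicator (box c d) x *\<^sub>R h x) = 0" by simp
  qed
  have "AE x in lborel. \<forall>n. indicator (box (- (real n *\<^sub>R One)) (real n *\<^sub>R One)) x *\<^sub>R h x = 0"
    by (subst AE_all_countable) (intro allI 1)
  then show ?thesis
  proof eventually_elim
    case (elim x)
    obtain n :: nat where "x \<in> box (- (real n *\<^sub>R One)) (real n *\<^sub>R One)"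
      using UN_box_eq_UNIV by blast
    with elim[rule_format, of n] show ?case by simp
  qed
qed

text \<open>
  The indicator of a box is the dominated limit of the bumps \<open>box_bump a b n\<close>. Integrability of \<open>h\<close> on the
  box comes from a test function that is bounded below there.
\<close>

lemma fundamental_lemma:
  fixes h :: "'a::euclidean_space \<Rightarrow> 'b::euclidean_space"
  assumes h[measurable]: "h \<in> borel_measurable borel"
    and test: "\<And>\<psi>. test_function UNIV \<psi> \<Longrightarrow> integrable lborel (\<lambda>x. \<psi> x *\<^sub>R h x) \<and> (\<integral>x. \<psi> x *\<^sub>R h x \<partial>lborel) = 0"
  shows "AE x in lborel. h x = 0"
proof (rule box_integral_zero_AE)
  fix a b :: 'a
  show int: "integrable lborel (\<lambda>x. indicator (box a b) x *\<^sub>R h x)"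
  proof (cases "box a b = {}")
    case False
    define \<psi> where "\<psi> = box_bump (a - One) (b + One) 0"
    have "cbox a b \<subseteq> box (a - One) (b + One)"
    proof
      fix x assume x: "x \<in> cbox a b"
      show "x \<in> box (a - One) (b + One)"
        unfolding mem_box
      proof (intro ballI)
        fix i :: 'a assume i: "i \<in> Basis"
        then have "a \<bullet> i \<le> x \<bullet> i \<and> x \<bullet> i \<le> b \<bullet> i" "One \<bullet> i = 1"
          using x by (simp_all add: mem_box)
        then show "(a - One) \<bullet> i < x \<bullet> i \<and> x \<bullet> i < (b + One) \<bullet> i"
          by (simp add: inner_diff_left inner_add_left)
      qed
    qed
    then have pos: "\<psi> x > 0" if "x \<in> cbox a b" for x
      using that box_bump_pos_iff[of "a - One" "b + One" 0 x] box_bump_bounds(1)[of "a - One" "b + One" 0 x]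
      by (auto simp: \<psi>_def less_le)
    have "continuous_on (cbox a b) \<psi>" by (simp add: \<psi>_def smooth_box_bump smooth_continuous)
    then obtain x0 where x0: "x0 \<in> cbox a b" "\<And>x. x \<in> cbox a b \<Longrightarrow> \<psi> x0 \<le> \<psi> x"
      using continuous_attains_inf[of "cbox a b" \<psi>] False box_subset_cbox by (metis compact_cbox subset_empty)
    have "integrable lborel (\<lambda>x. (1 / \<psi> x0) *\<^sub>R (\<psi> x *\<^sub>R h x))"
      using test[OF test_box_bump, of "a - One" "b + One" 0] unfolding \<psi>_def by (intro integrable_scaleR_right) blast
    then show ?thesis
    proof (rule Bochner_Integration.integrable_bound)
      show "AE x in lborel. norm (indicat_real (box a b) x *\<^sub>R h x) \<le> norm ((1 / \<psi> x0) *\<^sub>R \<psi> x *\<^sub>R h x)"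
      proof (rule AE_I2)
        fix x
        show "norm (indicat_real (box a b) x *\<^sub>R h x) \<le> norm ((1 / \<psi> x0) *\<^sub>R \<psi> x *\<^sub>R h x)"
        proof (cases "x \<in> box a b")
          case True
          then have "x \<in> cbox a b" using box_subset_cbox by blast
          then have "1 \<le> \<psi> x / \<psi> x0" using x0 pos by simp
          then show ?thesis
            using True mult_right_mono[of 1 "\<psi> x / \<psi> x0" "norm (h x)"] pos[OF x0(1)] pos[OF \<open>x \<in> cbox a b\<close>]
            by simp
        qed simp
      qed
    qed simp
  qed simp
  have "(\<lambda>n. (\<integral>x. box_bump a b n x *\<^sub>R h x \<partial>lborel)) \<longlonglongrightarrow> (\<integral>x. indicator (box a b) x *\<^sub>R h x \<partial>lborel)"
  proof (rule integral_dominated_convergence)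
    show "integrable lborel (\<lambda>x. norm (indicator (box a b) x *\<^sub>R h x))" by (rule integrable_norm[OF int])
    show "AE x in lborel. (\<lambda>n. box_bump a b n x *\<^sub>R h x) \<longlonglongrightarrow> indicat_real (box a b) x *\<^sub>R h x"
      by (auto intro!: tendsto_intros box_bump_tendsto)
    show "AE x in lborel. norm (box_bump a b n x *\<^sub>R h x) \<le> norm (indicat_real (box a b) x *\<^sub>R h x)" for n
    proof (rule AE_I2)
      fix x show "norm (box_bump a b n x *\<^sub>R h x) \<le> norm (indicat_real (box a b) x *\<^sub>R h x)"
        using box_bump_pos_iff[of a b n x] box_bump_bounds[of a b n x]
        by (cases "x \<in> box a b") (auto intro: mult_left_le_one_le)
    qed
    show "(\<lambda>x. box_bump a b i x *\<^sub>R h x) \<in> borel_measurable lborel" for i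
      using smooth_borel[OF smooth_box_bump, of a b i] by measurable
  qed simp
  moreover have "(\<integral>x. box_bump a b n x *\<^sub>R h x \<partial>lborel) = 0" for n
    using test[OF test_box_bump] by blast
  ultimately show "(\<integral>x. indicator (box a b) x *\<^sub>R h x \<partial>lborel) = 0"
    by (simp add: LIMSEQ_const_iff)
qed

section \<open>Square-integrable functions\<close>

text \<open>
  The squared \<open>L\<^sup>2\<close> norm as a nonnegative integral, which is meaningful before \<open>f\<close> is known to be
  in \<open>L\<^sup>2\<close>.
\<close>

abbreviation nn2 :: "('a::euclidean_space \<Rightarrow> 'b::real_normed_vector) \<Rightarrow> ennreal" where
  "nn2 f \<equiv> (\<integral>\<^sup>+x. ennreal ((norm (f x))\<^sup>2) \<partial>lborel)"

lemma L2_borel [measurable_dest]: "L2 f \<Longrightarrow> f \<in> borel_measurable borel"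
  by (simp add: L2_def)

lemma L2_iff: "L2 f \<longleftrightarrow> f \<in> borel_measurable borel \<and> nn2 f < \<infinity>"
  unfolding L2_def by (auto simp: integrable_iff_bounded)

lemma L2_norm_nonneg [simp]: "L2_norm f \<ge> 0"
  by (simp add: L2_norm_def)

lemma L2_norm_power2: "(L2_norm f)\<^sup>2 = (\<integral>x. (norm (f x))\<^sup>2 \<partial>lborel)"
  by (simp add: L2_norm_def)

lemma nn2_eq: "L2 f \<Longrightarrow> nn2 f = ennreal ((L2_norm f)\<^sup>2)"
  unfolding L2_norm_power2 L2_def by (subst nn_integral_eq_integral) auto

lemma L2I_bound:
  assumes "f \<in> borel_measurable borel" "c \<ge> 0" "nn2 f \<le> ennreal (c\<^sup>2)"
  shows "L2 f" "L2_norm f \<le> c"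
proof -
  show f: "L2 f" using assms by (auto simp: L2_iff intro: le_less_trans)
  have "ennreal ((L2_norm f)\<^sup>2) \<le> ennreal (c\<^sup>2)" using assms(3) nn2_eq[OF f] by simp
  then have "(L2_norm f)\<^sup>2 \<le> c\<^sup>2" by (simp add: ennreal_le_iff)
  then show "L2_norm f \<le> c" by (rule power2_le_imp_le) (rule assms)
qed

lemma L2_cong_AE:
  assumes "L2 f" "g \<in> borel_measurable borel" "AE x in lborel. f x = g x"
  shows "L2 g" "L2_norm g = L2_norm f"
proof -
  have "nn2 f = nn2 g" by (rule nn_integral_cong_AE) (use assms(3) in auto)
  then show g: "L2 g" using assms by (simp add: L2_iff)
  show "L2_norm g = L2_norm f" unfolding L2_norm_def
    by (rule arg_cong[of _ _ sqrt], rule integral_cong_AE) (use assms g in \<open>auto simp: L2_def\<close>)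
qed

lemma ennreal_power2_le_imp_le:
  fixes x y :: ennreal
  assumes "x\<^sup>2 \<le> y\<^sup>2" shows "x \<le> y"
proof (rule ccontr)
  assume "\<not> x \<le> y"
  then have "y < x" by simp
  then obtain r where r: "y = ennreal r" "0 \<le> r" by (cases y) auto
  show False
  proof (cases x)
    case (real t)
    then have "t\<^sup>2 \<le> r\<^sup>2" using r assms by (simp add: ennreal_power)
    then have "t \<le> r" by (rule power2_le_imp_le) (rule r)
    then show False using r real \<open>y < x\<close> by (simp add: ennreal_less_iff)
  next
    case top
    then show False using r assms by (simp add: ennreal_power ennreal_top_mult power2_eq_square top_unique ennreal_mult[symmetric])
  qed
qed

lemma L2_CS_nn:
  fixes f :: "'a::euclidean_space \<Rightarrow> 'b::euclidean_space" and g :: "'a \<Rightarrow> 'c::euclidean_space"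
  assumes f: "L2 f" and g: "L2 g"
  shows "(\<integral>\<^sup>+x. ennreal (norm (f x) * norm (g x)) \<partial>lborel) \<le> ennreal (L2_norm f * L2_norm g)"
proof (rule ennreal_power2_le_imp_le)
  have [measurable]: "f \<in> borel_measurable borel" "g \<in> borel_measurable borel" using f g by (auto simp: L2_def)
  have "(\<integral>\<^sup>+x. ennreal (norm (f x) * norm (g x)) \<partial>lborel)\<^sup>2 = (\<integral>\<^sup>+x. ennreal (norm (f x)) * ennreal (norm (g x)) \<partial>lborel)\<^sup>2"
    by (simp add: ennreal_mult)
  also have "\<dots> \<le> (\<integral>\<^sup>+x. ennreal (norm (f x)) ^ 2 \<partial>lborel) * (\<integral>\<^sup>+x. ennreal (norm (g x)) ^ 2 \<partial>lborel)"
    by (rule Cauchy_Schwarz_nn_integral) auto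
  also have "\<dots> = (ennreal (L2_norm f * L2_norm g))\<^sup>2"
    by (simp add: ennreal_power nn2_eq f g power_mult_distrib ennreal_mult)
  finally show "(\<integral>\<^sup>+x. ennreal (norm (f x) * norm (g x)) \<partial>lborel)\<^sup>2 \<le> (ennreal (L2_norm f * L2_norm g))\<^sup>2" .
qed

lemma L2_product_integrable:
  fixes f :: "'a::euclidean_space \<Rightarrow> 'b::euclidean_space" and g :: "'a \<Rightarrow> 'c::euclidean_space"
    and h :: "'a \<Rightarrow> 'd::euclidean_space"
  assumes f: "L2 f" and g: "L2 g" and h: "h \<in> borel_measurable borel"
    and le: "\<And>x. norm (h x) \<le> norm (f x) * norm (g x)"
  shows "integrable lborel h" "norm (\<integral>x. h x \<partial>lborel) \<le> L2_norm f * L2_norm g"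
    "(\<integral>x. norm (h x) \<partial>lborel) \<le> L2_norm f * L2_norm g"
proof -
  have "(\<integral>\<^sup>+x. ennreal (norm (h x)) \<partial>lborel) \<le> (\<integral>\<^sup>+x. ennreal (norm (f x) * norm (g x)) \<partial>lborel)"
    by (intro nn_integral_mono ennreal_leI le)
  also have "\<dots> \<le> ennreal (L2_norm f * L2_norm g)" by (rule L2_CS_nn[OF f g])
  finally have *: "(\<integral>\<^sup>+x. ennreal (norm (h x)) \<partial>lborel) \<le> ennreal (L2_norm f * L2_norm g)" .
  show int: "integrable lborel h"
    using h * by (intro integrableI_bounded) (auto intro: le_less_trans)
  show 3: "(\<integral>x. norm (h x) \<partial>lborel) \<le> L2_norm f * L2_norm g"
    using * int by (subst (asm) nn_integral_eq_integral) auto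
  show "norm (\<integral>x. h x \<partial>lborel) \<le> L2_norm f * L2_norm g"
    using integral_norm_bound[of lborel h] 3 by linarith
qed

lemma L2_inner_integrable: "L2 f \<Longrightarrow> L2 g \<Longrightarrow> integrable lborel (\<lambda>x. f x \<bullet> g x)"
  by (rule L2_product_integrable(1)[of f g]) (auto simp: Cauchy_Schwarz_ineq2 L2_def)

lemma L2_inner_le: "L2 f \<Longrightarrow> L2 g \<Longrightarrow> \<bar>\<integral>x. f x \<bullet> g x \<partial>lborel\<bar> \<le> L2_norm f * L2_norm g"
  using L2_product_integrable(2)[of f g "\<lambda>x. f x \<bullet> g x"] by (auto simp: Cauchy_Schwarz_ineq2 L2_def)

lemma L2_scaleR_integrable: "L2 \<psi> \<Longrightarrow> L2 g \<Longrightarrow> integrable lborel (\<lambda>x. \<psi> x *\<^sub>R g x)"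
  by (rule L2_product_integrable(1)[of \<psi> g]) (auto simp: L2_def)

lemma L2_scaleR_le: "L2 \<psi> \<Longrightarrow> L2 g \<Longrightarrow> norm (\<integral>x. \<psi> x *\<^sub>R g x \<partial>lborel) \<le> L2_norm \<psi> * L2_norm g"
  by (rule L2_product_integrable(2)[of \<psi> g]) (auto simp: L2_def)

lemma L2_norm_inner: "(L2_norm f)\<^sup>2 = (\<integral>x. f x \<bullet> f x \<partial>lborel)"
  by (simp add: L2_norm_power2 power2_norm_eq_inner)

lemma L2_zero [simp]: "L2 (\<lambda>x. 0)" by (simp add: L2_def)

lemma L2_scale: assumes "L2 f" shows "L2 (\<lambda>x. c *\<^sub>R f x)"
proof -
  have [measurable]: "f \<in> borel_measurable borel" using assms by (simp add: L2_def)
  show ?thesis using assms by (simp add: L2_def power_mult_distrib)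
qed

lemma L2_norm_scale: "L2_norm (\<lambda>x. c *\<^sub>R f x) = \<bar>c\<bar> * L2_norm f"
  by (simp add: L2_norm_def power_mult_distrib real_sqrt_mult)

lemma L2_norm_minus: "L2_norm (\<lambda>x. - f x) = L2_norm f"
  by (simp add: L2_norm_def)

lemma L2_norm_minus_commute: "L2_norm (\<lambda>x. f x - g x) = L2_norm (\<lambda>x. g x - f x)"
  by (simp add: L2_norm_def norm_minus_commute)

lemma L2_add:
  assumes f: "L2 f" and g: "L2 g"
  shows "L2 (\<lambda>x. f x + g x)" "L2_norm (\<lambda>x. f x + g x) \<le> L2_norm f + L2_norm g"
proof -
  have [measurable]: "f \<in> borel_measurable borel" "g \<in> borel_measurable borel" using f g by (auto simp: L2_def)
  have int: "integrable lborel (\<lambda>x. f x \<bullet> f x + 2 * (f x \<bullet> g x) + g x \<bullet> g x)"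
    by (intro Bochner_Integration.integrable_add integrable_mult_right L2_inner_integrable f g)
  have eq: "(norm (f x + g x))\<^sup>2 = f x \<bullet> f x + 2 * (f x \<bullet> g x) + g x \<bullet> g x" for x
    by (simp add: power2_norm_eq_inner inner_add inner_commute)
  show 1: "L2 (\<lambda>x. f x + g x)" using int by (simp add: L2_def eq)
  have "(L2_norm (\<lambda>x. f x + g x))\<^sup>2 = (L2_norm f)\<^sup>2 + 2 * (\<integral>x. f x \<bullet> g x \<partial>lborel) + (L2_norm g)\<^sup>2"
    unfolding L2_norm_power2[of "\<lambda>x. f x + g x"] eq L2_norm_inner using f g
    by (simp add: L2_inner_integrable)
  also have "\<dots> \<le> (L2_norm f + L2_norm g)\<^sup>2"
    using L2_inner_le[OF f g] by (simp add: power2_sum)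
  finally show "L2_norm (\<lambda>x. f x + g x) \<le> L2_norm f + L2_norm g"
    by (rule power2_le_imp_le) simp
qed

lemma L2_minus: "L2 f \<Longrightarrow> L2 (\<lambda>x. - f x)" using L2_scale[of f "-1"] by simp

lemma L2_diff:
  assumes f: "L2 f" and g: "L2 g"
  shows "L2 (\<lambda>x. f x - g x)" "L2_norm (\<lambda>x. f x - g x) \<le> L2_norm f + L2_norm g"
  using L2_add[OF f L2_minus[OF g]] by (simp_all add: L2_norm_minus)

lemma L2_norm_triangle_diff:
  assumes "L2 f" "L2 g" shows "\<bar>L2_norm f - L2_norm g\<bar> \<le> L2_norm (\<lambda>x. f x - g x)"
  using L2_add(2)[OF L2_diff(1)[OF assms] assms(2)]
    L2_add(2)[OF L2_diff(1)[OF assms(2,1)] assms(1)] L2_norm_minus_commute[of f g] by simp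

lemma L2_sum:
  assumes "finite A" "\<And>a. a \<in> A \<Longrightarrow> L2 (f a)"
  shows "L2 (\<lambda>x. \<Sum>a\<in>A. f a x) \<and> L2_norm (\<lambda>x. \<Sum>a\<in>A. f a x) \<le> (\<Sum>a\<in>A. L2_norm (f a))"
  using assms
proof (induction A rule: finite_induct)
  case empty then show ?case by (simp add: L2_norm_def)
next
  case (insert a A)
  then show ?case using L2_add[of "f a" "\<lambda>x. \<Sum>a\<in>A. f a x"] by auto
qed

lemma L2_norm_eq_0: assumes "L2 f" "L2_norm f = 0" shows "AE x in lborel. f x = 0"
proof -
  have "nn2 f = 0" using nn2_eq[OF assms(1)] assms(2) by simp
  then show ?thesis using assms(1) by (subst (asm) nn_integral_0_iff_AE) (auto simp: L2_def)
qed

lemma L2_bounded_integrable: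
  assumes "integrable lborel f" "\<And>x. norm (f x) \<le> C"
  shows "L2 f"
  unfolding L2_def
proof
  show [measurable]: "f \<in> borel_measurable borel" using assms(1) by auto
  have C: "0 \<le> C" using order_trans[OF norm_ge_zero assms(2)] .
  show "integrable lborel (\<lambda>x. (norm (f x))\<^sup>2)"
    by (rule Bochner_Integration.integrable_bound[of _ "\<lambda>x. C *\<^sub>R norm (f x)"])
      (use assms C in \<open>auto simp: power2_eq_square intro!: mult_right_mono\<close>)
qed

lemma continuous_compact_support_integrable:
  fixes f :: "'e::euclidean_space \<Rightarrow> 'f::euclidean_space"
  assumes "continuous_on UNIV f" "compact K" "\<And>x. x \<notin> K \<Longrightarrow> f x = 0"
  shows "integrable lborel f"
proof -
  have "integrable lborel (\<lambda>x. indicator K x *\<^sub>R f x)"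
    using borel_integrable_compact[OF assms(2), of f] assms(1) continuous_on_subset by blast
  moreover have "indicator K x *\<^sub>R f x = f x" for x using assms(3)[of x] by (cases "x \<in> K") auto
  ultimately show ?thesis by simp
qed

lemma test_function_integrable:
  assumes "test_function \<Omega> \<psi>" shows "integrable lborel \<psi>"
proof -
  obtain K where "compact K" "\<And>x. x \<notin> K \<Longrightarrow> \<psi> x = 0" using test_function_support[OF assms] by metis
  then show ?thesis
    using continuous_compact_support_integrable smooth_continuous test_function_smooth[OF assms] by blast
qed

lemma test_function_L2: assumes "test_function \<Omega> \<psi>" shows "L2 \<psi>"
proof -
  obtain C where "\<And>x. \<bar>\<psi> x\<bar> \<le> C" using test_function_bounded[OF assms] by metis
  then show ?thesis using L2_bounded_integrable[OF test_function_integrable[OF assms], of C] by simp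
qed

subsection \<open>Translations\<close>

lemma lborel_shift: "distr lborel borel (\<lambda>x. x - c) = (lborel :: 'a::euclidean_space measure)"
proof -
  have "(\<lambda>x. x - c) = (+) (- c)" by (auto simp: fun_eq_iff)
  then show ?thesis using lborel_distr_plus[of "- c"] by simp
qed

lemma nn_integral_shift:
  "f \<in> borel_measurable borel \<Longrightarrow> (\<integral>\<^sup>+x. f (x - c) \<partial>lborel) = (\<integral>\<^sup>+x. f x \<partial>(lborel :: 'a::euclidean_space measure))"
  by (subst (2) lborel_shift[of c, symmetric]) (simp add: nn_integral_distr)

lemma integral_shift:
  fixes f :: "'a::euclidean_space \<Rightarrow> 'b::{banach, second_countable_topology}"
  shows "f \<in> borel_measurable borel \<Longrightarrow> (\<integral>x. f (x - c) \<partial>lborel) = (\<integral>x. f x \<partial>lborel)"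
  by (subst (2) lborel_shift[of c, symmetric]) (simp add: integral_distr)

lemma integrable_shift:
  fixes f :: "'a::euclidean_space \<Rightarrow> 'b::{banach, second_countable_topology}"
  assumes "integrable lborel f" shows "integrable lborel (\<lambda>x. f (x - c))"
proof -
  have "integrable (distr lborel borel (\<lambda>x. x - c)) f" using assms by (simp add: lborel_shift)
  then show ?thesis by (subst (asm) integrable_distr_eq) (use assms in auto)
qed

lemma L2_shift: 
  assumes "L2 f" shows "L2 (\<lambda>x. f (x - c))" "L2_norm (\<lambda>x. f (x - c)) = L2_norm f"
proof -
  have [measurable]: "f \<in> borel_measurable borel" using assms by (simp add: L2_def)
  show "L2 (\<lambda>x. f (x - c))" using assms integrable_shift[of "\<lambda>x. (norm (f x))\<^sup>2" c] by (simp add: L2_def)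
  show "L2_norm (\<lambda>x. f (x - c)) = L2_norm f"
    unfolding L2_norm_def using integral_shift[of "\<lambda>x. (norm (f x))\<^sup>2" c] by simp
qed

lemma AE_shift:
  fixes c :: "'a::euclidean_space"
  assumes "AE x in lborel. P x" shows "AE x in lborel. P (x - c)"
proof -
  obtain N where N: "{x. \<not> P x} \<subseteq> N" "N \<in> null_sets lborel" using assms by (auto simp: eventually_ae_filter)
  have "(\<lambda>x. x - c) -` N \<in> null_sets lborel"
  proof
    have [measurable]: "N \<in> sets borel" using N by auto
    show "(\<lambda>x. x - c) -` N \<in> sets lborel" using measurable_sets_borel[of "\<lambda>x. x - c" borel N] by simp
    have "emeasure lborel ((\<lambda>x. x - c) -` N) = emeasure (distr lborel borel (\<lambda>x. x - c)) N"
      by (subst emeasure_distr) auto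
    also have "\<dots> = 0" unfolding lborel_shift using N by auto
    finally show "emeasure lborel ((\<lambda>x. x - c) -` N) = 0" .
  qed
  then show ?thesis using N(1)
    by (auto simp: eventually_ae_filter intro!: bexI[of _ "(\<lambda>x. x - c) -` N"])
qed

subsection \<open>Minkowski's integral inequality\<close>

text \<open>
  Expand the square of the inner integral into a double integral in \<open>y\<close> and \<open>y'\<close>, exchange the order of
  integration, and apply the Cauchy-Schwarz inequality in \<open>x\<close>.
\<close>

lemma minkowski_nn:
  fixes F :: "'c::euclidean_space \<Rightarrow> 'a::euclidean_space \<Rightarrow> ennreal"
  assumes F: "(\<lambda>z. F (fst z) (snd z)) \<in> borel_measurable borel"
    and a[measurable]: "a \<in> borel_measurable borel"
    and le: "\<And>y. (\<integral>\<^sup>+x. (F y x)\<^sup>2 \<partial>lborel) \<le> (a y)\<^sup>2"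
  shows "(\<integral>\<^sup>+x. (\<integral>\<^sup>+y. F y x \<partial>lborel)\<^sup>2 \<partial>lborel) \<le> (\<integral>\<^sup>+y. a y \<partial>lborel)\<^sup>2"
proof -
  have [measurable]: "(\<lambda>z. F (fst z) (snd z)) \<in> borel_measurable (borel \<Otimes>\<^sub>M borel)"
    using F by (simp add: borel_prod)
  have Fm[measurable]: "(\<lambda>z. F (f z) (g z)) \<in> borel_measurable M" if [measurable]: "f \<in> M \<rightarrow>\<^sub>M borel" "g \<in> M \<rightarrow>\<^sub>M borel" for f g M
    using measurable_compose[of "\<lambda>z. (f z, g z)" M "borel \<Otimes>\<^sub>M borel" "\<lambda>z. F (fst z) (snd z)" borel] by simp
  have CS: "(\<integral>\<^sup>+x. F y x * F y' x \<partial>lborel) \<le> a y * a y'" for y y'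
  proof (rule ennreal_power2_le_imp_le)
    have "(\<integral>\<^sup>+x. F y x * F y' x \<partial>lborel)\<^sup>2 \<le> (\<integral>\<^sup>+x. (F y x)\<^sup>2 \<partial>lborel) * (\<integral>\<^sup>+x. (F y' x)\<^sup>2 \<partial>lborel)"
      by (rule Cauchy_Schwarz_nn_integral) auto
    also have "\<dots> \<le> (a y)\<^sup>2 * (a y')\<^sup>2" by (intro mult_mono le) auto
    finally show "(\<integral>\<^sup>+x. F y x * F y' x \<partial>lborel)\<^sup>2 \<le> (a y * a y')\<^sup>2" by (simp add: power_mult_distrib)
  qed
  have "(\<integral>\<^sup>+x. (\<integral>\<^sup>+y. F y x \<partial>lborel)\<^sup>2 \<partial>lborel) = (\<integral>\<^sup>+x. (\<integral>\<^sup>+y. (\<integral>\<^sup>+y'. F y x * F y' x \<partial>lborel) \<partial>lborel) \<partial>lborel)"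
    by (simp add: nn_integral_cmult nn_integral_multc power2_eq_square)
  also have "\<dots> = (\<integral>\<^sup>+y. (\<integral>\<^sup>+x. (\<integral>\<^sup>+y'. F y x * F y' x \<partial>lborel) \<partial>lborel) \<partial>lborel)"
    by (rule lborel_pair.Fubini') measurable
  also have "\<dots> = (\<integral>\<^sup>+y. (\<integral>\<^sup>+y'. (\<integral>\<^sup>+x. F y x * F y' x \<partial>lborel) \<partial>lborel) \<partial>lborel)"
    by (intro nn_integral_cong lborel_pair.Fubini') measurable
  also have "\<dots> \<le> (\<integral>\<^sup>+y. (\<integral>\<^sup>+y'. a y * a y' \<partial>lborel) \<partial>lborel)"
    by (intro nn_integral_mono CS)
  also have "\<dots> = (\<integral>\<^sup>+y. a y \<partial>lborel)\<^sup>2"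
    by (simp add: nn_integral_cmult nn_integral_multc power2_eq_square)
  finally show ?thesis .
qed

lemma minkowski_L2:
  fixes F :: "'c::euclidean_space \<Rightarrow> 'a::euclidean_space \<Rightarrow> 'b::euclidean_space"
  assumes F: "(\<lambda>z. F (fst z) (snd z)) \<in> borel_measurable borel"
    and L2F: "\<And>y. L2 (F y)" and le: "\<And>y. L2_norm (F y) \<le> a y" and a: "integrable lborel a"
  shows "L2 (\<lambda>x. \<integral>y. F y x \<partial>lborel)" "L2_norm (\<lambda>x. \<integral>y. F y x \<partial>lborel) \<le> (\<integral>y. a y \<partial>lborel)"
    "AE x in lborel. integrable lborel (\<lambda>y. F y x)"
proof -
  have [measurable]: "(\<lambda>z. F (fst z) (snd z)) \<in> borel_measurable (borel \<Otimes>\<^sub>M borel)"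
    using F by (simp add: borel_prod)
  have Fm[measurable]: "(\<lambda>z. F (f z) (g z)) \<in> borel_measurable M" if [measurable]: "f \<in> M \<rightarrow>\<^sub>M borel" "g \<in> M \<rightarrow>\<^sub>M borel" for f g M
    using measurable_compose[of "\<lambda>z. (f z, g z)" M "borel \<Otimes>\<^sub>M borel" "\<lambda>z. F (fst z) (snd z)" borel] by simp
  have a0: "0 \<le> a y" for y using le[of y] L2_norm_nonneg[of "F y"] by linarith
  have am[measurable]: "a \<in> borel_measurable borel" using a by auto
  have "(\<integral>\<^sup>+x. (\<integral>\<^sup>+y. ennreal (norm (F y x)) \<partial>lborel)\<^sup>2 \<partial>lborel) \<le> (\<integral>\<^sup>+y. ennreal (a y) \<partial>lborel)\<^sup>2"
  proof (rule minkowski_nn)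
    show "(\<integral>\<^sup>+x. (ennreal (norm (F y x)))\<^sup>2 \<partial>lborel) \<le> (ennreal (a y))\<^sup>2" for y
      using nn2_eq[OF L2F[of y]] le[of y] a0 by (simp add: ennreal_power ennreal_leI power_mono)
    show "(\<lambda>z. ennreal (norm (F (fst z) (snd z)))) \<in> borel_measurable borel" using F by measurable
  qed auto
  also have "\<dots> = ennreal ((\<integral>y. a y \<partial>lborel)\<^sup>2)"
    using a a0 by (subst nn_integral_eq_integral) (auto simp: ennreal_power)
  finally have fin: "(\<integral>\<^sup>+x. (\<integral>\<^sup>+y. ennreal (norm (F y x)) \<partial>lborel)\<^sup>2 \<partial>lborel) \<le> ennreal ((\<integral>y. a y \<partial>lborel)\<^sup>2)" .
  have "AE x in lborel. (\<integral>\<^sup>+y. ennreal (norm (F y x)) \<partial>lborel)\<^sup>2 \<noteq> \<infinity>"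
    by (rule nn_integral_PInf_AE) (use fin in \<open>auto simp: top_unique\<close>)
  then show "AE x in lborel. integrable lborel (\<lambda>y. F y x)"
  proof eventually_elim
    case (elim x)
    then have "(\<integral>\<^sup>+y. ennreal (norm (F y x)) \<partial>lborel) \<noteq> \<infinity>"
      by (auto simp: power2_eq_square ennreal_top_mult)
    then show ?case by (intro integrableI_bounded) (auto simp: less_top)
  qed
  have "nn2 (\<lambda>x. \<integral>y. F y x \<partial>lborel) \<le> (\<integral>\<^sup>+x. (\<integral>\<^sup>+y. ennreal (norm (F y x)) \<partial>lborel)\<^sup>2 \<partial>lborel)"
  proof (rule nn_integral_mono)
    fix x
    have "ennreal (norm (\<integral>y. F y x \<partial>lborel)) \<le> (\<integral>\<^sup>+y. ennreal (norm (F y x)) \<partial>lborel)"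
      by (cases "integrable lborel (\<lambda>y. F y x)")
        (auto simp: integral_norm_bound_ennreal not_integrable_integral_eq)
    then show "ennreal ((norm (\<integral>y. F y x \<partial>lborel))\<^sup>2) \<le> (\<integral>\<^sup>+y. ennreal (norm (F y x)) \<partial>lborel)\<^sup>2"
      by (simp add: ennreal_power[symmetric] power_mono)
  qed
  also note fin
  finally have n: "nn2 (\<lambda>x. \<integral>y. F y x \<partial>lborel) \<le> ennreal ((\<integral>y. a y \<partial>lborel)\<^sup>2)" .
  have m: "(\<lambda>x. \<integral>y. F y x \<partial>lborel) \<in> borel_measurable borel"
    by (rule lborel.borel_measurable_lebesgue_integral) (unfold case_prod_unfold, measurable)
  show "L2 (\<lambda>x. \<integral>y. F y x \<partial>lborel)" "L2_norm (\<lambda>x. \<integral>y. F y x \<partial>lborel) \<le> (\<integral>y. a y \<partial>lborel)"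
    by (rule L2I_bound[OF m _ n], simp add: a0)+
qed

section \<open>Averages of translates\<close>

lemma borel_pair_arg:
  assumes "(\<lambda>z. F (fst z) (snd z)) \<in> borel_measurable (borel :: ('c::euclidean_space \<times> 'a::euclidean_space) measure)"
    and [measurable]: "f \<in> M \<rightarrow>\<^sub>M borel" "g \<in> M \<rightarrow>\<^sub>M borel"
  shows "(\<lambda>z. F (f z) (g z)) \<in> borel_measurable M"
proof -
  have [measurable]: "(\<lambda>z. F (fst z) (snd z)) \<in> borel_measurable (borel \<Otimes>\<^sub>M borel)"
    using assms(1) by (simp add: borel_prod)
  show ?thesis
    using measurable_compose[of "\<lambda>z. (f z, g z)" M "borel \<Otimes>\<^sub>M borel" "\<lambda>z. F (fst z) (snd z)" borel] by simp
qed

lemma product_integrable_pair: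
  fixes H :: "'c::euclidean_space \<Rightarrow> 'a::euclidean_space \<Rightarrow> 'd::euclidean_space"
  assumes H: "(\<lambda>z. H (fst z) (snd z)) \<in> borel_measurable borel"
    and k: "integrable lborel (k :: 'c \<Rightarrow> real)"
    and le: "\<And>y. (\<integral>\<^sup>+x. ennreal (norm (H y x)) \<partial>lborel) \<le> ennreal (k y)"
  shows "integrable (lborel \<Otimes>\<^sub>M lborel) (\<lambda>(y, x). H y x)"
proof (rule integrableI_bounded)
  have [measurable]: "(\<lambda>z. H (fst z) (snd z)) \<in> borel_measurable (borel \<Otimes>\<^sub>M borel)"
    using H by (simp add: borel_prod)
  note [measurable] = borel_pair_arg[OF H]
  have [measurable]: "k \<in> borel_measurable borel" using k by auto
  show "(\<lambda>(y, x). H y x) \<in> borel_measurable (lborel \<Otimes>\<^sub>M lborel)"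
    unfolding case_prod_unfold by measurable
  have "(\<integral>\<^sup>+z. ennreal (norm (case z of (y, x) \<Rightarrow> H y x)) \<partial>(lborel \<Otimes>\<^sub>M lborel)) =
      (\<integral>\<^sup>+y. (\<integral>\<^sup>+x. ennreal (norm (H y x)) \<partial>lborel) \<partial>lborel)"
    by (subst lborel.nn_integral_fst[symmetric]) (auto simp: case_prod_unfold)
  also have "\<dots> \<le> (\<integral>\<^sup>+y. ennreal (norm (k y)) \<partial>lborel)"
    by (intro nn_integral_mono order_trans[OF le] ennreal_leI) simp
  also have "\<dots> < \<infinity>" using k by (simp add: integrable_iff_bounded)
  finally show "(\<integral>\<^sup>+z. ennreal (norm (case z of (y, x) \<Rightarrow> H y x)) \<partial>(lborel \<Otimes>\<^sub>M lborel)) < \<infinity>" .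
qed

lemma kernel_integrable_pair:
  fixes H :: "'c::euclidean_space \<Rightarrow> 'a::euclidean_space \<Rightarrow> 'd::euclidean_space"
    and f :: "'a \<Rightarrow> 'b::euclidean_space" and g :: "'a \<Rightarrow> 'e::euclidean_space"
  assumes H: "(\<lambda>z. H (fst z) (snd z)) \<in> borel_measurable borel"
    and k: "integrable lborel k" and f: "L2 f" and g: "L2 g"
    and le: "\<And>y x. norm (H y x) \<le> \<bar>k y\<bar> * (norm (f (x - s y)) * norm (g x))"
  shows "integrable (lborel \<Otimes>\<^sub>M lborel) (\<lambda>(y, x). H y x)"
proof (rule product_integrable_pair[OF H])
  show "integrable lborel (\<lambda>y. \<bar>k y\<bar> * (L2_norm f * L2_norm g))" using k by simp
  fix y
  have [measurable]: "f \<in> borel_measurable borel" "g \<in> borel_measurable borel" using f g by (auto simp: L2_def)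
  have "(\<integral>\<^sup>+x. ennreal (norm (H y x)) \<partial>lborel) \<le> (\<integral>\<^sup>+x. ennreal \<bar>k y\<bar> * ennreal (norm (f (x - s y)) * norm (g x)) \<partial>lborel)"
    by (intro nn_integral_mono) (simp add: ennreal_mult[symmetric] le)
  also have "\<dots> = ennreal \<bar>k y\<bar> * (\<integral>\<^sup>+x. ennreal (norm (f (x - s y)) * norm (g x)) \<partial>lborel)"
    by (intro nn_integral_cmult) measurable
  also have "\<dots> \<le> ennreal \<bar>k y\<bar> * ennreal (L2_norm f * L2_norm g)"
    using L2_CS_nn[OF L2_shift(1)[OF f] g, of "s y"] by (simp add: L2_shift(2)[OF f] mult_left_mono)
  finally show "(\<integral>\<^sup>+x. ennreal (norm (H y x)) \<partial>lborel) \<le> ennreal (\<bar>k y\<bar> * (L2_norm f * L2_norm g))"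
    by (simp add: ennreal_mult)
qed

text \<open>
  A common form for convolutions (\<open>s y = y\<close>), for the mean of \<open>f\<close> over a segment, which occurs in the
  integral form of a difference quotient, and for single translates. All of them are superpositions
  of translates, hence bounded on \<open>L\<^sup>2\<close> and compatible with weak derivatives.
\<close>

definition avg :: "('c::euclidean_space \<Rightarrow> real) \<Rightarrow> ('c \<Rightarrow> 'a) \<Rightarrow> ('a::euclidean_space \<Rightarrow> 'b::euclidean_space) \<Rightarrow> 'a \<Rightarrow> 'b" where
  "avg k s f x = (\<integral>y. k y *\<^sub>R f (x - s y) \<partial>lborel)"

lemma avg_measurable:
  fixes k :: "'c::euclidean_space \<Rightarrow> real" and s :: "'c \<Rightarrow> 'a::euclidean_space" and f :: "'a \<Rightarrow> 'b::euclidean_space"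
  assumes [measurable]: "k \<in> borel_measurable borel" "s \<in> borel_measurable borel" "f \<in> borel_measurable borel"
  shows "(\<lambda>z. k (fst z) *\<^sub>R f (snd z - s (fst z))) \<in> borel_measurable borel"
  unfolding borel_prod[symmetric] by measurable

lemma avg_L2:
  assumes k: "integrable lborel k" and s: "s \<in> borel_measurable borel" and f: "L2 f"
  shows "L2 (avg k s f)" "L2_norm (avg k s f) \<le> (\<integral>y. \<bar>k y\<bar> \<partial>lborel) * L2_norm f"
    "AE x in lborel. integrable lborel (\<lambda>y. k y *\<^sub>R f (x - s y))"
proof -
  have m: "(\<lambda>z. k (fst z) *\<^sub>R f (snd z - s (fst z))) \<in> borel_measurable borel"
    using k s f by (intro avg_measurable) (auto simp: L2_def)
  have 1: "L2 (\<lambda>x. k y *\<^sub>R f (x - s y))" for y by (intro L2_scale L2_shift f)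
  have 2: "L2_norm (\<lambda>x. k y *\<^sub>R f (x - s y)) \<le> \<bar>k y\<bar> * L2_norm f" for y
    by (simp add: L2_norm_scale L2_shift[OF f])
  have 3: "integrable lborel (\<lambda>y. \<bar>k y\<bar> * L2_norm f)" using k by simp
  note * = minkowski_L2[of "\<lambda>y x. k y *\<^sub>R f (x - s y)", OF m 1 2 3]
  show "L2 (avg k s f)" "L2_norm (avg k s f) \<le> (\<integral>y. \<bar>k y\<bar> \<partial>lborel) * L2_norm f"
    "AE x in lborel. integrable lborel (\<lambda>y. k y *\<^sub>R f (x - s y))"
    using * by (simp_all add: avg_def[abs_def])
qed

lemma avg_inner:
  assumes k: "integrable lborel k" and s: "s \<in> borel_measurable borel" and f: "L2 f" and g: "L2 g"
  shows "(\<integral>x. avg k s f x \<bullet> g x \<partial>lborel) = (\<integral>y. k y * (\<integral>x. f (x - s y) \<bullet> g x \<partial>lborel) \<partial>lborel)"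
    and "integrable lborel (\<lambda>y. k y * (\<integral>x. f (x - s y) \<bullet> g x \<partial>lborel))"
proof -
  have [measurable]: "k \<in> borel_measurable borel" "f \<in> borel_measurable borel" "g \<in> borel_measurable borel" "s \<in> borel_measurable borel"
    using k f g s by (auto simp: L2_def)
  have int: "integrable (lborel \<Otimes>\<^sub>M lborel) (\<lambda>(y, x). k y * (f (x - s y) \<bullet> g x))"
  proof (rule kernel_integrable_pair[OF _ k f g])
    show "(\<lambda>z. k (fst z) * (f (snd z - s (fst z)) \<bullet> g (snd z))) \<in> borel_measurable borel"
      unfolding borel_prod[symmetric] by measurable
    show "norm (k y * (f (x - s y) \<bullet> g x)) \<le> \<bar>k y\<bar> * (norm (f (x - s y)) * norm (g x))" for y x
      by (simp add: abs_mult Cauchy_Schwarz_ineq2 mult_left_mono)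
  qed
  have "(\<integral>x. avg k s f x \<bullet> g x \<partial>lborel) = (\<integral>x. (\<integral>y. k y * (f (x - s y) \<bullet> g x) \<partial>lborel) \<partial>lborel)"
  proof (rule integral_cong_AE)
    show "(\<lambda>x. avg k s f x \<bullet> g x) \<in> borel_measurable lborel"
      using L2_borel[OF avg_L2(1)[OF k s f]] by measurable
    show "(\<lambda>x. \<integral>y. k y * (f (x - s y) \<bullet> g x) \<partial>lborel) \<in> borel_measurable lborel" by measurable
    show "AE x in lborel. avg k s f x \<bullet> g x = (\<integral>y. k y * (f (x - s y) \<bullet> g x) \<partial>lborel)"
      using avg_L2(3)[OF k s f]
    proof eventually_elim
      case (elim x)
      then show ?case unfolding avg_def
        by (subst integral_inner_left[symmetric]) (auto simp: mult.commute)
    qed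
  qed
  also have "\<dots> = (\<integral>y. (\<integral>x. k y * (f (x - s y) \<bullet> g x) \<partial>lborel) \<partial>lborel)"
    by (rule lborel_pair.Fubini_integral[OF int])
  finally show "(\<integral>x. avg k s f x \<bullet> g x \<partial>lborel) = (\<integral>y. k y * (\<integral>x. f (x - s y) \<bullet> g x \<partial>lborel) \<partial>lborel)" by simp
  show "integrable lborel (\<lambda>y. k y * (\<integral>x. f (x - s y) \<bullet> g x \<partial>lborel))"
    using lborel_pair.integrable_fst[OF int] by simp
qed

lemma avg_scaleR:
  fixes f :: "'a::euclidean_space \<Rightarrow> 'b::euclidean_space"
  assumes k: "integrable lborel k" and s: "s \<in> borel_measurable borel" and f: "L2 f" and g: "L2 \<psi>"
  shows "(\<integral>x. \<psi> x *\<^sub>R avg k s f x \<partial>lborel) = (\<integral>y. k y *\<^sub>R (\<integral>x. \<psi> x *\<^sub>R f (x - s y) \<partial>lborel) \<partial>lborel)"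
proof -
  have [measurable]: "k \<in> borel_measurable borel" "f \<in> borel_measurable borel" "\<psi> \<in> borel_measurable borel" "s \<in> borel_measurable borel"
    using k f g s by (auto simp: L2_def)
  have int: "integrable (lborel \<Otimes>\<^sub>M lborel) (\<lambda>(y, x). k y *\<^sub>R \<psi> x *\<^sub>R f (x - s y))"
  proof (rule kernel_integrable_pair[OF _ k f g])
    show "(\<lambda>z. k (fst z) *\<^sub>R \<psi> (snd z) *\<^sub>R f (snd z - s (fst z))) \<in> borel_measurable borel"
      unfolding borel_prod[symmetric] by measurable
    show "norm (k y *\<^sub>R \<psi> x *\<^sub>R f (x - s y)) \<le> \<bar>k y\<bar> * (norm (f (x - s y)) * norm (\<psi> x))" for y x
      by (simp add: abs_mult mult_ac)
  qed
  have "(\<integral>x. \<psi> x *\<^sub>R avg k s f x \<partial>lborel) = (\<integral>x. (\<integral>y. k y *\<^sub>R \<psi> x *\<^sub>R f (x - s y) \<partial>lborel) \<partial>lborel)"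
  proof (rule Bochner_Integration.integral_cong)
    fix x
    have "k y *\<^sub>R \<psi> x *\<^sub>R f (x - s y) = \<psi> x *\<^sub>R (k y *\<^sub>R f (x - s y))" for y by simp
    then show "\<psi> x *\<^sub>R avg k s f x = (\<integral>y. k y *\<^sub>R \<psi> x *\<^sub>R f (x - s y) \<partial>lborel)"
      unfolding avg_def by (simp del: scaleR_scaleR)
  qed simp
  also have "\<dots> = (\<integral>y. (\<integral>x. k y *\<^sub>R \<psi> x *\<^sub>R f (x - s y) \<partial>lborel) \<partial>lborel)"
    by (rule lborel_pair.Fubini_integral[OF int])
  finally show ?thesis by (simp del: scaleR_scaleR)
qed

subsection \<open>Weak derivatives\<close>

lemma test_partial_L2: "test_function \<Omega> \<psi> \<Longrightarrow> i \<in> Basis \<Longrightarrow> L2 (partial_deriv i \<psi>)"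
  using test_function_L2 test_function_partial by blast

lemma has_weak_deriv_unique:
  assumes "has_weak_deriv i f g" "has_weak_deriv i f g'" "L2 g" "L2 g'"
  shows "AE x in lborel. g x = g' x"
proof -
  have "AE x in lborel. g x - g' x = 0"
  proof (rule fundamental_lemma)
    show "(\<lambda>x. g x - g' x) \<in> borel_measurable borel" using assms by (auto simp: L2_def)
    fix \<psi> :: "'a \<Rightarrow> real" assume \<psi>: "test_function UNIV \<psi>"
    have "integrable lborel (\<lambda>x. \<psi> x *\<^sub>R g x)" "integrable lborel (\<lambda>x. \<psi> x *\<^sub>R g' x)"
      using L2_scaleR_integrable test_function_L2[OF \<psi>] assms by auto
    moreover have "(\<integral>x. \<psi> x *\<^sub>R g x \<partial>lborel) = (\<integral>x. \<psi> x *\<^sub>R g' x \<partial>lborel)"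
      using assms(1,2) \<psi> unfolding has_weak_deriv_def by (metis add.inverse_inverse)
    ultimately show "integrable lborel (\<lambda>x. \<psi> x *\<^sub>R (g x - g' x)) \<and> (\<integral>x. \<psi> x *\<^sub>R (g x - g' x) \<partial>lborel) = 0"
      by (simp add: scaleR_right_diff_distrib)
  qed
  then show ?thesis by simp
qed

lemma has_weak_deriv_cong_AE:
  assumes "has_weak_deriv i f g" "i \<in> Basis" "AE x in lborel. f x = f' x" "AE x in lborel. g x = g' x"
    "f \<in> borel_measurable borel" "g \<in> borel_measurable borel"
    "f' \<in> borel_measurable borel" "g' \<in> borel_measurable borel"
  shows "has_weak_deriv i f' g'"
  unfolding has_weak_deriv_def
proof (intro allI impI)
  fix \<psi> :: "'a \<Rightarrow> real" assume \<psi>: "test_function UNIV \<psi>"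
  note [measurable] = assms(5-8) smooth_borel[OF test_function_smooth[OF \<psi>]]
    smooth_borel[OF smooth_partial[OF test_function_smooth[OF \<psi>] assms(2)]]
  have "(\<integral>x. partial_deriv i \<psi> x *\<^sub>R f' x \<partial>lborel) = (\<integral>x. partial_deriv i \<psi> x *\<^sub>R f x \<partial>lborel)"
    by (rule integral_cong_AE) (use assms(3) in auto)
  also have "\<dots> = - (\<integral>x. \<psi> x *\<^sub>R g x \<partial>lborel)" using assms(1) \<psi> by (simp add: has_weak_deriv_def)
  also have "(\<integral>x. \<psi> x *\<^sub>R g x \<partial>lborel) = (\<integral>x. \<psi> x *\<^sub>R g' x \<partial>lborel)"
    by (rule integral_cong_AE) (use assms(4) in auto)
  finally show "(\<integral>x. partial_deriv i \<psi> x *\<^sub>R f' x \<partial>lborel) = - (\<integral>x. \<psi> x *\<^sub>R g' x \<partial>lborel)" .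
qed

lemma weak_deriv_eq:
  assumes "has_weak_deriv i f g" "L2 g"
  shows "L2 (weak_deriv i f)" "has_weak_deriv i f (weak_deriv i f)" "AE x in lborel. weak_deriv i f x = g x"
    "L2_norm (weak_deriv i f) = L2_norm g"
proof -
  have *: "L2 (weak_deriv i f) \<and> has_weak_deriv i f (weak_deriv i f)"
    unfolding weak_deriv_def by (rule someI[of _ g]) (use assms in simp)
  then show 1: "L2 (weak_deriv i f)" "has_weak_deriv i f (weak_deriv i f)" by auto
  show ae: "AE x in lborel. weak_deriv i f x = g x"
    using has_weak_deriv_unique[OF 1(2) assms(1) 1(1) assms(2)] .
  show "L2_norm (weak_deriv i f) = L2_norm g"
    by (rule L2_cong_AE(2)[OF assms(2) L2_borel[OF 1(1)]]) (use ae in \<open>auto elim: eventually_mono\<close>)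
qed

lemma has_weak_deriv_add:
  assumes "has_weak_deriv i f f'" "has_weak_deriv i g g'" "L2 f" "L2 f'" "L2 g" "L2 g'" "i \<in> Basis"
  shows "has_weak_deriv i (\<lambda>x. f x + g x) (\<lambda>x. f' x + g' x)"
  unfolding has_weak_deriv_def
proof (intro allI impI)
  fix \<psi> :: "'a \<Rightarrow> real" assume \<psi>: "test_function UNIV \<psi>"
  show "(\<integral>x. partial_deriv i \<psi> x *\<^sub>R (f x + g x) \<partial>lborel) = - (\<integral>x. \<psi> x *\<^sub>R (f' x + g' x) \<partial>lborel)"
    using assms \<psi> test_function_L2[OF \<psi>] test_partial_L2[OF \<psi> assms(7)]
    by (simp add: scaleR_add_right has_weak_deriv_def L2_scaleR_integrable)
qed

lemma has_weak_deriv_scale: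
  assumes "has_weak_deriv i f f'" shows "has_weak_deriv i (\<lambda>x. c *\<^sub>R f x) (\<lambda>x. c *\<^sub>R f' x)"
  unfolding has_weak_deriv_def
proof (intro allI impI)
  fix \<psi> :: "'a \<Rightarrow> real" assume \<psi>: "test_function UNIV \<psi>"
  have "(\<integral>x. partial_deriv i \<psi> x *\<^sub>R c *\<^sub>R f x \<partial>lborel) = c *\<^sub>R (\<integral>x. partial_deriv i \<psi> x *\<^sub>R f x \<partial>lborel)"
    by (subst integral_scaleR_right[symmetric]) (simp add: mult.commute)
  also have "\<dots> = - (c *\<^sub>R (\<integral>x. \<psi> x *\<^sub>R f' x \<partial>lborel))" using assms \<psi> by (simp add: has_weak_deriv_def)
  also have "c *\<^sub>R (\<integral>x. \<psi> x *\<^sub>R f' x \<partial>lborel) = (\<integral>x. \<psi> x *\<^sub>R c *\<^sub>R f' x \<partial>lborel)"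
    by (subst integral_scaleR_right[symmetric]) (simp add: mult.commute)
  finally show "(\<integral>x. partial_deriv i \<psi> x *\<^sub>R c *\<^sub>R f x \<partial>lborel) = - (\<integral>x. \<psi> x *\<^sub>R c *\<^sub>R f' x \<partial>lborel)" .
qed

lemma has_weak_deriv_diff:
  assumes "has_weak_deriv i f f'" "has_weak_deriv i g g'" "L2 f" "L2 f'" "L2 g" "L2 g'" "i \<in> Basis"
  shows "has_weak_deriv i (\<lambda>x. f x - g x) (\<lambda>x. f' x - g' x)"
  using has_weak_deriv_add[OF assms(1) has_weak_deriv_scale[OF assms(2), of "-1"] assms(3,4) _ _ assms(7)]
    assms(5,6) L2_minus[of g] L2_minus[of g'] by simp

lemma avg_weak_deriv:
  assumes "has_weak_deriv i f g" "L2 f" "L2 g" "i \<in> Basis"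
    and k: "integrable lborel k" and s: "s \<in> borel_measurable borel"
  shows "has_weak_deriv i (avg k s f) (avg k s g)"
  unfolding has_weak_deriv_def
proof (intro allI impI)
  fix \<psi> :: "'a \<Rightarrow> real" assume \<psi>: "test_function UNIV \<psi>"
  note m[measurable] = smooth_borel[OF test_function_smooth[OF \<psi>]]
    smooth_borel[OF smooth_partial[OF test_function_smooth[OF \<psi>] assms(4)]]
  have [measurable]: "f \<in> borel_measurable borel" "g \<in> borel_measurable borel" using assms by (auto simp: L2_def)
  have *: "(\<integral>x. partial_deriv i \<psi> x *\<^sub>R f (x - c) \<partial>lborel) = - (\<integral>x. \<psi> x *\<^sub>R g (x - c) \<partial>lborel)" for c
  proof -
    have t: "test_function UNIV (\<lambda>x. \<psi> (x - (- c)))" by (rule test_function_shift[OF \<psi>])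
    have "(\<integral>x. partial_deriv i \<psi> x *\<^sub>R f (x - c) \<partial>lborel) = (\<integral>x. partial_deriv i \<psi> (x - (-c)) *\<^sub>R f (x - (-c) - c) \<partial>lborel)"
      by (rule integral_shift[symmetric]) measurable
    also have "\<dots> = (\<integral>x. partial_deriv i (\<lambda>x. \<psi> (x - (-c))) x *\<^sub>R f x \<partial>lborel)"
      by (subst partial_deriv_shift[OF test_function_smooth[OF \<psi>] assms(4)]) simp
    also have "\<dots> = - (\<integral>x. \<psi> (x - (-c)) *\<^sub>R g (x - (-c) - c) \<partial>lborel)"
      using assms(1) t unfolding has_weak_deriv_def by simp
    also have "(\<integral>x. \<psi> (x - (-c)) *\<^sub>R g (x - (-c) - c) \<partial>lborel) = (\<integral>x. \<psi> x *\<^sub>R g (x - c) \<partial>lborel)"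
      by (rule integral_shift) measurable
    finally show ?thesis .
  qed
  show "(\<integral>x. partial_deriv i \<psi> x *\<^sub>R avg k s f x \<partial>lborel) = - (\<integral>x. \<psi> x *\<^sub>R avg k s g x \<partial>lborel)"
    by (simp add: avg_scaleR[OF k s assms(2) test_partial_L2[OF \<psi> assms(4)]]
        avg_scaleR[OF k s assms(3) test_function_L2[OF \<psi>]] *)
qed

lemma has_weak_deriv_shift:
  assumes "has_weak_deriv i f g" "L2 f" "L2 g" "i \<in> Basis"
  shows "has_weak_deriv i (\<lambda>x. f (x - c)) (\<lambda>x. g (x - c))"
proof -
  have k: "integrable lborel (\<lambda>y::real. indicator {0..1} y :: real)" by simp
  have "avg (\<lambda>y::real. indicator {0..1} y) (\<lambda>y. c) f = (\<lambda>x. f (x - c))" for f :: "'a \<Rightarrow> 'b"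
    unfolding avg_def by (auto simp: fun_eq_iff)
  then show ?thesis using avg_weak_deriv[OF assms k, of "\<lambda>y. c"] by simp
qed

subsection \<open>Differences along a coordinate direction\<close>

lemma continuous_on_line:
  fixes g :: "'a::real_normed_vector \<Rightarrow> 'b::topological_space"
  shows "continuous_on UNIV g \<Longrightarrow> continuous_on S (\<lambda>t. g (x + (t * h) *\<^sub>R i))"
  by (rule continuous_on_compose2[of UNIV g]) (auto intro!: continuous_intros)

text \<open>
  The fundamental theorem of calculus along the direction \<open>i\<close>, obtained by testing: the difference
  operator is moved to the test function, where the classical theorem applies.
\<close>

lemma difference_eq_integral:
  fixes f :: "'a::euclidean_space \<Rightarrow> 'b::euclidean_space"
  assumes w: "has_weak_deriv i f g" and f: "L2 f" and g: "L2 g" and i: "i \<in> Basis"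
  shows "AE x in lborel. f (x - h *\<^sub>R i) - f x = - h *\<^sub>R avg (\<lambda>t::real. indicator {0..1} t) (\<lambda>t. (t * h) *\<^sub>R i) g x"
proof -
  let ?k = "\<lambda>t::real. indicator {0..1} t :: real"
  let ?s = "\<lambda>t::real. (t * h) *\<^sub>R i"
  let ?A = "avg ?k ?s g"
  have k: "integrable lborel ?k" by simp
  have s[measurable]: "?s \<in> borel_measurable borel" by measurable
  have A: "L2 ?A" by (rule avg_L2(1)[OF k s g])
  note [measurable] = L2_borel[OF f] L2_borel[OF g] L2_borel[OF A]
  have fs: "L2 (\<lambda>x. f (x - h *\<^sub>R i))" by (rule L2_shift[OF f])
  have D: "L2 (\<lambda>x. f (x - h *\<^sub>R i) - f x + h *\<^sub>R ?A x)"
    by (intro L2_add L2_diff L2_scale fs f A)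
  have "AE x in lborel. f (x - h *\<^sub>R i) - f x + h *\<^sub>R ?A x = 0"
  proof (rule fundamental_lemma)
    fix \<psi> :: "'a \<Rightarrow> real" assume \<psi>: "test_function UNIV \<psi>"
    note sm = test_function_smooth[OF \<psi>]
    note P = test_function_L2[OF \<psi>]
    have [measurable]: "\<psi> \<in> borel_measurable borel" "partial_deriv i \<psi> \<in> borel_measurable borel"
      using sm i by (auto intro: smooth_borel smooth_partial)
    have kk: "integrable (lborel \<Otimes>\<^sub>M lborel) (\<lambda>(t, x). ?k t *\<^sub>R partial_deriv i \<psi> (x - (- ?s t)) *\<^sub>R f x)"
    proof (rule kernel_integrable_pair[OF _ k test_partial_L2[OF \<psi> i] f])
      show "(\<lambda>z. ?k (fst z) *\<^sub>R partial_deriv i \<psi> (snd z - (- ?s (fst z))) *\<^sub>R f (snd z)) \<in> borel_measurable borel"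
        unfolding borel_prod[symmetric] by measurable
      show "norm (?k y *\<^sub>R partial_deriv i \<psi> (x - (- ?s y)) *\<^sub>R f x)
         \<le> \<bar>?k y\<bar> * (norm (partial_deriv i \<psi> (x - (- ?s y))) * norm (f x))" for y x by (simp add: abs_mult mult_ac)
    qed
    have ftc: "\<psi> (x + h *\<^sub>R i) - \<psi> x = h * (\<integral>t. ?k t * partial_deriv i \<psi> (x + ?s t) \<partial>lborel)" for x
    proof -
      have "((\<lambda>t. \<psi> (x + ?s t)) has_vector_derivative h *\<^sub>R partial_deriv i \<psi> (x + ?s t)) (at t within {0..1})" for t
      proof -
        have "((\<lambda>t. t * h) has_vector_derivative h) (at t within {0..1})"
          by (auto intro!: derivative_eq_intros)
        from vector_diff_chain_within[OF this smooth_line_derivative[OF sm, of x i]]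
        show ?thesis by (simp add: o_def)
      qed
      then have "has_bochner_integral lborel (\<lambda>t. indicator {0..1} t *\<^sub>R (h *\<^sub>R partial_deriv i \<psi> (x + ?s t)))
          (\<psi> (x + ?s 1) - \<psi> (x + ?s 0))"
      proof (intro has_bochner_integral_FTC_Icc)
        have "continuous_on UNIV (partial_deriv i \<psi>)" using smooth_partial[OF sm i] by (rule smooth_continuous)
        then show "continuous_on {0..1} (\<lambda>t. h *\<^sub>R partial_deriv i \<psi> (x + ?s t))"
          by (intro continuous_on_scaleR continuous_on_const continuous_on_line)
      qed auto
      from has_bochner_integral_integral_eq[OF this]
      have "\<psi> (x + h *\<^sub>R i) - \<psi> x = (\<integral>t. h * (?k t * partial_deriv i \<psi> (x + ?s t)) \<partial>lborel)"
        by (simp add: mult_ac)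
      then show ?thesis by simp
    qed
    have 1: "(\<integral>x. \<psi> x *\<^sub>R f (x - h *\<^sub>R i) \<partial>lborel) = (\<integral>x. \<psi> (x + h *\<^sub>R i) *\<^sub>R f x \<partial>lborel)"
      using integral_shift[of "\<lambda>x. \<psi> (x + h *\<^sub>R i) *\<^sub>R f x" "h *\<^sub>R i"] by simp
    have Ps: "L2 (\<lambda>x. \<psi> (x + h *\<^sub>R i))" using L2_shift(1)[OF P, of "- h *\<^sub>R i"] by simp
    have "(\<integral>x. \<psi> x *\<^sub>R (f (x - h *\<^sub>R i) - f x) \<partial>lborel) = (\<integral>x. (\<psi> (x + h *\<^sub>R i) - \<psi> x) *\<^sub>R f x \<partial>lborel)"
      using 1 by (simp add: scaleR_left_diff_distrib scaleR_right_diff_distrib L2_scaleR_integrable P Ps f fs)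
    also have "\<dots> = (\<integral>x. h *\<^sub>R ((\<integral>t. ?k t * partial_deriv i \<psi> (x + ?s t) \<partial>lborel) *\<^sub>R f x) \<partial>lborel)"
      by (simp add: ftc)
    also have "\<dots> = h *\<^sub>R (\<integral>x. ((\<integral>t. ?k t * partial_deriv i \<psi> (x + ?s t) \<partial>lborel) *\<^sub>R f x) \<partial>lborel)"
      by (rule integral_scaleR_right)
    also have "(\<integral>x. ((\<integral>t. ?k t * partial_deriv i \<psi> (x + ?s t) \<partial>lborel) *\<^sub>R f x) \<partial>lborel)
        = (\<integral>x. (\<integral>t. ?k t *\<^sub>R partial_deriv i \<psi> (x - (- ?s t)) *\<^sub>R f x \<partial>lborel) \<partial>lborel)"
    proof (rule Bochner_Integration.integral_cong[OF refl])
      fix x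
      have "continuous_on UNIV (partial_deriv i \<psi>)" using smooth_partial[OF sm i] by (rule smooth_continuous)
      then have "continuous_on {0..1} (\<lambda>t. partial_deriv i \<psi> (x + ?s t))"
        by (rule continuous_on_line)
      from borel_integrable_compact[OF compact_Icc this]
      have "integrable lborel (\<lambda>t. ?k t * partial_deriv i \<psi> (x + ?s t))" by simp
      then show "(\<integral>t. ?k t * partial_deriv i \<psi> (x + ?s t) \<partial>lborel) *\<^sub>R f x = (\<integral>t. ?k t *\<^sub>R partial_deriv i \<psi> (x - (- ?s t)) *\<^sub>R f x \<partial>lborel)"
        by (subst integral_scaleR_left[symmetric]) auto
    qed
    also have "\<dots> = (\<integral>t. (\<integral>x. ?k t *\<^sub>R partial_deriv i \<psi> (x - (- ?s t)) *\<^sub>R f x \<partial>lborel) \<partial>lborel)"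
      by (rule lborel_pair.Fubini_integral[OF kk])
    also have "\<dots> = (\<integral>t. ?k t *\<^sub>R - (\<integral>x. \<psi> x *\<^sub>R g (x - ?s t) \<partial>lborel) \<partial>lborel)"
    proof (rule Bochner_Integration.integral_cong[OF refl])
      fix t
      have t: "test_function UNIV (\<lambda>x. \<psi> (x - (- ?s t)))" by (rule test_function_shift[OF \<psi>])
      have "(\<integral>x. partial_deriv i \<psi> (x - (- ?s t)) *\<^sub>R f x \<partial>lborel) = - (\<integral>x. \<psi> (x - (- ?s t)) *\<^sub>R g x \<partial>lborel)"
        using w[unfolded has_weak_deriv_def, rule_format, OF t] by (simp only: partial_deriv_shift[OF sm i])
      also have "(\<integral>x. \<psi> (x - (- ?s t)) *\<^sub>R g x \<partial>lborel) = (\<integral>x. \<psi> x *\<^sub>R g (x - ?s t) \<partial>lborel)"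
        using integral_shift[of "\<lambda>x. \<psi> x *\<^sub>R g (x - ?s t)" "- ?s t"] by simp
      finally have "(\<integral>x. partial_deriv i \<psi> (x - (- ?s t)) *\<^sub>R f x \<partial>lborel) = - (\<integral>x. \<psi> x *\<^sub>R g (x - ?s t) \<partial>lborel)" .
      then show "(\<integral>x. ?k t *\<^sub>R partial_deriv i \<psi> (x - (- ?s t)) *\<^sub>R f x \<partial>lborel) = ?k t *\<^sub>R - (\<integral>x. \<psi> x *\<^sub>R g (x - ?s t) \<partial>lborel)"
        by (simp only: integral_scaleR_right)
    qed
    also have "\<dots> = - (\<integral>x. \<psi> x *\<^sub>R ?A x \<partial>lborel)"
      using avg_scaleR[OF k s g P] by simp
    finally have "(\<integral>x. \<psi> x *\<^sub>R (f (x - h *\<^sub>R i) - f x) \<partial>lborel) = - (h *\<^sub>R (\<integral>x. \<psi> x *\<^sub>R ?A x \<partial>lborel))" by simp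
    moreover have "h *\<^sub>R (\<integral>x. \<psi> x *\<^sub>R ?A x \<partial>lborel) = (\<integral>x. \<psi> x *\<^sub>R (h *\<^sub>R ?A x) \<partial>lborel)"
      by (subst integral_scaleR_right[symmetric]) (simp add: mult.commute)
    ultimately have "(\<integral>x. \<psi> x *\<^sub>R (f (x - h *\<^sub>R i) - f x + h *\<^sub>R ?A x) \<partial>lborel) = 0"
      using L2_scaleR_integrable[OF P L2_diff(1)[OF fs f]] L2_scaleR_integrable[OF P L2_scale[OF A]]
      by (simp add: scaleR_add_right del: scaleR_scaleR)
    then show "integrable lborel (\<lambda>x. \<psi> x *\<^sub>R (f (x - h *\<^sub>R i) - f x + h *\<^sub>R ?A x)) \<and>
        (\<integral>x. \<psi> x *\<^sub>R (f (x - h *\<^sub>R i) - f x + h *\<^sub>R ?A x) \<partial>lborel) = 0"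
      using L2_scaleR_integrable[OF P D] by blast
  qed (use D in \<open>auto simp: L2_def\<close>)
  then show ?thesis by eventually_elim (simp add: eq_neg_iff_add_eq_0)
qed

lemma L2_norm_difference_le:
  assumes w: "has_weak_deriv i f g" and f: "L2 f" and g: "L2 g" and i: "i \<in> Basis"
  shows "L2_norm (\<lambda>x. f (x - h *\<^sub>R i) - f x) \<le> \<bar>h\<bar> * L2_norm g"
proof -
  let ?A = "avg (\<lambda>t::real. indicator {0..1} t) (\<lambda>t. (t * h) *\<^sub>R i) g"
  have A: "L2 ?A" "L2_norm ?A \<le> L2_norm g"
    using avg_L2[of "\<lambda>t::real. indicator {0..1} t", OF _ _ g, of "\<lambda>t. (t * h) *\<^sub>R i"] by auto
  have "L2_norm (\<lambda>x. f (x - h *\<^sub>R i) - f x) = L2_norm (\<lambda>x. - h *\<^sub>R ?A x)"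
  proof (rule L2_cong_AE(2)[OF L2_scale[OF A(1)] L2_borel[OF L2_diff(1)[OF L2_shift(1)[OF f] f]]])
    show "AE x in lborel. - h *\<^sub>R ?A x = f (x - h *\<^sub>R i) - f x"
      using difference_eq_integral[OF assms, of h] by eventually_elim (rule sym)
  qed
  also have "\<dots> \<le> \<bar>h\<bar> * L2_norm g" using A by (simp add: L2_norm_minus L2_norm_scale mult_left_mono)
  finally show ?thesis .
qed

text \<open>
  Translate one coordinate at a time.
\<close>

lemma L2_norm_translate_le:
  assumes w: "\<And>i. i \<in> Basis \<Longrightarrow> has_weak_deriv i f (g i)" and f: "L2 f" and g: "\<And>i. i \<in> Basis \<Longrightarrow> L2 (g i)"
  shows "L2_norm (\<lambda>x. f (x - y) - f x) \<le> norm y * (\<Sum>i\<in>Basis. L2_norm (g i))"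
proof -
  have "L2_norm (\<lambda>x. f (x - (\<Sum>i\<in>B. (y \<bullet> i) *\<^sub>R i)) - f x) \<le> (\<Sum>i\<in>B. \<bar>y \<bullet> i\<bar> * L2_norm (g i))" if "B \<subseteq> Basis" for B
    using finite_subset[OF that finite_Basis] that
  proof (induction B rule: finite_induct)
    case empty then show ?case by (simp add: L2_norm_def)
  next
    case (insert i B)
    let ?c = "\<Sum>i\<in>B. (y \<bullet> i) *\<^sub>R i"
    have i: "i \<in> Basis" using insert by auto
    have eq: "f (x - (\<Sum>i\<in>insert i B. (y \<bullet> i) *\<^sub>R i)) - f x =
        (f (x - ?c - (y \<bullet> i) *\<^sub>R i) - f (x - ?c)) + (f (x - ?c) - f x)" for x
      using insert by (simp add: algebra_simps)
    have "L2_norm (\<lambda>x. f (x - (\<Sum>i\<in>insert i B. (y \<bullet> i) *\<^sub>R i)) - f x)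
      \<le> L2_norm (\<lambda>x. f (x - ?c - (y \<bullet> i) *\<^sub>R i) - f (x - ?c)) + L2_norm (\<lambda>x. f (x - ?c) - f x)"
      unfolding eq by (intro L2_add(2) L2_diff(1) L2_shift(1)[OF L2_shift(1)[OF f]] L2_shift(1)[OF f] f)
    also have "L2_norm (\<lambda>x. f (x - ?c - (y \<bullet> i) *\<^sub>R i) - f (x - ?c)) \<le> \<bar>y \<bullet> i\<bar> * L2_norm (g i)"
      using L2_norm_difference_le[OF has_weak_deriv_shift[OF w[OF i] f g[OF i] i, of ?c] L2_shift(1)[OF f] L2_shift(1)[OF g[OF i]] i, of "y \<bullet> i"]
      by (simp add: L2_shift[OF g[OF i]] algebra_simps)
    also have "L2_norm (\<lambda>x. f (x - ?c) - f x) \<le> (\<Sum>i\<in>B. \<bar>y \<bullet> i\<bar> * L2_norm (g i))" using insert by auto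
    finally show ?case using insert by simp
  qed
  from this[OF subset_refl] have "L2_norm (\<lambda>x. f (x - y) - f x) \<le> (\<Sum>i\<in>Basis. \<bar>y \<bullet> i\<bar> * L2_norm (g i))"
    by (simp add: euclidean_representation)
  also have "\<dots> \<le> (\<Sum>i\<in>Basis. norm y * L2_norm (g i))"
    by (intro sum_mono mult_right_mono Basis_le_norm) auto
  finally show ?thesis by (simp add: sum_distrib_left)
qed

text \<open>
  The definition of a weak derivative only allows smooth \<open>g\<close>. For \<open>g\<close> with a weak derivative, pass
  through difference quotients, whose adjoints are difference quotients in the opposite direction;
  the error is quadratic in the step \<open>h\<close>, so dividing by \<open>h\<close> and letting \<open>h\<close> tend to \<open>0\<close> suffices
  and no density of smooth functions is involved.
\<close>

lemma weak_integration_by_parts: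
  assumes wf: "has_weak_deriv i f f'" and f: "L2 f" and f': "L2 f'" and i: "i \<in> Basis"
    and wg: "has_weak_deriv i g g'" and g: "L2 g" and g': "L2 g'"
  shows "(\<integral>x. f' x \<bullet> g x \<partial>lborel) = - (\<integral>x. f x \<bullet> g' x \<partial>lborel)"
proof -
  \<comment> \<open>replacing the difference of \<open>a\<close>, tested against \<open>b\<close>, by \<open>- h\<close> times the derivative costs \<open>O(h\<^sup>2)\<close>\<close>
  have key: "\<bar>(\<integral>x. (a (x - h *\<^sub>R i) - a x) \<bullet> b x \<partial>lborel) + h * (\<integral>x. a' x \<bullet> b x \<partial>lborel)\<bar> \<le> h\<^sup>2 * (L2_norm a' * L2_norm b')"
    if wa: "has_weak_deriv i a a'" and a: "L2 a" and a': "L2 a'"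
      and wb: "has_weak_deriv i b b'" and b: "L2 b" and b': "L2 b'" for a a' b b' :: "'a \<Rightarrow> 'b" and h :: real
  proof -
    let ?k = "\<lambda>t::real. indicator {0..1} t :: real" and ?s = "\<lambda>t::real. (t * h) *\<^sub>R i"
    let ?A = "avg ?k ?s a'"
    have k: "integrable lborel ?k" by simp
    have s: "?s \<in> borel_measurable borel" by measurable
    note A = avg_L2[OF k s a']
    note [measurable] = L2_borel[OF a] L2_borel[OF a'] L2_borel[OF b] L2_borel[OF A(1)]
    have "(\<integral>x. (a (x - h *\<^sub>R i) - a x) \<bullet> b x \<partial>lborel) = (\<integral>x. (- h *\<^sub>R ?A x) \<bullet> b x \<partial>lborel)"
      by (rule integral_cong_AE) (use difference_eq_integral[OF wa a a' i, of h] in \<open>auto elim!: eventually_mono\<close>)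
    also have "\<dots> = - (h * (\<integral>x. ?A x \<bullet> b x \<partial>lborel))" by simp
    also have "(\<integral>x. ?A x \<bullet> b x \<partial>lborel) = (\<integral>t. ?k t * (\<integral>x. a' (x - ?s t) \<bullet> b x \<partial>lborel) \<partial>lborel)"
      by (rule avg_inner[OF k s a' b])
    finally have 1: "(\<integral>x. (a (x - h *\<^sub>R i) - a x) \<bullet> b x \<partial>lborel)
        = - h * (\<integral>t. ?k t * (\<integral>x. a' (x - ?s t) \<bullet> b x \<partial>lborel) \<partial>lborel)" by simp
    have bound: "\<bar>(\<integral>x. a' (x - ?s t) \<bullet> b x \<partial>lborel) - (\<integral>x. a' x \<bullet> b x \<partial>lborel)\<bar> \<le> \<bar>h\<bar> * (L2_norm a' * L2_norm b')"
      if "t \<in> {0..1}" for t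
    proof -
      have bs: "L2 (\<lambda>x. b (x + ?s t))" using L2_shift(1)[OF b, of "- ?s t"] by simp
      have "(\<integral>x. a' (x - ?s t) \<bullet> b x \<partial>lborel) = (\<integral>x. a' x \<bullet> b (x + ?s t) \<partial>lborel)"
        using integral_shift[of "\<lambda>x. a' x \<bullet> b (x + ?s t)" "?s t"] by simp
      then have "(\<integral>x. a' (x - ?s t) \<bullet> b x \<partial>lborel) - (\<integral>x. a' x \<bullet> b x \<partial>lborel) = (\<integral>x. a' x \<bullet> (b (x - (- t * h) *\<^sub>R i) - b x) \<partial>lborel)"
        by (simp add: inner_diff_right L2_inner_integrable a' b bs)
      also have "\<bar>\<dots>\<bar> \<le> L2_norm a' * L2_norm (\<lambda>x. b (x - (- t * h) *\<^sub>R i) - b x)"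
        by (intro L2_inner_le a' L2_diff L2_shift b)
      also have "\<dots> \<le> L2_norm a' * (\<bar>- t * h\<bar> * L2_norm b')"
        by (intro mult_left_mono L2_norm_difference_le[OF wb b b' i]) simp
      also have "\<dots> \<le> L2_norm a' * (\<bar>h\<bar> * L2_norm b')"
        using that by (intro mult_left_mono mult_right_mono) (auto simp: abs_mult mult_left_le_one_le)
      finally show ?thesis by (simp add: mult_ac)
    qed
    have int: "integrable lborel (\<lambda>t. ?k t * (\<integral>x. a' (x - ?s t) \<bullet> b x \<partial>lborel))"
      by (rule avg_inner(2)[OF k s a' b])
    have "(\<integral>t. ?k t * (\<integral>x. a' (x - ?s t) \<bullet> b x \<partial>lborel) \<partial>lborel) - (\<integral>x. a' x \<bullet> b x \<partial>lborel)
       = (\<integral>t. ?k t * (\<integral>x. a' (x - ?s t) \<bullet> b x \<partial>lborel) - ?k t * (\<integral>x. a' x \<bullet> b x \<partial>lborel) \<partial>lborel)"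
      using int by (subst Bochner_Integration.integral_diff) auto
    also have "\<bar>\<dots>\<bar> \<le> (\<integral>t. ?k t * (\<bar>h\<bar> * (L2_norm a' * L2_norm b')) \<partial>lborel)"
      unfolding real_norm_def[symmetric]
    proof (rule Bochner_Integration.integral_norm_bound_integral)
      show "norm (?k t * (\<integral>x. a' (x - ?s t) \<bullet> b x \<partial>lborel) - ?k t * (\<integral>x. a' x \<bullet> b x \<partial>lborel))
         \<le> ?k t * (norm h * (L2_norm a' * L2_norm b'))" for t
        using bound[of t] by (cases "t \<in> {0..1}") auto
    qed (use int in auto)
    finally have "\<bar>(\<integral>t. ?k t * (\<integral>x. a' (x - ?s t) \<bullet> b x \<partial>lborel) \<partial>lborel) - (\<integral>x. a' x \<bullet> b x \<partial>lborel)\<bar> \<le> \<bar>h\<bar> * (L2_norm a' * L2_norm b')"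
      by simp
    then have "\<bar>h\<bar> * \<bar>(\<integral>t. ?k t * (\<integral>x. a' (x - ?s t) \<bullet> b x \<partial>lborel) \<partial>lborel) - (\<integral>x. a' x \<bullet> b x \<partial>lborel)\<bar> \<le> \<bar>h\<bar> * (\<bar>h\<bar> * (L2_norm a' * L2_norm b'))"
      by (rule mult_left_mono) simp
    then show ?thesis unfolding 1
      by (simp add: abs_mult[symmetric] power2_eq_square right_diff_distrib abs_minus_commute mult.assoc[symmetric])
  qed
  let ?C = "L2_norm f' * L2_norm g' + L2_norm g' * L2_norm f'"
  let ?P = "\<integral>x. f' x \<bullet> g x \<partial>lborel" and ?Q = "\<integral>x. g' x \<bullet> f x \<partial>lborel"
  note [measurable] = L2_borel[OF f] L2_borel[OF g]
  have C: "\<bar>h\<bar> * \<bar>?P + ?Q\<bar> \<le> h\<^sup>2 * ?C" for h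
  proof -
    have fs: "L2 (\<lambda>x. f (x - h *\<^sub>R i))" "L2 (\<lambda>x. g (x + h *\<^sub>R i))"
      using L2_shift(1)[OF f, of "h *\<^sub>R i"] L2_shift(1)[OF g, of "- h *\<^sub>R i"] by auto
    have "(\<integral>x. f (x - h *\<^sub>R i) \<bullet> g x \<partial>lborel) = (\<integral>x. g (x + h *\<^sub>R i) \<bullet> f x \<partial>lborel)"
      using integral_shift[of "\<lambda>x. f x \<bullet> g (x + h *\<^sub>R i)" "h *\<^sub>R i"] by (simp add: inner_commute)
    then have e: "(\<integral>x. (f (x - h *\<^sub>R i) - f x) \<bullet> g x \<partial>lborel) = (\<integral>x. (g (x - (- h) *\<^sub>R i) - g x) \<bullet> f x \<partial>lborel)"
      using fs f g by (simp add: inner_diff_left L2_inner_integrable) (simp add: inner_commute)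
    let ?X = "\<integral>x. (g (x - (- h) *\<^sub>R i) - g x) \<bullet> f x \<partial>lborel"
    have k1: "\<bar>?X + h * ?P\<bar> \<le> h\<^sup>2 * (L2_norm f' * L2_norm g')"
      using key[OF wf f f' wg g g', of h] by (simp only: e)
    have k2: "\<bar>?X - h * ?Q\<bar> \<le> h\<^sup>2 * (L2_norm g' * L2_norm f')"
      using key[OF wg g g' wf f f', of "- h"] by simp
    have "\<bar>h * ?P + h * ?Q\<bar> \<le> h\<^sup>2 * (L2_norm f' * L2_norm g') + h\<^sup>2 * (L2_norm g' * L2_norm f')"
      using k1 k2 by linarith
    moreover have "\<bar>h\<bar> * \<bar>?P + ?Q\<bar> = \<bar>h * ?P + h * ?Q\<bar>" by (simp add: abs_mult[symmetric] distrib_left)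
    ultimately show ?thesis by (simp only: distrib_left)
  qed
  have "\<bar>?P + ?Q\<bar> \<le> e" if "e > 0" for e
  proof -
    have C0: "?C \<ge> 0" by simp
    define h where "h = e / (?C + 1)"
    have h: "h > 0" unfolding h_def by (rule divide_pos_pos[OF that]) (use C0 in linarith)
    then have "\<bar>?P + ?Q\<bar> \<le> h * ?C" using C[of h] by (simp add: power2_eq_square)
    also have "\<dots> \<le> h * (?C + 1)" using h by simp
    also have "\<dots> = e" unfolding h_def using C0 by (simp add: add_nonneg_eq_0_iff)
    finally show ?thesis .
  qed
  then have "?P + ?Q = 0" by (meson abs_le_zero_iff field_le_epsilon le_add_same_cancel1 dense_ge)
  then show ?thesis by (simp add: inner_commute)
qed

section \<open>Fourier analysis\<close>

subsection \<open>Dilations\<close>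

lemma nn_integral_dilation:
  fixes f :: "'a::euclidean_space \<Rightarrow> ennreal"
  assumes [measurable]: "f \<in> borel_measurable borel" and c: "c \<noteq> 0"
  shows "(\<integral>\<^sup>+x. f x \<partial>lborel) = ennreal (\<bar>c\<bar> ^ DIM('a)) * (\<integral>\<^sup>+x. f (c *\<^sub>R x) \<partial>lborel)"
  by (subst lborel_affine[OF c, of 0])
     (simp add: nn_integral_density nn_integral_distr nn_integral_cmult)

lemma integrable_dilation:
  fixes f :: "'a::euclidean_space \<Rightarrow> 'b::{banach, second_countable_topology}"
  assumes f: "integrable lborel f" and c: "c \<noteq> 0"
  shows "integrable lborel (\<lambda>x. f (c *\<^sub>R x))"
proof -
  have [measurable]: "f \<in> borel_measurable borel" using f by auto
  have "ennreal (\<bar>c\<bar> ^ DIM('a)) * (\<integral>\<^sup>+x. ennreal (norm (f (c *\<^sub>R x))) \<partial>lborel) < \<infinity>"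
    using f nn_integral_dilation[of "\<lambda>x. ennreal (norm (f x))", OF _ c] by (simp add: integrable_iff_bounded)
  then have "(\<integral>\<^sup>+x. ennreal (norm (f (c *\<^sub>R x))) \<partial>lborel) < \<infinity>"
    using c by (auto simp: ennreal_mult_less_top)
  then show ?thesis by (intro integrableI_bounded) auto
qed

lemma integral_dilation:
  fixes f :: "'a::euclidean_space \<Rightarrow> 'b::{banach, second_countable_topology}"
  assumes f: "integrable lborel f" and c: "c \<noteq> 0"
  shows "(\<integral>x. f x \<partial>lborel) = \<bar>c\<bar> ^ DIM('a) *\<^sub>R (\<integral>x. f (c *\<^sub>R x) \<partial>lborel)"
proof -
  have [measurable]: "f \<in> borel_measurable borel" using f by auto
  note [simp] = integrable_dilation[OF f c]
  show ?thesis
    by (subst lborel_affine[OF c, of 0]) (simp add: integral_density integral_distr)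
qed

lemma integral_reflect:
  fixes f :: "'a::euclidean_space \<Rightarrow> 'b::{banach, second_countable_topology}"
  assumes f: "integrable lborel f"
  shows "(\<integral>x. f (- x) \<partial>lborel) = (\<integral>x. f x \<partial>lborel)"
  using integral_dilation[OF f, of "-1"] by simp

subsection \<open>Products of functions of one coordinate\<close>

lemma
  fixes f :: "'a::euclidean_space \<Rightarrow> real \<Rightarrow> 'b::{real_normed_field, banach, second_countable_topology}"
  assumes int: "\<And>b. b \<in> Basis \<Longrightarrow> integrable lborel (f b)"
  shows integrable_prod_Basis: "integrable lborel (\<lambda>x::'a. \<Prod>b\<in>Basis. f b (x \<bullet> b))"
    and integral_prod_Basis: "(\<integral>x. (\<Prod>b\<in>Basis. f b (x \<bullet> b)) \<partial>lborel) = (\<Prod>b\<in>(Basis::'a set). \<integral>t. f b t \<partial>lborel)"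
proof -
  interpret product_sigma_finite "\<lambda>_::'a. lborel :: real measure" by standard
  let ?T = "\<lambda>f. \<Sum>b\<in>(Basis::'a set). f b *\<^sub>R b"
  let ?P = "\<Pi>\<^sub>M b\<in>(Basis::'a set). (lborel :: real measure)"
  have T[measurable]: "?T \<in> ?P \<rightarrow>\<^sub>M borel" by measurable
  have [measurable]: "f b \<in> borel_measurable borel" if "b \<in> Basis" for b using int[OF that] by auto
  have [measurable]: "(\<lambda>x::'a. \<Prod>b\<in>Basis. f b (x \<bullet> b)) \<in> borel_measurable borel" by measurable
  have eq: "(\<Prod>b\<in>Basis. f b (?T x \<bullet> b)) = (\<Prod>b\<in>Basis. f b (x b))" for x by simp
  show "integrable lborel (\<lambda>x::'a. \<Prod>b\<in>Basis. f b (x \<bullet> b))"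
    by (subst lborel_eq, subst integrable_distr_eq[OF T]) (simp_all add: product_integrable_prod int)
  show "(\<integral>x. (\<Prod>b\<in>Basis. f b (x \<bullet> b)) \<partial>lborel) = (\<Prod>b\<in>(Basis::'a set). \<integral>t. f b t \<partial>lborel)"
    by (subst lborel_eq, subst integral_distr[OF T]) (simp_all add: product_integral_prod int)
qed

text \<open>
  \<open>(1 + norm x) ^ n\<close> is at least the product of the one-dimensional weights \<open>1 + (x \<bullet> b)\<^sup>2\<close>, each at most
  \<open>(1 + norm x)\<^sup>2\<close>; this is where the power \<open>2 * DIM('a)\<close> comes from.
\<close>

lemma integrable_inverse_weight:
  assumes "2 * DIM('a) \<le> n"
  shows "integrable lborel (\<lambda>x::'a::euclidean_space. 1 / (1 + norm x) ^ n)"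
proof (rule Bochner_Integration.integrable_bound)
  have "integrable lborel (\<lambda>t::real. inverse (1 + t\<^sup>2))"
    using integrable_inverse_1_plus_square by (simp add: set_integrable_def einterval_def)
  then show "integrable lborel (\<lambda>x::'a. \<Prod>b\<in>Basis. inverse (1 + (x \<bullet> b)\<^sup>2))"
    by (rule integrable_prod_Basis)
  show "AE x::'a in lborel. norm (1 / (1 + norm x) ^ n) \<le> norm (\<Prod>b\<in>Basis. inverse (1 + (x \<bullet> b)\<^sup>2))"
  proof (rule AE_I2)
    fix x :: 'a
    have le: "1 + (x \<bullet> b)\<^sup>2 \<le> (1 + norm x)\<^sup>2" if "b \<in> Basis" for b
    proof -
      have "(x \<bullet> b)\<^sup>2 \<le> (norm x)\<^sup>2" using Basis_le_norm[OF that, of x] by (simp add: abs_le_square_iff[symmetric])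
      then show ?thesis using norm_ge_zero[of x] unfolding power2_sum by (simp add: add_increasing2)
    qed
    have "(\<Prod>b\<in>(Basis::'a set). 1 + (x \<bullet> b)\<^sup>2) \<le> (\<Prod>b\<in>(Basis::'a set). (1 + norm x)\<^sup>2)"
      by (intro prod_mono) (use le in auto)
    also have "\<dots> = (1 + norm x) ^ (2 * DIM('a))" by (simp add: power_mult)
    also have "\<dots> \<le> (1 + norm x) ^ n" using assms by (intro power_increasing) auto
    finally have "inverse ((1 + norm x) ^ n) \<le> inverse (\<Prod>b\<in>(Basis::'a set). 1 + (x \<bullet> b)\<^sup>2)"
      by (intro le_imp_inverse_le prod_pos) (auto intro: add_pos_nonneg)
    moreover have "0 \<le> (\<Prod>b\<in>(Basis::'a set). inverse (1 + (x \<bullet> b)\<^sup>2))" by (intro prod_nonneg) auto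
    ultimately show "norm (1 / (1 + norm x) ^ n) \<le> norm (\<Prod>b\<in>(Basis::'a set). inverse (1 + (x \<bullet> b)\<^sup>2))"
      by (simp add: prod_inversef[symmetric] divide_inverse)
  qed
  show "(\<lambda>x::'a. 1 / (1 + norm x) ^ n) \<in> borel_measurable lborel" by measurable
qed

lemma integrable_weight_bound:
  fixes f :: "'a::euclidean_space \<Rightarrow> 'b::{banach, second_countable_topology}"
  assumes "f \<in> borel_measurable borel" "\<And>x. norm (f x) \<le> C / (1 + norm x) ^ n" "2 * DIM('a) \<le> n"
  shows "integrable lborel f"
proof (rule Bochner_Integration.integrable_bound)
  show "integrable lborel (\<lambda>x::'a. C * (1 / (1 + norm x) ^ n))"
    by (intro integrable_mult_right integrable_inverse_weight assms(3))
  show "AE x in lborel. norm (f x) \<le> norm (C * (1 / (1 + norm x) ^ n))"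
  proof (rule AE_I2)
    fix x
    have "norm (f x) \<le> C * (1 / (1 + norm x) ^ n)" using assms(2)[of x] by simp
    also have "\<dots> \<le> norm (C * (1 / (1 + norm x) ^ n))" by (simp only: real_norm_def abs_ge_self)
    finally show "norm (f x) \<le> norm (C * (1 / (1 + norm x) ^ n))" .
  qed
qed (use assms in simp)

subsection \<open>The Fourier transform of the Gaussian\<close>

lemma borel_measurable_cis [measurable]: "cis \<in> borel_measurable borel"
  by (intro borel_measurable_continuous_onI continuous_intros)

lemma integrable_gaussian_1: "integrable lborel (\<lambda>t::real. exp (- t\<^sup>2 / 2))"
proof -
  have "integrable lborel (\<lambda>t. sqrt (2 * pi) * std_normal_density t)" by simp
  then show ?thesis by (simp add: std_normal_density_def)
qed

text \<open>
  The characteristic function of the standard normal distribution.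
\<close>

lemma gaussian_fourier_1:
  "(\<integral>t. cis (- (t * z)) * complex_of_real (exp (- t\<^sup>2 / 2)) \<partial>lborel) = complex_of_real (sqrt (2 * pi) * exp (- z\<^sup>2 / 2))"
proof -
  have "char std_normal_distribution (- z) = (\<integral>t. iexp (- z * t) \<partial>std_normal_distribution)"
    by (simp add: char_def)
  also have "\<dots> = (\<integral>t. std_normal_density t *\<^sub>R iexp (- z * t) \<partial>lborel)"
    by (subst integral_density) auto
  also have "\<dots> = (\<integral>t. complex_of_real (1 / sqrt (2 * pi)) * (cis (- (t * z)) * complex_of_real (exp (- t\<^sup>2 / 2))) \<partial>lborel)"
    by (intro Bochner_Integration.integral_cong) (auto simp: std_normal_density_def cis_conv_exp scaleR_conv_of_real mult_ac)
  also have "\<dots> = complex_of_real (1 / sqrt (2 * pi)) * (\<integral>t. cis (- (t * z)) * complex_of_real (exp (- t\<^sup>2 / 2)) \<partial>lborel)"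
    by simp
  finally show ?thesis unfolding char_std_normal_distribution by (simp add: field_simps)
qed

abbreviation gauss :: "'a::euclidean_space \<Rightarrow> real" where
  "gauss x \<equiv> exp (- (norm x)\<^sup>2 / 2)"

lemma gauss_prod: "gauss x = (\<Prod>b\<in>Basis. exp (- (x \<bullet> b)\<^sup>2 / 2))"
proof -
  have "(norm x)\<^sup>2 = (\<Sum>b\<in>Basis. (x \<bullet> b)\<^sup>2)"
    unfolding power2_norm_eq_inner by (subst euclidean_inner) (simp add: power2_eq_square)
  then have "- (norm x)\<^sup>2 / 2 = (\<Sum>b\<in>Basis. - (x \<bullet> b)\<^sup>2 / 2)" by (simp add: sum_negf sum_divide_distrib)
  then show ?thesis by (simp add: exp_sum)
qed

lemma cis_prod: "finite A \<Longrightarrow> cis (\<Sum>b\<in>A. f b) = (\<Prod>b\<in>A. cis (f b))"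
  by (induction A rule: finite_induct) (auto simp: cis_mult[symmetric])

lemma integrable_gauss: "integrable lborel (gauss :: 'a::euclidean_space \<Rightarrow> real)"
  unfolding gauss_prod by (rule integrable_prod_Basis) (rule integrable_gaussian_1)

lemma gauss_fourier:
  "(\<integral>x. cis (- (x \<bullet> z)) * complex_of_real (gauss x) \<partial>lborel) = complex_of_real (sqrt (2 * pi) ^ DIM('a) * gauss (z :: 'a::euclidean_space))"
proof -
  have "cis (- (x \<bullet> z)) * complex_of_real (gauss x) = (\<Prod>b\<in>Basis. cis (- ((x \<bullet> b) * (z \<bullet> b))) * complex_of_real (exp (- (x \<bullet> b)\<^sup>2 / 2)))" for x
  proof -
    have "- (x \<bullet> z) = (\<Sum>b\<in>Basis. - ((x \<bullet> b) * (z \<bullet> b)))" by (simp add: euclidean_inner[of x z] sum_negf)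
    then show ?thesis by (simp only: cis_prod finite_Basis gauss_prod of_real_prod prod.distrib)
  qed
  then have "(\<integral>x. cis (- (x \<bullet> z)) * complex_of_real (gauss x) \<partial>lborel) = (\<integral>x. (\<Prod>b\<in>Basis. cis (- ((x \<bullet> b) * (z \<bullet> b))) * complex_of_real (exp (- (x \<bullet> b)\<^sup>2 / 2))) \<partial>lborel)"
    by (simp only:)
  also have "\<dots> = (\<Prod>b\<in>(Basis::'a set). (\<integral>t. cis (- (t * (z \<bullet> b))) * complex_of_real (exp (- t\<^sup>2 / 2)) \<partial>lborel))"
  proof (rule integral_prod_Basis)
    fix b
    show "integrable lborel (\<lambda>t. cis (- (t * (z \<bullet> b))) * complex_of_real (exp (- t\<^sup>2 / 2)))"
      by (rule Bochner_Integration.integrable_bound[OF integrable_gaussian_1]) (auto simp: norm_mult)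
  qed
  also have "\<dots> = (\<Prod>b\<in>(Basis::'a set). complex_of_real (sqrt (2 * pi) * exp (- (z \<bullet> b)\<^sup>2 / 2)))"
    by (simp only: gaussian_fourier_1)
  also have "\<dots> = complex_of_real (sqrt (2 * pi) ^ DIM('a) * gauss z)"
    by (simp only: gauss_prod of_real_prod[symmetric] prod.distrib prod_constant)
  finally show ?thesis .
qed

subsection \<open>Fourier inversion\<close>

text \<open>
  Insert the factor \<open>gauss (x / n)\<close> into the outer integral. As \<open>n\<close> grows, the integral converges to the
  left-hand side by dominated convergence; by Fubini it is also an average of \<open>m\<close> against a Gaussian
  concentrating at \<open>\<xi>\<close>.
\<close>

theorem fourier_inversion:
  fixes m :: "'a::euclidean_space \<Rightarrow> complex"
  assumes cont: "continuous_on UNIV m" and bound: "\<And>x. norm (m x) \<le> B"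
    and int: "integrable lborel m" and intF: "integrable lborel (inv_fourier m)"
  shows "fourier (inv_fourier m) \<xi> = m \<xi>"
proof -
  let ?d = "DIM('a)" and ?s = "sqrt (2 * pi)"
  let ?c = "complex_of_real (1 / (2 * pi) ^ ?d)"
  let ?F = "inv_fourier m"
  have [measurable]: "m \<in> borel_measurable borel" using int by auto
  have [measurable]: "?F \<in> borel_measurable borel" using intF by auto
  define I where "I n = (\<integral>x. cis (- (x \<bullet> \<xi>)) * ?F x * complex_of_real (gauss (x /\<^sub>R real (Suc n))) \<partial>lborel)" for n
  have g1: "(\<lambda>n. gauss (x /\<^sub>R real (Suc n))) \<longlonglongrightarrow> 1" for x :: 'a
  proof -
    have "(\<lambda>n. exp (- (inverse (real (Suc n)) * norm x)\<^sup>2 / 2)) \<longlonglongrightarrow> exp (- (0 * norm x)\<^sup>2 / 2)"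
      by (intro tendsto_intros LIMSEQ_inverse_real_of_nat) auto
    then show ?thesis by simp
  qed
  have "I \<longlonglongrightarrow> (\<integral>x. cis (- (x \<bullet> \<xi>)) * ?F x * 1 \<partial>lborel)"
    unfolding I_def
  proof (rule integral_dominated_convergence[where w = "\<lambda>x. norm (?F x)"])
    show "AE x in lborel. (\<lambda>n. cis (- (x \<bullet> \<xi>)) * ?F x * complex_of_real (gauss (x /\<^sub>R real (Suc n)))) \<longlonglongrightarrow> cis (- (x \<bullet> \<xi>)) * ?F x * 1"
      by (intro AE_I2 tendsto_intros tendsto_of_real[OF g1, of "_", simplified of_real_1])
    show "AE x in lborel. norm (cis (- (x \<bullet> \<xi>)) * ?F x * complex_of_real (gauss (x /\<^sub>R real (Suc n)))) \<le> norm (?F x)" for n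
      by (intro AE_I2) (auto simp: norm_mult intro!: mult_left_le)
  qed (use intF in auto)
  then have lim1: "I \<longlonglongrightarrow> fourier ?F \<xi>" by (simp add: fourier_def)
  have I_eq: "I n = ?c * complex_of_real (?s ^ ?d) * (\<integral>z. complex_of_real (gauss z) * m (\<xi> + z /\<^sub>R real (Suc n)) \<partial>lborel)" for n
  proof -
    let ?N = "real (Suc n)"
    let ?g = "\<lambda>x::'a. complex_of_real (gauss (x /\<^sub>R ?N))"
    have N: "?N > 0" by simp
    have ig: "integrable lborel (\<lambda>x::'a. gauss (x /\<^sub>R ?N))"
      using integrable_dilation[OF integrable_gauss, of "inverse ?N"] by simp
    have inner: "(\<integral>x. cis (- (x \<bullet> \<zeta>)) * ?g x \<partial>lborel) = complex_of_real (?N ^ ?d * (?s ^ ?d * gauss (?N *\<^sub>R \<zeta>)))" for \<zeta> :: 'a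
    proof -
      have i: "integrable lborel (\<lambda>x. cis (- (x \<bullet> \<zeta>)) * ?g x)"
        by (rule Bochner_Integration.integrable_bound[OF ig]) (auto simp: norm_mult)
      have "(\<integral>x. cis (- (x \<bullet> \<zeta>)) * ?g x \<partial>lborel) = \<bar>?N\<bar> ^ ?d *\<^sub>R (\<integral>x. cis (- ((?N *\<^sub>R x) \<bullet> \<zeta>)) * ?g (?N *\<^sub>R x) \<partial>lborel)"
        by (rule integral_dilation[OF i]) simp
      also have "(\<integral>x. cis (- ((?N *\<^sub>R x) \<bullet> \<zeta>)) * ?g (?N *\<^sub>R x) \<partial>lborel) = (\<integral>x. cis (- (x \<bullet> (?N *\<^sub>R \<zeta>))) * complex_of_real (gauss x) \<partial>lborel)"
        using N by simp
      also have "\<dots> = complex_of_real (?s ^ ?d * gauss (?N *\<^sub>R \<zeta>))" by (rule gauss_fourier)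
      finally show ?thesis by (simp add: scaleR_conv_of_real)
    qed
    have pair: "integrable (lborel \<Otimes>\<^sub>M lborel) (\<lambda>(x, \<eta>). cis (x \<bullet> (\<eta> - \<xi>)) * m \<eta> * ?g x)"
    proof (rule product_integrable_pair)
      show "(\<lambda>z. cis (fst z \<bullet> (snd z - \<xi>)) * m (snd z) * ?g (fst z)) \<in> borel_measurable borel"
        unfolding borel_prod[symmetric] by measurable
      show "integrable lborel (\<lambda>x::'a. gauss (x /\<^sub>R ?N) * (\<integral>\<eta>. norm (m \<eta>) \<partial>lborel))"
        using ig by simp
      fix x :: 'a
      have "(\<integral>\<^sup>+\<eta>. ennreal (norm (cis (x \<bullet> (\<eta> - \<xi>)) * m \<eta> * ?g x)) \<partial>lborel) = (\<integral>\<^sup>+\<eta>. ennreal (gauss (x /\<^sub>R ?N) * norm (m \<eta>)) \<partial>lborel)"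
        by (simp add: norm_mult mult_ac)
      also have "\<dots> = ennreal (gauss (x /\<^sub>R ?N) * (\<integral>\<eta>. norm (m \<eta>) \<partial>lborel))"
        using int by (subst nn_integral_eq_integral) auto
      finally show "(\<integral>\<^sup>+\<eta>. ennreal (norm (cis (x \<bullet> (\<eta> - \<xi>)) * m \<eta> * ?g x)) \<partial>lborel) \<le> ennreal (gauss (x /\<^sub>R ?N) * (\<integral>\<eta>. norm (m \<eta>) \<partial>lborel))"
        by simp
    qed
    have "I n = (\<integral>x. ?c * (\<integral>\<eta>. cis (x \<bullet> (\<eta> - \<xi>)) * m \<eta> * ?g x \<partial>lborel) \<partial>lborel)"
      unfolding I_def
    proof (rule Bochner_Integration.integral_cong[OF refl])
      fix x
      have "cis (- (x \<bullet> \<xi>)) * ?F x * ?g x = ?c * ((cis (- (x \<bullet> \<xi>)) * ?g x) * (\<integral>\<eta>. cis (x \<bullet> \<eta>) * m \<eta> \<partial>lborel))"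
        by (simp add: inv_fourier_def mult_ac)
      also have "(cis (- (x \<bullet> \<xi>)) * ?g x) * (\<integral>\<eta>. cis (x \<bullet> \<eta>) * m \<eta> \<partial>lborel)
          = (\<integral>\<eta>. (cis (- (x \<bullet> \<xi>)) * ?g x) * (cis (x \<bullet> \<eta>) * m \<eta>) \<partial>lborel)" by simp
      also have "\<dots> = (\<integral>\<eta>. cis (x \<bullet> (\<eta> - \<xi>)) * m \<eta> * ?g x \<partial>lborel)"
      proof (rule Bochner_Integration.integral_cong[OF refl])
        fix \<eta>
        have "cis (x \<bullet> (\<eta> - \<xi>)) = cis (- (x \<bullet> \<xi>)) * cis (x \<bullet> \<eta>)" by (simp add: cis_mult inner_diff_right)
        then show "(cis (- (x \<bullet> \<xi>)) * ?g x) * (cis (x \<bullet> \<eta>) * m \<eta>) = cis (x \<bullet> (\<eta> - \<xi>)) * m \<eta> * ?g x"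
          by (simp only: mult_ac)
      qed
      finally show "cis (- (x \<bullet> \<xi>)) * ?F x * ?g x = ?c * (\<integral>\<eta>. cis (x \<bullet> (\<eta> - \<xi>)) * m \<eta> * ?g x \<partial>lborel)" .
    qed
    also have "\<dots> = ?c * (\<integral>x. (\<integral>\<eta>. cis (x \<bullet> (\<eta> - \<xi>)) * m \<eta> * ?g x \<partial>lborel) \<partial>lborel)"
      by (rule integral_mult_right_zero)
    also have "(\<integral>x. (\<integral>\<eta>. cis (x \<bullet> (\<eta> - \<xi>)) * m \<eta> * ?g x \<partial>lborel) \<partial>lborel)
       = (\<integral>\<eta>. (\<integral>x. cis (x \<bullet> (\<eta> - \<xi>)) * m \<eta> * ?g x \<partial>lborel) \<partial>lborel)"
      by (rule lborel_pair.Fubini_integral[symmetric, OF pair])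
    also have "\<dots> = (\<integral>\<eta>. complex_of_real (?s ^ ?d) * (complex_of_real (?N ^ ?d) * (complex_of_real (gauss (?N *\<^sub>R (\<eta> - \<xi>))) * m \<eta>)) \<partial>lborel)"
    proof (rule Bochner_Integration.integral_cong[OF refl])
      fix \<eta>
      have "(\<integral>x. cis (x \<bullet> (\<eta> - \<xi>)) * m \<eta> * ?g x \<partial>lborel) = (\<integral>x. m \<eta> * (cis (- (x \<bullet> (\<xi> - \<eta>))) * ?g x) \<partial>lborel)"
        by (simp add: inner_diff_right mult_ac)
      also have "\<dots> = m \<eta> * complex_of_real (?N ^ ?d * (?s ^ ?d * gauss (?N *\<^sub>R (\<xi> - \<eta>))))"
        by (subst integral_mult_right_zero) (simp only: inner)
      finally show "(\<integral>x. cis (x \<bullet> (\<eta> - \<xi>)) * m \<eta> * ?g x \<partial>lborel) = complex_of_real (?s ^ ?d) * (complex_of_real (?N ^ ?d) * (complex_of_real (gauss (?N *\<^sub>R (\<eta> - \<xi>))) * m \<eta>))"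
        by (simp add: norm_minus_commute mult_ac)
    qed
    also have "\<dots> = complex_of_real (?s ^ ?d) * (complex_of_real (?N ^ ?d) * (\<integral>\<eta>. complex_of_real (gauss (?N *\<^sub>R (\<eta> - \<xi>))) * m \<eta> \<partial>lborel))"
      by simp
    also have "complex_of_real (?N ^ ?d) * (\<integral>\<eta>. complex_of_real (gauss (?N *\<^sub>R (\<eta> - \<xi>))) * m \<eta> \<partial>lborel)
        = (\<integral>z. complex_of_real (gauss z) * m (\<xi> + z /\<^sub>R ?N) \<partial>lborel)"
    proof -
      let ?h = "\<lambda>z. complex_of_real (gauss z) * m (\<xi> + z /\<^sub>R ?N)"
      have ih: "integrable lborel ?h"
      proof (rule Bochner_Integration.integrable_bound)
        show "integrable lborel (\<lambda>z::'a. gauss z * B)" by (intro integrable_mult_left integrable_gauss)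
        show "AE z in lborel. norm (?h z) \<le> norm (gauss z * B)"
        proof (rule AE_I2)
          fix z
          have "norm (?h z) = gauss z * norm (m (\<xi> + z /\<^sub>R ?N))" by (simp add: norm_mult)
          also have "\<dots> \<le> gauss z * B" by (intro mult_left_mono bound) simp
          also have "\<dots> \<le> norm (gauss z * B)" by (simp only: real_norm_def abs_ge_self)
          finally show "norm (?h z) \<le> norm (gauss z * B)" .
        qed
      qed measurable
      have "(\<integral>z. ?h z \<partial>lborel) = \<bar>?N\<bar> ^ ?d *\<^sub>R (\<integral>z. ?h (?N *\<^sub>R z) \<partial>lborel)"
        by (rule integral_dilation[OF ih]) simp
      also have "(\<integral>z. ?h (?N *\<^sub>R z) \<partial>lborel) = (\<integral>z. ?h (?N *\<^sub>R (z - \<xi>)) \<partial>lborel)"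
        by (rule integral_shift[symmetric]) measurable
      finally show ?thesis by (simp add: scaleR_conv_of_real)
    qed
    finally show ?thesis by (simp only: mult.assoc)
  qed
  have "(\<lambda>n. \<integral>z. complex_of_real (gauss z) * m (\<xi> + z /\<^sub>R real (Suc n)) \<partial>lborel) \<longlonglongrightarrow> integral\<^sup>L lborel (\<lambda>z::'a. complex_of_real (gauss z) * m \<xi>)"
  proof (rule integral_dominated_convergence[where w = "\<lambda>z. B * gauss z"])
    show "integrable lborel (\<lambda>z::'a. B * gauss z)" by (intro integrable_mult_right integrable_gauss)
    show "AE z in lborel. (\<lambda>n. complex_of_real (gauss z) * m (\<xi> + z /\<^sub>R real (Suc n))) \<longlonglongrightarrow> complex_of_real (gauss z) * m \<xi>"
    proof (rule AE_I2)
      fix z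
      have "(\<lambda>n. \<xi> + inverse (real (Suc n)) *\<^sub>R z) \<longlonglongrightarrow> \<xi> + 0 *\<^sub>R z"
        by (intro tendsto_intros LIMSEQ_inverse_real_of_nat)
      then have "(\<lambda>n. m (\<xi> + inverse (real (Suc n)) *\<^sub>R z)) \<longlonglongrightarrow> m (\<xi> + 0 *\<^sub>R z)"
        using cont by (intro continuous_on_tendsto_compose[OF cont]) auto
      then show "(\<lambda>n. complex_of_real (gauss z) * m (\<xi> + z /\<^sub>R real (Suc n))) \<longlonglongrightarrow> complex_of_real (gauss z) * m \<xi>"
        by (intro tendsto_intros) simp
    qed
    show "AE z in lborel. norm (complex_of_real (gauss z) * m (\<xi> + z /\<^sub>R real (Suc n))) \<le> B * gauss z" for n
      by (intro AE_I2) (auto simp: norm_mult mult.commute intro!: mult_right_mono bound)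
  qed auto
  moreover have "integral\<^sup>L lborel (\<lambda>z::'a. complex_of_real (gauss z) * m \<xi>) = complex_of_real (?s ^ ?d) * m \<xi>"
    using gauss_fourier[of "0 :: 'a"] by simp
  ultimately have "I \<longlonglongrightarrow> ?c * complex_of_real (?s ^ ?d) * (complex_of_real (?s ^ ?d) * m \<xi>)"
    unfolding I_eq by (intro tendsto_mult tendsto_const) (simp only:)
  also have "?c * complex_of_real (?s ^ ?d) * (complex_of_real (?s ^ ?d) * m \<xi>) = complex_of_real (1 / (2 * pi) ^ ?d * (?s ^ ?d * ?s ^ ?d)) * m \<xi>"
    by (simp add: mult_ac)
  also have "1 / (2 * pi) ^ ?d * (?s ^ ?d * ?s ^ ?d) = 1"
  proof -
    have "?s ^ ?d * ?s ^ ?d = (2 * pi) ^ ?d" by (subst power_mult_distrib[symmetric]) simp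
    then show ?thesis by simp
  qed
  finally show ?thesis using LIMSEQ_unique[OF lim1] by simp
qed

subsection \<open>Decay of Fourier integrals of test functions\<close>

text \<open>
  The integral of \<open>G (x + i) - G x\<close> over \<open>x\<close> is zero by translation invariance, and this difference is the
  integral of \<open>G'\<close> along a segment.
\<close>

lemma integral_line_derivative_zero:
  fixes G :: "'a::euclidean_space \<Rightarrow> 'b::euclidean_space"
  assumes d: "\<And>x t. ((\<lambda>t. G (x + t *\<^sub>R i)) has_vector_derivative G' (x + t *\<^sub>R i)) (at t)"
    and G: "integrable lborel G" and G': "integrable lborel G'" and c: "continuous_on UNIV G'"
  shows "(\<integral>x. G' x \<partial>lborel) = 0"
proof -
  let ?k = "\<lambda>t::real. indicator {0..1} t :: real"
  have [measurable]: "G \<in> borel_measurable borel" "G' \<in> borel_measurable borel" using G G' by auto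
  have Gs: "integrable lborel (\<lambda>x. G (x + i))" using integrable_shift[OF G, of "- i"] by simp
  have pair: "integrable (lborel \<Otimes>\<^sub>M lborel) (\<lambda>(t, x). ?k t *\<^sub>R G' (x + t *\<^sub>R i))"
  proof (rule product_integrable_pair)
    show "(\<lambda>z. ?k (fst z) *\<^sub>R G' (snd z + fst z *\<^sub>R i)) \<in> borel_measurable borel"
      unfolding borel_prod[symmetric] by measurable
    show "integrable lborel (\<lambda>t. ?k t * (\<integral>x. norm (G' x) \<partial>lborel))" by simp
    fix t
    have "(\<integral>\<^sup>+x. ennreal (norm (?k t *\<^sub>R G' (x + t *\<^sub>R i))) \<partial>lborel) = (\<integral>\<^sup>+x. ennreal (?k t) * ennreal (norm (G' (x - (- t *\<^sub>R i)))) \<partial>lborel)"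
      by (simp add: ennreal_mult)
    also have "\<dots> = ennreal (?k t) * (\<integral>\<^sup>+x. ennreal (norm (G' x)) \<partial>lborel)"
      by (subst nn_integral_cmult) (auto simp: nn_integral_shift[of "\<lambda>x. ennreal (norm (G' x))" "- t *\<^sub>R i", simplified])
    also have "\<dots> = ennreal (?k t * (\<integral>x. norm (G' x) \<partial>lborel))"
      using G' by (subst nn_integral_eq_integral) (auto simp: ennreal_mult)
    finally show "(\<integral>\<^sup>+x. ennreal (norm (?k t *\<^sub>R G' (x + t *\<^sub>R i))) \<partial>lborel) \<le> ennreal (?k t * (\<integral>x. norm (G' x) \<partial>lborel))" by simp
  qed
  have "0 = (\<integral>x. G (x + i) - G x \<partial>lborel)"
    using integral_shift[of G "- i"] by (simp add: G Gs)
  also have "\<dots> = (\<integral>x. (\<integral>t. ?k t *\<^sub>R G' (x + t *\<^sub>R i) \<partial>lborel) \<partial>lborel)"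
  proof (rule Bochner_Integration.integral_cong[OF refl])
    fix x
    have "(\<integral>t. ?k t *\<^sub>R G' (x + t *\<^sub>R i) \<partial>lborel) = G (x + 1 *\<^sub>R i) - G (x + 0 *\<^sub>R i)"
    proof (rule integral_FTC_Icc)
      show "((\<lambda>t. G (x + t *\<^sub>R i)) has_vector_derivative G' (x + t *\<^sub>R i)) (at t within {0..1})" for t
        by (rule has_vector_derivative_at_within[OF d])
      show "continuous_on {0..1} (\<lambda>t. G' (x + t *\<^sub>R i))" using continuous_on_line[OF c, of _ x 1 i] by simp
    qed simp
    then show "G (x + i) - G x = (\<integral>t. ?k t *\<^sub>R G' (x + t *\<^sub>R i) \<partial>lborel)" by simp
  qed
  also have "\<dots> = (\<integral>t. (\<integral>x. ?k t *\<^sub>R G' (x + t *\<^sub>R i) \<partial>lborel) \<partial>lborel)"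
    by (rule lborel_pair.Fubini_integral[OF pair])
  also have "\<dots> = (\<integral>t. ?k t *\<^sub>R (\<integral>x. G' x \<partial>lborel) \<partial>lborel)"
    using integral_shift[of G' "- _ *\<^sub>R i"] by simp
  also have "\<dots> = (\<integral>x. G' x \<partial>lborel)" by simp
  finally show ?thesis by simp
qed

text \<open>
  The inverse Fourier integral without the normalising constant, for real symbols.
\<close>

definition osc :: "('a::euclidean_space \<Rightarrow> real) \<Rightarrow> 'a \<Rightarrow> complex" where
  "osc m x = (\<integral>\<xi>. cis (x \<bullet> \<xi>) * complex_of_real (m \<xi>) \<partial>lborel)"

lemma osc_integrable: "integrable lborel m \<Longrightarrow> integrable lborel (\<lambda>\<xi>. cis (x \<bullet> \<xi>) * complex_of_real (m \<xi>))"
  by (rule Bochner_Integration.integrable_bound[of _ m]) (auto simp: norm_mult)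

lemma osc_bound: "integrable lborel m \<Longrightarrow> norm (osc m x) \<le> (\<integral>\<xi>. \<bar>m \<xi>\<bar> \<partial>lborel)"
  unfolding osc_def
  by (rule order_trans[OF integral_norm_bound]) (simp add: norm_mult)

lemma osc_measurable:
  assumes [measurable]: "m \<in> borel_measurable borel" shows "osc m \<in> borel_measurable borel"
  unfolding osc_def[abs_def]
  by (rule lborel.borel_measurable_lebesgue_integral) (unfold case_prod_unfold, measurable)

text \<open>
  Integration by parts: the oscillating factor contributes \<open>\<i> (x \<bullet> i)\<close>.
\<close>

lemma osc_partial:
  assumes m: "test_function UNIV m" and i: "i \<in> Basis"
  shows "osc (partial_deriv i m) x = - \<i> * complex_of_real (x \<bullet> i) * osc m x"
proof -
  note sm = test_function_smooth[OF m]
  note pm = test_function_partial[OF m i]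
  let ?G = "\<lambda>\<xi>. cis (x \<bullet> \<xi>) * complex_of_real (m \<xi>)"
  let ?H = "\<lambda>\<xi>. cis (x \<bullet> \<xi>) * complex_of_real (partial_deriv i m \<xi>)"
  note I = osc_integrable[OF test_function_integrable[OF m], of x] osc_integrable[OF test_function_integrable[OF pm], of x]
  have "(\<integral>\<xi>. \<i> * complex_of_real (x \<bullet> i) * ?G \<xi> + ?H \<xi> \<partial>lborel) = 0"
  proof (rule integral_line_derivative_zero[of ?G i])
    fix \<xi> :: 'a and t :: real
    have "((\<lambda>t. cis (x \<bullet> (\<xi> + t *\<^sub>R i))) has_vector_derivative \<i> * complex_of_real (x \<bullet> i) * cis (x \<bullet> (\<xi> + t *\<^sub>R i))) (at t)"
    proof -
      have 1: "((\<lambda>t. x \<bullet> (\<xi> + t *\<^sub>R i)) has_vector_derivative (x \<bullet> i)) (at t)"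
        by (auto intro!: derivative_eq_intros simp: inner_add_right has_real_derivative_iff_has_vector_derivative[symmetric])
      have 2: "(cis has_vector_derivative \<i> * cis s) (at s)" for s
      proof -
        have "((\<lambda>z. exp (\<i> * z)) has_field_derivative \<i> * exp (\<i> * complex_of_real s)) (at (complex_of_real s))"
          by (auto intro!: derivative_eq_intros)
        from has_vector_derivative_real_field[OF this] show ?thesis by (simp add: cis_conv_exp[abs_def])
      qed
      show ?thesis using vector_diff_chain_at[OF 1 2] by (simp add: o_def scaleR_conv_of_real mult_ac)
    qed
    moreover have "((\<lambda>t. complex_of_real (m (\<xi> + t *\<^sub>R i))) has_vector_derivative complex_of_real (partial_deriv i m (\<xi> + t *\<^sub>R i))) (at t)"
      using smooth_line_derivative[OF sm, of \<xi> i t UNIV]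
      by (rule bounded_linear.has_vector_derivative[OF bounded_linear_of_real])
    ultimately have "((\<lambda>t. cis (x \<bullet> (\<xi> + t *\<^sub>R i)) * complex_of_real (m (\<xi> + t *\<^sub>R i))) has_vector_derivative
        (cis (x \<bullet> (\<xi> + t *\<^sub>R i)) * complex_of_real (partial_deriv i m (\<xi> + t *\<^sub>R i)) +
         \<i> * complex_of_real (x \<bullet> i) * cis (x \<bullet> (\<xi> + t *\<^sub>R i)) * complex_of_real (m (\<xi> + t *\<^sub>R i)))) (at t)"
      by (rule has_vector_derivative_mult)
    then show "((\<lambda>t. ?G (\<xi> + t *\<^sub>R i)) has_vector_derivative \<i> * complex_of_real (x \<bullet> i) * ?G (\<xi> + t *\<^sub>R i) + ?H (\<xi> + t *\<^sub>R i)) (at t)"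
      by (simp only: mult_ac add_ac)
  next
    show "integrable lborel ?G" by (rule I)
    show "integrable lborel (\<lambda>\<xi>. \<i> * complex_of_real (x \<bullet> i) * ?G \<xi> + ?H \<xi>)"
      by (intro Bochner_Integration.integrable_add integrable_mult_right I)
    show "continuous_on UNIV (\<lambda>\<xi>. \<i> * complex_of_real (x \<bullet> i) * ?G \<xi> + ?H \<xi>)"
      by (intro continuous_intros smooth_continuous sm smooth_partial[OF sm i])
  qed
  then have "\<i> * complex_of_real (x \<bullet> i) * osc m x + osc (partial_deriv i m) x = 0"
    unfolding osc_def using I by simp
  then show ?thesis by (simp add: add_eq_0_iff)
qed

lemma osc_coordinate_decay:
  assumes "test_function UNIV m" "i \<in> Basis"
  shows "\<exists>C\<ge>0. \<forall>x. \<bar>x \<bullet> i\<bar> ^ n * norm (osc m x) \<le> C"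
  using assms(1)
proof (induction n arbitrary: m)
  case 0
  have "0 \<le> (\<integral>\<xi>. \<bar>m \<xi>\<bar> \<partial>lborel)" by simp
  then show ?case using osc_bound[OF test_function_integrable[OF 0]]
    by (intro exI[of _ "\<integral>\<xi>. \<bar>m \<xi>\<bar> \<partial>lborel"]) simp
next
  case (Suc n)
  obtain C where C: "C \<ge> 0" "\<And>x. \<bar>x \<bullet> i\<bar> ^ n * norm (osc (partial_deriv i m) x) \<le> C"
    using Suc.IH[OF test_function_partial[OF Suc.prems assms(2)]] by auto
  then show ?case
    by (intro exI[of _ C]) (simp add: osc_partial[OF Suc.prems assms(2)] norm_mult mult_ac)
qed

lemma osc_decay:
  fixes m :: "'a::euclidean_space \<Rightarrow> real"
  assumes m: "test_function UNIV m"
  shows "\<exists>C\<ge>0. \<forall>x. norm (osc m x) \<le> C / (1 + norm x) ^ n"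
proof -
  let ?d = "real DIM('a)"
  define B where "B = (\<integral>\<xi>. \<bar>m \<xi>\<bar> \<partial>lborel)"
  have B: "0 \<le> B" "\<And>x. norm (osc m x) \<le> B"
    using osc_bound[OF test_function_integrable[OF m]] by (auto simp: B_def)
  have "\<forall>i\<in>(Basis::'a set). \<exists>C\<ge>0. \<forall>x. \<bar>x \<bullet> i\<bar> ^ n * norm (osc m x) \<le> C"
    using osc_coordinate_decay[OF m] by blast
  then obtain C where C: "\<And>i. i \<in> Basis \<Longrightarrow> C i \<ge> 0" "\<And>i x. i \<in> (Basis::'a set) \<Longrightarrow> \<bar>x \<bullet> i\<bar> ^ n * norm (osc m x) \<le> C i"
    by metis
  define D where "D = (?d + 1) ^ n * (B + (\<Sum>i\<in>(Basis::'a set). C i))"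
  have sC: "0 \<le> (\<Sum>i\<in>(Basis::'a set). C i)" by (intro sum_nonneg C)
  have D0: "D \<ge> 0" unfolding D_def using B sC by simp
  have "norm (osc m x) \<le> D / (1 + norm x) ^ n" for x
  proof -
    \<comment> \<open>the largest coordinate controls the norm\<close>
    obtain j where j: "j \<in> Basis" "\<And>i. i \<in> Basis \<Longrightarrow> \<bar>x \<bullet> i\<bar> \<le> \<bar>x \<bullet> j\<bar>"
    proof -
      let ?A = "(\<lambda>i. \<bar>x \<bullet> i\<bar>) ` (Basis :: 'a set)"
      have "Max ?A \<in> ?A" by (intro Max_in) auto
      then obtain j where "j \<in> Basis" "Max ?A = \<bar>x \<bullet> j\<bar>" by blast
      moreover have "\<bar>x \<bullet> i\<bar> \<le> Max ?A" if "i \<in> Basis" for i using that by (intro Max_ge) auto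
      ultimately show thesis using that by metis
    qed
    let ?M = "max 1 \<bar>x \<bullet> j\<bar>"
    have "norm x \<le> (\<Sum>i\<in>Basis. \<bar>x \<bullet> i\<bar>)" by (rule norm_le_l1)
    also have "\<dots> \<le> (\<Sum>i\<in>(Basis::'a set). \<bar>x \<bullet> j\<bar>)" by (intro sum_mono j)
    also have "\<dots> \<le> ?d * ?M" by (simp add: mult_left_mono)
    finally have "1 + norm x \<le> (?d + 1) * ?M" by (simp add: distrib_right)
    then have "(1 + norm x) ^ n \<le> ((?d + 1) * ?M) ^ n" by (intro power_mono) auto
    also have "\<dots> = (?d + 1) ^ n * ?M ^ n" by (rule power_mult_distrib)
    finally have "(1 + norm x) ^ n * norm (osc m x) \<le> ((?d + 1) ^ n * ?M ^ n) * norm (osc m x)"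
      by (rule mult_right_mono) simp
    also have "\<dots> = (?d + 1) ^ n * (?M ^ n * norm (osc m x))" by simp
    also have "\<dots> \<le> D"
      unfolding D_def
    proof (rule mult_left_mono)
      have "C j \<le> (\<Sum>i\<in>(Basis::'a set). C i)" using j C by (intro member_le_sum) auto
      then show "?M ^ n * norm (osc m x) \<le> B + (\<Sum>i\<in>(Basis::'a set). C i)"
        using B(2)[of x] B(1) C(2)[OF j(1), of x] sC by (cases "\<bar>x \<bullet> j\<bar> \<le> 1") (simp_all add: max_def)
    qed simp
    finally show ?thesis by (simp add: field_simps add_pos_nonneg)
  qed
  then show ?thesis using D0 by blast
qed

text \<open>
  By Fubini, \<open>osc\<close> can be moved from one factor to the other, where a derivative of \<open>\<psi>\<close> turns into a
  multiplication by the coordinate; moving back attaches the coordinate to the symbol.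
\<close>

lemma osc_weak_deriv:
  fixes m :: "'a::euclidean_space \<Rightarrow> real"
  assumes m: "test_function UNIV m" and \<psi>: "test_function UNIV \<psi>" and i: "i \<in> Basis"
  shows "(\<integral>x. complex_of_real (partial_deriv i \<psi> x) * osc m x \<partial>lborel) =
     - (\<integral>x. complex_of_real (\<psi> x) * (\<i> * osc (\<lambda>\<xi>. (\<xi> \<bullet> i) * m \<xi>) x) \<partial>lborel)"
proof -
  have F: "(\<integral>x. complex_of_real (a x) * osc b x \<partial>lborel) = (\<integral>\<xi>. complex_of_real (b \<xi>) * osc a \<xi> \<partial>lborel)"
    if a: "integrable lborel a" and b: "integrable lborel b" for a b :: "'a \<Rightarrow> real"
  proof -
    have [measurable]: "a \<in> borel_measurable borel" "b \<in> borel_measurable borel" using a b by auto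
    have pair: "integrable (lborel \<Otimes>\<^sub>M lborel) (\<lambda>(x, \<xi>). complex_of_real (a x) * (cis (x \<bullet> \<xi>) * complex_of_real (b \<xi>)))"
    proof (rule product_integrable_pair)
      show "(\<lambda>z. complex_of_real (a (fst z)) * (cis (fst z \<bullet> snd z) * complex_of_real (b (snd z)))) \<in> borel_measurable borel"
        unfolding borel_prod[symmetric] by measurable
      show "integrable lborel (\<lambda>x. \<bar>a x\<bar> * (\<integral>\<xi>. \<bar>b \<xi>\<bar> \<partial>lborel))" using a by simp
      fix x
      have "(\<integral>\<^sup>+\<xi>. ennreal (norm (complex_of_real (a x) * (cis (x \<bullet> \<xi>) * complex_of_real (b \<xi>)))) \<partial>lborel) = (\<integral>\<^sup>+\<xi>. ennreal (\<bar>a x\<bar> * \<bar>b \<xi>\<bar>) \<partial>lborel)"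
        by (simp add: norm_mult)
      also have "\<dots> = ennreal (\<bar>a x\<bar> * (\<integral>\<xi>. \<bar>b \<xi>\<bar> \<partial>lborel))"
        using b by (subst nn_integral_eq_integral) auto
      finally show "(\<integral>\<^sup>+\<xi>. ennreal (norm (complex_of_real (a x) * (cis (x \<bullet> \<xi>) * complex_of_real (b \<xi>)))) \<partial>lborel) \<le> ennreal (\<bar>a x\<bar> * (\<integral>\<xi>. \<bar>b \<xi>\<bar> \<partial>lborel))" by simp
    qed
    have "(\<integral>x. complex_of_real (a x) * osc b x \<partial>lborel) = (\<integral>x. (\<integral>\<xi>. complex_of_real (a x) * (cis (x \<bullet> \<xi>) * complex_of_real (b \<xi>)) \<partial>lborel) \<partial>lborel)"
      by (simp add: osc_def)
    also have "\<dots> = (\<integral>\<xi>. (\<integral>x. complex_of_real (a x) * (cis (x \<bullet> \<xi>) * complex_of_real (b \<xi>)) \<partial>lborel) \<partial>lborel)"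
      by (rule lborel_pair.Fubini_integral[symmetric, OF pair])
    also have "\<dots> = (\<integral>\<xi>. complex_of_real (b \<xi>) * osc a \<xi> \<partial>lborel)"
    proof (rule Bochner_Integration.integral_cong[OF refl])
      fix \<xi>
      have "(\<integral>x. complex_of_real (a x) * (cis (x \<bullet> \<xi>) * complex_of_real (b \<xi>)) \<partial>lborel) = (\<integral>x. complex_of_real (b \<xi>) * (cis (\<xi> \<bullet> x) * complex_of_real (a x)) \<partial>lborel)"
        by (simp add: mult_ac inner_commute)
      then show "(\<integral>x. complex_of_real (a x) * (cis (x \<bullet> \<xi>) * complex_of_real (b \<xi>)) \<partial>lborel) = complex_of_real (b \<xi>) * osc a \<xi>"
        by (simp add: osc_def)
    qed
    finally show ?thesis .
  qed
  have xm: "integrable lborel (\<lambda>\<xi>. (\<xi> \<bullet> i) * m \<xi>)"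
  proof -
    obtain K where "compact K" "\<And>x. x \<notin> K \<Longrightarrow> m x = 0" using test_function_support[OF m] by metis
    then show ?thesis
      by (intro continuous_compact_support_integrable[of _ K] continuous_intros smooth_continuous test_function_smooth[OF m]) auto
  qed
  have "(\<integral>x. complex_of_real (partial_deriv i \<psi> x) * osc m x \<partial>lborel) = (\<integral>\<xi>. complex_of_real (m \<xi>) * osc (partial_deriv i \<psi>) \<xi> \<partial>lborel)"
    by (rule F[OF test_function_integrable[OF test_function_partial[OF \<psi> i]] test_function_integrable[OF m]])
  also have "\<dots> = (\<integral>\<xi>. - \<i> * (complex_of_real ((\<xi> \<bullet> i) * m \<xi>) * osc \<psi> \<xi>) \<partial>lborel)"
    by (simp add: osc_partial[OF \<psi> i] mult_ac)
  also have "\<dots> = - \<i> * (\<integral>\<xi>. complex_of_real ((\<xi> \<bullet> i) * m \<xi>) * osc \<psi> \<xi> \<partial>lborel)"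
    by (rule integral_mult_right_zero)
  also have "(\<integral>\<xi>. complex_of_real ((\<xi> \<bullet> i) * m \<xi>) * osc \<psi> \<xi> \<partial>lborel) = (\<integral>x. complex_of_real (\<psi> x) * osc (\<lambda>\<xi>. (\<xi> \<bullet> i) * m \<xi>) x \<partial>lborel)"
    by (rule F[symmetric, OF test_function_integrable[OF \<psi>] xm])
  also have "- \<i> * \<dots> = - (\<integral>x. \<i> * (complex_of_real (\<psi> x) * osc (\<lambda>\<xi>. (\<xi> \<bullet> i) * m \<xi>) x) \<partial>lborel)"
    by simp
  finally show ?thesis by (simp add: mult_ac)
qed

section \<open>Low-pass filters\<close>

lemma avg_adjoint:
  fixes f :: "'a::euclidean_space \<Rightarrow> 'b::euclidean_space" and \<psi> :: "'a \<Rightarrow> real"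
  assumes k: "integrable lborel k" and s: "s \<in> borel_measurable borel" and f: "L2 f" and g: "L2 \<psi>"
  shows "(\<integral>x. \<psi> x *\<^sub>R avg k s f x \<partial>lborel) = (\<integral>x. avg k (\<lambda>y. - s y) \<psi> x *\<^sub>R f x \<partial>lborel)"
proof -
  have [measurable]: "k \<in> borel_measurable borel" "f \<in> borel_measurable borel" "\<psi> \<in> borel_measurable borel" "s \<in> borel_measurable borel"
    using k f g s by (auto simp: L2_def)
  have s': "(\<lambda>y. - s y) \<in> borel_measurable borel" by measurable
  have int: "integrable (lborel \<Otimes>\<^sub>M lborel) (\<lambda>(y, x). (k y * \<psi> (x - (- s y))) *\<^sub>R f x)"
  proof (rule kernel_integrable_pair[OF _ k g f])
    show "(\<lambda>z. (k (fst z) * \<psi> (snd z - (- s (fst z)))) *\<^sub>R f (snd z)) \<in> borel_measurable borel"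
      unfolding borel_prod[symmetric] by measurable
    show "norm ((k y * \<psi> (x - (- s y))) *\<^sub>R f x) \<le> \<bar>k y\<bar> * (norm (\<psi> (x - (- s y))) * norm (f x))" for y x
      by (simp add: abs_mult)
  qed
  have "(\<integral>x. \<psi> x *\<^sub>R avg k s f x \<partial>lborel) = (\<integral>y. k y *\<^sub>R (\<integral>x. \<psi> x *\<^sub>R f (x - s y) \<partial>lborel) \<partial>lborel)"
    by (rule avg_scaleR[OF k s f g])
  also have "\<dots> = (\<integral>y. (\<integral>x. (k y * \<psi> (x - (- s y))) *\<^sub>R f x \<partial>lborel) \<partial>lborel)"
  proof (rule Bochner_Integration.integral_cong[OF refl])
    fix y
    have "(\<integral>x. \<psi> x *\<^sub>R f (x - s y) \<partial>lborel) = (\<integral>x. \<psi> (x - (- s y)) *\<^sub>R f x \<partial>lborel)"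
      using integral_shift[of "\<lambda>x. \<psi> x *\<^sub>R f (x - s y)" "- s y"] by simp
    then show "k y *\<^sub>R (\<integral>x. \<psi> x *\<^sub>R f (x - s y) \<partial>lborel) = (\<integral>x. (k y * \<psi> (x - (- s y))) *\<^sub>R f x \<partial>lborel)"
      by (simp only: integral_scaleR_right scaleR_scaleR[symmetric])
  qed
  also have "\<dots> = (\<integral>x. (\<integral>y. (k y * \<psi> (x - (- s y))) *\<^sub>R f x \<partial>lborel) \<partial>lborel)"
    by (rule lborel_pair.Fubini_integral[symmetric, OF int])
  also have "\<dots> = (\<integral>x. avg k (\<lambda>y. - s y) \<psi> x *\<^sub>R f x \<partial>lborel)"
  proof (rule integral_cong_AE)
    note A = avg_L2[OF k s' g]
    note [measurable] = L2_borel[OF A(1)]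
    show "(\<lambda>x. avg k (\<lambda>y. - s y) \<psi> x *\<^sub>R f x) \<in> borel_measurable lborel" by measurable
    show "(\<lambda>x. \<integral>y. (k y * \<psi> (x - (- s y))) *\<^sub>R f x \<partial>lborel) \<in> borel_measurable lborel" by measurable
    show "AE x in lborel. (\<integral>y. (k y * \<psi> (x - (- s y))) *\<^sub>R f x \<partial>lborel) = avg k (\<lambda>y. - s y) \<psi> x *\<^sub>R f x"
      using A(3)
    proof eventually_elim
      case (elim x)
      then show ?case unfolding avg_def by (subst integral_scaleR_left[symmetric]) auto
    qed
  qed
  finally show ?thesis .
qed

lemma L2_reflect: assumes "L2 f" shows "L2 (\<lambda>y. f (x - y))"
proof -
  have [measurable]: "f \<in> borel_measurable borel" using assms by (simp add: L2_def)
  have "integrable lborel (\<lambda>y. (norm (f (- y)))\<^sup>2)"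
    using integrable_dilation[of "\<lambda>y. (norm (f y))\<^sup>2" "-1"] assms by (simp add: L2_def)
  then have "L2 (\<lambda>y. f (- y))" by (simp add: L2_def)
  from L2_shift(1)[OF this, of x] show ?thesis by simp
qed

abbreviation conv :: "('a::euclidean_space \<Rightarrow> real) \<Rightarrow> ('a \<Rightarrow> 'b::euclidean_space) \<Rightarrow> 'a \<Rightarrow> 'b" where
  "conv k f \<equiv> avg k (\<lambda>y. y) f"

lemma conv_integrable: "L2 k \<Longrightarrow> L2 f \<Longrightarrow> integrable lborel (\<lambda>y. k y *\<^sub>R f (x - y))"
  by (intro L2_scaleR_integrable L2_reflect)

lemma conv_diff_right: "L2 k \<Longrightarrow> L2 f \<Longrightarrow> L2 g \<Longrightarrow> conv k (\<lambda>x. f x - g x) x = conv k f x - conv k g x"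
  by (simp add: avg_def conv_integrable scaleR_diff_right)

lemma conv_diff_left: "L2 k \<Longrightarrow> L2 l \<Longrightarrow> L2 f \<Longrightarrow> conv (\<lambda>y. k y - l y) f x = conv k f x - conv l f x"
  by (simp add: avg_def conv_integrable scaleR_diff_left)

lemma conv_assoc:
  assumes k: "integrable lborel k" and l: "L2 l" and f: "L2 f"
  shows "conv k (conv l f) x = conv (\<lambda>z. \<integral>y. k y * l (z - y) \<partial>lborel) f x"
proof -
  let ?g = "\<lambda>z. f (x - z)"
  have g: "L2 ?g" by (rule L2_reflect[OF f])
  have [measurable]: "k \<in> borel_measurable borel" "l \<in> borel_measurable borel" "f \<in> borel_measurable borel"
    using k l f by (auto simp: L2_def)
  have id: "(\<lambda>y::'a. y) \<in> borel_measurable borel" by simp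
  have pair: "integrable (lborel \<Otimes>\<^sub>M lborel) (\<lambda>(y, z). (k y * l (z - y)) *\<^sub>R ?g z)"
  proof (rule kernel_integrable_pair[where s = "\<lambda>y. y", OF _ k l g])
    show "(\<lambda>z. (k (fst z) * l (snd z - fst z)) *\<^sub>R ?g (snd z)) \<in> borel_measurable borel"
      unfolding borel_prod[symmetric] by measurable
    show "norm ((k y * l (z - y)) *\<^sub>R ?g z) \<le> \<bar>k y\<bar> * (norm (l (z - y)) * norm (?g z))" for y z
      by (simp add: abs_mult)
  qed
  have "conv k (conv l f) x = (\<integral>y. k y *\<^sub>R (\<integral>z. l z *\<^sub>R f (x - y - z) \<partial>lborel) \<partial>lborel)"
    by (simp add: avg_def)
  also have "\<dots> = (\<integral>y. (\<integral>z. (k y * l (z - y)) *\<^sub>R ?g z \<partial>lborel) \<partial>lborel)"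
  proof (rule Bochner_Integration.integral_cong[OF refl])
    fix y
    have "(\<integral>z. l z *\<^sub>R f (x - y - z) \<partial>lborel) = (\<integral>z. l (z - y) *\<^sub>R ?g z \<partial>lborel)"
      using integral_shift[of "\<lambda>z. l z *\<^sub>R f (x - y - z)" y] by (simp add: algebra_simps)
    then show "k y *\<^sub>R (\<integral>z. l z *\<^sub>R f (x - y - z) \<partial>lborel) = (\<integral>z. (k y * l (z - y)) *\<^sub>R ?g z \<partial>lborel)"
      by (simp only: integral_scaleR_right scaleR_scaleR[symmetric])
  qed
  also have "\<dots> = (\<integral>z. (\<integral>y. (k y * l (z - y)) *\<^sub>R ?g z \<partial>lborel) \<partial>lborel)"
    by (rule lborel_pair.Fubini_integral[symmetric, OF pair])
  also have "\<dots> = conv (\<lambda>z. \<integral>y. k y * l (z - y) \<partial>lborel) f x"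
    unfolding avg_def
  proof (rule integral_cong_AE)
    have "(\<lambda>z. \<integral>y. k y * l (z - y) \<partial>lborel) = conv k l" by (simp add: avg_def fun_eq_iff)
    with L2_borel[OF avg_L2(1)[OF k id l]]
    have [measurable]: "(\<lambda>z. \<integral>y. k y * l (z - y) \<partial>lborel) \<in> borel_measurable borel" by simp
    show "(\<lambda>z. (\<integral>y. k y * l (z - y) \<partial>lborel) *\<^sub>R f (x - z)) \<in> borel_measurable lborel" by measurable
    show "(\<lambda>z. \<integral>y. (k y * l (z - y)) *\<^sub>R ?g z \<partial>lborel) \<in> borel_measurable lborel" by measurable
    show "AE z in lborel. (\<integral>y. (k y * l (z - y)) *\<^sub>R ?g z \<partial>lborel) = (\<integral>y. k y * l (z - y) \<partial>lborel) *\<^sub>R f (x - z)"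
      using avg_L2(3)[OF k id l]
    proof eventually_elim
      case (elim z)
      then show ?case by (subst integral_scaleR_left[symmetric]) auto
    qed
  qed
  finally show ?thesis .
qed

text \<open>
  The bound holds at every point, although \<open>f\<close> is bounded almost everywhere only.
\<close>

lemma conv_sup:
  assumes k: "integrable lborel k" and le: "AE x in lborel. norm (f x) \<le> M"
    and km: "f \<in> borel_measurable borel" and M: "M \<ge> 0"
  shows "norm (conv k f x) \<le> (\<integral>y. \<bar>k y\<bar> \<partial>lborel) * M"
proof -
  have [measurable]: "k \<in> borel_measurable borel" "f \<in> borel_measurable borel" using k km by auto
  have "AE y in lborel. norm (f (x - y)) \<le> M"
  proof -
    have eq: "distr lborel borel uminus = (lborel :: 'a measure)"
      using lborel_affine[of "-1" "0::'a"] by (simp add: density_1)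
    have "AE y in distr lborel borel uminus. norm (f y) \<le> M" unfolding eq by (rule le)
    from AE_distrD[OF _ this] have 1: "AE y in lborel. norm (f (- y)) \<le> M" by simp
    from AE_shift[OF this, of x] show ?thesis by simp
  qed
  then have le': "AE y in lborel. norm (k y *\<^sub>R f (x - y)) \<le> \<bar>k y\<bar> * M"
    by eventually_elim (simp add: mult_left_mono)
  have int: "integrable lborel (\<lambda>y. k y *\<^sub>R f (x - y))"
  proof (rule Bochner_Integration.integrable_bound)
    show "integrable lborel (\<lambda>y. \<bar>k y\<bar> * M)" using k by simp
    show "AE y in lborel. norm (k y *\<^sub>R f (x - y)) \<le> norm (\<bar>k y\<bar> * M)"
      using le' by eventually_elim (use M in simp)
  qed measurable
  have "norm (conv k f x) \<le> (\<integral>y. norm (k y *\<^sub>R f (x - y)) \<partial>lborel)"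
    unfolding avg_def by (rule integral_norm_bound)
  also have "\<dots> \<le> (\<integral>y. \<bar>k y\<bar> * M \<partial>lborel)"
    by (rule integral_mono_AE[OF integrable_norm[OF int] _ le']) (use k in simp)
  finally have "norm (conv k f x) \<le> (\<integral>y. \<bar>k y\<bar> * M \<partial>lborel)" .
  then show ?thesis by simp
qed

text \<open>
  The properties of the function \<open>\<chi>\<close> of a Littlewood-Paley decomposition that matter for its dilates.
  The radii \<open>2/3\<close> and \<open>4/3\<close> give \<open>\<chi>(\<xi>/l) = 1\<close> on the support of \<open>\<chi>(\<xi>/m)\<close> as soon as \<open>l \<ge> 2 m\<close>. Evenness
  makes the kernels real.
\<close>

locale low_pass =
  fixes chi :: "'a::euclidean_space \<Rightarrow> real"
  assumes chi_test: "test_function UNIV chi"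
    and chi_even: "\<And>\<xi>. chi (- \<xi>) = chi \<xi>"
    and chi_one: "\<And>\<xi>. norm \<xi> \<le> 2 / 3 \<Longrightarrow> chi \<xi> = 1"
    and chi_supp: "\<And>\<xi>. 4 / 3 < norm \<xi> \<Longrightarrow> chi \<xi> = 0"
begin

definition symb :: "real \<Rightarrow> 'a \<Rightarrow> real" where
  "symb l \<xi> = chi (\<xi> /\<^sub>R l)"

definition ker :: "real \<Rightarrow> 'a \<Rightarrow> real" where
  "ker l x = Re (osc (symb l) x) / (2 * pi) ^ DIM('a)"

text \<open>
  The derivative of the kernel in the direction \<open>i\<close>; see \<open>ker_weak_deriv\<close>.
\<close>

definition dker :: "real \<Rightarrow> 'a \<Rightarrow> 'a \<Rightarrow> real" where
  "dker l i x = Re (\<i> * osc (\<lambda>\<xi>. (\<xi> \<bullet> i) * symb l \<xi>) x) / (2 * pi) ^ DIM('a)"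

lemma test_dilation:
  assumes \<psi>: "test_function UNIV (\<psi> :: 'a \<Rightarrow> real)" and "c \<noteq> 0"
  shows "test_function UNIV (\<lambda>x. \<psi> (c *\<^sub>R x))"
proof -
  obtain K where K: "compact K" "\<And>x. x \<notin> K \<Longrightarrow> \<psi> x = 0" using test_function_support[OF \<psi>] by metis
  let ?K = "(\<lambda>x. inverse c *\<^sub>R x) ` K"
  have cK: "compact ?K" by (rule compact_scaling[OF K(1)])
  have "{x. \<psi> (c *\<^sub>R x) \<noteq> 0} \<subseteq> ?K"
  proof
    fix x assume "x \<in> {x. \<psi> (c *\<^sub>R x) \<noteq> 0}"
    then have "c *\<^sub>R x \<in> K" using K(2) by blast
    then show "x \<in> ?K" using \<open>c \<noteq> 0\<close> by (intro image_eqI[of _ _ "c *\<^sub>R x"]) auto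
  qed
  then have "closure {x. \<psi> (c *\<^sub>R x) \<noteq> 0} \<subseteq> ?K" using cK by (intro closure_minimal compact_imp_closed)
  then have "compact (closure {x. \<psi> (c *\<^sub>R x) \<noteq> 0})" using cK by (meson closed_closure compact_Int_closed inf.absorb_iff2 compact_eq_bounded_closed bounded_subset)
  moreover have "smooth (\<lambda>x. \<psi> (c *\<^sub>R x))"
    using smooth_affine[OF bounded_linear_scaleR_right[of c] test_function_smooth[OF \<psi>], of 0] by simp
  ultimately show ?thesis by (simp add: test_function_def)
qed

lemma symb_test: "l > 0 \<Longrightarrow> test_function UNIV (symb l)"
  using test_dilation[OF chi_test, of "inverse l"] by (simp add: symb_def[abs_def])

lemma test_times_coordinate:
  assumes "test_function UNIV (m :: 'a \<Rightarrow> real)" "i \<in> Basis"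
  shows "test_function UNIV (\<lambda>\<xi>. (\<xi> \<bullet> i) * m \<xi>)"
proof -
  have "closure {\<xi>. (\<xi> \<bullet> i) * m \<xi> \<noteq> 0} \<subseteq> closure {\<xi>. m \<xi> \<noteq> 0}" by (intro closure_mono) auto
  then have "compact (closure {\<xi>. (\<xi> \<bullet> i) * m \<xi> \<noteq> 0})"
    using assms(1) unfolding test_function_def by (meson bounded_subset closed_closure compact_eq_bounded_closed)
  then show ?thesis using assms by (simp add: test_function_def smooth_mult smooth_linear_form)
qed

lemma symb_even: "symb l (- \<xi>) = symb l \<xi>"
  using chi_even[of "\<xi> /\<^sub>R l"] by (simp add: symb_def)

lemma symb_0: "symb l 0 = 1" using chi_one[of 0] by (simp add: symb_def)

lemma osc_symb_real: assumes "l > 0" shows "osc (symb l) x = complex_of_real (Re (osc (symb l) x))"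
proof -
  note I = osc_integrable[OF test_function_integrable[OF symb_test[OF assms]], of x]
  have "cnj (osc (symb l) x) = (\<integral>\<xi>. cnj (cis (x \<bullet> \<xi>) * complex_of_real (symb l \<xi>)) \<partial>lborel)"
    unfolding osc_def by (rule Bochner_Integration.integral_cnj[symmetric])
  also have "\<dots> = (\<integral>\<xi>. (\<lambda>\<xi>. cis (x \<bullet> \<xi>) * complex_of_real (symb l \<xi>)) (- \<xi>) \<partial>lborel)"
    by (simp add: cis_cnj symb_even)
  also have "\<dots> = osc (symb l) x" unfolding osc_def by (rule integral_reflect[OF I])
  finally show ?thesis by (metis Reals_cnj_iff of_real_Re)
qed

lemma inv_fourier_symb: "l > 0 \<Longrightarrow> inv_fourier (\<lambda>\<xi>. complex_of_real (symb l \<xi>)) x = complex_of_real (ker l x)"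
  using osc_symb_real[of l x] unfolding inv_fourier_def ker_def osc_def[symmetric]
  by (metis (no_types, opaque_lifting) divide_inverse inverse_eq_divide mult.commute of_real_mult)

lemma osc_dilation:
  assumes m: "integrable lborel (m :: 'a \<Rightarrow> real)" and l: "l > 0"
  shows "osc (\<lambda>\<xi>. m (\<xi> /\<^sub>R l)) x = complex_of_real (l ^ DIM('a)) * osc m (l *\<^sub>R x)"
proof -
  have "integrable lborel (\<lambda>\<xi>. m (\<xi> /\<^sub>R l))" using integrable_dilation[OF m, of "inverse l"] l by simp
  from integral_dilation[OF osc_integrable[OF this, of x], of l] l
  show ?thesis by (simp add: osc_def scaleR_conv_of_real)
qed

lemma symb_1: "symb 1 = chi" by (simp add: symb_def fun_eq_iff)

lemma ker_scale: "l > 0 \<Longrightarrow> ker l x = l ^ DIM('a) * ker 1 (l *\<^sub>R x)"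
  using osc_dilation[OF test_function_integrable[OF chi_test], of l x]
  unfolding ker_def symb_1 by (simp add: symb_def[abs_def])

lemma dker_scale: 
  assumes "l > 0" "i \<in> Basis"
  shows "dker l i x = l ^ (DIM('a) + 1) * dker 1 i (l *\<^sub>R x)"
proof -
  let ?m = "\<lambda>\<xi>. (\<xi> \<bullet> i) * chi \<xi>"
  have m: "integrable lborel ?m"
    by (rule test_function_integrable[OF test_times_coordinate[OF chi_test assms(2)]])
  have "osc (\<lambda>\<xi>. (\<xi> \<bullet> i) * symb l \<xi>) x = complex_of_real l * osc (\<lambda>\<xi>. ?m (\<xi> /\<^sub>R l)) x"
  proof -
    have "cis (x \<bullet> \<xi>) * complex_of_real ((\<xi> \<bullet> i) * symb l \<xi>) = complex_of_real l * (cis (x \<bullet> \<xi>) * complex_of_real (?m (\<xi> /\<^sub>R l)))" for \<xi>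
      using assms by (simp add: symb_def)
    then show ?thesis by (simp only: osc_def integral_mult_right_zero)
  qed
  also have "\<dots> = complex_of_real (l ^ (DIM('a) + 1)) * osc ?m (l *\<^sub>R x)"
    by (subst osc_dilation[OF m assms(1)]) simp
  finally have "\<i> * osc (\<lambda>\<xi>. (\<xi> \<bullet> i) * symb l \<xi>) x = complex_of_real (l ^ (DIM('a) + 1)) * (\<i> * osc ?m (l *\<^sub>R x))"
    by simp
  then have "Re (\<i> * osc (\<lambda>\<xi>. (\<xi> \<bullet> i) * symb l \<xi>) x) = l ^ (DIM('a) + 1) * Re (\<i> * osc ?m (l *\<^sub>R x))"
    by (simp only: Re_complex_of_real times_complex.sel) simp
  then show ?thesis unfolding dker_def symb_1 by simp
qed

lemma ker_borel [measurable]: "l > 0 \<Longrightarrow> ker l \<in> borel_measurable borel"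
  unfolding ker_def[abs_def]
  using osc_measurable[of "symb l"] test_function_integrable[OF symb_test[of l]] by measurable

lemma dker_borel: "l > 0 \<Longrightarrow> i \<in> Basis \<Longrightarrow> dker l i \<in> borel_measurable borel"
  unfolding dker_def[abs_def]
  using osc_measurable[of "\<lambda>\<xi>. (\<xi> \<bullet> i) * symb l \<xi>"] test_function_integrable[OF test_times_coordinate[OF symb_test[of l], of i]]
  by measurable

lemma Re_osc_decay:
  assumes "test_function UNIV (m :: 'a \<Rightarrow> real)" and c: "norm c = 1"
  shows "\<exists>C\<ge>0. \<forall>x. \<bar>Re (c * osc m x) / (2 * pi) ^ DIM('a)\<bar> \<le> C / (1 + norm x) ^ n"
proof -
  obtain C where C: "C \<ge> 0" "\<And>x. norm (osc m x) \<le> C / (1 + norm x) ^ n" using osc_decay[OF assms(1)] by blast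
  have "\<bar>Re (c * osc m x) / (2 * pi) ^ DIM('a)\<bar> \<le> C / (1 + norm x) ^ n" for x
  proof -
    have "\<bar>Re (c * osc m x)\<bar> \<le> norm (osc m x)" using abs_Re_le_cmod[of "c * osc m x"] c by (simp add: norm_mult)
    moreover have "1 \<le> (2 * pi) ^ DIM('a)" using pi_gt3 by (intro one_le_power) simp
    ultimately have "\<bar>Re (c * osc m x)\<bar> / (2 * pi) ^ DIM('a) \<le> norm (osc m x) / 1"
      by (intro frac_le) auto
    then show ?thesis using C(2)[of x] by simp
  qed
  then show ?thesis using C(1) by blast
qed

lemma ker_decay: "l > 0 \<Longrightarrow> \<exists>C\<ge>0. \<forall>x. \<bar>ker l x\<bar> \<le> C / (1 + norm x) ^ n"
  using Re_osc_decay[OF symb_test, of l 1 n] by (simp add: ker_def)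

lemma dker_decay: "l > 0 \<Longrightarrow> i \<in> Basis \<Longrightarrow> \<exists>C\<ge>0. \<forall>x. \<bar>dker l i x\<bar> \<le> C / (1 + norm x) ^ n"
  using Re_osc_decay[OF test_times_coordinate[OF symb_test, of l i], of \<i> n] by (simp only: dker_def) simp

lemma decay_integrable:
  assumes [measurable]: "f \<in> borel_measurable borel" and "\<exists>C\<ge>0. \<forall>x. \<bar>f x\<bar> \<le> C / (1 + norm x) ^ (2 * DIM('a) + 1)"
  shows "integrable lborel (f :: 'a \<Rightarrow> real)" "integrable lborel (\<lambda>x. norm x * \<bar>f x\<bar>)" "L2 f" "\<exists>B. \<forall>x. \<bar>f x\<bar> \<le> B"
proof -
  let ?n = "2 * DIM('a)"
  obtain C where C: "C \<ge> 0" "\<And>x. \<bar>f x\<bar> \<le> C / (1 + norm x) ^ (?n + 1)" using assms(2) by blast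
  have 2: "norm x * \<bar>f x\<bar> \<le> C / (1 + norm x) ^ ?n" for x
  proof -
    have "norm x * \<bar>f x\<bar> \<le> (1 + norm x) * (C / (1 + norm x) ^ (?n + 1))"
      by (intro mult_mono C) auto
    also have "\<dots> = C / (1 + norm x) ^ ?n"
    proof -
      have "1 + norm x \<noteq> 0" using norm_ge_zero[of x] by linarith
      then show ?thesis by simp
    qed
    finally show ?thesis .
  qed
  show i: "integrable lborel f"
    by (rule integrable_weight_bound[of _ C "?n + 1"]) (use C in auto)
  show "integrable lborel (\<lambda>x. norm x * \<bar>f x\<bar>)"
    by (rule integrable_weight_bound[of _ C "?n"]) (use 2 in auto)
  have b: "\<bar>f x\<bar> \<le> C" for x
  proof -
    have "C / (1 + norm x) ^ (?n + 1) \<le> C / 1" using C(1) 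
      by (intro divide_left_mono one_le_power mult_pos_pos zero_less_power add_pos_nonneg) auto
    then show ?thesis using C(2)[of x] by simp
  qed
  then show "\<exists>B. \<forall>x. \<bar>f x\<bar> \<le> B" by blast
  show "L2 f" by (rule L2_bounded_integrable[OF i, of C]) (use b in simp)
qed

lemmas ker_facts = decay_integrable[OF ker_borel ker_decay]
lemmas dker_facts = decay_integrable[OF dker_borel dker_decay]

lemma ker_integrable: "l > 0 \<Longrightarrow> integrable lborel (ker l)" and ker_L2: "l > 0 \<Longrightarrow> L2 (ker l)"
  and dker_integrable: "l > 0 \<Longrightarrow> i \<in> Basis \<Longrightarrow> integrable lborel (dker l i)"
  using ker_facts dker_facts by blast+

text \<open>
  By scaling, all bounds for the kernels follow from those at \<open>l = 1\<close>: the mass \<open>C0\<close>, the first moment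
  \<open>C1\<close>, the mass \<open>D1\<close> of the gradient, and a pointwise bound \<open>B0\<close>.
\<close>

definition "C0 = (\<integral>y. \<bar>ker 1 y\<bar> \<partial>lborel)"
definition "C1 = (\<integral>y. norm y * \<bar>ker 1 y\<bar> \<partial>lborel)"
definition "D1 = (\<Sum>i\<in>Basis. \<integral>y. \<bar>dker 1 i y\<bar> \<partial>lborel)"
definition "B0 = (SOME B. \<forall>x. \<bar>ker 1 x\<bar> \<le> B)"

lemma C_nonneg: "C0 \<ge> 0" "C1 \<ge> 0" "D1 \<ge> 0" "B0 \<ge> 0"
proof -
  show "C0 \<ge> 0" "C1 \<ge> 0" "D1 \<ge> 0" by (simp_all add: C0_def C1_def D1_def sum_nonneg)
  have "\<forall>x. \<bar>ker 1 x\<bar> \<le> B0" unfolding B0_def by (rule someI_ex) (rule ker_facts(4); simp)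
  then show "B0 \<ge> 0" using abs_ge_zero[of "ker 1 0"] by (metis order_trans)
qed

lemma ker_abs_integral: assumes "l > 0" shows "(\<integral>y. \<bar>ker l y\<bar> \<partial>lborel) = C0"
proof -
  have "C0 = \<bar>l\<bar> ^ DIM('a) *\<^sub>R (\<integral>x. \<bar>ker 1 (l *\<^sub>R x)\<bar> \<partial>lborel)"
    unfolding C0_def by (rule integral_dilation) (use ker_integrable assms in auto)
  then show ?thesis using assms by (simp add: ker_scale[OF assms] abs_mult)
qed

lemma ker_moment: assumes "l > 0" shows "(\<integral>y. norm y * \<bar>ker l y\<bar> \<partial>lborel) = C1 / l"
proof -
  have "C1 = \<bar>l\<bar> ^ DIM('a) *\<^sub>R (\<integral>x. norm (l *\<^sub>R x) * \<bar>ker 1 (l *\<^sub>R x)\<bar> \<partial>lborel)"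
    unfolding C1_def by (rule integral_dilation) (use ker_facts(2) assms in auto)
  also have "\<dots> = l ^ DIM('a) * (l * (\<integral>x. norm x * \<bar>ker 1 (l *\<^sub>R x)\<bar> \<partial>lborel))"
    using assms by (simp add: mult.assoc)
  finally have 1: "C1 = l ^ DIM('a) * (l * (\<integral>x. norm x * \<bar>ker 1 (l *\<^sub>R x)\<bar> \<partial>lborel))" .
  have "norm y * \<bar>ker l y\<bar> = l ^ DIM('a) * (norm y * \<bar>ker 1 (l *\<^sub>R y)\<bar>)" for y
    using assms by (simp add: ker_scale[OF assms] abs_mult)
  then have "(\<integral>y. norm y * \<bar>ker l y\<bar> \<partial>lborel) = l ^ DIM('a) * (\<integral>x. norm x * \<bar>ker 1 (l *\<^sub>R x)\<bar> \<partial>lborel)"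
    by (simp only: integral_mult_right_zero)
  then show ?thesis using assms unfolding 1 by simp
qed

lemma dker_abs_integral: assumes "l > 0" "i \<in> Basis" shows "(\<integral>y. \<bar>dker l i y\<bar> \<partial>lborel) \<le> l * D1"
proof -
  have "(\<integral>y. \<bar>dker 1 i y\<bar> \<partial>lborel) = \<bar>l\<bar> ^ DIM('a) *\<^sub>R (\<integral>x. \<bar>dker 1 i (l *\<^sub>R x)\<bar> \<partial>lborel)"
    by (rule integral_dilation) (use dker_integrable assms in auto)
  then have "(\<integral>y. \<bar>dker l i y\<bar> \<partial>lborel) = l * (\<integral>y. \<bar>dker 1 i y\<bar> \<partial>lborel)"
    using assms by (simp add: dker_scale[OF assms] abs_mult)
  also have "\<dots> \<le> l * D1"
    unfolding D1_def using assms by (intro mult_left_mono member_le_sum) auto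
  finally show ?thesis .
qed

lemma ker_bound: assumes "l > 0" shows "\<bar>ker l x\<bar> \<le> l ^ DIM('a) * B0"
proof -
  have "\<forall>x. \<bar>ker 1 x\<bar> \<le> B0" unfolding B0_def by (rule someI_ex) (rule ker_facts(4); simp)
  then show ?thesis using assms by (simp add: ker_scale[OF assms] abs_mult mult_left_mono)
qed

lemma ker_fourier:
  assumes "l > 0"
  shows "(\<integral>x. cis (- (x \<bullet> \<xi>)) * complex_of_real (ker l x) \<partial>lborel) = complex_of_real (symb l \<xi>)"
proof -
  note t = symb_test[OF assms]
  obtain B where B: "\<And>x. \<bar>symb l x\<bar> \<le> B" using test_function_bounded[OF t] by metis
  have "fourier (inv_fourier (\<lambda>\<xi>. complex_of_real (symb l \<xi>))) \<xi> = complex_of_real (symb l \<xi>)"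
  proof (rule fourier_inversion)
    show "continuous_on UNIV (\<lambda>\<xi>. complex_of_real (symb l \<xi>))"
      by (intro continuous_intros smooth_continuous test_function_smooth[OF t])
    show "norm (complex_of_real (symb l x)) \<le> B" for x using B by simp
    show "integrable lborel (\<lambda>\<xi>. complex_of_real (symb l \<xi>))" using test_function_integrable[OF t] by simp
    show "integrable lborel (inv_fourier (\<lambda>\<xi>. complex_of_real (symb l \<xi>)))"
      using ker_integrable[OF assms] by (simp add: inv_fourier_symb[OF assms, THEN ext[of "inv_fourier _"]])
  qed
  then show ?thesis by (simp add: fourier_def inv_fourier_symb[OF assms])
qed

lemma ker_integral: assumes "l > 0" shows "(\<integral>x. ker l x \<partial>lborel) = 1"
  using ker_fourier[OF assms, of 0] by (simp add: symb_0)

text \<open>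
  On the Fourier side this is \<open>\<chi>(\<eta>/l) \<chi>(\<eta>/m) = \<chi>(\<eta>/m)\<close>.
\<close>

lemma ker_convolution:
  assumes m: "m > 0" and l: "l \<ge> 2 * m"
  shows "(\<integral>y. ker l y * ker m (z - y) \<partial>lborel) = ker m z"
proof -
  have l0: "l > 0" using m l by linarith
  note i = test_function_integrable[OF symb_test[OF m]]
  have [measurable]: "symb m \<in> borel_measurable borel" using i by auto
  have kl[measurable]: "ker l \<in> borel_measurable borel" by (rule ker_borel[OF l0])
  let ?c = "complex_of_real (1 / (2 * pi) ^ DIM('a))"
  have prod: "symb m \<eta> * symb l \<eta> = symb m \<eta>" for \<eta>
  proof (cases "norm \<eta> \<le> 4 / 3 * m")
    case True
    then have "norm (\<eta> /\<^sub>R l) \<le> 2 / 3" using l l0 by (simp add: field_simps)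
    then show ?thesis using chi_one by (simp add: symb_def)
  next
    case False
    then have "4 / 3 < norm (\<eta> /\<^sub>R m)" using m by (simp add: field_simps)
    then show ?thesis using chi_supp by (simp add: symb_def)
  qed
  have pair: "integrable (lborel \<Otimes>\<^sub>M lborel) (\<lambda>(y, \<eta>). complex_of_real (ker l y) * (cis ((z - y) \<bullet> \<eta>) * complex_of_real (symb m \<eta>)))"
  proof (rule product_integrable_pair)
    show "(\<lambda>w. complex_of_real (ker l (fst w)) * (cis ((z - fst w) \<bullet> snd w) * complex_of_real (symb m (snd w)))) \<in> borel_measurable borel"
      unfolding borel_prod[symmetric] by measurable
    show "integrable lborel (\<lambda>y. \<bar>ker l y\<bar> * (\<integral>\<eta>. \<bar>symb m \<eta>\<bar> \<partial>lborel))" using ker_integrable[OF l0] by simp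
    fix y
    have "(\<integral>\<^sup>+\<eta>. ennreal (norm (complex_of_real (ker l y) * (cis ((z - y) \<bullet> \<eta>) * complex_of_real (symb m \<eta>)))) \<partial>lborel)
        = (\<integral>\<^sup>+\<eta>. ennreal (\<bar>ker l y\<bar> * \<bar>symb m \<eta>\<bar>) \<partial>lborel)"
      by (simp add: norm_mult)
    also have "\<dots> = ennreal (\<bar>ker l y\<bar> * (\<integral>\<eta>. \<bar>symb m \<eta>\<bar> \<partial>lborel))"
      using i by (subst nn_integral_eq_integral) auto
    finally show "(\<integral>\<^sup>+\<eta>. ennreal (norm (complex_of_real (ker l y) * (cis ((z - y) \<bullet> \<eta>) * complex_of_real (symb m \<eta>)))) \<partial>lborel)
       \<le> ennreal (\<bar>ker l y\<bar> * (\<integral>\<eta>. \<bar>symb m \<eta>\<bar> \<partial>lborel))" by simp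
  qed
  have km: "complex_of_real (ker m x) = ?c * osc (symb m) x" for x
    using inv_fourier_symb[OF m, of x] by (simp add: inv_fourier_def osc_def)
  have "complex_of_real (\<integral>y. ker l y * ker m (z - y) \<partial>lborel) = (\<integral>y. complex_of_real (ker l y) * complex_of_real (ker m (z - y)) \<partial>lborel)"
    by (subst integral_complex_of_real[symmetric]) simp
  also have "\<dots> = (\<integral>y. ?c * (\<integral>\<eta>. complex_of_real (ker l y) * (cis ((z - y) \<bullet> \<eta>) * complex_of_real (symb m \<eta>)) \<partial>lborel) \<partial>lborel)"
    by (simp add: km osc_def mult.left_commute)
  also have "\<dots> = ?c * (\<integral>y. (\<integral>\<eta>. complex_of_real (ker l y) * (cis ((z - y) \<bullet> \<eta>) * complex_of_real (symb m \<eta>)) \<partial>lborel) \<partial>lborel)"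
    by (rule integral_mult_right_zero)
  also have "(\<integral>y. (\<integral>\<eta>. complex_of_real (ker l y) * (cis ((z - y) \<bullet> \<eta>) * complex_of_real (symb m \<eta>)) \<partial>lborel) \<partial>lborel)
     = (\<integral>\<eta>. (\<integral>y. complex_of_real (ker l y) * (cis ((z - y) \<bullet> \<eta>) * complex_of_real (symb m \<eta>)) \<partial>lborel) \<partial>lborel)"
    by (rule lborel_pair.Fubini_integral[symmetric, OF pair])
  also have "\<dots> = (\<integral>\<eta>. cis (z \<bullet> \<eta>) * complex_of_real (symb m \<eta>) \<partial>lborel)"
  proof (rule Bochner_Integration.integral_cong[OF refl])
    fix \<eta>
    have "(\<integral>y. complex_of_real (ker l y) * (cis ((z - y) \<bullet> \<eta>) * complex_of_real (symb m \<eta>)) \<partial>lborel)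
       = (\<integral>y. (cis (z \<bullet> \<eta>) * complex_of_real (symb m \<eta>)) * (cis (- (y \<bullet> \<eta>)) * complex_of_real (ker l y)) \<partial>lborel)"
    proof (rule Bochner_Integration.integral_cong[OF refl])
      fix y
      have "cis ((z - y) \<bullet> \<eta>) = cis (z \<bullet> \<eta>) * cis (- (y \<bullet> \<eta>))" by (simp add: cis_mult inner_diff_left)
      then show "complex_of_real (ker l y) * (cis ((z - y) \<bullet> \<eta>) * complex_of_real (symb m \<eta>)) = (cis (z \<bullet> \<eta>) * complex_of_real (symb m \<eta>)) * (cis (- (y \<bullet> \<eta>)) * complex_of_real (ker l y))"
        by (simp only: mult_ac)
    qed
    also have "\<dots> = (cis (z \<bullet> \<eta>) * complex_of_real (symb m \<eta>)) * complex_of_real (symb l \<eta>)"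
      by (subst integral_mult_right_zero) (simp only: ker_fourier[OF l0])
    also have "\<dots> = cis (z \<bullet> \<eta>) * complex_of_real (symb m \<eta>)"
      using arg_cong[OF prod[of \<eta>], of complex_of_real] by (simp add: mult.assoc)
    finally show "(\<integral>y. complex_of_real (ker l y) * (cis ((z - y) \<bullet> \<eta>) * complex_of_real (symb m \<eta>)) \<partial>lborel) = cis (z \<bullet> \<eta>) * complex_of_real (symb m \<eta>)" .
  qed
  also have "?c * \<dots> = complex_of_real (ker m z)" by (simp only: km osc_def)
  finally show ?thesis by simp
qed

lemma ker_weak_deriv:
  assumes l: "l > 0" and i: "i \<in> Basis" shows "has_weak_deriv i (ker l) (dker l i)"
  unfolding has_weak_deriv_def
proof (intro allI impI)
  fix \<psi> :: "'a \<Rightarrow> real" assume \<psi>: "test_function UNIV \<psi>"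
  let ?p = "(2 * pi) ^ DIM('a)" and ?m = "\<lambda>\<xi>. (\<xi> \<bullet> i) * symb l \<xi>"
  note s = symb_test[OF l] and sm = test_times_coordinate[OF symb_test[OF l] i]
  have L2osc: "L2 (osc m)" if m: "test_function UNIV m" for m :: "'a \<Rightarrow> real"
  proof -
    obtain C where C: "C \<ge> 0" "\<And>x. norm (osc m x) \<le> C / (1 + norm x) ^ (2 * DIM('a))" using osc_decay[OF m] by blast
    have "integrable lborel (osc m)"
      by (rule integrable_weight_bound[OF osc_measurable C(2)]) (use test_function_integrable[OF m] in auto)
    then show ?thesis by (rule L2_bounded_integrable) (rule osc_bound[OF test_function_integrable[OF m]])
  qed
  have R: "(\<integral>x. a x * (Re (h x) / ?p) \<partial>lborel) = Re (\<integral>x. complex_of_real (a x) * h x \<partial>lborel) / ?p"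
    if a: "L2 a" and h: "L2 h" for a :: "'a \<Rightarrow> real" and h :: "'a \<Rightarrow> complex"
  proof -
    have "integrable lborel (\<lambda>x. complex_of_real (a x) * h x)"
      using L2_scaleR_integrable[OF a h] by (simp add: scaleR_conv_of_real)
    from integral_Re[OF this] show ?thesis by simp
  qed
  have h: "L2 (\<lambda>x. \<i> * osc ?m x)"
    using L2osc[OF sm] by (auto simp: L2_def norm_mult intro!: borel_measurable_times)
  have "(\<integral>x. partial_deriv i \<psi> x *\<^sub>R ker l x \<partial>lborel) = Re (\<integral>x. complex_of_real (partial_deriv i \<psi> x) * osc (symb l) x \<partial>lborel) / ?p"
    using R[OF test_partial_L2[OF \<psi> i] L2osc[OF s]] by (simp add: ker_def)
  also have "\<dots> = - (Re (\<integral>x. complex_of_real (\<psi> x) * (\<i> * osc ?m x) \<partial>lborel) / ?p)"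
    by (simp only: osc_weak_deriv[OF s \<psi> i] uminus_complex.sel minus_divide_left)
  also have "Re (\<integral>x. complex_of_real (\<psi> x) * (\<i> * osc ?m x) \<partial>lborel) / ?p = (\<integral>x. \<psi> x *\<^sub>R dker l i x \<partial>lborel)"
    using R[OF test_function_L2[OF \<psi>] h] by (simp only: dker_def real_scaleR_def)
  finally show "(\<integral>x. partial_deriv i \<psi> x *\<^sub>R ker l x \<partial>lborel) = - (\<integral>x. \<psi> x *\<^sub>R dker l i x \<partial>lborel)" .
qed

end

lemma L2_mono:
  assumes "L2 q" "p \<in> borel_measurable borel" "AE x in lborel. norm (p x) \<le> norm (q x)"
  shows "L2 p" "L2_norm p \<le> L2_norm q"
proof -
  have "nn2 p \<le> nn2 q"
    by (rule nn_integral_mono_AE) (use assms(3) in eventually_elim, simp add: power_mono ennreal_leI)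
  then have *: "nn2 p \<le> ennreal ((L2_norm q)\<^sup>2)" using nn2_eq[OF assms(1)] by simp
  show "L2 p" "L2_norm p \<le> L2_norm q" using L2I_bound[OF assms(2) _ *] by auto
qed

lemma L2_mult_bounded:
  assumes g: "L2 g" and h: "h \<in> borel_measurable borel" and le: "AE x in lborel. norm (h x) \<le> M" and M: "M \<ge> 0"
  shows "L2 (\<lambda>x. norm (h x) * norm (g x))" "L2_norm (\<lambda>x. norm (h x) * norm (g x)) \<le> M * L2_norm g"
proof -
  have [measurable]: "g \<in> borel_measurable borel" "h \<in> borel_measurable borel" using g h by (auto simp: L2_def)
  have ae: "AE x in lborel. norm (norm (h x) * norm (g x)) \<le> norm (M *\<^sub>R g x)"
    using le by eventually_elim (use M in \<open>simp add: abs_mult mult_right_mono\<close>)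
  have m: "(\<lambda>x. norm (h x) * norm (g x)) \<in> borel_measurable borel" by measurable
  show "L2 (\<lambda>x. norm (h x) * norm (g x))" "L2_norm (\<lambda>x. norm (h x) * norm (g x)) \<le> M * L2_norm g"
    using L2_mono[OF L2_scale[OF g, of M] m ae] M by (auto simp: L2_norm_scale)
qed

text \<open>
  The squares of the norms are summable, hence so are the squares \<open>|h n x|\<^sup>2\<close> for almost every \<open>x\<close>.
\<close>

lemma L2_fast_AE_tendsto:
  fixes h :: "nat \<Rightarrow> 'a::euclidean_space \<Rightarrow> 'b::euclidean_space"
  assumes L: "\<And>n. L2 (h n)" and le: "\<And>n. L2_norm (h n) \<le> c / 2 ^ n"
  shows "AE x in lborel. (\<lambda>n. h n x) \<longlonglongrightarrow> 0"
proof -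
  have [measurable]: "h n \<in> borel_measurable borel" for n using L by (simp add: L2_def)
  have "(\<integral>\<^sup>+x. (\<Sum>n. ennreal ((norm (h n x))\<^sup>2)) \<partial>lborel) = (\<Sum>n. nn2 (h n))"
    by (rule nn_integral_suminf) measurable
  also have "\<dots> \<le> (\<Sum>n. ennreal (c\<^sup>2 * (1/4) ^ n))"
  proof (intro suminf_le summableI)
    fix n
    have "(L2_norm (h n))\<^sup>2 \<le> (c / 2 ^ n)\<^sup>2" by (intro power_mono le) simp
    also have "\<dots> = c\<^sup>2 * (1/4) ^ n" by (simp add: power_divide power2_eq_square power_mult_distrib[symmetric])
    finally show "nn2 (h n) \<le> ennreal (c\<^sup>2 * (1/4) ^ n)" by (simp add: nn2_eq[OF L] ennreal_leI)
  qed
  also have "\<dots> < \<infinity>"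
    by (subst suminf_ennreal2) (auto intro!: summable_mult summable_geometric)
  finally have "AE x in lborel. (\<Sum>n. ennreal ((norm (h n x))\<^sup>2)) \<noteq> \<infinity>"
    by (intro nn_integral_PInf_AE) auto
  then show ?thesis
  proof eventually_elim
    case (elim x)
    then have "summable (\<lambda>n. (norm (h n x))\<^sup>2)" by (intro summable_suminf_not_top) auto
    then have "(\<lambda>n. (norm (h n x))\<^sup>2) \<longlonglongrightarrow> 0" by (rule summable_LIMSEQ_zero)
    then have "(\<lambda>n. sqrt ((norm (h n x))\<^sup>2)) \<longlonglongrightarrow> sqrt 0" by (rule tendsto_real_sqrt)
    then show ?case by (simp add: tendsto_norm_zero_iff)
  qed
qed

context low_pass
begin

text \<open>
  \<open>S l f\<close> keeps the frequencies of \<open>f\<close> below about \<open>l\<close>.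
\<close>

definition S :: "real \<Rightarrow> ('a \<Rightarrow> 'b::euclidean_space) \<Rightarrow> 'a \<Rightarrow> 'b" where
  "S l f = conv (ker l) f"

lemma S_L2: assumes "l > 0" "L2 f" shows "L2 (S l f)" "L2_norm (S l f) \<le> C0 * L2_norm f"
  using avg_L2(1,2)[OF ker_integrable[OF assms(1)] _ assms(2), of "\<lambda>y. y"] by (simp_all add: S_def ker_abs_integral[OF assms(1)])

lemma S_weak_deriv:
  assumes "l > 0" "has_weak_deriv i f g" "L2 f" "L2 g" "i \<in> Basis"
  shows "has_weak_deriv i (S l f) (S l g)"
  unfolding S_def by (rule avg_weak_deriv[OF assms(2-5) ker_integrable[OF assms(1)]]) simp

lemma S_diff: "l > 0 \<Longrightarrow> L2 f \<Longrightarrow> L2 g \<Longrightarrow> S l (\<lambda>x. f x - g x) x = S l f x - S l g x"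
  by (simp add: S_def conv_diff_right ker_L2)

lemma S_S: assumes "m > 0" "l \<ge> 2 * m" "L2 f" shows "S l (S m f) = S m f"
proof
  fix x
  have l: "l > 0" using assms by linarith
  show "S l (S m f) x = S m f x"
    unfolding S_def conv_assoc[OF ker_integrable[OF l] ker_L2[OF assms(1)] assms(3)]
    by (simp add: ker_convolution[OF assms(1,2)])
qed

lemma S_S': assumes "m > 0" "l \<ge> 2 * m" "L2 f" shows "S m (S l f) = S m f"
proof
  fix x
  have l: "l > 0" using assms by linarith
  have "(\<integral>y. ker m y * ker l (z - y) \<partial>lborel) = ker m z" for z
  proof -
    have k: "integrable lborel (\<lambda>y. ker l y * ker m (z - y))"
      using conv_integrable[OF ker_L2[OF l] ker_L2[OF assms(1)], of z] by simp
    have [measurable]: "ker l \<in> borel_measurable borel" "ker m \<in> borel_measurable borel"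
      using ker_borel l assms(1) by auto
    have "(\<integral>y. ker m y * ker l (z - y) \<partial>lborel) = (\<integral>y. ker l (- (y - z)) * ker m (z - (- (y - z))) \<partial>lborel)"
      by (simp add: mult.commute)
    also have "\<dots> = (\<integral>y. ker l (- y) * ker m (z - (- y)) \<partial>lborel)"
      by (rule integral_shift[of "\<lambda>y. ker l (- y) * ker m (z - (- y))"]) measurable
    also have "\<dots> = (\<integral>y. ker l y * ker m (z - y) \<partial>lborel)"
      by (rule integral_reflect[OF k])
    finally show ?thesis by (simp add: ker_convolution[OF assms(1,2)])
  qed
  then show "S m (S l f) x = S m f x"
    unfolding S_def conv_assoc[OF ker_integrable[OF assms(1)] ker_L2[OF l] assms(3)] by simp
qed

text \<open>
  The kernel has integral \<open>1\<close>, so \<open>S l f - f\<close> is an average of the differences \<open>f (x - y) - f x\<close>, whose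
  norm is linear in \<open>y\<close>; the first moment of the kernel is \<open>C1 / l\<close>.
\<close>

lemma S_approx:
  fixes f :: "'a \<Rightarrow> 'b::euclidean_space"
  assumes l: "l > 0" and f: "L2 f" and w: "\<And>i. i \<in> Basis \<Longrightarrow> has_weak_deriv i f (g i)" and g: "\<And>i. i \<in> Basis \<Longrightarrow> L2 (g i)"
  shows "L2_norm (\<lambda>x. S l f x - f x) \<le> C1 / l * (\<Sum>i\<in>Basis. L2_norm (g i))"
proof -
  let ?N = "\<Sum>i\<in>Basis. L2_norm (g i)"
  note [measurable] = L2_borel[OF f] ker_borel[OF l]
  have eq: "S l f x - f x = (\<integral>y. ker l y *\<^sub>R (f (x - y) - f x) \<partial>lborel)" for x
    using conv_integrable[OF ker_L2[OF l] f, of x] ker_integrable[OF l]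
    by (simp add: S_def avg_def scaleR_diff_right ker_integral[OF l])
  have "L2_norm (\<lambda>x. \<integral>y. ker l y *\<^sub>R (f (x - y) - f x) \<partial>lborel) \<le> (\<integral>y. (norm y * \<bar>ker l y\<bar>) * ?N \<partial>lborel)"
  proof (rule minkowski_L2(2))
    show "(\<lambda>z. ker l (fst z) *\<^sub>R (f (snd z - fst z) - f (snd z))) \<in> borel_measurable borel"
      unfolding borel_prod[symmetric] by measurable
    show "L2 (\<lambda>x. ker l y *\<^sub>R (f (x - y) - f x))" for y by (intro L2_scale L2_diff L2_shift f)
    show "L2_norm (\<lambda>x. ker l y *\<^sub>R (f (x - y) - f x)) \<le> (norm y * \<bar>ker l y\<bar>) * ?N" for y
    proof -
      have "L2_norm (\<lambda>x. ker l y *\<^sub>R (f (x - y) - f x)) = \<bar>ker l y\<bar> * L2_norm (\<lambda>x. f (x - y) - f x)" by (rule L2_norm_scale)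
      also have "\<dots> \<le> \<bar>ker l y\<bar> * (norm y * ?N)" by (intro mult_left_mono L2_norm_translate_le w f g) auto
      finally show ?thesis by (simp add: mult_ac)
    qed
    show "integrable lborel (\<lambda>y. (norm y * \<bar>ker l y\<bar>) * ?N)"
      by (intro integrable_mult_left ker_facts(2) l)
  qed
  also have "\<dots> = C1 / l * ?N" by (simp add: ker_moment[OF l])
  finally show ?thesis by (simp only: eq)
qed

text \<open>
  The derivative is put on the kernel, whose partial derivatives have mass at most \<open>l D1\<close>.
\<close>

lemma S_deriv_sup:
  fixes f :: "'a \<Rightarrow> 'b::euclidean_space"
  assumes l: "l > 0" and w: "has_weak_deriv i f g" and f: "L2 f" and g: "L2 g" and i: "i \<in> Basis"
    and le: "AE x in lborel. norm (f x) \<le> M" and M: "M \<ge> 0"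
  shows "AE x in lborel. norm (S l g x) \<le> l * D1 * M"
proof -
  have id: "(\<lambda>y::'a. y) \<in> borel_measurable borel" by simp
  note dk = dker_integrable[OF l i] and k = ker_integrable[OF l]
  note [measurable] = ker_borel[OF l] dker_borel[OF l i]
  have w2: "has_weak_deriv i (S l f) (conv (dker l i) f)"
    unfolding has_weak_deriv_def S_def
  proof (intro allI impI)
    fix \<psi> :: "'a \<Rightarrow> real" assume \<psi>: "test_function UNIV \<psi>"
    have ad: "avg (ker l) (\<lambda>y. - y) (partial_deriv i \<psi>) x = - avg (dker l i) (\<lambda>y. - y) \<psi> x" for x
    proof -
      have t: "test_function UNIV (\<lambda>y. \<psi> (y - (- x)))" by (rule test_function_shift[OF \<psi>])
      have "(\<integral>y. partial_deriv i (\<lambda>y. \<psi> (y - (- x))) y *\<^sub>R ker l y \<partial>lborel) = - (\<integral>y. \<psi> (y - (- x)) *\<^sub>R dker l i y \<partial>lborel)"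
        using ker_weak_deriv[OF l i] t unfolding has_weak_deriv_def by blast
      then have "(\<integral>y. partial_deriv i \<psi> (y - (- x)) *\<^sub>R ker l y \<partial>lborel) = - (\<integral>y. \<psi> (y - (- x)) *\<^sub>R dker l i y \<partial>lborel)"
        by (simp only: partial_deriv_shift[OF test_function_smooth[OF \<psi>] i])
      then show ?thesis by (simp add: avg_def mult.commute add.commute)
    qed
    have "(\<integral>x. partial_deriv i \<psi> x *\<^sub>R conv (ker l) f x \<partial>lborel) = (\<integral>x. avg (ker l) (\<lambda>y. - y) (partial_deriv i \<psi>) x *\<^sub>R f x \<partial>lborel)"
      by (rule avg_adjoint[OF k id f test_partial_L2[OF \<psi> i]])
    also have "\<dots> = - (\<integral>x. avg (dker l i) (\<lambda>y. - y) \<psi> x *\<^sub>R f x \<partial>lborel)" by (simp add: ad)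
    also have "(\<integral>x. avg (dker l i) (\<lambda>y. - y) \<psi> x *\<^sub>R f x \<partial>lborel) = (\<integral>x. \<psi> x *\<^sub>R conv (dker l i) f x \<partial>lborel)"
      by (rule avg_adjoint[symmetric, OF dk id f test_function_L2[OF \<psi>]])
    finally show "(\<integral>x. partial_deriv i \<psi> x *\<^sub>R conv (ker l) f x \<partial>lborel) = - (\<integral>x. \<psi> x *\<^sub>R conv (dker l i) f x \<partial>lborel)" .
  qed
  have "AE x in lborel. S l g x = conv (dker l i) f x"
    by (rule has_weak_deriv_unique[OF S_weak_deriv[OF l w f g i] w2 S_L2(1)[OF l g] avg_L2(1)[OF dk id f]])
  then show ?thesis
  proof eventually_elim
    case (elim x)
    have "norm (conv (dker l i) f x) \<le> (\<integral>y. \<bar>dker l i y\<bar> \<partial>lborel) * M"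
      by (rule conv_sup[OF dk le L2_borel[OF f] M])
    also have "\<dots> \<le> l * D1 * M" by (intro mult_right_mono dker_abs_integral l i M)
    finally show ?case using elim by simp
  qed
qed

text \<open>
  The constants that come out of \<open>dyadic_block_bounds\<close>.
\<close>

definition "E1 = 4 * C0 * C1 * DIM('a)"
definition "E2 = 2 * C1 * DIM('a) * E1"

lemma E_nonneg: "E1 \<ge> 0" "E2 \<ge> 0" using C_nonneg by (simp_all add: E1_def E2_def)

text \<open>
  Let \<open>D f = S\<^sub>2\<^sub>l f - S\<^sub>l f\<close>. Since \<open>D f\<close> has no frequencies below \<open>2l/3\<close>, it is controlled by its
  gradient, \<open>\<parallel>D f\<parallel> \<lesssim> \<parallel>D \<nabla>f\<parallel> / l\<close>. Integration by parts gives \<open>\<parallel>D \<nabla>f\<parallel>\<^sup>2 \<le> \<parallel>D f\<parallel> \<parallel>D \<Delta>f\<parallel>\<close>. Together these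
  bound the blocks by the Laplacian alone, without recourse to an estimate of all second
  derivatives by the Laplacian.
\<close>

lemma dyadic_block_bounds:
  fixes f :: "'a \<Rightarrow> 'b::euclidean_space" and G H :: "'a \<Rightarrow> 'a \<Rightarrow> 'b"
  assumes l: "l > 0" and f: "L2 f"
    and wG: "\<And>i. i \<in> Basis \<Longrightarrow> has_weak_deriv i f (G i)" and G: "\<And>i. i \<in> Basis \<Longrightarrow> L2 (G i)"
    and wH: "\<And>i. i \<in> Basis \<Longrightarrow> has_weak_deriv i (G i) (H i)" and H: "\<And>i. i \<in> Basis \<Longrightarrow> L2 (H i)"
  defines "Y \<equiv> L2_norm (\<lambda>x. \<Sum>i\<in>Basis. H i x)"
  shows "i \<in> Basis \<Longrightarrow> L2_norm (\<lambda>x. S (2 * l) (G i) x - S l (G i) x) \<le> E1 / l * Y"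
    and "L2_norm (\<lambda>x. S (2 * l) f x - S l f x) \<le> E2 / l\<^sup>2 * Y"
proof -
  let ?D = "\<lambda>f x. S (2 * l) f x - S l f x"
  have l2: "2 * l > 0" "l / 2 > 0" using l by auto
  have D_L2: "L2 (?D h)" if "L2 h" for h :: "'a \<Rightarrow> 'b" using that by (intro L2_diff S_L2 l l2)
  have D_w: "has_weak_deriv i (?D h) (?D h')" if "has_weak_deriv i h h'" "L2 h" "L2 h'" "i \<in> Basis" for i and h h' :: "'a \<Rightarrow> 'b"
    using that by (intro has_weak_deriv_diff S_weak_deriv S_L2 l l2)
  define b where "b = sqrt (\<Sum>i\<in>Basis. (L2_norm (?D (G i)))\<^sup>2)"
  have b2: "b\<^sup>2 = (\<Sum>i\<in>Basis. (L2_norm (?D (G i)))\<^sup>2)" and b0: "b \<ge> 0" by (simp_all add: b_def sum_nonneg)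
  have bi: "L2_norm (?D (G i)) \<le> b" if "i \<in> Basis" for i
    unfolding b_def using that by (intro real_le_rsqrt member_le_sum) auto
  \<comment> \<open>as \<open>S\<^sub>l\<^sub>/\<^sub>2\<close> annihilates the block, the block equals its own approximation error\<close>
  have vanish: "S (l / 2) (?D f) x = 0" for x
  proof -
    have "S (l / 2) (?D f) x = S (l / 2) (S (2 * l) f) x - S (l / 2) (S l f) x"
      by (intro S_diff S_L2 l l2 f)
    also have "\<dots> = 0" using l f by (simp add: S_S')
    finally show ?thesis .
  qed
  have "L2_norm (?D f) = L2_norm (\<lambda>x. S (l / 2) (?D f) x - ?D f x)"
    by (simp only: vanish diff_0 L2_norm_minus)
  also have "\<dots> \<le> C1 / (l / 2) * (\<Sum>i\<in>Basis. L2_norm (?D (G i)))"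
    by (intro S_approx l2 D_L2 f D_w wG G)
  also have "\<dots> \<le> C1 / (l / 2) * (\<Sum>i\<in>(Basis :: 'a set). b)"
    using C_nonneg l by (intro mult_left_mono sum_mono bi) auto
  finally have d1: "L2_norm (?D f) \<le> (2 * C1 * DIM('a) / l) * b" by (simp add: mult_ac)
  have sumH: "L2 (\<lambda>x. \<Sum>i\<in>Basis. H i x)" using L2_sum[of Basis H] H by auto
  have "b\<^sup>2 = (\<Sum>i\<in>Basis. \<integral>x. ?D (G i) x \<bullet> ?D (G i) x \<partial>lborel)" by (simp add: b2 L2_norm_inner)
  also have "\<dots> = (\<Sum>i\<in>Basis. - (\<integral>x. ?D f x \<bullet> ?D (H i) x \<partial>lborel))"
  proof (rule sum.cong[OF refl])
    fix i :: 'a assume i: "i \<in> Basis"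
    show "(\<integral>x. ?D (G i) x \<bullet> ?D (G i) x \<partial>lborel) = - (\<integral>x. ?D f x \<bullet> ?D (H i) x \<partial>lborel)"
      by (rule weak_integration_by_parts[OF D_w[OF wG[OF i] f G[OF i] i] D_L2[OF f] D_L2[OF G[OF i]] i
            D_w[OF wH[OF i] G[OF i] H[OF i] i] D_L2[OF G[OF i]] D_L2[OF H[OF i]]])
  qed
  also have "\<dots> = - (\<integral>x. ?D f x \<bullet> ?D (\<lambda>x. \<Sum>i\<in>Basis. H i x) x \<partial>lborel)"
  proof -
    have S_sum: "S m (\<lambda>x. \<Sum>i\<in>Basis. H i x) x = (\<Sum>i\<in>Basis. S m (H i) x)" if "m > 0" for m x
      unfolding S_def avg_def scaleR_sum_right using H that
      by (subst Bochner_Integration.integral_sum) (auto intro!: conv_integrable ker_L2)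
    have "?D f x \<bullet> ?D (\<lambda>x. \<Sum>i\<in>Basis. H i x) x = (\<Sum>i\<in>Basis. ?D f x \<bullet> ?D (H i) x)" for x
      unfolding S_sum[OF l] S_sum[OF l2(1)] sum_subtractf[symmetric] by (rule inner_sum_right)
    then show ?thesis
      using D_L2 f H by (simp add: sum_negf) (subst Bochner_Integration.integral_sum; auto intro!: L2_inner_integrable)
  qed
  also have "\<dots> \<le> L2_norm (?D f) * L2_norm (?D (\<lambda>x. \<Sum>i\<in>Basis. H i x))"
    using L2_inner_le[OF D_L2[OF f] D_L2[OF sumH]] by linarith
  also have "\<dots> \<le> L2_norm (?D f) * (2 * C0 * Y)"
  proof (rule mult_left_mono)
    have "L2_norm (?D (\<lambda>x. \<Sum>i\<in>Basis. H i x)) \<le> C0 * Y + C0 * Y"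
      unfolding Y_def by (rule order_trans[OF L2_diff(2)]) (intro add_mono S_L2 l l2 sumH)+
    then show "L2_norm (?D (\<lambda>x. \<Sum>i\<in>Basis. H i x)) \<le> 2 * C0 * Y" by linarith
  qed simp
  also have "\<dots> \<le> ((2 * C1 * DIM('a) / l) * b) * (2 * C0 * Y)"
    using d1 C_nonneg by (intro mult_right_mono) (auto simp: Y_def)
  also have "\<dots> = (E1 / l * Y) * b" by (simp add: E1_def)
  finally have "b * b \<le> (E1 / l * Y) * b" by (simp add: power2_eq_square)
  then have bY: "b \<le> E1 / l * Y"
  proof (cases "b = 0")
    case True
    then show ?thesis using E_nonneg l by (simp add: Y_def)
  next
    case False
    with b0 have "b > 0" by simp
    with \<open>b * b \<le> (E1 / l * Y) * b\<close> show ?thesis by (rule mult_right_le_imp_le)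
  qed
  show "i \<in> Basis \<Longrightarrow> L2_norm (?D (G i)) \<le> E1 / l * Y" using bi[of i] bY by linarith
  have "L2_norm (?D f) \<le> (2 * C1 * DIM('a) / l) * (E1 / l * Y)"
    using d1 bY C_nonneg l by (meson order_trans mult_left_mono divide_nonneg_pos mult_nonneg_nonneg of_nat_0_le_iff zero_le_numeral)
  also have "\<dots> = E2 / l\<^sup>2 * Y" by (simp add: E2_def power2_eq_square)
  finally show "L2_norm (?D f) \<le> E2 / l\<^sup>2 * Y" .
qed

text \<open>
  The constant of a single telescoping step: \<open>t E1 + 2 D1 E2\<close> with \<open>t\<close> bounded by \<open>2\<close>.
\<close>

definition "E3 = 2 * E1 + 2 * D1 * E2"

lemma E3_nonneg: "E3 \<ge> 0" using C_nonneg E_nonneg by (simp add: E3_def)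

text \<open>
  With \<open>v\<^sub>k = S\<^sub>k f\<close> and \<open>g\<^sub>k = S\<^sub>k \<partial>\<^sub>i f\<close> for the cut-off at \<open>2\<^sup>k\<close>,
  \<open>|v\<^sub>k\<^sub>+\<^sub>1| |g\<^sub>k\<^sub>+\<^sub>1| \<le> |v\<^sub>k| |g\<^sub>k| + |v\<^sub>k\<^sub>+\<^sub>1| |g\<^sub>k\<^sub>+\<^sub>1 - g\<^sub>k| + |g\<^sub>k| |v\<^sub>k\<^sub>+\<^sub>1 - v\<^sub>k|\<close>. In each of the last two products the
  first factor is bounded in \<open>L\<^sup>\<infinity>\<close>, by \<open>M t\<^sup>k\<^sup>+\<^sup>1\<close> and by a multiple of \<open>2\<^sup>k M t\<^sup>k\<close>, and the second is a dyadic block,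
  of size \<open>2\<^sup>-\<^sup>k\<close> and \<open>2\<^sup>-\<^sup>2\<^sup>k\<close> in \<open>L\<^sup>2\<close>. Every step therefore adds a multiple of \<open>(t/2)\<^sup>k\<close>. The sum from \<open>K\<close>
  on converges because \<open>t < 2\<close>, and Fatou's lemma passes to \<open>f \<partial>\<^sub>i f\<close>.
\<close>

lemma product_estimate:
  fixes f :: "'a \<Rightarrow> 'b::euclidean_space" and G :: "'a \<Rightarrow> 'a \<Rightarrow> 'b" and H :: "'a \<Rightarrow> 'a \<Rightarrow> 'a \<Rightarrow> 'b"
  assumes f: "L2 f"
    and wG: "\<And>i. i \<in> Basis \<Longrightarrow> has_weak_deriv i f (G i)" and G: "\<And>i. i \<in> Basis \<Longrightarrow> L2 (G i)"
    and wH: "\<And>i j. i \<in> Basis \<Longrightarrow> j \<in> Basis \<Longrightarrow> has_weak_deriv j (G i) (H i j)"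
    and H: "\<And>i j. i \<in> Basis \<Longrightarrow> j \<in> Basis \<Longrightarrow> L2 (H i j)"
    and t: "1 \<le> t" "t < 2" and M: "M \<ge> 0"
    and sup: "\<And>k::nat. AE x in lborel. norm (S (2 ^ k) f x) \<le> M * t ^ k"
    and i: "i \<in> Basis"
  defines "Y \<equiv> L2_norm (\<lambda>x. \<Sum>i\<in>Basis. H i i x)"
  shows "(\<integral>\<^sup>+x. ennreal ((norm (f x))\<^sup>2 * (norm (G i x))\<^sup>2) \<partial>lborel)
    \<le> ennreal ((M * (C0 * t ^ K * L2_norm (G i) + E3 / (1 - t / 2) * (t / 2) ^ K * Y))\<^sup>2)"
proof -
  let ?v = "\<lambda>k::nat. S (2 ^ k) f" and ?g = "\<lambda>k::nat. S (2 ^ k) (G i)"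
  let ?r = "t / 2"
  define p where "p k x = norm (?v k x) * norm (?g k x)" for k x
  have two: "(2::real) ^ k > 0" for k :: nat by simp
  have v: "L2 (?v k)" and g: "L2 (?g k)" for k by (simp_all add: S_L2 f G i)
  note vm = L2_borel[OF v] and gm = L2_borel[OF g]
  have Mt: "M * t ^ k \<ge> 0" for k using M t by simp
  have p: "L2 (p k)" "L2_norm (p k) \<le> M * t ^ k * L2_norm (?g k)" for k
    unfolding p_def[abs_def] using L2_mult_bounded[OF g[of k] vm sup Mt] by auto
  have Y0: "Y \<ge> 0" by (simp add: Y_def)
  have step: "L2_norm (p (Suc k)) \<le> L2_norm (p k) + M * E3 * ?r ^ k * Y" for k
  proof -
    let ?l = "(2::real) ^ k"
    let ?dg = "\<lambda>x. ?g (Suc k) x - ?g k x" and ?dv = "\<lambda>x. ?v (Suc k) x - ?v k x"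
    have dg: "L2 ?dg" and dv: "L2 ?dv" by (intro L2_diff g v)+
    have ndg: "L2_norm ?dg \<le> E1 / ?l * Y" and ndv: "L2_norm ?dv \<le> E2 / ?l\<^sup>2 * Y"
      using dyadic_block_bounds[of ?l f G "\<lambda>i. H i i", OF two f wG G wH H] i by (simp_all add: Y_def)
    \<comment> \<open>\<open>S\<^sub>k\<^sub>+\<^sub>1\<close> reproduces \<open>g\<^sub>k\<close>, so that the derivative can be put on a kernel\<close>
    have gsup: "AE x in lborel. norm (?g k x) \<le> 2 * ?l * D1 * (M * t ^ k)"
    proof -
      have "AE x in lborel. norm (S (2 * ?l) (?g k) x) \<le> 2 * ?l * D1 * (M * t ^ k)"
        by (rule S_deriv_sup[OF _ S_weak_deriv[OF two wG[OF i] f G[OF i] i] v g i sup Mt]) simp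
      then show ?thesis using S_S[OF two order_refl G[OF i], of k] by simp
    qed
    have g0: "2 * ?l * D1 * (M * t ^ k) \<ge> 0" using C_nonneg Mt by simp
    note q1 = L2_mult_bounded[OF dg vm sup Mt, of "Suc k"]
    note q2 = L2_mult_bounded[OF dv gm gsup g0]
    have "L2_norm (p (Suc k)) \<le> L2_norm (\<lambda>x. p k x + norm (?v (Suc k) x) * norm (?dg x) + norm (?g k x) * norm (?dv x))"
    proof (rule L2_mono(2))
      show "L2 (\<lambda>x. p k x + norm (?v (Suc k) x) * norm (?dg x) + norm (?g k x) * norm (?dv x))"
        by (intro L2_add p q1 q2)
      show "p (Suc k) \<in> borel_measurable borel" by (rule L2_borel[OF p(1)])
      show "AE x in lborel. norm (p (Suc k) x) \<le> norm (p k x + norm (?v (Suc k) x) * norm (?dg x) + norm (?g k x) * norm (?dv x))"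
      proof (rule AE_I2)
        fix x
        let ?a = "norm (?v k x)" and ?a' = "norm (?v (Suc k) x)" and ?b = "norm (?g k x)" and ?b' = "norm (?g (Suc k) x)"
        have 1: "?b' \<le> ?b + norm (?dg x)" and 2: "?a' \<le> ?a + norm (?dv x)"
          by (simp_all add: norm_triangle_sub)
        have "?a' * ?b' \<le> ?a' * (?b + norm (?dg x))" by (intro mult_left_mono 1) simp
        also have "\<dots> = ?a' * ?b + ?a' * norm (?dg x)" by (rule distrib_left)
        also have "?a' * ?b \<le> (?a + norm (?dv x)) * ?b" by (intro mult_right_mono 2) simp
        finally show "norm (p (Suc k) x) \<le> norm (p k x + ?a' * norm (?dg x) + ?b * norm (?dv x))"
          by (simp add: p_def algebra_simps)
      qed
    qed
    also have "\<dots> \<le> L2_norm (p k) + L2_norm (\<lambda>x. norm (?v (Suc k) x) * norm (?dg x)) + L2_norm (\<lambda>x. norm (?g k x) * norm (?dv x))"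
      by (rule order_trans[OF L2_add(2)[OF L2_add(1)[OF p(1) q1(1)] q2(1)]]) (intro add_right_mono L2_add(2) p q1)
    also have "\<dots> \<le> L2_norm (p k) + M * t ^ Suc k * (E1 / ?l * Y) + 2 * ?l * D1 * (M * t ^ k) * (E2 / ?l\<^sup>2 * Y)"
      using mult_left_mono[OF ndg Mt[of "Suc k"]] mult_left_mono[OF ndv g0] q1(2) q2(2) by linarith
    also have "\<dots> = L2_norm (p k) + M * ?r ^ k * Y * (t * E1 + 2 * D1 * E2)"
      by (simp add: field_simps power2_eq_square power_divide)
    also have "\<dots> \<le> L2_norm (p k) + M * ?r ^ k * Y * E3"
      unfolding E3_def using t E_nonneg M Y0 by (intro add_left_mono mult_left_mono add_right_mono mult_right_mono) auto
    finally show ?thesis by (simp add: mult_ac)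
  qed
  let ?Q = "M * (C0 * t ^ K * L2_norm (G i) + E3 / (1 - ?r) * ?r ^ K * Y)"
  have r: "0 < ?r" "?r < 1" using t by auto
  have Q: "L2_norm (p (K + n)) \<le> M * (C0 * t ^ K * L2_norm (G i)) + M * E3 * Y * (\<Sum>j<n. ?r ^ (K + j))" for n
  proof (induction n)
    case 0
    have "L2_norm (p K) \<le> M * t ^ K * (C0 * L2_norm (G i))"
      using p(2)[of K] mult_left_mono[OF S_L2(2)[OF two[of K] G[OF i]] Mt[of K]] by linarith
    then show ?case by (simp add: mult_ac)
  next
    case (Suc n)
    then show ?case using step[of "K + n"] by (simp add: algebra_simps)
  qed
  have Q': "L2_norm (p (K + n)) \<le> ?Q" for n
  proof -
    have "(\<Sum>j<n. ?r ^ (K + j)) = ?r ^ K * (\<Sum>j<n. ?r ^ j)" by (simp add: power_add sum_distrib_left)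
    also have "\<dots> \<le> ?r ^ K * (1 / (1 - ?r))"
    proof (rule mult_left_mono)
      have "(\<Sum>j<n. ?r ^ j) = (1 - ?r ^ n) / (1 - ?r)" using r by (subst sum_gp_strict) auto
      also have "\<dots> \<le> 1 / (1 - ?r)" using r by (intro divide_right_mono) auto
      finally show "(\<Sum>j<n. ?r ^ j) \<le> 1 / (1 - ?r)" .
    qed (use r in simp)
    finally have "M * E3 * Y * (\<Sum>j<n. ?r ^ (K + j)) \<le> M * E3 * Y * (?r ^ K * (1 / (1 - ?r)))"
      using M E3_nonneg Y0 by (intro mult_left_mono) auto
    then show ?thesis using Q[of n] by (simp add: algebra_simps)
  qed
  \<comment> \<open>along the dyadic scales the approximation error is summable, which gives pointwise convergence\<close>
  have lim: "AE x in lborel. (\<lambda>k. S (2 ^ k) h x - h x) \<longlonglongrightarrow> 0"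
    if h: "L2 h" and w: "\<And>j. j \<in> Basis \<Longrightarrow> has_weak_deriv j h (h' j)" and h': "\<And>j. j \<in> Basis \<Longrightarrow> L2 (h' j)"
    for h :: "'a \<Rightarrow> 'b" and h'
  proof (rule L2_fast_AE_tendsto)
    show "L2 (\<lambda>x. S (2 ^ k) h x - h x)" for k :: nat by (intro L2_diff S_L2 h) simp
    show "L2_norm (\<lambda>x. S (2 ^ k) h x - h x) \<le> C1 * (\<Sum>j\<in>Basis. L2_norm (h' j)) / 2 ^ k" for k :: nat
      using S_approx[OF two[of k] h w h'] by simp
  qed
  have limf: "AE x in lborel. (\<lambda>k. S (2 ^ k) f x - f x) \<longlonglongrightarrow> 0"
    by (rule lim[of f G]) (auto intro: f wG G)
  have limG: "AE x in lborel. (\<lambda>k. S (2 ^ k) (G i) x - G i x) \<longlonglongrightarrow> 0"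
    by (rule lim[of "G i" "H i"]) (auto intro: G wH H i)
  note [measurable] = vm gm L2_borel[OF f] L2_borel[OF G[OF i]] L2_borel[OF p(1)]
  have "(\<integral>\<^sup>+x. ennreal ((norm (f x))\<^sup>2 * (norm (G i x))\<^sup>2) \<partial>lborel) = (\<integral>\<^sup>+x. liminf (\<lambda>n. ennreal ((norm (p (K + n) x))\<^sup>2)) \<partial>lborel)"
  proof (rule nn_integral_cong_AE)
    show "AE x in lborel. ennreal ((norm (f x))\<^sup>2 * (norm (G i x))\<^sup>2) = liminf (\<lambda>n. ennreal ((norm (p (K + n) x))\<^sup>2))"
      using limf limG
    proof eventually_elim
      case (elim x)
      have "(\<lambda>k. S (2 ^ k) f x) \<longlonglongrightarrow> f x" "(\<lambda>k. S (2 ^ k) (G i) x) \<longlonglongrightarrow> G i x"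
        using elim by (simp_all add: LIM_zero_iff)
      then have "(\<lambda>k. ennreal ((norm (p k x))\<^sup>2)) \<longlonglongrightarrow> ennreal ((norm (norm (f x) * norm (G i x)))\<^sup>2)"
        unfolding p_def by (intro tendsto_ennrealI tendsto_intros)
      from LIMSEQ_ignore_initial_segment[OF this, of K]
      have "(\<lambda>n. ennreal ((norm (p (K + n) x))\<^sup>2)) \<longlonglongrightarrow> ennreal ((norm (f x))\<^sup>2 * (norm (G i x))\<^sup>2)"
        by (simp add: add.commute power_mult_distrib)
      from lim_imp_Liminf[OF _ this] show ?case by simp
    qed
  qed
  also have "\<dots> \<le> liminf (\<lambda>n. nn2 (p (K + n)))"
    by (rule nn_integral_liminf) measurable
  also have "\<dots> \<le> ennreal (?Q\<^sup>2)"
  proof (rule Liminf_le)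
    have "nn2 (p (K + n)) \<le> ennreal (?Q\<^sup>2)" for n
      unfolding nn2_eq[OF p(1)] by (intro ennreal_leI power_mono Q') simp
    then show "eventually (\<lambda>n. nn2 (p (K + n)) \<le> ennreal (?Q\<^sup>2)) sequentially" by simp
  qed simp
  finally show ?thesis .
qed

end

section \<open>Littlewood-Paley blocks\<close>

lemma schwartz_bound:
  assumes "schwartz (\<psi> :: 'a::euclidean_space \<Rightarrow> complex)"
  obtains C where "\<And>x. norm (\<psi> x) \<le> C / (1 + norm x) ^ n"
proof -
  have "bounded (range (\<lambda>x. (1 + norm x) ^ n *\<^sub>R foldr partial_deriv [] \<psi> x))"
    using assms unfolding schwartz_def by (metis empty_set empty_subsetI)
  then obtain C where C: "\<And>x. norm ((1 + norm x) ^ n *\<^sub>R \<psi> x) \<le> C" by (auto simp: bounded_iff)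
  have "norm (\<psi> x) \<le> C / (1 + norm x) ^ n" for x
    using C[of x] by (simp add: field_simps add_pos_nonneg)
  then show thesis by (rule that)
qed

lemma schwartz_borel: "schwartz \<psi> \<Longrightarrow> \<psi> \<in> borel_measurable borel"
  by (simp add: schwartz_def smooth_borel)

lemma schwartz_integrable_L2:
  assumes \<psi>: "schwartz (\<psi> :: 'a::euclidean_space \<Rightarrow> complex)"
  shows "integrable lborel \<psi>" "L2 \<psi>"
proof -
  obtain C where C: "\<And>x. norm (\<psi> x) \<le> C / (1 + norm x) ^ (2 * DIM('a))" using schwartz_bound[OF \<psi>] by metis
  show i: "integrable lborel \<psi>" by (rule integrable_weight_bound[OF schwartz_borel[OF \<psi>] C order_refl])
  obtain B where "\<And>x. norm (\<psi> x) \<le> B / (1 + norm x) ^ 0" using schwartz_bound[OF \<psi>] by metis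
  then show "L2 \<psi>" by (intro L2_bounded_integrable[OF i, of B]) simp
qed

lemma test_function_foldr:
  "test_function UNIV \<psi> \<Longrightarrow> set is \<subseteq> Basis \<Longrightarrow> test_function UNIV (foldr partial_deriv is \<psi>)"
  by (induction "is") (auto intro: test_function_partial)

lemma foldr_partial_of_real:
  assumes "test_function UNIV \<psi>" "set is \<subseteq> Basis"
  shows "foldr partial_deriv is (\<lambda>x. complex_of_real (\<psi> x)) = (\<lambda>x. complex_of_real (foldr partial_deriv is \<psi> x))"
  using assms(2)
proof (induction "is")
  case (Cons i "is")
  then have "test_function UNIV (foldr partial_deriv is \<psi>)" by (intro test_function_foldr assms(1)) auto
  then have pd: "partial_deriv i (\<lambda>x. complex_of_real (foldr partial_deriv is \<psi> x)) x = complex_of_real (partial_deriv i (foldr partial_deriv is \<psi>) x)" for x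
    by (intro partial_deriv_bounded_linear bounded_linear_of_real smooth_differentiable test_function_smooth)
  have "foldr partial_deriv is (\<lambda>x. complex_of_real (\<psi> x)) = (\<lambda>x. complex_of_real (foldr partial_deriv is \<psi> x))"
    using Cons by simp
  then show ?case by (simp only: foldr.simps o_apply) (rule ext, rule pd)
qed simp

lemma test_function_schwartz:
  fixes \<psi> :: "'a::euclidean_space \<Rightarrow> real"
  assumes \<psi>: "test_function UNIV \<psi>" shows "schwartz (\<lambda>x. complex_of_real (\<psi> x))"
proof -
  have sm: "smooth (\<lambda>x. complex_of_real (\<psi> x))"
    by (rule smooth_bounded_linear[OF bounded_linear_of_real test_function_smooth[OF \<psi>]])
  have bd: "bounded (range (\<lambda>x. (1 + norm x) ^ n *\<^sub>R foldr partial_deriv is (\<lambda>x. complex_of_real (\<psi> x)) x))"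
    if sB: "set is \<subseteq> Basis" for "is" :: "'a list" and n :: nat
  proof -
    let ?F = "foldr partial_deriv is \<psi>"
    note t = test_function_foldr[OF \<psi> sB]
    obtain K where K: "compact K" "\<And>x. x \<notin> K \<Longrightarrow> ?F x = 0" using test_function_support[OF t] by metis
    have cont: "continuous_on UNIV (\<lambda>x. (1 + norm x) ^ n *\<^sub>R complex_of_real (?F x))"
      by (intro continuous_intros smooth_continuous test_function_smooth[OF t])
    obtain C where "C \<ge> 0" "\<And>x. norm ((1 + norm x) ^ n *\<^sub>R complex_of_real (?F x)) \<le> C"
      by (rule compact_support_bounded[OF cont K(1)]) (use K(2) in auto)
    then show ?thesis
      unfolding foldr_partial_of_real[OF \<psi> sB] bounded_iff by auto
  qed
  show ?thesis unfolding schwartz_def using sm bd by blast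
qed

text \<open>
  In the duality that defines a multiplier, the transposed operator maps \<open>\<psi>\<close> to its correlation with
  the kernel \<open>k\<close> of the symbol, which is the adjoint of the convolution with \<open>k\<close>.
\<close>

lemma is_multiplier_conv:
  fixes f :: "'a::euclidean_space \<Rightarrow> 'b::euclidean_space"
  assumes m: "integrable lborel m" and k: "integrable lborel k"
    and inv: "\<And>x. inv_fourier (\<lambda>\<xi>. complex_of_real (m \<xi>)) x = complex_of_real (k x)" and f: "L2 f"
  shows "is_multiplier m f (conv k f)"
proof (unfold is_multiplier_def Let_def, intro conjI allI impI ballI)
  have id: "(\<lambda>y::'a. y) \<in> borel_measurable borel" and nid: "(\<lambda>y::'a. - y) \<in> borel_measurable borel" by simp_all
  note cf = avg_L2[OF k id f]
  show "conv k f \<in> borel_measurable borel" by (rule L2_borel[OF cf(1)])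
  fix \<psi> :: "'a \<Rightarrow> complex" and b :: 'b assume \<psi>: "schwartz \<psi>" and b: "b \<in> Basis"
  note \<psi>i = schwartz_integrable_L2[OF \<psi>]
  note [measurable] = schwartz_borel[OF \<psi>] L2_borel[OF f] L2_borel[OF cf(1)]
  have [measurable]: "m \<in> borel_measurable borel" using m by auto
  let ?c = "complex_of_real (1 / (2 * pi) ^ DIM('a))"
  let ?h = "\<lambda>x. f x \<bullet> b"
  have dot: "L2 (\<lambda>x. g x \<bullet> b)" if "L2 g" for g :: "'a \<Rightarrow> 'b"
  proof -
    note [measurable] = L2_borel[OF that]
    show ?thesis
      by (rule L2_mono(1)[OF that]) (use b Basis_le_norm in auto)
  qed
  have pt: "fourier (\<lambda>\<xi>. complex_of_real (m \<xi>) * inv_fourier \<psi> \<xi>) x = avg k (\<lambda>y. - y) \<psi> x" for x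
  proof -
    have pair: "integrable (lborel \<Otimes>\<^sub>M lborel) (\<lambda>(\<xi>, y). cis ((y - x) \<bullet> \<xi>) * complex_of_real (m \<xi>) * \<psi> y)"
    proof (rule product_integrable_pair)
      show "(\<lambda>w. cis ((snd w - x) \<bullet> fst w) * complex_of_real (m (fst w)) * \<psi> (snd w)) \<in> borel_measurable borel"
        unfolding borel_prod[symmetric] by measurable
      show "integrable lborel (\<lambda>\<xi>. \<bar>m \<xi>\<bar> * (\<integral>y. norm (\<psi> y) \<partial>lborel))" using m by simp
      fix \<xi>
      have "(\<integral>\<^sup>+y. ennreal (norm (cis ((y - x) \<bullet> \<xi>) * complex_of_real (m \<xi>) * \<psi> y)) \<partial>lborel) = (\<integral>\<^sup>+y. ennreal (\<bar>m \<xi>\<bar> * norm (\<psi> y)) \<partial>lborel)"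
        by (simp add: norm_mult)
      also have "\<dots> = ennreal (\<bar>m \<xi>\<bar> * (\<integral>y. norm (\<psi> y) \<partial>lborel))"
        using \<psi>i(1) by (subst nn_integral_eq_integral) auto
      finally show "(\<integral>\<^sup>+y. ennreal (norm (cis ((y - x) \<bullet> \<xi>) * complex_of_real (m \<xi>) * \<psi> y)) \<partial>lborel) \<le> ennreal (\<bar>m \<xi>\<bar> * (\<integral>y. norm (\<psi> y) \<partial>lborel))" by simp
    qed
    have "fourier (\<lambda>\<xi>. complex_of_real (m \<xi>) * inv_fourier \<psi> \<xi>) x = (\<integral>\<xi>. ?c * (\<integral>y. cis ((y - x) \<bullet> \<xi>) * complex_of_real (m \<xi>) * \<psi> y \<partial>lborel) \<partial>lborel)"
      unfolding fourier_def
    proof (rule Bochner_Integration.integral_cong[OF refl])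
      fix \<xi>
      have "cis (- (\<xi> \<bullet> x)) * (complex_of_real (m \<xi>) * inv_fourier \<psi> \<xi>) = ?c * ((cis (- (\<xi> \<bullet> x)) * complex_of_real (m \<xi>)) * (\<integral>y. cis (\<xi> \<bullet> y) * \<psi> y \<partial>lborel))"
        by (simp add: inv_fourier_def mult_ac)
      also have "(cis (- (\<xi> \<bullet> x)) * complex_of_real (m \<xi>)) * (\<integral>y. cis (\<xi> \<bullet> y) * \<psi> y \<partial>lborel) = (\<integral>y. (cis (- (\<xi> \<bullet> x)) * complex_of_real (m \<xi>)) * (cis (\<xi> \<bullet> y) * \<psi> y) \<partial>lborel)"
        by (rule integral_mult_right_zero[symmetric])
      also have "\<dots> = (\<integral>y. cis ((y - x) \<bullet> \<xi>) * complex_of_real (m \<xi>) * \<psi> y \<partial>lborel)"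
      proof (rule Bochner_Integration.integral_cong[OF refl])
        fix y
        have "cis ((y - x) \<bullet> \<xi>) = cis (- (\<xi> \<bullet> x)) * cis (\<xi> \<bullet> y)" by (simp add: cis_mult inner_diff_left inner_commute[of \<xi>])
        then show "(cis (- (\<xi> \<bullet> x)) * complex_of_real (m \<xi>)) * (cis (\<xi> \<bullet> y) * \<psi> y) = cis ((y - x) \<bullet> \<xi>) * complex_of_real (m \<xi>) * \<psi> y"
          by (simp only: mult_ac)
      qed
      finally show "cis (- (\<xi> \<bullet> x)) * (complex_of_real (m \<xi>) * inv_fourier \<psi> \<xi>) = ?c * (\<integral>y. cis ((y - x) \<bullet> \<xi>) * complex_of_real (m \<xi>) * \<psi> y \<partial>lborel)" .
    qed
    also have "\<dots> = ?c * (\<integral>\<xi>. (\<integral>y. cis ((y - x) \<bullet> \<xi>) * complex_of_real (m \<xi>) * \<psi> y \<partial>lborel) \<partial>lborel)"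
      by (rule integral_mult_right_zero)
    also have "(\<integral>\<xi>. (\<integral>y. cis ((y - x) \<bullet> \<xi>) * complex_of_real (m \<xi>) * \<psi> y \<partial>lborel) \<partial>lborel) = (\<integral>y. (\<integral>\<xi>. cis ((y - x) \<bullet> \<xi>) * complex_of_real (m \<xi>) * \<psi> y \<partial>lborel) \<partial>lborel)"
      by (rule lborel_pair.Fubini_integral[symmetric, OF pair])
    also have "?c * \<dots> = (\<integral>y. ?c * (\<integral>\<xi>. cis ((y - x) \<bullet> \<xi>) * complex_of_real (m \<xi>) * \<psi> y \<partial>lborel) \<partial>lborel)"
      by (rule integral_mult_right_zero[symmetric])
    also have "\<dots> = (\<integral>y. k (y - x) *\<^sub>R \<psi> y \<partial>lborel)"
    proof (rule Bochner_Integration.integral_cong[OF refl])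
      fix y
      have "?c * (\<integral>\<xi>. cis ((y - x) \<bullet> \<xi>) * complex_of_real (m \<xi>) * \<psi> y \<partial>lborel) = inv_fourier (\<lambda>\<xi>. complex_of_real (m \<xi>)) (y - x) * \<psi> y"
        by (simp add: inv_fourier_def)
      then show "?c * (\<integral>\<xi>. cis ((y - x) \<bullet> \<xi>) * complex_of_real (m \<xi>) * \<psi> y \<partial>lborel) = k (y - x) *\<^sub>R \<psi> y"
        by (simp add: inv scaleR_conv_of_real)
    qed
    also have "\<dots> = (\<integral>y. k y *\<^sub>R \<psi> (x - (- y)) \<partial>lborel)"
    proof -
      have [measurable]: "k \<in> borel_measurable borel" using k by auto
      show ?thesis using integral_shift[of "\<lambda>y. k y *\<^sub>R \<psi> (x + y)" x] by simp
    qed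
    finally show ?thesis by (simp add: avg_def)
  qed
  have prod: "integrable lborel (\<lambda>x. complex_of_real (a x) * g x)" if "L2 a" "L2 g" for a :: "'a \<Rightarrow> real" and g :: "'a \<Rightarrow> complex"
    using L2_scaleR_integrable[OF that] by (simp add: scaleR_conv_of_real)
  note P = avg_L2[OF k nid \<psi>i(2)]
  note ch = avg_L2[OF k id dot[OF f]]
  have "(\<integral>x. complex_of_real (conv k f x \<bullet> b) * \<psi> x \<partial>lborel) = (\<integral>x. conv k ?h x *\<^sub>R \<psi> x \<partial>lborel)"
  proof (rule integral_cong_AE)
    note [measurable] = L2_borel[OF ch(1)]
    show "(\<lambda>x. complex_of_real (conv k f x \<bullet> b) * \<psi> x) \<in> borel_measurable lborel" by measurable
    show "(\<lambda>x. conv k ?h x *\<^sub>R \<psi> x) \<in> borel_measurable lborel" by measurable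
    show "AE x in lborel. complex_of_real (conv k f x \<bullet> b) * \<psi> x = conv k ?h x *\<^sub>R \<psi> x"
      using cf(3)
    proof eventually_elim
      case (elim x)
      then have "conv k f x \<bullet> b = conv k ?h x"
        unfolding avg_def by (subst integral_inner_left[symmetric]) auto
      then show ?case by (simp add: scaleR_conv_of_real)
    qed
  qed
  also have "\<dots> = (\<integral>x. ?h x *\<^sub>R avg k (\<lambda>y. - y) \<psi> x \<partial>lborel)"
    using avg_adjoint[OF k nid \<psi>i(2) dot[OF f]] by simp
  finally have "(\<integral>x. complex_of_real (conv k f x \<bullet> b) * \<psi> x \<partial>lborel) = (\<integral>x. complex_of_real (f x \<bullet> b) * avg k (\<lambda>y. - y) \<psi> x \<partial>lborel)"
    by (simp add: scaleR_conv_of_real)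
  then show "(\<integral>x. complex_of_real (conv k f x \<bullet> b) * \<psi> x \<partial>lborel)
      = (\<integral>x. complex_of_real (f x \<bullet> b) * fourier (\<lambda>\<xi>. complex_of_real (m \<xi>) * inv_fourier \<psi> \<xi>) x \<partial>lborel)"
    by (simp only: pt)
  show "integrable lborel (\<lambda>x. complex_of_real (conv k f x \<bullet> b) * \<psi> x)"
    by (intro prod dot cf \<psi>i)
  show "integrable lborel (\<lambda>x. complex_of_real (f x \<bullet> b) * fourier (\<lambda>\<xi>. complex_of_real (m \<xi>) * inv_fourier \<psi> \<xi>) x)"
    unfolding pt by (intro prod dot f P)
qed

text \<open>
  Test functions are Schwartz functions. Hence the multipliers of the decomposition, which are
  chosen among the possible representatives, are known almost everywhere.
\<close>

lemma is_multiplier_unique: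
  fixes g1 g2 :: "'a::euclidean_space \<Rightarrow> 'b::euclidean_space"
  assumes g1: "is_multiplier m f g1" and g2: "is_multiplier m f g2"
  shows "AE x in lborel. g1 x = g2 x"
proof -
  note [measurable] = g1[unfolded is_multiplier_def, THEN conjunct1] g2[unfolded is_multiplier_def, THEN conjunct1]
  have "AE x in lborel. g1 x \<bullet> b - g2 x \<bullet> b = 0" if b: "b \<in> Basis" for b
  proof (rule fundamental_lemma)
    show "(\<lambda>x. g1 x \<bullet> b - g2 x \<bullet> b) \<in> borel_measurable borel" by measurable
    fix \<psi> :: "'a \<Rightarrow> real" assume "test_function UNIV \<psi>"
    then have s: "schwartz (\<lambda>x. complex_of_real (\<psi> x))" by (rule test_function_schwartz)
    have A: "integrable lborel (\<lambda>x. complex_of_real (g1 x \<bullet> b * \<psi> x))" "integrable lborel (\<lambda>x. complex_of_real (g2 x \<bullet> b * \<psi> x))"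
      "(\<integral>x. complex_of_real (g1 x \<bullet> b * \<psi> x) \<partial>lborel) = (\<integral>x. complex_of_real (g2 x \<bullet> b * \<psi> x) \<partial>lborel)"
      using g1[unfolded is_multiplier_def Let_def] g2[unfolded is_multiplier_def Let_def] s b by auto
    have "integrable lborel (\<lambda>x. g1 x \<bullet> b * \<psi> x)" "integrable lborel (\<lambda>x. g2 x \<bullet> b * \<psi> x)"
      using A(1,2) by (simp_all only: complex_of_real_integrable_eq)
    moreover have "(\<integral>x. g1 x \<bullet> b * \<psi> x \<partial>lborel) = (\<integral>x. g2 x \<bullet> b * \<psi> x \<partial>lborel)"
      using A(3) by (simp only: integral_complex_of_real of_real_eq_iff)
    ultimately show "integrable lborel (\<lambda>x. \<psi> x *\<^sub>R (g1 x \<bullet> b - g2 x \<bullet> b)) \<and> (\<integral>x. \<psi> x *\<^sub>R (g1 x \<bullet> b - g2 x \<bullet> b) \<partial>lborel) = 0"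
      by (simp add: right_diff_distrib mult.commute)
  qed
  then have "AE x in lborel. \<forall>b\<in>Basis. g1 x \<bullet> b - g2 x \<bullet> b = 0" by (intro AE_finite_allI) auto
  then show ?thesis by eventually_elim (auto intro: euclidean_eqI)
qed

lemma fourier_multiplier_is_multiplier: "is_multiplier m f g \<Longrightarrow> is_multiplier m f (fourier_multiplier m f)"
  unfolding fourier_multiplier_def by (rule someI[of "\<lambda>g. is_multiplier m f g"])

lemma fourier_multiplier_eq: "is_multiplier m f g \<Longrightarrow> AE x in lborel. fourier_multiplier m f x = g x"
  using is_multiplier_unique fourier_multiplier_is_multiplier by blast

lemma fourier_multiplier_borel: "is_multiplier m f g \<Longrightarrow> fourier_multiplier m f \<in> borel_measurable borel"
  using fourier_multiplier_is_multiplier[of m f g] by (simp add: is_multiplier_def)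

text \<open>
  For \<open>|\<xi>| \<le> 2/3\<close> no dilate of \<open>\<phi>\<close> reaches \<open>\<xi>\<close>, and the partition of unity leaves \<open>\<chi>(\<xi>) = 1\<close>.
\<close>

lemma littlewood_paley_low_pass:
  assumes "littlewood_paley chi phi" shows "low_pass chi"
proof
  have smooth: "smooth chi" and radial: "\<And>\<xi> \<eta>. norm \<xi> = norm \<eta> \<Longrightarrow> chi \<xi> = chi \<eta>"
    and supp: "\<And>\<xi>. chi \<xi> \<noteq> 0 \<Longrightarrow> norm \<xi> \<le> 4 / 3" and supp': "\<And>\<xi>. phi \<xi> \<noteq> 0 \<Longrightarrow> 3 / 4 \<le> norm \<xi>"
    and one: "\<And>\<xi>. chi \<xi> + (\<Sum>j. phi ((1 / 2) ^ j *\<^sub>R \<xi>)) = 1"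
    using assms unfolding littlewood_paley_def schwartz_def by blast+
  have "{x. chi x \<noteq> 0} \<subseteq> cball 0 (4 / 3)" using supp by auto
  then have "closure {x. chi x \<noteq> 0} \<subseteq> cball 0 (4 / 3)" by (rule closure_minimal) simp
  then have "compact (closure {x. chi x \<noteq> 0})" by (meson bounded_cball bounded_subset closed_closure compact_eq_bounded_closed)
  then show "test_function UNIV chi" using smooth by (simp add: test_function_def)
  show "chi (- \<xi>) = chi \<xi>" for \<xi> by (rule radial) simp
  show "chi \<xi> = 0" if "4 / 3 < norm \<xi>" for \<xi> using supp[of \<xi>] that by force
  show "chi \<xi> = 1" if "norm \<xi> \<le> 2 / 3" for \<xi>
  proof -
    have "phi ((1 / 2) ^ j *\<^sub>R \<xi>) = 0" for j :: nat
    proof -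
      have "norm ((1 / 2) ^ j *\<^sub>R \<xi>) \<le> 1 * norm \<xi>"
        unfolding norm_scaleR by (intro mult_right_mono) (auto simp: power_le_one)
      then have "\<not> 3 / 4 \<le> norm ((1 / 2) ^ j *\<^sub>R \<xi>)" using that by linarith
      then show ?thesis using supp' by blast
    qed
    then show ?thesis using one[of \<xi>] by simp
  qed
qed

text \<open>
  Subtract the partition of unity at \<open>\<eta>\<close> from the one at \<open>\<eta>/2\<close>. As a consequence, the dyadic blocks are
  differences of low-pass filters.
\<close>

lemma littlewood_paley_telescope:
  assumes "littlewood_paley chi phi" shows "phi \<eta> = chi (\<eta> /\<^sub>R 2) - chi \<eta>"
proof -
  have sm: "summable (\<lambda>j. phi ((1 / 2) ^ j *\<^sub>R \<eta>))" and 1: "chi \<eta> + (\<Sum>j. phi ((1 / 2) ^ j *\<^sub>R \<eta>)) = 1"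
    and 2: "chi (\<eta> /\<^sub>R 2) + (\<Sum>j. phi ((1 / 2) ^ j *\<^sub>R (\<eta> /\<^sub>R 2))) = 1"
    using assms unfolding littlewood_paley_def by blast+
  have "(\<Sum>j. phi ((1 / 2) ^ j *\<^sub>R (\<eta> /\<^sub>R 2))) = (\<Sum>j. phi ((1 / 2) ^ Suc j *\<^sub>R \<eta>))"
    by (simp add: inverse_eq_divide mult.commute)
  also have "\<dots> = (\<Sum>j. phi ((1 / 2) ^ j *\<^sub>R \<eta>)) - phi ((1 / 2) ^ 0 *\<^sub>R \<eta>)"
    by (rule suminf_split_head[OF sm])
  finally show ?thesis using 1 2 by simp
qed

lemma Lp_norm_cong_AE:
  assumes "f \<in> borel_measurable borel" "g \<in> borel_measurable borel" "AE x in lborel. f x = g x"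
  shows "Lp_norm p f = Lp_norm p g"
proof -
  have "esssup lborel (\<lambda>x. ennreal (norm (f x))) = esssup lborel (\<lambda>x. ennreal (norm (g x)))"
    by (rule esssup_AE_cong) (use assms in \<open>auto elim: eventually_mono\<close>)
  moreover have "(\<integral>\<^sup>+ x. ennreal (norm (f x) powr r) \<partial>lborel) = (\<integral>\<^sup>+ x. ennreal (norm (g x) powr r) \<partial>lborel)" for r
    by (rule nn_integral_cong_AE) (use assms(3) in \<open>auto elim: eventually_mono\<close>)
  ultimately show ?thesis by (simp add: Lp_norm_def)
qed

context low_pass
begin

lemma is_multiplier_S:
  assumes "l > 0" "L2 f" shows "is_multiplier (symb l) f (S l f)"
  unfolding S_def
  by (rule is_multiplier_conv[OF test_function_integrable[OF symb_test[OF assms(1)]] ker_integrable[OF assms(1)] inv_fourier_symb[OF assms(1)] assms(2)])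

lemma is_multiplier_S_diff:
  assumes l: "l > 0" and m: "m > 0" and f: "L2 f"
  shows "is_multiplier (\<lambda>\<xi>. symb l \<xi> - symb m \<xi>) f (\<lambda>x. S l f x - S m f x)"
proof -
  note i = test_function_integrable[OF symb_test[OF l]] test_function_integrable[OF symb_test[OF m]]
  have "is_multiplier (\<lambda>\<xi>. symb l \<xi> - symb m \<xi>) f (conv (\<lambda>x. ker l x - ker m x) f)"
  proof (rule is_multiplier_conv[OF _ _ _ f])
    show "integrable lborel (\<lambda>\<xi>. symb l \<xi> - symb m \<xi>)" using i by simp
    show "integrable lborel (\<lambda>x. ker l x - ker m x)" using ker_integrable l m by simp
    have "inv_fourier (\<lambda>\<xi>. complex_of_real (symb l \<xi> - symb m \<xi>)) x = inv_fourier (\<lambda>\<xi>. complex_of_real (symb l \<xi>)) x - inv_fourier (\<lambda>\<xi>. complex_of_real (symb m \<xi>)) x" for x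
      unfolding inv_fourier_def using osc_integrable[OF i(1), of x] osc_integrable[OF i(2), of x]
      by (simp add: right_diff_distrib)
    then show "inv_fourier (\<lambda>\<xi>. complex_of_real (symb l \<xi> - symb m \<xi>)) x = complex_of_real (ker l x - ker m x)" for x
      by (simp add: inv_fourier_symb l m)
  qed
  moreover have "conv (\<lambda>x. ker l x - ker m x) f = (\<lambda>x. S l f x - S m f x)"
    by (simp add: S_def fun_eq_iff conv_diff_left ker_L2 l m f)
  ultimately show ?thesis by simp
qed

text \<open>
  Since \<open>g\<close> is reproduced by a kernel at scale \<open>L\<close>, this is Hoelder's inequality. For \<open>p = r < \<infinity>\<close> the proof uses the elementary \<open>c \<le> A + A\<^sup>1\<^sup>-\<^sup>r c\<^sup>r\<close>, integrated against the kernel; the choice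
  \<open>A = L\<^sup>d\<^sup>/\<^sup>r N\<close> balances the two terms, the first being controlled by the mass of the kernel and the second by
  its supremum.
\<close>

lemma bernstein:
  fixes g :: "'a \<Rightarrow> 'b::euclidean_space"
  assumes L: "L > 0" and g: "L2 g" and rep: "S L g = g" and N: "N > 0" and le: "Lp_norm p g \<le> ennreal N"
    and p: "1 \<le> p"
  shows "norm (g x) \<le> (C0 + B0) * L powr (real_of_ereal (ereal DIM('a) / p)) * N"
proof (cases "p = \<infinity>")
  case True
  have "esssup lborel (\<lambda>x. ennreal (norm (g x))) \<le> ennreal N" using le True by (simp add: Lp_norm_def)
  moreover have "AE x in lborel. ennreal (norm (g x)) \<le> esssup lborel (\<lambda>x. ennreal (norm (g x)))" by (rule esssup_AE)
  ultimately have "AE x in lborel. norm (g x) \<le> N"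
    by (auto elim!: eventually_mono) (meson N ennreal_le_iff less_imp_le order_trans)
  from conv_sup[OF ker_integrable[OF L] this L2_borel[OF g], of x] N
  have "norm (g x) \<le> C0 * N" using rep by (simp add: S_def[symmetric] ker_abs_integral[OF L])
  also have "\<dots> \<le> (C0 + B0) * N" using N C_nonneg by (intro mult_right_mono) auto
  finally show ?thesis using True L by simp
next
  case False
  with p obtain r where r: "p = ereal r" "r \<ge> 1" by (cases p) auto
  let ?d = "real DIM('a)"
  define I where "I = (\<integral>\<^sup>+ x. ennreal (norm (g x) powr r) \<partial>lborel)"
  note [measurable] = L2_borel[OF g] ker_borel[OF L]
  have "I \<noteq> \<infinity>" using le r by (auto simp: Lp_norm_def Let_def I_def top_unique)
  then obtain J where J: "I = ennreal J" "J \<ge> 0" by (cases I) auto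
  have "ennreal (J powr (1 / r)) \<le> ennreal N" using le r J False by (simp add: Lp_norm_def Let_def I_def[symmetric])
  then have "J powr (1 / r) \<le> N" using N by simp
  then have "(J powr (1 / r)) powr r \<le> N powr r" using r by (intro powr_mono2) auto
  then have JN: "J \<le> N powr r" using r J by (simp add: powr_powr)
  define A where "A = L powr (?d / r) * N"
  have A: "A > 0" using L N by (simp add: A_def)
  have ir: "integrable lborel (\<lambda>y. norm (g (x - y)) powr r)" and Jr: "(\<integral>y. norm (g (x - y)) powr r \<partial>lborel) \<le> N powr r"
  proof -
    have "integrable lborel (\<lambda>y. norm (g y) powr r)" using J by (intro integrableI_bounded) (auto simp: I_def)
    note i = this
    then have "integrable lborel (\<lambda>y. norm (g (- y)) powr r)" using integrable_dilation[OF i, of "-1"] by simp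
    from integrable_shift[OF this, of x] show "integrable lborel (\<lambda>y. norm (g (x - y)) powr r)" by simp
    have "(\<integral>y. norm (g (x - y)) powr r \<partial>lborel) = (\<integral>y. norm (g (- (y - x))) powr r \<partial>lborel)" by simp
    also have "\<dots> = (\<integral>y. norm (g (- y)) powr r \<partial>lborel)" by (rule integral_shift[of "\<lambda>y. norm (g (- y)) powr r"]) measurable
    also have "\<dots> = (\<integral>y. norm (g y) powr r \<partial>lborel)" by (rule integral_reflect[OF i])
    also have "ennreal \<dots> = I" unfolding I_def by (rule nn_integral_eq_integral[symmetric, OF i]) simp
    then have "(\<integral>y. norm (g y) powr r \<partial>lborel) = J" using J by (simp add: ennreal_inj)
    finally show "(\<integral>y. norm (g (x - y)) powr r \<partial>lborel) \<le> N powr r" using JN by simp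
  qed
  have young: "c \<le> A + A powr (1 - r) * c powr r" if "c \<ge> 0" for c
  proof (cases "c \<le> A")
    case False
    then have "c = c powr (1 - r) * c powr r" using A by (simp add: powr_add[symmetric])
    also have "\<dots> \<le> A powr (1 - r) * c powr r" using False A r by (intro mult_right_mono powr_mono2') auto
    finally show ?thesis using A by linarith
  qed (simp add: add_increasing2)
  let ?b = "L ^ DIM('a) * B0"
  have "norm (g x) = norm (conv (ker L) g x)" using rep by (simp add: S_def[symmetric])
  also have "\<dots> \<le> (\<integral>y. norm (ker L y *\<^sub>R g (x - y)) \<partial>lborel)" unfolding avg_def by (rule integral_norm_bound)
  also have "\<dots> \<le> (\<integral>y. \<bar>ker L y\<bar> * A + ?b * A powr (1 - r) * norm (g (x - y)) powr r \<partial>lborel)"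
  proof (rule integral_mono)
    show "integrable lborel (\<lambda>y. norm (ker L y *\<^sub>R g (x - y)))" by (intro integrable_norm conv_integrable ker_L2 L g)
    show "integrable lborel (\<lambda>y. \<bar>ker L y\<bar> * A + ?b * A powr (1 - r) * norm (g (x - y)) powr r)"
      using ker_integrable[OF L] ir by simp
    fix y
    have "norm (ker L y *\<^sub>R g (x - y)) \<le> \<bar>ker L y\<bar> * (A + A powr (1 - r) * norm (g (x - y)) powr r)"
      unfolding norm_scaleR real_norm_def by (intro mult_left_mono young) auto
    also have "\<dots> = \<bar>ker L y\<bar> * A + \<bar>ker L y\<bar> * (A powr (1 - r) * norm (g (x - y)) powr r)" by (rule distrib_left)
    also have "\<dots> \<le> \<bar>ker L y\<bar> * A + ?b * (A powr (1 - r) * norm (g (x - y)) powr r)"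
      by (intro add_left_mono mult_right_mono ker_bound L) auto
    finally show "norm (ker L y *\<^sub>R g (x - y)) \<le> \<bar>ker L y\<bar> * A + ?b * A powr (1 - r) * norm (g (x - y)) powr r" by (simp only: mult.assoc)
  qed
  also have "\<dots> = C0 * A + ?b * A powr (1 - r) * (\<integral>y. norm (g (x - y)) powr r \<partial>lborel)"
    using ker_integrable[OF L] ir by (simp add: ker_abs_integral[OF L])
  also have "\<dots> \<le> C0 * A + ?b * A powr (1 - r) * N powr r"
    using L C_nonneg by (intro add_left_mono mult_left_mono Jr) auto
  also have "?b * A powr (1 - r) * N powr r = B0 * A"
  proof -
    have "L ^ DIM('a) * A powr (1 - r) * N powr r = L powr ?d * (L powr (?d / r * (1 - r)) * N powr (1 - r)) * N powr r"
      using L N by (simp add: A_def powr_mult powr_powr powr_realpow)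
    also have "\<dots> = L powr (?d + ?d / r * (1 - r)) * N powr ((1 - r) + r)" by (simp only: powr_add mult_ac)
    also have "?d + ?d / r * (1 - r) = ?d / r" using r by (simp add: field_simps)
    also have "(1 - r) + r = 1" by simp
    also have "L powr (?d / r) * N powr 1 = A" using N by (simp only: A_def powr_one)
    finally show ?thesis by (metis mult.assoc mult.commute)
  qed
  also have "C0 * A + B0 * A = (C0 + B0) * L powr (?d / r) * N" by (simp add: A_def distrib_right mult.assoc)
  finally show ?thesis using r by simp
qed

end

text \<open>
  \<open>S\<^sub>k f\<close> is the sum of the blocks up to \<open>k\<close>, and the block \<open>j\<close> is at most a multiple of \<open>2\<^sup>j\<^sup>e 2\<^sup>j\<^sup>s N\<close> by Bernstein's
  inequality. The sum is geometric and, as \<open>s > 0\<close>, bounded by a multiple of its last term.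
\<close>

lemma low_pass_sup_bound:
  fixes f :: "'a::euclidean_space \<Rightarrow> 'b::euclidean_space"
  assumes lp: "littlewood_paley chi phi" and f: "L2 f" and N: "N > 0"
    and le: "besov_norm chi phi (- s) p f \<le> ennreal N" and p: "1 \<le> p" and s: "s > 0"
  defines "e \<equiv> real_of_ereal (ereal DIM('a) / p)"
  defines "t \<equiv> 2 powr (s + e)"
  shows "norm (low_pass.S chi (2 ^ k) f x) \<le> ((low_pass.C0 chi + low_pass.B0 chi) * 4 powr e * (1 + 1 / (t - 1)) * N) * t ^ k"
proof -
  interpret low_pass chi by (rule littlewood_paley_low_pass[OF lp])
  let ?C = "C0 + B0"
  have e0: "e \<ge> 0" unfolding e_def using p by (cases p) auto
  have t1: "t > 1" unfolding t_def using s e0 by (intro gr_one_powr) auto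
  have C: "?C \<ge> 0" using C_nonneg by simp
  have blk: "Lp_norm p (dyadic_block chi phi j f) \<le> ennreal (N * 2 powr (real_of_int j * s))" if "j \<ge> -1" for j
  proof -
    have "ennreal (2 powr (real_of_int j * - s)) * Lp_norm p (dyadic_block chi phi j f) \<le> ennreal N"
      by (rule order_trans[OF _ le], unfold besov_norm_def, rule SUP_upper2[of j]) (use that in auto)
    then have "ennreal (2 powr (real_of_int j * s)) * (ennreal (2 powr (real_of_int j * - s)) * Lp_norm p (dyadic_block chi phi j f)) \<le> ennreal (2 powr (real_of_int j * s)) * ennreal N"
      by (rule mult_left_mono) simp
    then show ?thesis
      using N by (simp add: mult.assoc[symmetric] ennreal_mult[symmetric] powr_add[symmetric] mult.commute[of N])
  qed
  have b0: "norm (S 1 f x) \<le> ?C * 4 powr e * N"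
  proof -
    have m: "is_multiplier chi f (S 1 f)" using is_multiplier_S[of 1, OF _ f] by (simp add: symb_1)
    have "Lp_norm p (S 1 f) = Lp_norm p (dyadic_block chi phi (-1) f)"
      using fourier_multiplier_eq[OF m] fourier_multiplier_borel[OF m]
      by (intro Lp_norm_cong_AE L2_borel[OF S_L2(1)] f) (auto simp: dyadic_block_def elim: eventually_mono)
    also have "\<dots> \<le> ennreal (N * 2 powr (- s))" using blk[of "-1"] by simp
    also have "\<dots> \<le> ennreal N" using N s powr_mono[of "- s" 0 2] by (intro ennreal_leI mult_left_le) auto
    finally have "norm (S 1 f x) \<le> ?C * 2 powr e * N"
      unfolding e_def using S_S[of 1 2 f] f N p by (intro bernstein S_L2) auto
    also have "\<dots> \<le> ?C * 4 powr e * N" using C N e0 by (intro mult_right_mono mult_left_mono powr_mono2) auto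
    finally show ?thesis .
  qed
  have bj: "norm (S (2 ^ Suc j) f x - S (2 ^ j) f x) \<le> ?C * 4 powr e * N * t ^ j" for j :: nat
  proof -
    let ?g = "\<lambda>x. S (2 ^ Suc j) f x - S (2 ^ j) f x"
    have sy: "phi (2 powi (- int j) *\<^sub>R \<xi>) = symb (2 ^ Suc j) \<xi> - symb (2 ^ j) \<xi>" for \<xi>
      unfolding littlewood_paley_telescope[OF lp] symb_def by (simp add: power_int_minus mult.commute)
    have m: "is_multiplier (\<lambda>\<xi>. phi (2 powi (- int j) *\<^sub>R \<xi>)) f ?g"
      unfolding sy by (rule is_multiplier_S_diff) (use f in auto)
    have g: "L2 ?g" by (intro L2_diff S_L2 f) auto
    \<comment> \<open>the scale \<open>2\<^sup>j\<^sup>+\<^sup>2\<close> that reproduces the block is the source of the factor \<open>4\<^sup>e\<close>\<close>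
    have rep: "S (2 ^ (j + 2)) ?g = ?g"
    proof
      fix x
      have "S (2 ^ (j + 2)) ?g x = S (2 ^ (j + 2)) (S (2 ^ Suc j) f) x - S (2 ^ (j + 2)) (S (2 ^ j) f) x"
        by (intro S_diff S_L2 f) auto
      also have "S (2 ^ (j + 2)) (S (2 ^ Suc j) f) = S (2 ^ Suc j) f" by (rule S_S) (use f in auto)
      also have "S (2 ^ (j + 2)) (S (2 ^ j) f) = S (2 ^ j) f" by (rule S_S) (use f in auto)
      finally show "S (2 ^ (j + 2)) ?g x = ?g x" .
    qed
    have "Lp_norm p ?g = Lp_norm p (dyadic_block chi phi (int j) f)"
      using fourier_multiplier_eq[OF m] fourier_multiplier_borel[OF m]
      by (intro Lp_norm_cong_AE L2_borel[OF g]) (auto simp: dyadic_block_def elim: eventually_mono)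
    also have "\<dots> \<le> ennreal (N * 2 powr (real j * s))" using blk[of "int j"] by simp
    finally have n: "norm (?g x) \<le> ?C * (2 ^ (j + 2)) powr e * (N * 2 powr (real j * s))"
      unfolding e_def using N p by (intro bernstein g rep) auto
    have "(2 ^ (j + 2)) powr e * (N * 2 powr (real j * s)) = 4 powr e * N * t ^ j"
    proof -
      have "((2::real) ^ (j + 2)) powr e = (2 powr (real (j + 2))) powr e" by (subst powr_realpow) auto
      also have "\<dots> = 2 powr (real j * e) * 2 powr (2 * e)" by (simp only: powr_powr powr_add[symmetric]) (simp add: algebra_simps)
      also have "2 powr (2 * e) = (2 powr 2) powr e" by (simp only: powr_powr)
      finally have 1: "((2::real) ^ (j + 2)) powr e = 2 powr (real j * e) * 4 powr e" by simp
      have "t ^ j = 2 powr (real j * (s + e))" unfolding t_def by (simp add: powr_power mult.commute)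
      then have "t ^ j = 2 powr (real j * s) * 2 powr (real j * e)" by (simp only: powr_add[symmetric] distrib_left)
      then show ?thesis unfolding 1 by (simp add: mult_ac)
    qed
    then show ?thesis using n by (simp only: mult.assoc)
  qed
  let ?B = "?C * 4 powr e * N"
  have B: "?B \<ge> 0" using C N by simp
  have "S (2 ^ k) f x = S 1 f x + (\<Sum>j<k. S (2 ^ Suc j) f x - S (2 ^ j) f x)"
    by (subst sum_lessThan_telescope) simp
  also have "norm \<dots> \<le> norm (S 1 f x) + (\<Sum>j<k. norm (S (2 ^ Suc j) f x - S (2 ^ j) f x))"
    by (intro norm_triangle_le add_left_mono norm_sum)
  also have "\<dots> \<le> ?B + (\<Sum>j<k. ?B * t ^ j)" by (intro add_mono b0 sum_mono bj)
  also have "\<dots> = ?B * (1 + (t ^ k - 1) / (t - 1))"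
  proof -
    have "(\<Sum>j<k. t ^ j) = (t ^ k - 1) / (t - 1)" using t1 minus_divide_divide[of "t ^ k - 1" "t - 1"] by (simp add: sum_gp_strict)
    then show ?thesis by (simp add: sum_distrib_left[symmetric] distrib_left)
  qed
  also have "\<dots> \<le> ?B * (t ^ k + t ^ k / (t - 1))"
    using t1 by (intro mult_left_mono[OF _ B] add_mono divide_right_mono) (auto simp: one_le_power)
  also have "\<dots> = ?C * 4 powr e * (1 + 1 / (t - 1)) * N * t ^ k" by (simp add: algebra_simps)
  finally show ?thesis .
qed

section \<open>The spatial estimate\<close>

lemma sobolev_1D:
  assumes "sobolev 1 f"
  shows "L2 f" and "i \<in> Basis \<Longrightarrow> L2 (weak_deriv i f)" and "i \<in> Basis \<Longrightarrow> has_weak_deriv i f (weak_deriv i f)"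
proof -
  have 1: "L2 f" "\<And>i. i \<in> Basis \<Longrightarrow> \<exists>g. L2 g \<and> has_weak_deriv i f g" using assms by auto
  show "L2 f" by (rule 1)
  show "i \<in> Basis \<Longrightarrow> L2 (weak_deriv i f)" "i \<in> Basis \<Longrightarrow> has_weak_deriv i f (weak_deriv i f)"
    using 1(2)[of i] weak_deriv_eq[of i f] by blast+
qed

lemma sobolev_1I:
  assumes "L2 f" "\<And>i. i \<in> Basis \<Longrightarrow> L2 (g i)" "\<And>i. i \<in> Basis \<Longrightarrow> has_weak_deriv i f (g i)"
  shows "sobolev 1 f"
  using assms by auto

lemma sobolev_2D:
  assumes "sobolev 2 f"
  shows "sobolev 1 f" and "i \<in> Basis \<Longrightarrow> sobolev 1 (weak_deriv i f)"
proof -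
  have 2: "L2 f" "\<And>i. i \<in> Basis \<Longrightarrow> \<exists>g. sobolev 1 g \<and> has_weak_deriv i f g"
    using assms by (auto simp: numeral_2_eq_2)
  then have "\<And>i. i \<in> Basis \<Longrightarrow> \<exists>g. L2 g \<and> has_weak_deriv i f g" using sobolev_1D(1) by blast
  with 2 show "sobolev 1 f" by auto
  assume i: "i \<in> Basis"
  obtain g where g: "sobolev 1 g" "has_weak_deriv i f g" using 2(2)[OF i] by blast
  note e = weak_deriv_eq[OF g(2) sobolev_1D(1)[OF g(1)]]
  show "sobolev 1 (weak_deriv i f)"
  proof (rule sobolev_1I[OF e(1)])
    fix j :: 'a assume j: "j \<in> Basis"
    show "L2 (weak_deriv j g)" by (rule sobolev_1D(2)[OF g(1) j])
    show "has_weak_deriv j (weak_deriv i f) (weak_deriv j g)"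
      by (rule has_weak_deriv_cong_AE[OF sobolev_1D(3)[OF g(1) j] j])
        (use e sobolev_1D[OF g(1)] j in \<open>auto intro: L2_borel elim: eventually_mono\<close>)
  qed
qed

lemma sobolev_norm_sq_nonneg: "0 \<le> sobolev_norm_sq k f"
  by (induction k arbitrary: f) (auto intro!: add_nonneg_nonneg sum_nonneg)

lemma sobolev_norm_nonneg [simp]: "0 \<le> sobolev_norm k f"
  by (simp add: sobolev_norm_def sobolev_norm_sq_nonneg)

lemma sobolev_norm_power2: "(sobolev_norm k f)\<^sup>2 = sobolev_norm_sq k f"
  by (simp add: sobolev_norm_def sobolev_norm_sq_nonneg)

lemma norm_grad_L2:
  assumes "sobolev 1 f"
  shows "L2 (norm_grad f)" "(L2_norm (norm_grad f))\<^sup>2 = (\<Sum>i\<in>Basis. (L2_norm (weak_deriv i f))\<^sup>2)"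
proof -
  note D = sobolev_1D[OF assms]
  have eq: "(norm_grad f x)\<^sup>2 = (\<Sum>i\<in>Basis. (norm (weak_deriv i f x))\<^sup>2)" for x
    by (simp add: norm_grad_def sum_nonneg)
  have int: "integrable lborel (\<lambda>x. (norm (weak_deriv i f x))\<^sup>2)" if "i \<in> Basis" for i
    using D(2)[OF that] by (simp add: L2_def)
  have m: "weak_deriv i f \<in> borel_measurable borel" if "i \<in> Basis" for i by (rule L2_borel[OF D(2)[OF that]])
  have "norm_grad f \<in> borel_measurable borel" unfolding norm_grad_def[abs_def] using m by measurable
  then show "L2 (norm_grad f)" using int by (simp add: L2_def eq)
  show "(L2_norm (norm_grad f))\<^sup>2 = (\<Sum>i\<in>Basis. (L2_norm (weak_deriv i f))\<^sup>2)"
    using int by (simp add: L2_norm_power2 eq)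
qed

lemma sobolev_norm_1: "sobolev 1 f \<Longrightarrow> (sobolev_norm 1 f)\<^sup>2 = (L2_norm f)\<^sup>2 + (L2_norm (norm_grad f))\<^sup>2"
  by (simp add: sobolev_norm_power2 norm_grad_L2(2))

lemma laplacian_L2: "sobolev 2 f \<Longrightarrow> L2 (laplacian f)"
  unfolding laplacian_def[abs_def]
  using L2_sum[of Basis "\<lambda>i. weak_deriv i (weak_deriv i f)"] sobolev_1D(2)[OF sobolev_2D(2)] by auto

text \<open>
  Sum \<open>product_estimate\<close> over the directions. The scale \<open>K\<close> is left free: it balances a low-frequency part
  that involves the gradient and a high-frequency part that involves the Laplacian.
\<close>

lemma spatial_estimate:
  fixes s :: real and p :: ereal
  assumes lp: "littlewood_paley chi phi" and s: "0 < s" and p: "1 \<le> p"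
    and e: "s + real_of_ereal (ereal DIM('a::euclidean_space) / p) < 1"
  defines "t \<equiv> 2 powr (s + real_of_ereal (ereal DIM('a) / p))"
  shows "\<exists>C\<ge>0. \<forall>(f :: 'a \<Rightarrow> 'b::euclidean_space) N K. sobolev 2 f \<longrightarrow> N > 0 \<longrightarrow>
    besov_norm chi phi (- s) p f \<le> ennreal N \<longrightarrow>
    (\<integral>\<^sup>+x. ennreal ((norm (f x))\<^sup>2 * (norm_grad f x)\<^sup>2) \<partial>lborel)
      \<le> ennreal (C * N\<^sup>2 * ((t\<^sup>2) ^ K * (L2_norm (norm_grad f))\<^sup>2 + ((t / 2)\<^sup>2) ^ K * (L2_norm (laplacian f))\<^sup>2))"
proof -
  interpret low_pass chi by (rule littlewood_paley_low_pass[OF lp])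
  let ?e = "real_of_ereal (ereal DIM('a) / p)" and ?d = "real DIM('a)"
  have e0: "?e \<ge> 0" using p by (cases p) auto
  have t: "1 \<le> t" "t < 2"
    using s e e0 powr_less_mono[of "s + ?e" 1 2] by (auto simp: t_def ge_one_powr_ge_zero)
  define CM where "CM = (C0 + B0) * 4 powr ?e * (1 + 1 / (t - 1))"
  have t1: "t > 1" unfolding t_def using s e0 by (intro gr_one_powr) auto
  have CM: "CM \<ge> 0" unfolding CM_def using C_nonneg t1 by (intro mult_nonneg_nonneg) auto
  define F where "F = E3 / (1 - t / 2)"
  have F: "F \<ge> 0" unfolding F_def using E3_nonneg t by simp
  define C where "C = ?d * (2 * CM\<^sup>2 * (C0\<^sup>2 + F\<^sup>2))"
  have C: "C \<ge> 0" by (simp add: C_def)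
  show ?thesis
  proof (intro exI[of _ C] conjI C allI impI)
    fix f :: "'a \<Rightarrow> 'b" and N :: real and K :: nat
    assume f: "sobolev 2 f" and N: "N > 0" and b: "besov_norm chi phi (- s) p f \<le> ennreal N"
    let ?X = "L2_norm (norm_grad f)" and ?Y = "L2_norm (laplacian f)"
    let ?G = "\<lambda>i. weak_deriv i f" and ?H = "\<lambda>i j. weak_deriv j (weak_deriv i f)"
    note f1 = sobolev_2D(1)[OF f] and f2 = sobolev_2D(2)[OF f]
    note D1 = sobolev_1D[OF f1] and D2 = sobolev_1D[OF f2]
    have [measurable]: "f \<in> borel_measurable borel" by (rule L2_borel[OF D1(1)])
    have [measurable]: "?G i \<in> borel_measurable borel" if "i \<in> Basis" for i by (rule L2_borel[OF D1(2)[OF that]])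
    let ?a = "C0\<^sup>2 * ((t\<^sup>2) ^ K * ?X\<^sup>2)" and ?b = "F\<^sup>2 * (((t / 2)\<^sup>2) ^ K * ?Y\<^sup>2)"
    have est: "(\<integral>\<^sup>+x. ennreal ((norm (f x))\<^sup>2 * (norm (?G i x))\<^sup>2) \<partial>lborel) \<le> ennreal (2 * (CM * N)\<^sup>2 * (?a + ?b))"
      if i: "i \<in> Basis" for i
    proof -
      have "(\<integral>\<^sup>+x. ennreal ((norm (f x))\<^sup>2 * (norm (?G i x))\<^sup>2) \<partial>lborel)
        \<le> ennreal ((CM * N * (C0 * t ^ K * L2_norm (?G i) + E3 / (1 - t / 2) * (t / 2) ^ K * L2_norm (\<lambda>x. \<Sum>i\<in>Basis. ?H i i x)))\<^sup>2)"
      proof (rule product_estimate[where G = ?G and H = ?H])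
        show "AE x in lborel. norm (S (2 ^ k) f x) \<le> CM * N * t ^ k" for k
          using low_pass_sup_bound[OF lp D1(1) N b p s, of k] by (simp add: CM_def t_def)
      qed (use D1 D2 t i CM N in auto)
      also have "\<dots> \<le> ennreal ((CM * N * (C0 * t ^ K * ?X + F * (t / 2) ^ K * ?Y))\<^sup>2)"
      proof (intro ennreal_leI power_mono mult_left_mono)
        have "(L2_norm (?G i))\<^sup>2 \<le> ?X\<^sup>2" unfolding norm_grad_L2(2)[OF f1] using i by (intro member_le_sum) auto
        then have "L2_norm (?G i) \<le> ?X" by (rule power2_le_imp_le) simp
        then show "C0 * t ^ K * L2_norm (?G i) + E3 / (1 - t / 2) * (t / 2) ^ K * L2_norm (\<lambda>x. \<Sum>i\<in>Basis. ?H i i x) \<le> C0 * t ^ K * ?X + F * (t / 2) ^ K * ?Y"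
          using C_nonneg t by (intro add_mono mult_left_mono) (auto simp: F_def laplacian_def[abs_def])
        show "0 \<le> CM * N" using CM N by simp
        show "0 \<le> CM * N * (C0 * t ^ K * L2_norm (?G i) + E3 / (1 - t / 2) * (t / 2) ^ K * L2_norm (\<lambda>x. \<Sum>i\<in>Basis. ?H i i x))"
          using CM N C_nonneg F t by (intro mult_nonneg_nonneg add_nonneg_nonneg) (auto simp: F_def)
      qed
      also have "\<dots> \<le> ennreal (2 * (CM * N)\<^sup>2 * (?a + ?b))"
      proof (rule ennreal_leI)
        have "(CM * N * (C0 * t ^ K * ?X + F * (t / 2) ^ K * ?Y))\<^sup>2 \<le> (CM * N)\<^sup>2 * (2 * (C0 * t ^ K * ?X)\<^sup>2 + 2 * (F * (t / 2) ^ K * ?Y)\<^sup>2)"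
        proof -
          have "(x + y)\<^sup>2 \<le> 2 * x\<^sup>2 + 2 * y\<^sup>2" for x y :: real
            using zero_le_power2[of "x - y"] by (simp add: power2_sum power2_diff)
          then show ?thesis unfolding power_mult_distrib[of "CM * N"] by (intro mult_left_mono) auto
        qed
        also have "\<dots> = 2 * (CM * N)\<^sup>2 * (?a + ?b)"
        proof -
          have e1: "(x ^ K)\<^sup>2 = (x\<^sup>2) ^ K" for x :: real by (simp only: power_mult[symmetric] mult.commute)
          show ?thesis by (simp only: power_mult_distrib e1 ring_distribs mult_ac)
        qed
        finally show "(CM * N * (C0 * t ^ K * ?X + F * (t / 2) ^ K * ?Y))\<^sup>2 \<le> 2 * (CM * N)\<^sup>2 * (?a + ?b)" .
      qed
      finally show ?thesis .
    qed
    have "(\<integral>\<^sup>+x. ennreal ((norm (f x))\<^sup>2 * (norm_grad f x)\<^sup>2) \<partial>lborel) = (\<integral>\<^sup>+x. (\<Sum>i\<in>Basis. ennreal ((norm (f x))\<^sup>2 * (norm (?G i x))\<^sup>2)) \<partial>lborel)"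
      by (intro nn_integral_cong) (simp add: norm_grad_def sum_nonneg sum_distrib_left)
    also have "\<dots> = (\<Sum>i\<in>Basis. (\<integral>\<^sup>+x. ennreal ((norm (f x))\<^sup>2 * (norm (?G i x))\<^sup>2) \<partial>lborel))"
      by (rule nn_integral_sum) measurable
    also have "\<dots> \<le> (\<Sum>i\<in>(Basis::'a set). ennreal (2 * (CM * N)\<^sup>2 * (?a + ?b)))"
      by (intro sum_mono est)
    also have "\<dots> = ennreal (?d * (2 * (CM * N)\<^sup>2 * (?a + ?b)))"
      by (simp add: ennreal_mult ennreal_of_nat_eq_real_of_nat)
    also have "\<dots> \<le> ennreal (C * N\<^sup>2 * ((t\<^sup>2) ^ K * ?X\<^sup>2 + ((t / 2)\<^sup>2) ^ K * ?Y\<^sup>2))"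
    proof (rule ennreal_leI)
      let ?A = "(t\<^sup>2) ^ K * ?X\<^sup>2" and ?B = "((t / 2)\<^sup>2) ^ K * ?Y\<^sup>2"
      have A: "?A \<ge> 0" "?B \<ge> 0" by simp_all
      have "C0\<^sup>2 * ?A + F\<^sup>2 * ?B \<le> (C0\<^sup>2 + F\<^sup>2) * (?A + ?B)"
      proof -
        have "(C0\<^sup>2 + F\<^sup>2) * (?A + ?B) - (C0\<^sup>2 * ?A + F\<^sup>2 * ?B) = C0\<^sup>2 * ?B + F\<^sup>2 * ?A" by (simp only: ring_distribs)
        moreover have "0 \<le> C0\<^sup>2 * ?B + F\<^sup>2 * ?A" using A by simp
        ultimately show ?thesis by linarith
      qed
      then have "?d * (2 * (CM * N)\<^sup>2 * (C0\<^sup>2 * ?A + F\<^sup>2 * ?B)) \<le> ?d * (2 * (CM * N)\<^sup>2 * ((C0\<^sup>2 + F\<^sup>2) * (?A + ?B)))"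
        by (intro mult_left_mono) auto
      also have "\<dots> = C * N\<^sup>2 * (?A + ?B)" by (simp add: C_def power_mult_distrib)
      finally show "?d * (2 * (CM * N)\<^sup>2 * (?a + ?b)) \<le> C * N\<^sup>2 * (?A + ?B)" .
    qed
    finally show "(\<integral>\<^sup>+x. ennreal ((norm (f x))\<^sup>2 * (norm_grad f x)\<^sup>2) \<partial>lborel)
      \<le> ennreal (C * N\<^sup>2 * ((t\<^sup>2) ^ K * ?X\<^sup>2 + ((t / 2)\<^sup>2) ^ K * ?Y\<^sup>2))" .
  qed
qed

text \<open>
  \<open>K\<close> is \<open>log\<^sub>2 (a N) / (1 - \<sigma>)\<close> rounded up. The logarithm makes the high-frequency coefficient at most
  \<open>a\<^sup>-\<^sup>2\<close>, and the rounding costs at most the factor \<open>4\<close> in the low-frequency one.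
\<close>

lemma choose_scale:
  fixes \<sigma> a N :: real
  assumes \<sigma>: "0 < \<sigma>" "\<sigma> < 1" and a: "a \<ge> 1" and N: "N \<ge> 1"
  shows "\<exists>K::nat. N\<^sup>2 * ((2 powr \<sigma> / 2)\<^sup>2) ^ K \<le> 1 / a\<^sup>2 \<and>
    N\<^sup>2 * ((2 powr \<sigma>)\<^sup>2) ^ K \<le> 4 * a powr (2 * \<sigma> / (1 - \<sigma>)) * N powr (2 / (1 - \<sigma>))"
proof -
  define y where "y = log 2 (a * N) / (1 - \<sigma>)"
  define K where "K = nat \<lceil>y\<rceil>"
  have aN: "a * N \<ge> 1" using a N by (metis mult_mono' mult_1 zero_le_one)
  then have y0: "y \<ge> 0" unfolding y_def using \<sigma> by (intro divide_nonneg_nonneg) auto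
  then have K: "y \<le> real K" "real K \<le> y + 1" unfolding K_def by (auto simp: of_nat_nat)
  have pw: "((2 powr b)\<^sup>2) ^ K = 2 powr (2 * b * real K)" for b :: real
    by (simp add: powr_power power_mult[symmetric] mult_ac)
  have y': "2 powr ((1 - \<sigma>) * y) = a * N" unfolding y_def using aN \<sigma> by simp
  have r: "2 powr \<sigma> / 2 = 2 powr (\<sigma> - 1)" by (simp add: powr_diff)
  have "((2 powr \<sigma> / 2)\<^sup>2) ^ K = 2 powr (2 * (\<sigma> - 1) * real K)" unfolding r by (rule pw)
  also have "\<dots> \<le> 2 powr (2 * (\<sigma> - 1) * y)"
    using K(1) \<sigma> by (intro powr_mono mult_left_mono_neg) auto
  also have "\<dots> = (2 powr ((1 - \<sigma>) * y)) powr (- 2)" by (simp only: powr_powr) (simp add: algebra_simps)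
  also have "\<dots> = 1 / (a\<^sup>2 * N\<^sup>2)" unfolding y' using aN a N by (simp add: powr_minus_divide power_mult_distrib)
  finally have 1: "N\<^sup>2 * ((2 powr \<sigma> / 2)\<^sup>2) ^ K \<le> N\<^sup>2 * (1 / (a\<^sup>2 * N\<^sup>2))"
    by (intro mult_left_mono) auto
  have "((2 powr \<sigma>)\<^sup>2) ^ K = 2 powr (2 * \<sigma> * real K)" by (rule pw)
  also have "\<dots> \<le> 2 powr (2 + 2 * \<sigma> * y)"
  proof (intro powr_mono)
    have "2 * \<sigma> * real K \<le> 2 * \<sigma> * (y + 1)" using K(2) \<sigma> by (intro mult_left_mono) auto
    also have "\<dots> \<le> 2 + 2 * \<sigma> * y" using \<sigma> by (simp add: algebra_simps)
    finally show "2 * \<sigma> * real K \<le> 2 + 2 * \<sigma> * y" .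
  qed simp
  also have "\<dots> = 4 * (2 powr ((1 - \<sigma>) * y)) powr (2 * \<sigma> / (1 - \<sigma>))"
  proof -
    have "((1 - \<sigma>) * y) * (2 * \<sigma> / (1 - \<sigma>)) = 2 * \<sigma> * y" using \<sigma> by simp
    then show ?thesis by (simp only: powr_add powr_powr) simp
  qed
  also have "\<dots> = 4 * (a powr (2 * \<sigma> / (1 - \<sigma>)) * N powr (2 * \<sigma> / (1 - \<sigma>)))"
    unfolding y' using a N by (simp add: powr_mult)
  finally have "N\<^sup>2 * ((2 powr \<sigma>)\<^sup>2) ^ K \<le> N\<^sup>2 * (4 * (a powr (2 * \<sigma> / (1 - \<sigma>)) * N powr (2 * \<sigma> / (1 - \<sigma>))))"
    by (intro mult_left_mono) auto
  also have "\<dots> = 4 * a powr (2 * \<sigma> / (1 - \<sigma>)) * (N powr 2 * N powr (2 * \<sigma> / (1 - \<sigma>)))" using N by simp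
  also have "N powr 2 * N powr (2 * \<sigma> / (1 - \<sigma>)) = N powr (2 / (1 - \<sigma>))"
  proof -
    have "2 + 2 * \<sigma> / (1 - \<sigma>) = 2 / (1 - \<sigma>)" using \<sigma> by (simp add: field_simps)
    then show ?thesis by (simp only: powr_add[symmetric])
  qed
  finally have 2: "N\<^sup>2 * ((2 powr \<sigma>)\<^sup>2) ^ K \<le> 4 * a powr (2 * \<sigma> / (1 - \<sigma>)) * N powr (2 / (1 - \<sigma>))" .
  show ?thesis using 1 2 N a by (intro exI[of _ K]) simp
qed

text \<open>
  The number \<open>a\<close> of \<open>choose_scale\<close> is taken large enough for the Laplacian term to be absorbed by
  \<open>c \<parallel>\<Delta>f\<parallel>\<^sup>2\<close>. The Besov norm enters through \<open>N = 1 + n\<close>, which satisfies \<open>N \<ge> 1\<close> also when \<open>n\<close> is small.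
\<close>

lemma absorbed_estimate:
  fixes s :: real and p :: ereal
  assumes lp: "littlewood_paley chi phi" and s: "0 < s" and p: "1 \<le> p"
  defines "\<sigma> \<equiv> s + real_of_ereal (ereal DIM('a::euclidean_space) / p)"
  assumes e: "\<sigma> < 1" and c: "c > 0" "c' > 0"
  shows "\<exists>C\<ge>0. \<forall>f :: 'a \<Rightarrow> 'b::euclidean_space. sobolev 2 f \<longrightarrow> besov_norm chi phi (- s) p f < \<infinity> \<longrightarrow>
    (\<integral>\<^sup>+x. ennreal ((norm (f x))\<^sup>2 * (norm_grad f x)\<^sup>2) \<partial>lborel) < \<infinity> \<and>
    c' * enn2real (\<integral>\<^sup>+x. ennreal ((norm (f x))\<^sup>2 * (norm_grad f x)\<^sup>2) \<partial>lborel)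
      \<le> c * (L2_norm (laplacian f))\<^sup>2 +
        C * (1 + enn2real (besov_norm chi phi (- s) p f) powr (2 / (1 - \<sigma>))) * (L2_norm (norm_grad f))\<^sup>2"
proof -
  let ?q = "2 / (1 - \<sigma>)"
  have \<sigma>0: "\<sigma> > 0" unfolding \<sigma>_def using s p by (cases p) (auto intro: add_pos_nonneg)
  obtain C1 where C1: "C1 \<ge> 0" and est: "\<And>(f :: 'a \<Rightarrow> 'b) N K. sobolev 2 f \<Longrightarrow> N > 0 \<Longrightarrow> besov_norm chi phi (- s) p f \<le> ennreal N \<Longrightarrow>
    (\<integral>\<^sup>+x. ennreal ((norm (f x))\<^sup>2 * (norm_grad f x)\<^sup>2) \<partial>lborel)
      \<le> ennreal (C1 * N\<^sup>2 * (((2 powr \<sigma>)\<^sup>2) ^ K * (L2_norm (norm_grad f))\<^sup>2 + ((2 powr \<sigma> / 2)\<^sup>2) ^ K * (L2_norm (laplacian f))\<^sup>2))"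
    using spatial_estimate[OF lp s p e[unfolded \<sigma>_def], where 'b = 'b] unfolding \<sigma>_def by blast
  define a where "a = max 1 (c' * C1 / c)"
  have a: "a \<ge> 1" and ac: "c' * C1 \<le> c * a\<^sup>2"
  proof -
    show "a \<ge> 1" by (simp add: a_def)
    have "c' * C1 / c \<le> a * 1" by (simp add: a_def)
    also have "\<dots> \<le> a * a" using \<open>a \<ge> 1\<close> by (intro mult_left_mono) auto
    finally show "c' * C1 \<le> c * a\<^sup>2" using c by (simp add: field_simps power2_eq_square)
  qed
  define C where "C = c' * C1 * (4 * a powr (2 * \<sigma> / (1 - \<sigma>))) * 2 powr ?q"
  have C: "C \<ge> 0" unfolding C_def using c C1 by simp
  show ?thesis
  proof (intro exI[of _ C] conjI C allI impI)
    fix f :: "'a \<Rightarrow> 'b" assume f: "sobolev 2 f" and b: "besov_norm chi phi (- s) p f < \<infinity>"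
    let ?I = "\<integral>\<^sup>+x. ennreal ((norm (f x))\<^sup>2 * (norm_grad f x)\<^sup>2) \<partial>lborel"
    let ?X = "L2_norm (norm_grad f)" and ?Y = "L2_norm (laplacian f)"
    define n where "n = enn2real (besov_norm chi phi (- s) p f)"
    have n: "n \<ge> 0" "besov_norm chi phi (- s) p f = ennreal n" unfolding n_def using b by (auto simp: less_top)
    obtain K where K: "(1 + n)\<^sup>2 * ((2 powr \<sigma> / 2)\<^sup>2) ^ K \<le> 1 / a\<^sup>2"
      "(1 + n)\<^sup>2 * ((2 powr \<sigma>)\<^sup>2) ^ K \<le> 4 * a powr (2 * \<sigma> / (1 - \<sigma>)) * (1 + n) powr ?q"
      using choose_scale[OF \<sigma>0 e a, of "1 + n"] n by auto
    let ?R = "C1 * (1 + n)\<^sup>2 * (((2 powr \<sigma>)\<^sup>2) ^ K * ?X\<^sup>2 + ((2 powr \<sigma> / 2)\<^sup>2) ^ K * ?Y\<^sup>2)"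
    have I: "?I \<le> ennreal ?R" using n by (intro est f) (auto intro: ennreal_leI)
    then show "?I < \<infinity>" by (auto intro: le_less_trans)
    have R0: "?R \<ge> 0" using C1 by (intro mult_nonneg_nonneg add_nonneg_nonneg) auto
    have "(1 + n) powr ?q \<le> 2 powr ?q * (1 + n powr ?q)"
    proof -
      have q0: "?q \<ge> 0" using e by simp
      have "(1 + n) powr ?q \<le> (2 * max 1 n) powr ?q" using n q0 by (intro powr_mono2) auto
      also have "\<dots> = 2 powr ?q * (max 1 n) powr ?q" by (rule powr_mult)
      also have "(max 1 n) powr ?q \<le> 1 + n powr ?q" by (simp add: max_def)
      finally show ?thesis by simp
    qed
    then have q: "c' * C1 * (4 * a powr (2 * \<sigma> / (1 - \<sigma>)) * (1 + n) powr ?q) \<le> C * (1 + n powr ?q)"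
      unfolding C_def mult.assoc using c C1 by (intro mult_left_mono) auto
    have "c' * enn2real ?I \<le> c' * ?R"
      using c I R0 by (intro mult_left_mono enn2real_leI) auto
    also have "\<dots> = c' * C1 * ((1 + n)\<^sup>2 * ((2 powr \<sigma>)\<^sup>2) ^ K) * ?X\<^sup>2 + c' * C1 * ((1 + n)\<^sup>2 * ((2 powr \<sigma> / 2)\<^sup>2) ^ K) * ?Y\<^sup>2"
      by (simp only: ring_distribs mult_ac)
    also have "\<dots> \<le> c' * C1 * (4 * a powr (2 * \<sigma> / (1 - \<sigma>)) * (1 + n) powr ?q) * ?X\<^sup>2 + c' * C1 * (1 / a\<^sup>2) * ?Y\<^sup>2"
      using c C1 by (intro add_mono mult_right_mono mult_left_mono K) auto
    also have "\<dots> \<le> C * (1 + n powr ?q) * ?X\<^sup>2 + c * ?Y\<^sup>2"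
    proof (intro add_mono mult_right_mono q)
      show "c' * C1 * (1 / a\<^sup>2) \<le> c" using ac a by (simp add: divide_simps)
    qed auto
    finally show "c' * enn2real ?I \<le> c * ?Y\<^sup>2 + C * (1 + enn2real (besov_norm chi phi (- s) p f) powr ?q) * ?X\<^sup>2"
      unfolding n_def by simp
  qed
qed

section \<open>Absolutely continuous functions on an interval\<close>

text \<open>
  Outer regularity of the finite measure with density \<open>G\<close>.
\<close>

lemma null_set_in_small_open:
  fixes G :: "real \<Rightarrow> real"
  assumes G: "integrable lborel G" "\<And>x. 0 \<le> G x" and N: "N \<in> null_sets lborel" and e: "e > 0"
  obtains U where "open U" "N \<subseteq> U" "(\<integral>x. indicator U x * G x \<partial>lborel) < e"
proof -
  let ?M = "density lborel (\<lambda>x. ennreal (G x))"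
  have [measurable]: "G \<in> borel_measurable borel" "N \<in> sets borel" using G N by auto
  have "emeasure ?M (space ?M) = (\<integral>\<^sup>+x. ennreal (G x) \<partial>lborel)" by (simp add: emeasure_density)
  also have "\<dots> = ennreal (\<integral>x. G x \<partial>lborel)" using G by (intro nn_integral_eq_integral) auto
  finally have fin: "emeasure ?M (space ?M) \<noteq> \<infinity>" by simp
  have "emeasure ?M N = 0"
  proof -
    have "AE x in lborel. x \<notin> N" by (rule AE_not_in[OF N])
    then have "(\<integral>\<^sup>+x. ennreal (G x) * indicator N x \<partial>lborel) = 0"
      by (subst nn_integral_0_iff_AE) (auto elim!: eventually_mono)
    then show ?thesis by (simp add: emeasure_density)
  qed
  moreover have "emeasure ?M N = (INF U \<in> {U. N \<subseteq> U \<and> open U}. emeasure ?M U)"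
    by (rule outer_regular[OF _ fin]) auto
  ultimately have "(INF U \<in> {U. N \<subseteq> U \<and> open U}. emeasure ?M U) < ennreal e" using e by simp
  then obtain U where U: "N \<subseteq> U" "open U" "emeasure ?M U < ennreal e" unfolding INF_less_iff by auto
  have [measurable]: "U \<in> sets borel" using U by auto
  have i: "integrable lborel (\<lambda>x. indicator U x * G x)" using integrable_mult_indicator[OF _ G(1), of U] by simp
  have "ennreal (\<integral>x. indicator U x * G x \<partial>lborel) = (\<integral>\<^sup>+x. ennreal (indicator U x * G x) \<partial>lborel)"
    using i G by (intro nn_integral_eq_integral[symmetric]) auto
  also have "\<dots> = emeasure ?M U"
    by (simp add: emeasure_density) (intro nn_integral_cong, simp split: split_indicator)
  finally have "ennreal (\<integral>x. indicator U x * G x \<partial>lborel) < ennreal e" using U(3) by simp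
  then have "(\<integral>x. indicator U x * G x \<partial>lborel) < e"
    using e by (subst (asm) ennreal_less_iff) (auto intro!: integral_nonneg_AE simp: G)
  then show thesis using U that by blast
qed

text \<open>
  The upper bound for the derivative is integrated over a fine tagged division. At a tag outside \<open>N\<close>
  the increment over a small interval is at most \<open>(H x + e)\<close> times its length. At a tag in \<open>N\<close>, where nothing
  is known about the derivative, the increment is bounded through \<open>G\<close>; such intervals lie in
  an open set that carries little mass of \<open>G\<close>.
\<close>

lemma increment_le_integral:
  fixes E G H :: "real \<Rightarrow> real"
  assumes ab: "a \<le> b" and G: "integrable lborel G" "\<And>x. 0 \<le> G x"
    and inc: "\<And>c d. a \<le> c \<Longrightarrow> c \<le> d \<Longrightarrow> d \<le> b \<Longrightarrow> \<bar>E d - E c\<bar> \<le> (\<integral>x. indicator {c..d} x * G x \<partial>lborel)"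
    and N: "N \<in> null_sets lborel"
    and der: "\<And>x. x \<in> {a..b} \<Longrightarrow> x \<notin> N \<Longrightarrow> \<exists>D. (E has_real_derivative D) (at x) \<and> D \<le> H x"
    and H: "H integrable_on {a..b}"
  shows "E b - E a \<le> integral {a..b} H"
proof (rule field_le_epsilon)
  fix e0 :: real assume e0: "e0 > 0"
  define e where "e = e0 / (3 + (b - a))"
  have e: "e > 0" using e0 ab by (simp add: e_def)
  have [measurable]: "G \<in> borel_measurable borel" using G by auto
  obtain U where U: "open U" "N \<subseteq> U" "(\<integral>x. indicator U x * G x \<partial>lborel) < e"
    using null_set_in_small_open[OF G N e] by blast
  have [measurable]: "U \<in> sets borel" using U by auto
  define GU where "GU = (\<lambda>x. indicator U x * G x)"
  have GUi: "integrable lborel GU" unfolding GU_def using integrable_mult_indicator[OF _ G(1), of U] by simp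
  have GU0: "GU x \<ge> 0" for x using G by (simp add: GU_def)
  have GUset: "set_integrable lborel {c..d} GU" for c d
    unfolding set_integrable_def by (intro integrable_mult_indicator GUi) auto
  have GUon: "GU integrable_on {c..d}" for c d by (rule set_borel_integral_eq_integral(1)[OF GUset])
  have GUtotal: "integral {a..b} GU < e"
  proof -
    have "integral {a..b} GU = (\<integral>x. indicator {a..b} x * GU x \<partial>lborel)"
      using set_borel_integral_eq_integral(2)[OF GUset, of a b] by (simp add: set_lebesgue_integral_def)
    also have "\<dots> \<le> (\<integral>x. GU x \<partial>lborel)"
      using GUset[of a b] GU0 by (intro integral_mono GUi) (auto simp: set_integrable_def indicator_def)
    also have "\<dots> < e" using U(3) by (simp add: GU_def)
    finally show ?thesis .
  qed
  \<comment> \<open>with the value \<open>0\<close> on \<open>N\<close>, Riemann terms at such tags cannot spoil the upper bound\<close>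
  define H' where "H' = (\<lambda>x. if x \<in> N then 0 else H x)"
  have "negligible N" using N by (simp add: negligible_iff_null_sets null_sets_completionI)
  then have H': "(H' has_integral integral {a..b} H) {a..b}"
    by (rule has_integral_spike[OF _ _ integrable_integral[OF H]]) (auto simp: H'_def)
  have "\<exists>\<gamma>. gauge \<gamma> \<and> (\<forall>p. p tagged_division_of {a..b} \<and> \<gamma> fine p \<longrightarrow>
      norm ((\<Sum>(x, k)\<in>p. measure lborel k *\<^sub>R H' x) - integral {a..b} H) < e)"
    by (rule H'[unfolded has_integral_real, THEN spec, THEN mp, OF e])
  then obtain \<gamma>1 where g1: "gauge \<gamma>1 \<and> (\<forall>p. p tagged_division_of {a..b} \<and> \<gamma>1 fine p \<longrightarrow>
      norm ((\<Sum>(x, k)\<in>p. measure lborel k *\<^sub>R H' x) - integral {a..b} H) < e)"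
    by (rule exE)
  have \<gamma>1: "gauge \<gamma>1" "\<And>p. p tagged_division_of {a..b} \<Longrightarrow> \<gamma>1 fine p \<Longrightarrow>
      norm ((\<Sum>(x, k)\<in>p. measure lborel k *\<^sub>R H' x) - integral {a..b} H) < e"
  proof -
    show "gauge \<gamma>1" by (rule g1[THEN conjunct1])
    fix p assume "p tagged_division_of {a..b}" "\<gamma>1 fine p"
    then show "norm ((\<Sum>(x, k)\<in>p. measure lborel k *\<^sub>R H' x) - integral {a..b} H) < e"
      using g1[THEN conjunct2, THEN spec, of p] by (simp only: simp_thms)
  qed
  have loc: "\<exists>r>0. \<forall>c d. a \<le> c \<longrightarrow> c \<le> x \<longrightarrow> x \<le> d \<longrightarrow> d \<le> b \<longrightarrow> {c..d} \<subseteq> ball x r \<longrightarrow>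
      E d - E c \<le> (H' x + e) * (d - c) + integral {c..d} GU" if x: "x \<in> {a..b}" for x
  proof (cases "x \<in> N")
    case True
    then obtain r where r: "r > 0" "ball x r \<subseteq> U" using U by (meson openE subsetD)
    show ?thesis
    proof (intro exI[of _ r] conjI r allI impI)
      fix c d assume cd: "a \<le> c" "c \<le> x" "x \<le> d" "d \<le> b" "{c..d} \<subseteq> ball x r"
      have "E d - E c \<le> (\<integral>x. indicator {c..d} x * G x \<partial>lborel)" using inc[of c d] cd by linarith
      also have "\<dots> = (\<integral>x. indicator {c..d} x *\<^sub>R GU x \<partial>lborel)"
        by (intro Bochner_Integration.integral_cong) (use cd r in \<open>auto simp: GU_def indicator_def\<close>)
      also have "\<dots> = integral {c..d} GU" using set_borel_integral_eq_integral(2)[OF GUset] by (simp add: set_lebesgue_integral_def)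
      also have "\<dots> \<le> (H' x + e) * (d - c) + integral {c..d} GU" using True e cd by (simp add: H'_def)
      finally show "E d - E c \<le> (H' x + e) * (d - c) + integral {c..d} GU" .
    qed
  next
    case False
    then obtain D where D: "(E has_real_derivative D) (at x)" "D \<le> H x" using der[OF x] by blast
    have "(E has_derivative (\<lambda>h. D * h)) (at x)" using D(1) by (simp add: has_field_derivative_def)
    then obtain r where r: "r > 0" "\<And>y. norm (y - x) < r \<Longrightarrow> norm (E y - E x - D * (y - x)) \<le> e * norm (y - x)"
      using e unfolding has_derivative_at_alt by blast
    show ?thesis
    proof (intro exI[of _ r] conjI r allI impI)
      fix c d assume cd: "a \<le> c" "c \<le> x" "x \<le> d" "d \<le> b" "{c..d} \<subseteq> ball x r"
      have "c \<in> {c..d}" "d \<in> {c..d}" using cd by auto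
      then have "c \<in> ball x r" "d \<in> ball x r" using cd(5) by blast+
      then have "norm (c - x) < r" "norm (d - x) < r" by (auto simp: dist_real_def)
      from r(2)[OF this(1)] r(2)[OF this(2)] cd
      have 1: "E x - E c + D * (c - x) \<le> e * (x - c)" "E d - E x - D * (d - x) \<le> e * (d - x)" by (auto simp: abs_le_iff)
      have "E d - E c \<le> (D + e) * (d - c)" using 1 by (simp add: algebra_simps)
      also have "\<dots> \<le> (H' x + e) * (d - c)" using D False cd by (intro mult_right_mono) (auto simp: H'_def)
      finally have "E d - E c \<le> (H' x + e) * (d - c)" .
      moreover have "0 \<le> integral {c..d} GU" by (rule Henstock_Kurzweil_Integration.integral_nonneg[OF GUon]) (rule GU0)
      ultimately show "E d - E c \<le> (H' x + e) * (d - c) + integral {c..d} GU" by linarith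
    qed
  qed
  then have "\<forall>x. \<exists>r>0. x \<in> {a..b} \<longrightarrow> (\<forall>c d. a \<le> c \<longrightarrow> c \<le> x \<longrightarrow> x \<le> d \<longrightarrow> d \<le> b \<longrightarrow> {c..d} \<subseteq> ball x r \<longrightarrow>
      E d - E c \<le> (H' x + e) * (d - c) + integral {c..d} GU)"
    by (metis zero_less_one)
  then obtain r where r: "\<And>x. r x > 0" "\<And>x c d. x \<in> {a..b} \<Longrightarrow> a \<le> c \<Longrightarrow> c \<le> x \<Longrightarrow> x \<le> d \<Longrightarrow> d \<le> b \<Longrightarrow> {c..d} \<subseteq> ball x (r x) \<Longrightarrow>
      E d - E c \<le> (H' x + e) * (d - c) + integral {c..d} GU" by metis
  have "gauge (\<lambda>x. ball x (r x))" using r(1) by (intro gauge_ball_dependent) auto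
  then have g: "gauge (\<lambda>x. \<gamma>1 x \<inter> ball x (r x))" using \<gamma>1(1) by (intro gauge_Int)
  obtain p where p: "p tagged_division_of {a..b}" "(\<lambda>x. \<gamma>1 x \<inter> ball x (r x)) fine p"
    using fine_division_exists_real[OF g] by metis
  have pf: "\<gamma>1 fine p" "(\<lambda>x. ball x (r x)) fine p" using p(2) by (auto simp: fine_Int)
  have "E b - E a = (\<Sum>(x,K)\<in>p. E (Sup K) - E (Inf K))"
    by (rule additive_tagged_division_1[OF ab p(1), symmetric])
  also have "\<dots> \<le> (\<Sum>(x,K)\<in>p. measure lborel K *\<^sub>R H' x + e * measure lborel K + integral K GU)"
  proof (rule sum_mono, clarify)
    fix x K assume xK: "(x, K) \<in> p"
    obtain c d where K: "K = {c..d}" using tagged_division_ofD(4)[OF p(1) xK] by auto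
    have x: "x \<in> K" "K \<subseteq> {a..b}" using tagged_division_ofD(2,3)[OF p(1) xK] by auto
    have "K \<subseteq> ball x (r x)" using pf(2) xK by (auto simp: fine_def)
    with x K have "E d - E c \<le> (H' x + e) * (d - c) + integral {c..d} GU" by (intro r(2)) auto
    then show "E (Sup K) - E (Inf K) \<le> measure lborel K *\<^sub>R H' x + e * measure lborel K + integral K GU"
      using x K by (simp add: algebra_simps)
  qed
  also have "\<dots> = (\<Sum>(x,K)\<in>p. measure lborel K *\<^sub>R H' x) + e * (\<Sum>(x,K)\<in>p. measure lborel K) + (\<Sum>(x,K)\<in>p. integral K GU)"
    by (simp add: case_prod_unfold sum.distrib sum_distrib_left)
  also have "(\<Sum>(x,K)\<in>p. measure lborel K) = b - a"
    using additive_content_tagged_division[of p a b] p(1) ab by simp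
  also have "(\<Sum>(x,K)\<in>p. integral K GU) = integral {a..b} GU"
    using integral_combine_tagged_division_topdown[of GU a b p] GUon p(1) by simp
  also have "(\<Sum>(x,K)\<in>p. measure lborel K *\<^sub>R H' x) \<le> integral {a..b} H + e"
    using \<gamma>1(2)[OF p(1) pf(1)] by (simp add: abs_less_iff)
  finally have "E b - E a \<le> integral {a..b} H + e + e * (b - a) + integral {a..b} GU" by simp
  also have "\<dots> \<le> integral {a..b} H + e * (3 + (b - a))" using GUtotal e by (simp add: algebra_simps)
  also have "e * (3 + (b - a)) = e0" using ab by (simp add: e_def)
  finally show "E b - E a \<le> integral {a..b} H + e0" .
qed

text \<open>
  The hypothesis compares only times outside a null set, and its last term is not an integral. Average
  it over the pairs \<open>(t, t + \<delta>)\<close> with \<open>t\<close> in the interval: the null set disappears, and the last term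
  becomes \<open>\<delta>\<close> times an integral of \<open>P\<close>. After division by \<open>\<delta>\<close>, the averages of \<open>E\<close> near the two ends converge to
  \<open>E b\<close> and \<open>E a\<close> by continuity, and the double integral of \<open>\<omega>\<close> over the intervals \<open>[t, t + \<delta>]\<close> is at most
  \<open>\<delta>\<close> times the integral of \<open>\<omega>\<close>.
\<close>

lemma AE_increments_imp_increments:
  fixes E \<omega> P :: "real \<Rightarrow> real"
  assumes cont: "continuous_on {0<..<T} E"
    and \<omega>: "integrable lborel \<omega>" "\<And>x. 0 \<le> \<omega> x" and P: "integrable lborel P" "\<And>x. 0 \<le> P x"
    and Z: "Z \<in> null_sets lborel"
    and inc: "\<And>s t. 0 < s \<Longrightarrow> s < t \<Longrightarrow> t < T \<Longrightarrow> s \<notin> Z \<Longrightarrow> t \<notin> Z \<Longrightarrow>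
      \<bar>E t - E s\<bar> \<le> (\<integral>x. indicator {s..t} x * \<omega> x \<partial>lborel) + (t - s) * (P s + P t)"
    and ab: "0 < a" "a \<le> b" "b < T"
  shows "\<bar>E b - E a\<bar> \<le> (\<integral>x. indicator {a..b} x * (\<omega> x + 2 * P x) \<partial>lborel)"
proof -
  note [measurable] = borel_measurable_integrable[OF \<omega>(1)] borel_measurable_integrable[OF P(1)]
  let ?G = "\<lambda>x. \<omega> x + 2 * P x"
  have iG: "integrable lborel (\<lambda>x. indicator {c..d} x * ?G x)" for c d
    using integrable_mult_indicator[of "{c..d}" lborel ?G] \<omega> P by simp
  have iP: "integrable lborel (\<lambda>x. indicator {c..d} x * P x)" for c d
    using integrable_mult_indicator[of "{c..d}" lborel P] P by simp
  have i\<omega>: "integrable lborel (\<lambda>x. indicator {c..d} x * \<omega> x)" for c d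
    using integrable_mult_indicator[of "{c..d}" lborel \<omega>] \<omega> by simp
  \<comment> \<open>room is left between \<open>b1\<close> and \<open>b\<close> for the shift by \<open>\<delta>\<close>\<close>
  have main: "\<bar>E b1 - E a\<bar> \<le> (\<integral>x. indicator {a..b} x * ?G x \<partial>lborel)" if b1: "a < b1" "b1 < b" for b1
  proof -
    \<comment> \<open>a primitive of \<open>E\<close>, so that averages of \<open>E\<close> over \<open>[c, c + \<delta>]\<close> are its difference quotients\<close>
    define F where "F x = integral {a..x} E" for x
    have cE: "continuous_on {a..b} E" using cont ab by (auto intro: continuous_on_subset)
    define e where "e x = indicator {a..b} x * E x" for x
    have e_int: "integrable lborel (\<lambda>x. indicator {c..d} x * e x)" and e_eq: "(\<integral>x. indicator {c..d} x * e x \<partial>lborel) = F d - F c"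
      if "a \<le> c" "c \<le> d" "d \<le> b" for c d
    proof -
      have cs: "continuous_on {c..d} E" using cE that by (auto intro: continuous_on_subset)
      have s: "set_integrable lborel {c..d} E"
        unfolding set_integrable_def by (rule borel_integrable_compact[OF compact_Icc cs])
      have eq: "indicator {c..d} x * e x = indicator {c..d} x *\<^sub>R E x" for x using that by (auto simp: e_def indicator_def)
      show "integrable lborel (\<lambda>x. indicator {c..d} x * e x)" using s unfolding eq set_integrable_def .
      have Ei: "E integrable_on {a..d}" using cE that by (intro integrable_continuous_interval) (auto intro: continuous_on_subset)
      have "(\<integral>x. indicator {c..d} x * e x \<partial>lborel) = integral {c..d} E"
        unfolding eq using set_borel_integral_eq_integral(2)[OF s] by (simp add: set_lebesgue_integral_def)
      also have "\<dots> = F d - F c"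
        using Henstock_Kurzweil_Integration.integral_combine[OF that(1,2) Ei] by (simp add: F_def)
      finally show "(\<integral>x. indicator {c..d} x * e x \<partial>lborel) = F d - F c" .
    qed
    have [measurable]: "e \<in> borel_measurable borel"
      unfolding e_def[abs_def] using borel_measurable_continuous_on_indicator[OF _ cE] by simp
    have step: "\<bar>(F (b1 + \<delta>) - F (a + \<delta>)) - (F b1 - F a)\<bar> \<le> \<delta> * (\<integral>x. indicator {a..b} x * ?G x \<partial>lborel)"
      if \<delta>: "0 < \<delta>" "\<delta> < b - b1" for \<delta>
    proof -
      let ?I = "\<lambda>t. indicator {a..b1} t :: real"
      have sh: "(\<integral>t. ?I t * h (t + \<delta>) \<partial>lborel) = (\<integral>t. indicator {a + \<delta>..b1 + \<delta>} t * h t \<partial>lborel)"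
        and shi: "integrable lborel (\<lambda>t. indicator {a + \<delta>..b1 + \<delta>} t * h t) \<Longrightarrow> integrable lborel (\<lambda>t. ?I t * h (t + \<delta>))"
        if [measurable]: "h \<in> borel_measurable borel" for h :: "real \<Rightarrow> real"
      proof -
        have eq: "indicator {a + \<delta>..b1 + \<delta>} (t - (- \<delta>)) * h (t - (- \<delta>)) = ?I t * h (t + \<delta>)" for t
          by (auto simp: indicator_def)
        show "(\<integral>t. ?I t * h (t + \<delta>) \<partial>lborel) = (\<integral>t. indicator {a + \<delta>..b1 + \<delta>} t * h t \<partial>lborel)"
          using integral_shift[of "\<lambda>t. indicator {a + \<delta>..b1 + \<delta>} t * h t" "- \<delta>"] by (simp only: eq) measurable
        assume "integrable lborel (\<lambda>t. indicator {a + \<delta>..b1 + \<delta>} t * h t)"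
        from integrable_shift[OF this, of "- \<delta>"] show "integrable lborel (\<lambda>t. ?I t * h (t + \<delta>))" by (simp only: eq)
      qed
      define W where "W t = (\<integral>x. indicator {t..t + \<delta>} x * \<omega> x \<partial>lborel)" for t
      have pair: "integrable (lborel \<Otimes>\<^sub>M lborel) (\<lambda>(x, t). ?I t * (indicator {t..t + \<delta>} x * \<omega> x))"
      proof (rule product_integrable_pair)
        have ind: "indicator {t..t + \<delta>} x = (if t \<le> x \<and> x \<le> t + \<delta> then 1 else 0 :: real)" for t x :: real by (simp add: indicator_def)
        show "(\<lambda>z. ?I (snd z) * (indicator {snd z..snd z + \<delta>} (fst z) * \<omega> (fst z))) \<in> borel_measurable borel"
          unfolding borel_prod[symmetric] ind by measurable
        show "integrable lborel (\<lambda>x. \<delta> * \<omega> x)" using \<omega> by simp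
        fix x
        have "(\<integral>\<^sup>+t. ennreal (norm (?I t * (indicator {t..t + \<delta>} x * \<omega> x))) \<partial>lborel) \<le> (\<integral>\<^sup>+t. ennreal (\<omega> x) * indicator {x - \<delta>..x} t \<partial>lborel)"
          using \<omega>(2)[of x] by (intro nn_integral_mono) (auto simp: indicator_def)
        also have "\<dots> = ennreal (\<delta> * \<omega> x)"
          using \<delta> \<omega>(2)[of x] by (simp add: nn_integral_cmult_indicator ennreal_mult mult.commute)
        finally show "(\<integral>\<^sup>+t. ennreal (norm (?I t * (indicator {t..t + \<delta>} x * \<omega> x))) \<partial>lborel) \<le> ennreal (\<delta> * \<omega> x)" .
      qed
      have iW: "integrable lborel (\<lambda>t. ?I t * W t)" and W_le: "(\<integral>t. ?I t * W t \<partial>lborel) \<le> \<delta> * (\<integral>x. indicator {a..b} x * \<omega> x \<partial>lborel)"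
      proof -
        have "integrable lborel (\<lambda>t. \<integral>x. ?I t * (indicator {t..t + \<delta>} x * \<omega> x) \<partial>lborel)"
          by (rule lborel_pair.integrable_snd[OF pair])
        then show "integrable lborel (\<lambda>t. ?I t * W t)" by (simp add: W_def)
        have "(\<integral>t. ?I t * W t \<partial>lborel) = (\<integral>t. (\<integral>x. ?I t * (indicator {t..t + \<delta>} x * \<omega> x) \<partial>lborel) \<partial>lborel)"
          by (simp add: W_def)
        also have "\<dots> = (\<integral>x. (\<integral>t. ?I t * (indicator {t..t + \<delta>} x * \<omega> x) \<partial>lborel) \<partial>lborel)"
          by (rule lborel_pair.Fubini_integral[OF pair])
        also have "\<dots> \<le> (\<integral>x. \<delta> * (indicator {a..b} x * \<omega> x) \<partial>lborel)"
        proof (rule integral_mono)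
          show "integrable lborel (\<lambda>x. \<integral>t. ?I t * (indicator {t..t + \<delta>} x * \<omega> x) \<partial>lborel)"
            by (rule lborel_pair.integrable_fst[OF pair])
          show "integrable lborel (\<lambda>x. \<delta> * (indicator {a..b} x * \<omega> x))" using i\<omega>[of a b] by simp
          fix x
          have "(\<integral>t. ?I t * (indicator {t..t + \<delta>} x * \<omega> x) \<partial>lborel) \<le> (\<integral>t. (indicator {a..b} x * \<omega> x) * indicator {x - \<delta>..x} t \<partial>lborel)"
          proof (rule integral_mono')
            show "integrable lborel (\<lambda>t. (indicator {a..b} x * \<omega> x) * indicator {x - \<delta>..x} t)"
              by (intro integrable_mult_right integrable_real_indicator) (auto simp: emeasure_lborel_Icc_eq)
            show "?I t * (indicator {t..t + \<delta>} x * \<omega> x) \<le> (indicator {a..b} x * \<omega> x) * indicator {x - \<delta>..x} t" for t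
              using \<delta> \<omega>(2)[of x] by (auto simp: indicator_def)
            show "0 \<le> (indicator {a..b} x * \<omega> x) * indicator {x - \<delta>..x} t" for t :: real using \<omega>(2)[of x] by simp
          qed
          also have "\<dots> = \<delta> * (indicator {a..b} x * \<omega> x)" using \<delta> by simp
          finally show "(\<integral>t. ?I t * (indicator {t..t + \<delta>} x * \<omega> x) \<partial>lborel) \<le> \<delta> * (indicator {a..b} x * \<omega> x)" .
        qed
        finally show "(\<integral>t. ?I t * W t \<partial>lborel) \<le> \<delta> * (\<integral>x. indicator {a..b} x * \<omega> x \<partial>lborel)" by simp
      qed
      have mono_ind: "(\<integral>t. indicator {c..d} t * P t \<partial>lborel) \<le> (\<integral>t. indicator {a..b} t * P t \<partial>lborel)" if "a \<le> c" "d \<le> b" for c d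
        using that P(2) by (intro integral_mono iP) (auto simp: indicator_def)
      have Pm: "P \<in> borel_measurable borel" by measurable
      have iPs: "integrable lborel (\<lambda>t. ?I t * P (t + \<delta>))" by (rule shi[OF Pm iP])
      have em: "e \<in> borel_measurable borel" by measurable
      have e1: "(\<integral>t. indicator {a + \<delta>..b1 + \<delta>} t * e t \<partial>lborel) = F (b1 + \<delta>) - F (a + \<delta>)"
        by (rule e_eq) (use \<delta> b1 in linarith)+
      have e2: "(\<integral>t. ?I t * e t \<partial>lborel) = F b1 - F a"
        by (rule e_eq) (use \<delta> b1 in linarith)+
      have i1: "integrable lborel (\<lambda>t. ?I t * e (t + \<delta>))"
        by (rule shi[OF em], rule e_int) (use \<delta> b1 in linarith)+
      have i2: "integrable lborel (\<lambda>t. ?I t * e t)"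
        by (rule e_int) (use \<delta> b1 in linarith)+
      have "(F (b1 + \<delta>) - F (a + \<delta>)) - (F b1 - F a) = (\<integral>t. ?I t * e (t + \<delta>) \<partial>lborel) - (\<integral>t. ?I t * e t \<partial>lborel)"
        by (simp only: sh[OF em] e1 e2)
      also have "\<dots> = (\<integral>t. ?I t * e (t + \<delta>) - ?I t * e t \<partial>lborel)"
        by (rule Bochner_Integration.integral_diff[OF i1 i2, symmetric])
      also have "\<bar>\<dots>\<bar> \<le> (\<integral>t. \<bar>?I t * e (t + \<delta>) - ?I t * e t\<bar> \<partial>lborel)" by (rule integral_abs_bound)
      also have "\<dots> \<le> (\<integral>t. ?I t * W t + \<delta> * (?I t * P t + ?I t * P (t + \<delta>)) \<partial>lborel)"
      proof (rule integral_mono_AE)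
        show "integrable lborel (\<lambda>t. \<bar>?I t * e (t + \<delta>) - ?I t * e t\<bar>)"
          by (intro integrable_abs Bochner_Integration.integrable_diff i1 i2)
        show "integrable lborel (\<lambda>t. ?I t * W t + \<delta> * (?I t * P t + ?I t * P (t + \<delta>)))"
          by (intro Bochner_Integration.integrable_add integrable_mult_right iW iP iPs)
        have nz: "AE t in lborel. t \<notin> Z" by (rule AE_not_in[OF Z])
        show "AE t in lborel. \<bar>?I t * e (t + \<delta>) - ?I t * e t\<bar> \<le> ?I t * W t + \<delta> * (?I t * P t + ?I t * P (t + \<delta>))"
          using nz AE_shift[OF nz, of "- \<delta>"]
        proof eventually_elim
          case (elim t)
          show ?case
          proof (cases "t \<in> {a..b1}")
            case True
            then have "e (t + \<delta>) = E (t + \<delta>)" "e t = E t" using \<delta> b1 by (auto simp: e_def)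
            moreover have "\<bar>E (t + \<delta>) - E t\<bar> \<le> W t + \<delta> * (P t + P (t + \<delta>))"
              using inc[of t "t + \<delta>"] True elim \<delta> b1 ab by (simp add: W_def)
            ultimately show ?thesis using True by simp
          qed simp
        qed
      qed
      also have "\<dots> = (\<integral>t. ?I t * W t \<partial>lborel) + \<delta> * ((\<integral>t. ?I t * P t \<partial>lborel) + (\<integral>t. indicator {a + \<delta>..b1 + \<delta>} t * P t \<partial>lborel))"
        using iW iP iPs by (simp add: sh[OF Pm])
      also have "\<dots> \<le> \<delta> * (\<integral>x. indicator {a..b} x * \<omega> x \<partial>lborel) + \<delta> * ((\<integral>t. indicator {a..b} t * P t \<partial>lborel) + (\<integral>t. indicator {a..b} t * P t \<partial>lborel))"
        using \<delta> b1 by (intro add_mono W_le mult_left_mono mono_ind) auto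
      also have "\<dots> = \<delta> * (\<integral>x. indicator {a..b} x * ?G x \<partial>lborel)"
      proof -
        have "(\<integral>x. indicator {a..b} x * ?G x \<partial>lborel) = (\<integral>x. indicator {a..b} x * \<omega> x + 2 * (indicator {a..b} x * P x) \<partial>lborel)"
          by (simp add: algebra_simps)
        also have "\<dots> = (\<integral>x. indicator {a..b} x * \<omega> x \<partial>lborel) + 2 * (\<integral>x. indicator {a..b} x * P x \<partial>lborel)"
          using iP i\<omega> by simp
        finally show ?thesis by (simp add: algebra_simps)
      qed
      finally show ?thesis .
    qed
    have F': "((\<lambda>\<delta>. (F (c + \<delta>) - F c) / \<delta>) \<longlongrightarrow> E c) (at_right 0)" if c: "a \<le> c" "c < b" for c
    proof -
      have "(F has_real_derivative E c) (at c within {a..b})"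
        unfolding F_def[abs_def] by (rule integral_has_real_derivative[OF cE]) (use c in auto)
      then have "(F has_real_derivative E c) (at c within {c..b})" by (rule DERIV_subset) (use c in auto)
      then have "((\<lambda>y. (F y - F c) / (y - c)) \<longlongrightarrow> E c) (at c within {c..b})"
        by (simp add: has_field_derivative_iff)
      then have "((\<lambda>y. (F y - F c) / (y - c)) \<longlongrightarrow> E c) (at_right c)"
        using c by (simp add: at_within_Icc_at_right)
      then show ?thesis
        unfolding filterlim_at_right_to_0[of _ _ c] by (simp add: add.commute)
    qed
    have "((\<lambda>\<delta>. (F (b1 + \<delta>) - F b1) / \<delta> - (F (a + \<delta>) - F a) / \<delta>) \<longlongrightarrow> E b1 - E a) (at_right 0)"
      using b1 by (intro tendsto_diff F') auto
    then have lim: "((\<lambda>\<delta>. \<bar>(F (b1 + \<delta>) - F b1) / \<delta> - (F (a + \<delta>) - F a) / \<delta>\<bar>) \<longlongrightarrow> \<bar>E b1 - E a\<bar>) (at_right 0)"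
      by (rule tendsto_rabs)
    show ?thesis
    proof (rule tendsto_upperbound[OF lim])
      have "eventually (\<lambda>\<delta>. 0 < \<delta> \<and> \<delta> < b - b1) (at_right 0)"
        using b1 by (auto simp: eventually_at_right_field intro!: exI[of _ "b - b1"])
      then show "\<forall>\<^sub>F \<delta> in at_right 0. \<bar>(F (b1 + \<delta>) - F b1) / \<delta> - (F (a + \<delta>) - F a) / \<delta>\<bar> \<le> (\<integral>x. indicator {a..b} x * ?G x \<partial>lborel)"
      proof eventually_elim
        case (elim \<delta>)
        have "\<bar>(F (b1 + \<delta>) - F b1) / \<delta> - (F (a + \<delta>) - F a) / \<delta>\<bar> = \<bar>(F (b1 + \<delta>) - F (a + \<delta>)) - (F b1 - F a)\<bar> / \<delta>"
          using elim by (simp add: diff_divide_distrib[symmetric] algebra_simps abs_divide)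
        also have "\<dots> \<le> (\<integral>x. indicator {a..b} x * ?G x \<partial>lborel)"
          using step[of \<delta>] elim by (simp add: divide_le_eq mult.commute)
        finally show ?case .
      qed
    qed simp
  qed
  show ?thesis
  proof (cases "a = b")
    case True
    have "0 \<le> (\<integral>x. indicator {a..b} x * ?G x \<partial>lborel)" using \<omega> P by (intro integral_nonneg_AE AE_I2) (auto intro!: mult_nonneg_nonneg add_nonneg_nonneg)
    then show ?thesis using True by simp
  next
    case False
    then have ab': "a < b" using ab by simp
    have "isCont E b" using cont ab by (simp add: continuous_on_eq_continuous_at)
    then have "(E \<longlongrightarrow> E b) (at_left b)" by (simp add: isCont_def filterlim_at_split)
    then have lim: "((\<lambda>x. \<bar>E x - E a\<bar>) \<longlongrightarrow> \<bar>E b - E a\<bar>) (at_left b)" by (intro tendsto_intros)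
    show ?thesis
    proof (rule tendsto_upperbound[OF lim])
      have "eventually (\<lambda>x. a < x \<and> x < b) (at_left b)"
        using ab' by (auto simp: eventually_at_left_field intro!: exI[of _ a])
      then show "\<forall>\<^sub>F x in at_left b. \<bar>E x - E a\<bar> \<le> (\<integral>x. indicator {a..b} x * ?G x \<partial>lborel)"
        by eventually_elim (rule main; simp)
    qed (simp add: trivial_limit_at_left_real)
  qed
qed

section \<open>Regularity in time\<close>

lemma real_smooth_derivative:
  fixes \<theta> :: "real \<Rightarrow> real"
  assumes "smooth \<theta>" shows "(\<theta> has_real_derivative partial_deriv 1 \<theta> t) (at t)"
  using smooth_line_derivative[OF assms, of 0 1 t UNIV] by (simp add: has_real_derivative_iff_has_vector_derivative)

lemma smooth_realI:
  assumes "\<And>t. (\<theta> has_real_derivative \<eta> t) (at t)" "smooth \<eta>"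
  shows "smooth \<theta>" "partial_deriv 1 \<theta> = \<eta>"
proof -
  show p: "partial_deriv 1 \<theta> = \<eta>"
    using partial_derivI[OF assms(1)[unfolded has_field_derivative_def]] by auto
  show "smooth \<theta>"
    unfolding smooth_unfold[of \<theta>] using assms p by (auto simp: real_differentiable_def)
qed

text \<open>
  The normalised primitive of a bump function.
\<close>

lemma smooth_step:
  obtains H :: "real \<Rightarrow> real" where "smooth H" "\<And>x. x \<le> 0 \<Longrightarrow> H x = 0" "\<And>x. 1 \<le> x \<Longrightarrow> H x = 1" "\<And>x y. x \<le> y \<Longrightarrow> H x \<le> H y"
proof -
  let ?b = "box_bump (0::real) 1 0"
  have sb: "smooth ?b" by (rule smooth_box_bump)
  have "\<exists>F. \<forall>x::real. - \<infinity> < ereal x \<longrightarrow> ereal x < \<infinity> \<longrightarrow> (F has_vector_derivative ?b x) (at x)"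
    by (rule einterval_antiderivative) (use smooth_continuous[OF sb, of UNIV] in \<open>auto simp: continuous_on_eq_continuous_at\<close>)
  then obtain F where F: "\<And>x. (F has_real_derivative ?b x) (at x)"
    by (auto simp: has_real_derivative_iff_has_vector_derivative)
  have b0: "?b x = 0" if "x \<le> 0 \<or> 1 \<le> x" for x
  proof -
    have "x \<notin> box 0 1" using that by (auto simp: mem_box)
    then show ?thesis using box_bump_pos_iff by blast
  qed
  have mono: "F x \<le> F y" if "x \<le> y" for x y
    by (rule DERIV_nonneg_imp_nondecreasing[OF that]) (use F box_bump_bounds(1) in blast)
  have c0: "F x = F 0" if "x \<le> 0" for x
  proof (cases "x = 0")
    case False
    then have "x < 0" using that by simp
    then show ?thesis
      by (rule DERIV_isconst_end[symmetric]) (use F b0 in \<open>auto intro!: continuous_at_imp_continuous_on DERIV_isCont simp: less_imp_le\<close>, metis F b0 less_imp_le)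
  qed simp
  have c1: "F x = F 1" if "1 \<le> x" for x
  proof (cases "x = 1")
    case False
    then have "1 < x" using that by simp
    then show ?thesis
      by (rule DERIV_isconst_end) (use F b0 in \<open>auto intro!: continuous_at_imp_continuous_on DERIV_isCont simp: less_imp_le\<close>, metis F b0 less_imp_le)
  qed simp
  have F01: "F 0 < F 1"
  proof (rule DERIV_pos_imp_increasing_open[of 0 1 F])
    fix x :: real assume "0 < x" "x < 1"
    then have "?b x \<noteq> 0" by (subst box_bump_pos_iff) (auto simp: mem_box)
    then have "?b x > 0" using box_bump_bounds(1)[of 0 1 0 x] by simp
    then show "\<exists>y. (F has_real_derivative y) (at x) \<and> 0 < y" using F by blast
  qed (use F in \<open>auto intro!: continuous_at_imp_continuous_on intro: DERIV_isCont\<close>)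
  define c where "c = F 1 - F 0"
  have c: "c > 0" using F01 by (simp add: c_def)
  define H where "H x = (F x - F 0) / c" for x
  have d: "(H has_real_derivative (1 / c) *\<^sub>R ?b t) (at t)" for t
    unfolding H_def[abs_def] by (use c in \<open>auto intro!: derivative_eq_intros F\<close>)
  have "smooth (\<lambda>t. (1 / c) *\<^sub>R ?b t)" by (intro smooth_scaleR smooth_const sb)
  then have "smooth H" by (rule smooth_realI(1)[OF d])
  moreover have "H x = 0" if "x \<le> 0" for x using c0[OF that] by (simp add: H_def)
  moreover have "H x = 1" if "1 \<le> x" for x using c1[OF that] c by (simp add: H_def c_def)
  moreover have "H x \<le> H y" if "x \<le> y" for x y using mono[OF that] c by (simp add: H_def divide_right_mono)
  ultimately show thesis using that by blast
qed

text \<open>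
  Test with smooth functions that rise from \<open>0\<close> to \<open>1\<close> immediately after \<open>t1\<close> and fall back to \<open>0\<close> immediately
  after \<open>t2\<close>. Their derivatives concentrate at \<open>t1\<close> and \<open>t2\<close>, where \<open>U\<close> is continuous, and the
  functions converge to the indicator of the interval.
\<close>

lemma increment_eq_integral_weak:
  fixes U W :: "real \<Rightarrow> 'b::euclidean_space"
  assumes U: "continuous_on {a..b} U" and W: "integrable lborel (\<lambda>t. indicator {a<..<b} t *\<^sub>R W t)"
    and weak: "\<And>\<theta>. test_function {a<..<b} \<theta> \<Longrightarrow> (\<integral>t. partial_deriv 1 \<theta> t *\<^sub>R U t \<partial>lborel) = - (\<integral>t. \<theta> t *\<^sub>R W t \<partial>lborel)"
    and t: "a < t1" "t1 < t2" "t2 < b"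
  shows "U t2 - U t1 = (\<integral>t. indicator {t1<..t2} t *\<^sub>R W t \<partial>lborel)"
proof -
  obtain H :: "real \<Rightarrow> real" where H: "smooth H" "\<And>x. x \<le> 0 \<Longrightarrow> H x = 0" "\<And>x. 1 \<le> x \<Longrightarrow> H x = 1" "\<And>x y. x \<le> y \<Longrightarrow> H x \<le> H y"
    using smooth_step by metis
  have H01: "0 \<le> H x" "H x \<le> 1" for x using H(2)[of "min x 0"] H(3)[of "max x 1"] H(4)[of "min x 0" x] H(4)[of x "max x 1"] by auto
  define \<eta> where "\<eta> = partial_deriv 1 H"
  have H': "(H has_real_derivative \<eta> t) (at t)" for t unfolding \<eta>_def by (rule real_smooth_derivative[OF H(1)])
  have s\<eta>: "smooth \<eta>" unfolding \<eta>_def by (rule smooth_partial[OF H(1)]) simp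
  have [measurable]: "\<eta> \<in> borel_measurable borel" "H \<in> borel_measurable borel" by (intro smooth_borel s\<eta> H)+
  have \<eta>0: "\<eta> x = 0" if "x \<notin> {0..1}" for x
  proof -
    have "\<exists>S k. open S \<and> x \<in> S \<and> (\<forall>y\<in>S. H y = k)"
    proof (cases "x < 0")
      case True then show ?thesis using H(2) by (intro exI[of _ "{..<0}"] exI[of _ 0]) auto
    next
      case False then have "x > 1" using that by auto
      then show ?thesis using H(3) by (intro exI[of _ "{1<..}"] exI[of _ 1]) auto
    qed
    then obtain S k where S: "open S" "x \<in> S" "\<And>y. y \<in> S \<Longrightarrow> H y = k" by blast
    then have "\<eta> x = partial_deriv 1 (\<lambda>x. k) x"
      unfolding \<eta>_def by (intro partial_deriv_cong_ev) (auto simp: eventually_nhds)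
    then show ?thesis by (simp add: partial_deriv_def)
  qed
  have \<eta>int: "integrable lborel \<eta>" "(\<integral>x. \<eta> x \<partial>lborel) = 1"
  proof -
    have eq: "indicator {0..1} x *\<^sub>R \<eta> x = \<eta> x" for x using \<eta>0[of x] by (cases "x \<in> {0..1}") auto
    have "integrable lborel (\<lambda>x. indicator {0..1} x *\<^sub>R \<eta> x)"
      by (rule borel_integrable_compact[OF compact_Icc]) (rule smooth_continuous[OF s\<eta>])
    then show "integrable lborel \<eta>" by (simp only: eq)
    have "(\<integral>x. indicator {0..1} x *\<^sub>R \<eta> x \<partial>lborel) = H 1 - H 0"
      by (rule integral_FTC_Icc)
        (auto intro!: smooth_continuous s\<eta> has_vector_derivative_at_within[OF H'[unfolded has_real_derivative_iff_has_vector_derivative]])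
    then show "(\<integral>x. \<eta> x \<partial>lborel) = 1" using H(2)[of 0] H(3)[of 1] by (simp only: eq)
  qed
  \<comment> \<open>the shift by \<open>m\<close> keeps the support of the test functions inside \<open>{a<..<b}\<close>\<close>
  obtain m :: nat where m: "1 / real (Suc m) < b - t2" using reals_Archimedean[of "b - t2"] t by (auto simp: inverse_eq_divide)
  define N where "N n = real (Suc (m + n))" for n
  have N: "N n > 0" "1 / N n < b - t2" for n
  proof -
    have "1 / N n \<le> 1 / real (Suc m)" unfolding N_def by (intro divide_left_mono) auto
    then show "1 / N n < b - t2" using m by linarith
    show "N n > 0" by (simp add: N_def)
  qed
  define \<theta> where "\<theta> n t = H (N n * (t - t1)) - H (N n * (t - t2))" for n t
  define g where "g n c t = N n * \<eta> (N n * (t - c))" for n c t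
  have \<theta>': "(\<theta> n has_real_derivative g n t1 t - g n t2 t) (at t)" for n t
  proof -
    have "((\<lambda>t. H (N n * (t - c))) has_real_derivative g n c t) (at t)" for c
      unfolding g_def by (rule DERIV_cong[OF DERIV_chain2[OF H']]) (auto intro!: derivative_eq_intros)
    then show ?thesis unfolding \<theta>_def[abs_def] by (intro DERIV_diff)
  qed
  have sg: "smooth (\<lambda>t. g n t1 t - g n t2 t)" for n
  proof -
    have "smooth (\<lambda>t. \<eta> (N n * (t - c)))" for c
      using smooth_affine[OF bounded_linear_mult_right[of "N n"] s\<eta>, of "- (N n * c)"] by (simp add: algebra_simps)
    then have "smooth (\<lambda>t. N n *\<^sub>R \<eta> (N n * (t - t1)) + (- N n) *\<^sub>R \<eta> (N n * (t - t2)))"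
      by (intro smooth_add smooth_scaleR smooth_const)
    then show ?thesis by (simp add: g_def)
  qed
  have s\<theta>: "smooth (\<theta> n)" "partial_deriv 1 (\<theta> n) = (\<lambda>t. g n t1 t - g n t2 t)" for n
    using smooth_realI[OF \<theta>' sg] by auto
  have \<theta>0: "\<theta> n t = 0" if "t \<notin> {t1..t2 + 1 / N n}" for n t
  proof (cases "t < t1")
    case True
    then show ?thesis using t N(1)[of n] by (simp add: \<theta>_def H(2) mult_nonneg_nonpos)
  next
    case False
    then have "t > t2 + 1 / N n" using that by auto
    then have "1 \<le> N n * (t - t2)" using N(1)[of n] by (simp add: field_simps)
    moreover have "N n * (t - t2) \<le> N n * (t - t1)" using t N(1)[of n] by (intro mult_left_mono) auto
    ultimately show ?thesis by (simp add: \<theta>_def H(3))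
  qed
  have test: "test_function {a<..<b} (\<theta> n)" for n
  proof -
    have "closure {t. \<theta> n t \<noteq> 0} \<subseteq> {t1..t2 + 1 / N n}"
    proof (rule closure_minimal)
      show "{t. \<theta> n t \<noteq> 0} \<subseteq> {t1..t2 + 1 / N n}"
      proof
        fix t assume "t \<in> {t. \<theta> n t \<noteq> 0}"
        then show "t \<in> {t1..t2 + 1 / N n}" using \<theta>0[of t n] by blast
      qed
    qed simp
    moreover have "{t1..t2 + 1 / N n} \<subseteq> {a<..<b}" using t N(2)[of n] by auto
    moreover have "compact (closure {t. \<theta> n t \<noteq> 0})"
      using calculation(1) by (meson bounded_closed_interval bounded_subset closed_closure compact_eq_bounded_closed bounded_cbox compact_Icc compact_imp_bounded)
    ultimately show ?thesis using s\<theta> by (auto simp: test_function_def)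
  qed
  obtain B where B: "\<And>t. t \<in> {a..b} \<Longrightarrow> norm (U t) \<le> B" "B \<ge> 0"
  proof -
    have "bounded (U ` {a..b})" by (intro compact_imp_bounded compact_continuous_image U compact_Icc)
    then obtain B where "\<forall>y\<in>U ` {a..b}. norm y \<le> B" by (auto simp: bounded_iff)
    then show thesis by (intro that[of "max B 0"]) (auto simp: le_max_iff_disj)
  qed
  have inside: "c + s / N n \<in> {a..b}" if "s \<in> {0..1}" "t1 \<le> c" "c \<le> t2" for s c n
  proof -
    have "s / N n \<le> 1 / N n" "0 \<le> s / N n" using that N(1)[of n] by (auto intro!: divide_right_mono)
    then show ?thesis using that t N(2)[of n] by auto
  qed
  have g_int: "(\<integral>t. g n c t *\<^sub>R U t \<partial>lborel) = (\<integral>s. \<eta> s *\<^sub>R U (c + s / N n) \<partial>lborel)" for n c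
  proof -
    have "(\<integral>t. g n c t *\<^sub>R U t \<partial>lborel) = \<bar>1 / N n\<bar> *\<^sub>R (\<integral>s. g n c (c + 1 / N n * s) *\<^sub>R U (c + 1 / N n * s) \<partial>lborel)"
      by (rule lborel_integral_real_affine) (use N(1)[of n] in simp)
    also have "(\<integral>s. g n c (c + 1 / N n * s) *\<^sub>R U (c + 1 / N n * s) \<partial>lborel) = (\<integral>s. N n *\<^sub>R (\<eta> s *\<^sub>R U (c + s / N n)) \<partial>lborel)"
      using N(1)[of n] by (simp add: g_def)
    also have "\<dots> = N n *\<^sub>R (\<integral>s. \<eta> s *\<^sub>R U (c + s / N n) \<partial>lborel)" by (rule integral_scaleR_right)
    finally show ?thesis using N(1)[of n] by simp
  qed
  have meas: "(\<lambda>s. \<eta> s *\<^sub>R U (c + s / N n)) \<in> borel_measurable lborel" if "t1 \<le> c" "c \<le> t2" for c n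
  proof -
    have "continuous_on {0..1} (\<lambda>s. \<eta> s *\<^sub>R U (c + s / N n))"
      by (intro continuous_intros smooth_continuous s\<eta> continuous_on_compose2[OF U]) (use inside that N(1)[of n] in auto)
    then have "(\<lambda>s. indicator {0..1} s *\<^sub>R (\<eta> s *\<^sub>R U (c + s / N n))) \<in> borel_measurable borel"
      by (intro borel_measurable_continuous_on_indicator) auto
    moreover have "(\<lambda>s. indicator {0..1} s *\<^sub>R (\<eta> s *\<^sub>R U (c + s / N n))) = (\<lambda>s. \<eta> s *\<^sub>R U (c + s / N n))"
    proof
      fix s show "indicator {0..1} s *\<^sub>R (\<eta> s *\<^sub>R U (c + s / N n)) = \<eta> s *\<^sub>R U (c + s / N n)"
        using \<eta>0[of s] by (cases "s \<in> {0..1}") auto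
    qed
    ultimately show ?thesis by (simp only: measurable_lborel2)
  qed
  have bnd: "norm (\<eta> s *\<^sub>R U (c + s / N n)) \<le> B * \<bar>\<eta> s\<bar>" if "t1 \<le> c" "c \<le> t2" for c n s
  proof (cases "s \<in> {0..1}")
    case True
    then show ?thesis using mult_left_mono[OF B(1)[OF inside[OF True that, of n]], of "\<bar>\<eta> s\<bar>"] by (simp add: mult.commute)
  qed (simp add: \<eta>0)
  have \<eta>U: "integrable lborel (\<lambda>s. \<eta> s *\<^sub>R U (c + s / N n))" if "t1 \<le> c" "c \<le> t2" for c n
    by (rule Bochner_Integration.integrable_bound[of _ "\<lambda>s. B * \<bar>\<eta> s\<bar>"])
      (use \<eta>int meas[OF that] bnd[OF that] B in \<open>auto intro: AE_I2\<close>)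
  have lim: "(\<lambda>n. \<integral>s. \<eta> s *\<^sub>R U (c + s / N n) \<partial>lborel) \<longlonglongrightarrow> U c" if c: "t1 \<le> c" "c \<le> t2" for c
  proof -
    have "(\<lambda>n. \<integral>s. \<eta> s *\<^sub>R U (c + s / N n) \<partial>lborel) \<longlonglongrightarrow> (\<integral>s. \<eta> s *\<^sub>R U c \<partial>lborel)"
    proof (rule integral_dominated_convergence[where w = "\<lambda>s. B * \<bar>\<eta> s\<bar>"])
      show "(\<lambda>s. \<eta> s *\<^sub>R U (c + s / N n)) \<in> borel_measurable lborel" for n by (rule meas[OF c])
      show "AE s in lborel. norm (\<eta> s *\<^sub>R U (c + s / N n)) \<le> B * \<bar>\<eta> s\<bar>" for n by (intro AE_I2 bnd c)
      show "AE s in lborel. (\<lambda>n. \<eta> s *\<^sub>R U (c + s / N n)) \<longlonglongrightarrow> \<eta> s *\<^sub>R U c"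
      proof (rule AE_I2)
        fix s :: real
        show "(\<lambda>n. \<eta> s *\<^sub>R U (c + s / N n)) \<longlonglongrightarrow> \<eta> s *\<^sub>R U c"
        proof (cases "s \<in> {0..1}")
          case True
          have "(\<lambda>n. inverse (real (Suc n))) \<longlonglongrightarrow> 0" by (rule LIMSEQ_inverse_real_of_nat)
          from LIMSEQ_ignore_initial_segment[OF this, of m]
          have "(\<lambda>n. inverse (N n)) \<longlonglongrightarrow> 0" by (simp add: N_def add.commute)
          then have "(\<lambda>n. c + s * inverse (N n)) \<longlonglongrightarrow> c + s * 0" by (intro tendsto_intros)
          then have "(\<lambda>n. c + s / N n) \<longlonglongrightarrow> c" by (simp add: divide_inverse)
          then have "(\<lambda>n. U (c + s / N n)) \<longlonglongrightarrow> U c"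
            by (rule continuous_on_tendsto_compose[OF U]) (use inside[OF True c] c t in auto)
          then show ?thesis by (intro tendsto_intros)
        qed (simp add: \<eta>0)
      qed
    qed (use \<eta>int in auto)
    then show ?thesis using \<eta>int by simp
  qed
  have "(\<integral>t. partial_deriv 1 (\<theta> n) t *\<^sub>R U t \<partial>lborel) = (\<integral>s. \<eta> s *\<^sub>R U (t1 + s / N n) \<partial>lborel) - (\<integral>s. \<eta> s *\<^sub>R U (t2 + s / N n) \<partial>lborel)" for n
  proof -
    have gi: "integrable lborel (\<lambda>t. g n c t *\<^sub>R U t)" if "t1 \<le> c" "c \<le> t2" for c
    proof -
      have "integrable lborel (\<lambda>t. N n *\<^sub>R (\<eta> (- (N n * c) + N n * t) *\<^sub>R U (c + (- (N n * c) + N n * t) / N n)))"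
        using N(1)[of n] by (intro integrable_scaleR_right lborel_integrable_real_affine[OF \<eta>U[OF that, of n]]) simp
      moreover have "c + (- (N n * c) + N n * t) / N n = t" for t using N(1)[of n] by (simp add: field_simps)
      ultimately show ?thesis by (simp add: g_def algebra_simps)
    qed
    have "(\<integral>t. partial_deriv 1 (\<theta> n) t *\<^sub>R U t \<partial>lborel) = (\<integral>t. g n t1 t *\<^sub>R U t - g n t2 t *\<^sub>R U t \<partial>lborel)"
      by (simp add: s\<theta> scaleR_diff_left)
    also have "\<dots> = (\<integral>t. g n t1 t *\<^sub>R U t \<partial>lborel) - (\<integral>t. g n t2 t *\<^sub>R U t \<partial>lborel)"
      by (rule Bochner_Integration.integral_diff) (intro gi; use t in simp)+
    finally show ?thesis by (simp only: g_int)
  qed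
  then have eq: "(\<integral>s. \<eta> s *\<^sub>R U (t1 + s / N n) \<partial>lborel) - (\<integral>s. \<eta> s *\<^sub>R U (t2 + s / N n) \<partial>lborel) = - (\<integral>t. \<theta> n t *\<^sub>R W t \<partial>lborel)" for n
    using weak[OF test[of n]] by simp
  have "(\<lambda>n. - (\<integral>t. \<theta> n t *\<^sub>R W t \<partial>lborel)) \<longlonglongrightarrow> U t1 - U t2"
    unfolding eq[symmetric] using t by (intro tendsto_diff lim) auto
  moreover have "(\<lambda>n. - (\<integral>t. \<theta> n t *\<^sub>R W t \<partial>lborel)) \<longlonglongrightarrow> - (\<integral>t. indicator {t1<..t2} t *\<^sub>R W t \<partial>lborel)"
  proof -
    let ?W = "\<lambda>t. indicator {a<..<b} t *\<^sub>R W t"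
    have e1: "\<theta> n t *\<^sub>R W t = \<theta> n t *\<^sub>R ?W t" for n t
      using \<theta>0[where n = n and t = t] t N(2)[of n] by (cases "t \<in> {a<..<b}") auto
    have e2: "indicator {t1<..t2} t *\<^sub>R W t = indicator {t1<..t2} t *\<^sub>R ?W t" for t
      using t by (auto simp: indicator_def)
    have [measurable]: "?W \<in> borel_measurable borel" using W by auto
    have [measurable]: "\<theta> n \<in> borel_measurable borel" for n by (intro smooth_borel s\<theta>)
    have "(\<lambda>n. \<integral>t. \<theta> n t *\<^sub>R ?W t \<partial>lborel) \<longlonglongrightarrow> (\<integral>t. indicator {t1<..t2} t *\<^sub>R ?W t \<partial>lborel)"
    proof (rule integral_dominated_convergence[where w = "\<lambda>t. norm (?W t)"])
      show "AE t in lborel. norm (\<theta> n t *\<^sub>R ?W t) \<le> norm (?W t)" for n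
      proof (rule AE_I2)
        fix t
        have "\<bar>\<theta> n t\<bar> \<le> 1" using H01[of "N n * (t - t1)"] H01[of "N n * (t - t2)"] by (simp add: \<theta>_def abs_le_iff)
        then have "\<bar>\<theta> n t\<bar> * norm (?W t) \<le> 1 * norm (?W t)" by (intro mult_right_mono) auto
        then show "norm (\<theta> n t *\<^sub>R ?W t) \<le> norm (?W t)" by (simp only: norm_scaleR mult_1)
      qed
      show "AE t in lborel. (\<lambda>n. \<theta> n t *\<^sub>R ?W t) \<longlonglongrightarrow> indicator {t1<..t2} t *\<^sub>R ?W t"
      proof (rule AE_I2)
        fix t
        have Hl: "(\<lambda>n. H (N n * (t - c))) \<longlonglongrightarrow> (if t > c then 1 else 0)" for c
        proof (cases "t > c")
          case True
          obtain k :: nat where k: "1 / (t - c) < real k" using reals_Archimedean2 by blast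
          have "eventually (\<lambda>n. H (N n * (t - c)) = 1) sequentially"
            unfolding eventually_sequentially
          proof (intro exI[of _ k] allI impI)
            fix n assume "k \<le> n"
            then have "1 / (t - c) \<le> N n" using k by (simp add: N_def)
            then have "1 \<le> N n * (t - c)" using True by (simp add: field_simps)
            then show "H (N n * (t - c)) = 1" by (rule H(3))
          qed
          then show ?thesis using True by (simp add: tendsto_eventually)
        next
          case False
          then have "H (N n * (t - c)) = 0" for n using N(1)[of n] by (intro H(2)) (simp add: mult_nonneg_nonpos)
          then show ?thesis using False by simp
        qed
        have "(\<lambda>n. \<theta> n t) \<longlonglongrightarrow> (if t > t1 then 1 else 0) - (if t > t2 then 1 else 0)"
          unfolding \<theta>_def by (intro tendsto_diff Hl)
        also have "(if t > t1 then 1 else 0) - (if t > t2 then 1 else 0) = (indicator {t1<..t2} t :: real)"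
          using t by (auto simp: indicator_def)
        finally show "(\<lambda>n. \<theta> n t *\<^sub>R ?W t) \<longlonglongrightarrow> indicator {t1<..t2} t *\<^sub>R ?W t" by (intro tendsto_intros)
      qed
      show "integrable lborel (\<lambda>t. norm (?W t))" by (rule integrable_norm[OF W])
    qed measurable
    then show ?thesis unfolding e1 e2 by (rule tendsto_minus)
  qed
  ultimately have "U t1 - U t2 = - (\<integral>t. indicator {t1<..t2} t *\<^sub>R W t \<partial>lborel)" by (rule LIMSEQ_unique)
  then show ?thesis by (simp add: algebra_simps)
qed

lemma test_function_product:
  fixes \<theta> :: "real \<Rightarrow> real" and \<rho> :: "'a::euclidean_space \<Rightarrow> real"
  assumes \<theta>: "test_function {a<..<b} \<theta>" and \<rho>: "test_function UNIV \<rho>"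
  shows "test_function ({a<..<b} \<times> UNIV) (\<lambda>z. \<theta> (fst z) * \<rho> (snd z))"
    and "partial_deriv (1, 0) (\<lambda>z. \<theta> (fst z) * \<rho> (snd z)) (t, x) = partial_deriv 1 \<theta> t * \<rho> x"
proof -
  have s: "smooth \<theta>" "smooth \<rho>" using \<theta> \<rho> by (auto simp: test_function_def)
  have "smooth (\<lambda>z::real \<times> 'a. \<theta> (fst z))" "smooth (\<lambda>z::real \<times> 'a. \<rho> (snd z))"
    using smooth_affine[OF bounded_linear_fst s(1), of 0] smooth_affine[OF bounded_linear_snd s(2), of 0] by simp_all
  then have sm: "smooth (\<lambda>z. \<theta> (fst z) * \<rho> (snd z))" by (rule smooth_mult)
  have sub: "closure {z. \<theta> (fst z) * \<rho> (snd z) \<noteq> 0} \<subseteq> closure {t. \<theta> t \<noteq> 0} \<times> closure {x. \<rho> x \<noteq> 0}"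
    unfolding closure_Times[symmetric] by (intro closure_mono) auto
  have "compact (closure {t. \<theta> t \<noteq> 0} \<times> closure {x. \<rho> x \<noteq> 0} \<inter> closure {z. \<theta> (fst z) * \<rho> (snd z) \<noteq> 0})"
    using \<theta> \<rho> by (intro compact_Int_closed compact_Times) (auto simp: test_function_def)
  also have "closure {t. \<theta> t \<noteq> 0} \<times> closure {x. \<rho> x \<noteq> 0} \<inter> closure {z. \<theta> (fst z) * \<rho> (snd z) \<noteq> 0} =
      closure {z. \<theta> (fst z) * \<rho> (snd z) \<noteq> 0}"
    using sub by blast
  finally have "compact (closure {z. \<theta> (fst z) * \<rho> (snd z) \<noteq> 0})" .
  moreover have "closure {z. \<theta> (fst z) * \<rho> (snd z) \<noteq> 0} \<subseteq> {a<..<b} \<times> UNIV"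
    using sub \<theta> unfolding test_function_def by blast
  ultimately show "test_function ({a<..<b} \<times> UNIV) (\<lambda>z. \<theta> (fst z) * \<rho> (snd z))"
    using sm by (simp add: test_function_def)
  have d: "((\<lambda>z. \<theta> (fst z)) has_derivative (\<lambda>h. frechet_derivative \<theta> (at t) (fst h))) (at (t, x))"
    using has_derivative_compose[OF has_derivative_fst[OF has_derivative_ident], of \<theta> _ "(t, x)" UNIV]
      has_derivative_frechet[OF smooth_differentiable[OF s(1)]] by simp
  have d': "((\<lambda>z. \<rho> (snd z)) has_derivative (\<lambda>h. frechet_derivative \<rho> (at x) (snd h))) (at (t, x))"
    using has_derivative_compose[OF has_derivative_snd[OF has_derivative_ident], of \<rho> _ "(t, x)" UNIV]
      has_derivative_frechet[OF smooth_differentiable[OF s(2)]] by simp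
  have "frechet_derivative \<rho> (at x) 0 = 0"
    using has_derivative_frechet[OF smooth_differentiable[OF s(2)], of x] by (intro linear_0 has_derivative_linear)
  then show "partial_deriv (1, 0) (\<lambda>z. \<theta> (fst z) * \<rho> (snd z)) (t, x) = partial_deriv 1 \<theta> t * \<rho> x"
    using partial_derivI[OF has_derivative_mult[OF d d'], of "(1, 0)"] by (simp add: partial_deriv_def)
qed

text \<open>
  \<open>2 |g| |w| \<le> |w|\<^sup>2 + |g|\<^sup>2\<close>, where both squares are integrable on the product of \<open>S\<close> with the space.
\<close>

lemma space_time_pairing:
  fixes w :: "real \<Rightarrow> 'a::euclidean_space \<Rightarrow> 'b::euclidean_space" and K :: "real \<Rightarrow> 'a \<Rightarrow> 'd::euclidean_space"
    and g :: "'a \<Rightarrow> 'e::euclidean_space"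
  assumes w: "integrable (lborel \<Otimes>\<^sub>M lborel) (\<lambda>(t, x). (norm (w t x))\<^sup>2)"
    and g: "L2 g" and S: "S \<in> sets borel" "emeasure lborel S < \<infinity>"
    and K: "(\<lambda>z. K (fst z) (snd z)) \<in> borel_measurable borel"
    and le: "\<And>t x. norm (K t x) \<le> indicator S t * (norm (g x) * norm (w t x))"
  shows "integrable (lborel \<Otimes>\<^sub>M lborel) (\<lambda>(t, x). K t x)"
    and "norm (\<integral>t. (\<integral>x. K t x \<partial>lborel) \<partial>lborel) \<le>
      (\<integral>t. indicator S t * (\<integral>x. (norm (w t x))\<^sup>2 \<partial>lborel) \<partial>lborel) / 2 + measure lborel S * (L2_norm g)\<^sup>2 / 2"
proof -
  have [measurable]: "S \<in> sets borel" "g \<in> borel_measurable borel" using S g by (auto simp: L2_def)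
  have [measurable]: "(\<lambda>(t, x). (norm (w t x))\<^sup>2) \<in> borel_measurable (lborel \<Otimes>\<^sub>M lborel)" using w by auto
  have [measurable]: "(\<lambda>z. K (fst z) (snd z)) \<in> borel_measurable (borel \<Otimes>\<^sub>M borel)" using K by (simp add: borel_prod)
  let ?A = "\<lambda>t x. indicator S t * (norm (w t x))\<^sup>2 :: real"
  let ?B = "\<lambda>t x. indicator S t * (norm (g x))\<^sup>2 :: real"
  have A: "integrable (lborel \<Otimes>\<^sub>M lborel) (\<lambda>(t, x). ?A t x)"
  proof (rule Bochner_Integration.integrable_bound[OF w])
    have "(\<lambda>z. indicator S (fst z) * (case z of (t, x) \<Rightarrow> (norm (w t x))\<^sup>2)) \<in> borel_measurable (lborel \<Otimes>\<^sub>M lborel)"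
      by measurable
    then show "(\<lambda>(t, x). ?A t x) \<in> borel_measurable (lborel \<Otimes>\<^sub>M lborel)" by (simp add: case_prod_unfold)
  qed (auto simp: indicator_def)
  have B: "integrable (lborel \<Otimes>\<^sub>M lborel) (\<lambda>(t, x). ?B t x)"
  proof (rule product_integrable_pair)
    show "(\<lambda>z. ?B (fst z) (snd z)) \<in> borel_measurable borel" unfolding borel_prod[symmetric] by measurable
    show "integrable lborel (\<lambda>t. indicator S t * (L2_norm g)\<^sup>2)" using S by (intro integrable_mult_left) simp
    show "(\<integral>\<^sup>+ x. ennreal (norm (?B t x)) \<partial>lborel) \<le> ennreal (indicator S t * (L2_norm g)\<^sup>2)" for t
      using nn2_eq[OF g] by (cases "t \<in> S") auto
  qed
  have bound: "norm (case z of (t, x) \<Rightarrow> K t x) \<le> ((case z of (t, x) \<Rightarrow> ?A t x) + (case z of (t, x) \<Rightarrow> ?B t x)) / 2" for z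
  proof (cases z)
    case (Pair t x)
    have "2 * (norm (g x) * norm (w t x)) \<le> (norm (w t x))\<^sup>2 + (norm (g x))\<^sup>2"
      using sum_squares_bound[of "norm (w t x)" "norm (g x)"] by (simp add: mult_ac)
    then show ?thesis using le[of t x] Pair by (cases "t \<in> S") auto
  qed
  have AB: "integrable (lborel \<Otimes>\<^sub>M lborel) (\<lambda>z. ((case z of (t, x) \<Rightarrow> ?A t x) + (case z of (t, x) \<Rightarrow> ?B t x)) / 2)"
    by (intro integrable_divide_zero Bochner_Integration.integrable_add A B)
  show int: "integrable (lborel \<Otimes>\<^sub>M lborel) (\<lambda>(t, x). K t x)"
  proof (rule Bochner_Integration.integrable_bound[OF AB])
    show "(\<lambda>(t, x). K t x) \<in> borel_measurable (lborel \<Otimes>\<^sub>M lborel)" unfolding case_prod_unfold by measurable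
  qed (use order_trans[OF bound abs_ge_self] in \<open>auto intro!: AE_I2 simp: real_norm_def\<close>)
  have "norm (\<integral>t. (\<integral>x. K t x \<partial>lborel) \<partial>lborel) = norm (integral\<^sup>L (lborel \<Otimes>\<^sub>M lborel) (\<lambda>(t, x). K t x))"
    by (simp only: lborel_pair.integral_fst[OF int])
  also have "\<dots> \<le> (\<integral>z. norm (case z of (t, x) \<Rightarrow> K t x) \<partial>(lborel \<Otimes>\<^sub>M lborel))"
    by (rule integral_norm_bound)
  also have "\<dots> \<le> (\<integral>z. ((case z of (t, x) \<Rightarrow> ?A t x) + (case z of (t, x) \<Rightarrow> ?B t x)) / 2 \<partial>(lborel \<Otimes>\<^sub>M lborel))"
    by (intro integral_mono integrable_norm int AB bound)
  also have "\<dots> = (integral\<^sup>L (lborel \<Otimes>\<^sub>M lborel) (\<lambda>(t, x). ?A t x) + integral\<^sup>L (lborel \<Otimes>\<^sub>M lborel) (\<lambda>(t, x). ?B t x)) / 2"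
    by (simp only: integral_divide_zero Bochner_Integration.integral_add[OF A B])
  also have "\<dots> = ((\<integral>t. (\<integral>x. ?A t x \<partial>lborel) \<partial>lborel) + (\<integral>t. (\<integral>x. ?B t x \<partial>lborel) \<partial>lborel)) / 2"
    by (simp only: lborel_pair.integral_fst[OF A] lborel_pair.integral_fst[OF B])
  also have "\<dots> = (\<integral>t. indicator S t * (\<integral>x. (norm (w t x))\<^sup>2 \<partial>lborel) \<partial>lborel) / 2 + measure lborel S * (L2_norm g)\<^sup>2 / 2"
    by (simp add: L2_norm_power2 add_divide_distrib)
  finally show "norm (\<integral>t. (\<integral>x. K t x \<partial>lborel) \<partial>lborel) \<le>
      (\<integral>t. indicator S t * (\<integral>x. (norm (w t x))\<^sup>2 \<partial>lborel) \<partial>lborel) / 2 + measure lborel S * (L2_norm g)\<^sup>2 / 2" .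
qed

lemma L2_norm_le_sobolev_norm: "L2_norm f \<le> sobolev_norm k f"
proof (rule power2_le_imp_le)
  show "(L2_norm f)\<^sup>2 \<le> (sobolev_norm k f)\<^sup>2"
    unfolding sobolev_norm_power2 by (cases k) (auto intro!: sum_nonneg sobolev_norm_sq_nonneg)
qed simp

lemma sobolev_1_diff:
  assumes f: "sobolev 1 f" and g: "sobolev 1 g"
  shows "sobolev 1 (\<lambda>x. f x - g x)"
    and "i \<in> Basis \<Longrightarrow> L2_norm (\<lambda>x. weak_deriv i f x - weak_deriv i g x) \<le> sobolev_norm 1 (\<lambda>x. f x - g x)"
proof -
  note F = sobolev_1D[OF f] and G = sobolev_1D[OF g]
  have 1: "L2 (\<lambda>x. weak_deriv i f x - weak_deriv i g x)" "has_weak_deriv i (\<lambda>x. f x - g x) (\<lambda>x. weak_deriv i f x - weak_deriv i g x)"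
    if "i \<in> Basis" for i
    using has_weak_deriv_diff[OF F(3)[OF that] G(3)[OF that] F(1) F(2)[OF that] G(1) G(2)[OF that] that]
      L2_diff(1)[OF F(2)[OF that] G(2)[OF that]] by auto
  show s: "sobolev 1 (\<lambda>x. f x - g x)" by (rule sobolev_1I[OF L2_diff(1)[OF F(1) G(1)] 1])
  assume i: "i \<in> Basis"
  have "(L2_norm (weak_deriv i (\<lambda>x. f x - g x)))\<^sup>2 \<le> (\<Sum>i\<in>Basis. (L2_norm (weak_deriv i (\<lambda>x. f x - g x)))\<^sup>2)"
    by (rule member_le_sum[OF i]) auto
  also have "\<dots> \<le> (sobolev_norm 1 (\<lambda>x. f x - g x))\<^sup>2" by (simp add: sobolev_norm_power2)
  finally have "L2_norm (weak_deriv i (\<lambda>x. f x - g x)) \<le> sobolev_norm 1 (\<lambda>x. f x - g x)" by (rule power2_le_imp_le) simp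
  then show "L2_norm (\<lambda>x. weak_deriv i f x - weak_deriv i g x) \<le> sobolev_norm 1 (\<lambda>x. f x - g x)"
    using weak_deriv_eq(4)[OF 1(2)[OF i] 1(1)[OF i]] by simp
qed

lemma continuous_H1_imp_continuous_on:
  fixes F :: "real \<Rightarrow> 'c::real_normed_vector"
  assumes u: "continuous_H1 I u" and C: "C \<ge> 0"
    and le: "\<And>r t. r \<in> I \<Longrightarrow> t \<in> I \<Longrightarrow> norm (F r - F t) \<le> C * sobolev_norm 1 (\<lambda>x. u r x - u t x)"
  shows "continuous_on I F"
  unfolding continuous_on_def
proof
  fix t assume t: "t \<in> I"
  have lim: "((\<lambda>r. C * sobolev_norm 1 (\<lambda>x. u r x - u t x)) \<longlongrightarrow> C * 0) (at t within I)"
    using u t unfolding continuous_H1_def by (intro tendsto_mult_left) blast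
  have "\<forall>\<^sub>F r in at t within I. norm (F r - F t) \<le> C * sobolev_norm 1 (\<lambda>x. u r x - u t x)"
    unfolding eventually_at_filter by (rule always_eventually) (use le t in blast)
  then have "((\<lambda>r. F r - F t) \<longlongrightarrow> 0) (at t within I)"
    by (rule Lim_null_comparison) (use lim in simp)
  then show "(F \<longlongrightarrow> F t) (at t within I)" by (rule LIM_zero_cancel)
qed

lemma continuous_dirichlet_energy:
  assumes u: "continuous_H1 I u"
  shows "continuous_on I (\<lambda>t. (L2_norm (norm_grad (u t)))\<^sup>2)"
proof -
  have s: "sobolev 1 (u t)" if "t \<in> I" for t using u that by (auto simp: continuous_H1_def simp del: sobolev.simps)
  have "continuous_on I (\<lambda>t. L2_norm (weak_deriv i (u t)))" if i: "i \<in> Basis" for i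
  proof (rule continuous_H1_imp_continuous_on[OF u zero_le_one])
    fix r t assume rt: "r \<in> I" "t \<in> I"
    have "\<bar>L2_norm (weak_deriv i (u r)) - L2_norm (weak_deriv i (u t))\<bar> \<le> L2_norm (\<lambda>x. weak_deriv i (u r) x - weak_deriv i (u t) x)"
      by (rule L2_norm_triangle_diff) (use s rt i sobolev_1D(2) in blast)+
    then show "norm (L2_norm (weak_deriv i (u r)) - L2_norm (weak_deriv i (u t))) \<le> 1 * sobolev_norm 1 (\<lambda>x. u r x - u t x)"
      using sobolev_1_diff(2)[OF s[OF rt(1)] s[OF rt(2)] i] by simp
  qed
  then have "continuous_on I (\<lambda>t. \<Sum>i\<in>Basis. (L2_norm (weak_deriv i (u t)))\<^sup>2)" by (intro continuous_intros) auto
  then show ?thesis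
    by (rule continuous_on_eq) (use norm_grad_L2(2)[OF s] in simp)
qed

text \<open>
  The form in which the weak time derivative is used: tests with products only, and \<open>w\<close> set to zero
  outside the time interval. The spatial integral of \<open>\<rho> u(t)\<close> is a continuous function of time, whereas
  \<open>u\<close> need not be jointly measurable.
\<close>

locale weak_time_derivative =
  fixes a b :: real and u w :: "real \<Rightarrow> 'a::euclidean_space \<Rightarrow> 'b::euclidean_space"
  assumes H1: "continuous_H1 {a..b} u"
    and borel: "(\<lambda>z. w (fst z) (snd z)) \<in> borel_measurable borel"
    and integrable: "integrable (lborel \<Otimes>\<^sub>M lborel) (\<lambda>(t, x). (norm (w t x))\<^sup>2)"
    and vanish: "\<And>t x. t \<notin> {a<..<b} \<Longrightarrow> w t x = 0"
    and weak: "\<And>\<theta> \<rho>. test_function {a<..<b} \<theta> \<Longrightarrow> test_function UNIV \<rho> \<Longrightarrow>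
      (\<integral>t. partial_deriv 1 \<theta> t *\<^sub>R (\<integral>x. \<rho> x *\<^sub>R u t x \<partial>lborel) \<partial>lborel) = - (\<integral>t. \<theta> t *\<^sub>R (\<integral>x. \<rho> x *\<^sub>R w t x \<partial>lborel) \<partial>lborel)"
begin

lemma sobolev_u: "t \<in> {a..b} \<Longrightarrow> sobolev 1 (u t)"
  using H1 by (auto simp: continuous_H1_def simp del: sobolev.simps)

lemma L2_u: "t \<in> {a..b} \<Longrightarrow> L2 (u t)"
  using sobolev_u sobolev_1D(1) by blast

lemma tested_increment:
  assumes \<rho>: "test_function UNIV \<rho>" and t: "a < t1" "t1 < t2" "t2 < b"
  shows "(\<integral>x. \<rho> x *\<^sub>R (u t2 x - u t1 x) \<partial>lborel) = (\<integral>t. indicator {t1<..t2} t *\<^sub>R (\<integral>x. \<rho> x *\<^sub>R w t x \<partial>lborel) \<partial>lborel)"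
proof -
  have L\<rho>: "L2 \<rho>" by (rule test_function_L2[OF \<rho>])
  have [measurable]: "\<rho> \<in> borel_measurable borel" using L\<rho> by (auto simp: L2_def)
  note [measurable] = borel_pair_arg[OF borel]
  let ?U = "\<lambda>t. \<integral>x. \<rho> x *\<^sub>R u t x \<partial>lborel" and ?W = "\<lambda>t. \<integral>x. \<rho> x *\<^sub>R w t x \<partial>lborel"
  have diff: "(\<integral>x. \<rho> x *\<^sub>R (u r x - u t x) \<partial>lborel) = ?U r - ?U t" if "r \<in> {a..b}" "t \<in> {a..b}" for r t
    using L2_scaleR_integrable[OF L\<rho> L2_u] that by (simp add: scaleR_diff_right)
  have U: "continuous_on {a..b} ?U"
  proof (rule continuous_H1_imp_continuous_on[OF H1])
    fix r t assume rt: "r \<in> {a..b}" "t \<in> {a..b}"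
    have "norm (?U r - ?U t) \<le> L2_norm \<rho> * L2_norm (\<lambda>x. u r x - u t x)"
      using L2_scaleR_le[OF L\<rho> L2_diff(1)[OF L2_u[OF rt(1)] L2_u[OF rt(2)]]] diff[OF rt] by simp
    then show "norm (?U r - ?U t) \<le> L2_norm \<rho> * sobolev_norm 1 (\<lambda>x. u r x - u t x)"
      using mult_left_mono[OF L2_norm_le_sobolev_norm[of "\<lambda>x. u r x - u t x" 1] L2_norm_nonneg[of \<rho>]] by linarith
  qed simp
  have "integrable (lborel \<Otimes>\<^sub>M lborel) (\<lambda>(t, x). indicator {a<..<b} t *\<^sub>R \<rho> x *\<^sub>R w t x)"
  proof (rule space_time_pairing(1)[OF integrable L\<rho>, where S = "{a<..<b}"])
    show "(\<lambda>z. indicator {a<..<b} (fst z) *\<^sub>R \<rho> (snd z) *\<^sub>R w (fst z) (snd z)) \<in> borel_measurable borel"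
      unfolding borel_prod[symmetric] by measurable
  qed (use t in \<open>auto simp: indicator_def\<close>)
  from lborel_pair.integrable_fst[OF this] have "integrable lborel (\<lambda>t. indicator {a<..<b} t *\<^sub>R ?W t)"
    by (simp only: integral_scaleR_right)
  then have "?U t2 - ?U t1 = (\<integral>t. indicator {t1<..t2} t *\<^sub>R ?W t \<partial>lborel)"
    by (rule increment_eq_integral_weak[OF U _ weak[OF _ \<rho>] t])
  then show ?thesis using diff[of t2 t1] t by simp
qed

text \<open>
  Both sides have the same integral against every spatial test function.
\<close>

lemma increment_AE:
  assumes t: "a < t1" "t1 < t2" "t2 < b"
  shows "AE x in lborel. u t2 x - u t1 x = (\<integral>t. indicator {t1<..t2} t *\<^sub>R w t x \<partial>lborel)"
proof -
  let ?h = "\<lambda>x. \<integral>t. indicator {t1<..t2} t *\<^sub>R w t x \<partial>lborel"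
  note [measurable] = borel_pair_arg[OF borel]
  have d: "L2 (\<lambda>x. u t2 x - u t1 x)" by (intro L2_diff L2_u) (use t in auto)
  have h[measurable]: "?h \<in> borel_measurable borel" by measurable
  have "AE x in lborel. (u t2 x - u t1 x) - ?h x = 0"
  proof (rule fundamental_lemma)
    show "(\<lambda>x. (u t2 x - u t1 x) - ?h x) \<in> borel_measurable borel" using d h by (auto simp: L2_def)
    fix \<rho> :: "'a \<Rightarrow> real" assume \<rho>: "test_function UNIV \<rho>"
    have L\<rho>: "L2 \<rho>" by (rule test_function_L2[OF \<rho>])
    have [measurable]: "\<rho> \<in> borel_measurable borel" using L\<rho> by (auto simp: L2_def)
    have int: "integrable (lborel \<Otimes>\<^sub>M lborel) (\<lambda>(t, x). indicator {t1<..t2} t *\<^sub>R \<rho> x *\<^sub>R w t x)"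
    proof (rule space_time_pairing(1)[OF integrable L\<rho>, where S = "{t1<..t2}"])
      show "(\<lambda>z. indicator {t1<..t2} (fst z) *\<^sub>R \<rho> (snd z) *\<^sub>R w (fst z) (snd z)) \<in> borel_measurable borel"
        unfolding borel_prod[symmetric] by measurable
    qed (use t in \<open>auto simp: indicator_def\<close>)
    have eq: "(\<integral>t. indicator {t1<..t2} t *\<^sub>R \<rho> x *\<^sub>R w t x \<partial>lborel) = \<rho> x *\<^sub>R ?h x" for x
    proof -
      have "(\<integral>t. indicator {t1<..t2} t *\<^sub>R \<rho> x *\<^sub>R w t x \<partial>lborel) = (\<integral>t. \<rho> x *\<^sub>R (indicator {t1<..t2} t *\<^sub>R w t x) \<partial>lborel)"
        by (simp only: scaleR_left_commute)
      then show ?thesis by (simp only: integral_scaleR_right)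
    qed
    have ih: "integrable lborel (\<lambda>x. \<rho> x *\<^sub>R ?h x)"
      using lborel_pair.integrable_snd[OF int] by (simp only: eq)
    have id: "integrable lborel (\<lambda>x. \<rho> x *\<^sub>R (u t2 x - u t1 x))" by (rule L2_scaleR_integrable[OF L\<rho> d])
    have "(\<integral>x. \<rho> x *\<^sub>R (u t2 x - u t1 x) \<partial>lborel) = (\<integral>t. (\<integral>x. indicator {t1<..t2} t *\<^sub>R \<rho> x *\<^sub>R w t x \<partial>lborel) \<partial>lborel)"
      using tested_increment[OF \<rho> t] by (simp only: integral_scaleR_right)
    also have "\<dots> = (\<integral>x. \<rho> x *\<^sub>R ?h x \<partial>lborel)"
      using lborel_pair.Fubini_integral[OF int] by (simp only: eq)
    finally have "(\<integral>x. \<rho> x *\<^sub>R (u t2 x - u t1 x) \<partial>lborel) = (\<integral>x. \<rho> x *\<^sub>R ?h x \<partial>lborel)" .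
    then show "integrable lborel (\<lambda>x. \<rho> x *\<^sub>R ((u t2 x - u t1 x) - ?h x)) \<and> (\<integral>x. \<rho> x *\<^sub>R ((u t2 x - u t1 x) - ?h x) \<partial>lborel) = 0"
      unfolding scaleR_diff_right[of _ "_ - _"] using ih id by simp
  qed
  then show ?thesis by simp
qed

lemma increment_inner_le:
  assumes t: "a < t1" "t1 < t2" "t2 < b" and v: "L2 v"
  shows "\<bar>\<integral>x. (u t2 x - u t1 x) \<bullet> v x \<partial>lborel\<bar> \<le>
    (\<integral>t. indicator {t1<..t2} t * (\<integral>x. (norm (w t x))\<^sup>2 \<partial>lborel) \<partial>lborel) / 2 + (t2 - t1) * (L2_norm v)\<^sup>2 / 2"
proof -
  let ?h = "\<lambda>x. \<integral>t. indicator {t1<..t2} t *\<^sub>R w t x \<partial>lborel"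
  note [measurable] = borel_pair_arg[OF borel]
  have [measurable]: "v \<in> borel_measurable borel" using v by (auto simp: L2_def)
  have d: "L2 (\<lambda>x. u t2 x - u t1 x)" by (intro L2_diff L2_u) (use t in auto)
  note [measurable] = L2_borel[OF d]
  have S: "{t1<..t2} \<in> sets borel" "emeasure lborel {t1<..t2} < \<infinity>" using t by auto
  have mK: "(\<lambda>z. indicator {t1<..t2} (fst z) * (w (fst z) (snd z) \<bullet> v (snd z))) \<in> borel_measurable borel"
      "(\<lambda>z. indicator {t1<..t2} (fst z) *\<^sub>R norm (v (snd z)) *\<^sub>R w (fst z) (snd z)) \<in> borel_measurable borel"
    unfolding borel_prod[symmetric] by measurable
  have leK: "norm (indicator {t1<..t2} t * (w t x \<bullet> v x)) \<le> indicator {t1<..t2} t * (norm (v x) * norm (w t x))" for t x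
    using Cauchy_Schwarz_ineq2[of "w t x" "v x"] by (auto simp: indicator_def mult.commute)
  note K = space_time_pairing[OF integrable v S mK(1) leK]
  have "integrable (lborel \<Otimes>\<^sub>M lborel) (\<lambda>(t, x). indicator {t1<..t2} t *\<^sub>R norm (v x) *\<^sub>R w t x)"
    by (rule space_time_pairing(1)[OF integrable v S mK(2)]) (auto simp: indicator_def)
  then have iw: "AE x in lborel. integrable lborel (\<lambda>t. indicator {t1<..t2} t *\<^sub>R norm (v x) *\<^sub>R w t x)"
    by (rule lborel_pair.AE_integrable_snd)
  have mh: "?h \<in> borel_measurable borel" by measurable
  have "(\<integral>x. (u t2 x - u t1 x) \<bullet> v x \<partial>lborel) = (\<integral>x. (\<integral>t. indicator {t1<..t2} t * (w t x \<bullet> v x) \<partial>lborel) \<partial>lborel)"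
  proof (rule integral_cong_AE)
    show "AE x in lborel. (u t2 x - u t1 x) \<bullet> v x = (\<integral>t. indicator {t1<..t2} t * (w t x \<bullet> v x) \<partial>lborel)"
      using increment_AE[OF t] iw
    proof eventually_elim
      case (elim x)
      show ?case
      proof (cases "v x = 0")
        case False
        have "integrable lborel (\<lambda>t. (1 / norm (v x)) *\<^sub>R (indicator {t1<..t2} t *\<^sub>R norm (v x) *\<^sub>R w t x))"
          by (rule integrable_scaleR_right) (rule elim(2))
        then have "integrable lborel (\<lambda>t. indicator {t1<..t2} t *\<^sub>R w t x)" using False by (simp add: mult.commute)
        then have "(\<integral>t. (indicator {t1<..t2} t *\<^sub>R w t x) \<bullet> v x \<partial>lborel) = ?h x \<bullet> v x" by (rule integral_inner_left)
        then show ?thesis using elim(1) by simp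
      qed simp
    qed
  qed measurable
  also have "\<dots> = (\<integral>t. (\<integral>x. indicator {t1<..t2} t * (w t x \<bullet> v x) \<partial>lborel) \<partial>lborel)"
    by (rule lborel_pair.Fubini_integral[OF K(1)])
  finally show ?thesis using K(2) t by simp
qed

text \<open>
  \<open>\<parallel>\<nabla>f\<parallel>\<^sup>2 - \<parallel>\<nabla>g\<parallel>\<^sup>2\<close> is the pairing of \<open>\<nabla>(f - g)\<close> with \<open>\<nabla>(f + g)\<close>; moving one derivative over
  leaves \<open>f - g\<close>, an increment of \<open>u\<close> controlled by \<open>\<partial>\<^sub>t u\<close>, against \<open>\<Delta>(f + g)\<close>.
\<close>

lemma dirichlet_energy_increment_le:
  assumes t: "a < t1" "t1 < t2" "t2 < b" and s1: "sobolev 2 (u t1)" and s2: "sobolev 2 (u t2)"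
  shows "\<bar>(L2_norm (norm_grad (u t2)))\<^sup>2 - (L2_norm (norm_grad (u t1)))\<^sup>2\<bar> \<le>
    (\<integral>t. indicator {t1<..t2} t * (\<integral>x. (norm (w t x))\<^sup>2 \<partial>lborel) \<partial>lborel) / 2
      + (t2 - t1) * ((L2_norm (laplacian (u t1)))\<^sup>2 + (L2_norm (laplacian (u t2)))\<^sup>2)"
proof -
  let ?f = "u t2" and ?g = "u t1"
  note F = sobolev_1D[OF sobolev_2D(1)[OF s2]] and G = sobolev_1D[OF sobolev_2D(1)[OF s1]]
  note FF = sobolev_1D[OF sobolev_2D(2)[OF s2]] and GG = sobolev_1D[OF sobolev_2D(2)[OF s1]]
  have d: "L2 (\<lambda>x. ?f x - ?g x)" by (rule L2_diff[OF F(1) G(1)])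
  let ?v = "\<lambda>x. laplacian ?f x + laplacian ?g x"
  note l = laplacian_L2[OF s2] laplacian_L2[OF s1]
  have v: "L2 ?v" by (rule L2_add[OF l])
  let ?p = "\<lambda>i x. weak_deriv i (weak_deriv i ?f) x + weak_deriv i (weak_deriv i ?g) x"
  have p: "L2 (?p i)" if "i \<in> Basis" for i by (intro L2_add FF(2) GG(2) that)
  have "(L2_norm (weak_deriv i ?f))\<^sup>2 - (L2_norm (weak_deriv i ?g))\<^sup>2 = - (\<integral>x. (?f x - ?g x) \<bullet> ?p i x \<partial>lborel)" if i: "i \<in> Basis" for i
  proof -
    have "(L2_norm (weak_deriv i ?f))\<^sup>2 - (L2_norm (weak_deriv i ?g))\<^sup>2 =
        (\<integral>x. weak_deriv i ?f x \<bullet> weak_deriv i ?f x - weak_deriv i ?g x \<bullet> weak_deriv i ?g x \<partial>lborel)"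
      unfolding L2_norm_inner
      by (rule Bochner_Integration.integral_diff[symmetric]; rule L2_inner_integrable) (intro F(2) G(2) i)+
    also have "\<dots> = (\<integral>x. (weak_deriv i ?f x - weak_deriv i ?g x) \<bullet> (weak_deriv i ?f x + weak_deriv i ?g x) \<partial>lborel)"
      by (intro Bochner_Integration.integral_cong refl) (simp add: inner_diff_left inner_diff_right inner_add_left inner_add_right inner_commute)
    also have "\<dots> = - (\<integral>x. (?f x - ?g x) \<bullet> ?p i x \<partial>lborel)"
      by (rule weak_integration_by_parts)
        (use F G FF GG i in \<open>auto intro!: has_weak_deriv_diff has_weak_deriv_add L2_diff(1) L2_add(1)\<close>)
    finally show ?thesis .
  qed
  then have "(L2_norm (norm_grad ?f))\<^sup>2 - (L2_norm (norm_grad ?g))\<^sup>2 = - (\<Sum>i\<in>Basis. (\<integral>x. (?f x - ?g x) \<bullet> ?p i x \<partial>lborel))"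
    unfolding norm_grad_L2(2)[OF sobolev_2D(1)[OF s2]] norm_grad_L2(2)[OF sobolev_2D(1)[OF s1]]
    by (simp add: sum_subtractf[symmetric] sum_negf)
  also have "(\<Sum>i\<in>Basis. (\<integral>x. (?f x - ?g x) \<bullet> ?p i x \<partial>lborel)) = (\<integral>x. (\<Sum>i\<in>Basis. (?f x - ?g x) \<bullet> ?p i x) \<partial>lborel)"
    by (rule Bochner_Integration.integral_sum[symmetric]) (rule L2_inner_integrable[OF d p])
  also have "\<dots> = (\<integral>x. (?f x - ?g x) \<bullet> ?v x \<partial>lborel)"
    by (simp add: laplacian_def inner_sum_right[symmetric] sum.distrib)
  finally have "\<bar>(L2_norm (norm_grad ?f))\<^sup>2 - (L2_norm (norm_grad ?g))\<^sup>2\<bar> = \<bar>\<integral>x. (?f x - ?g x) \<bullet> ?v x \<partial>lborel\<bar>" by simp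
  moreover have *: "(L2_norm ?v)\<^sup>2 / 2 \<le> (L2_norm (laplacian ?g))\<^sup>2 + (L2_norm (laplacian ?f))\<^sup>2"
  proof -
    have "(L2_norm ?v)\<^sup>2 \<le> (L2_norm (laplacian ?f) + L2_norm (laplacian ?g))\<^sup>2"
      by (rule power_mono[OF L2_add(2)[OF l]]) simp
    also have "\<dots> \<le> 2 * ((L2_norm (laplacian ?g))\<^sup>2 + (L2_norm (laplacian ?f))\<^sup>2)"
      using sum_squares_bound[of "L2_norm (laplacian ?f)" "L2_norm (laplacian ?g)"] by (simp add: power2_sum)
    finally show ?thesis by simp
  qed
  moreover have "(t2 - t1) * (L2_norm ?v)\<^sup>2 / 2 \<le> (t2 - t1) * ((L2_norm (laplacian ?g))\<^sup>2 + (L2_norm (laplacian ?f))\<^sup>2)"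
    unfolding times_divide_eq_right[symmetric] by (rule mult_left_mono[OF *]) (use t in simp)
  ultimately show ?thesis
    using increment_inner_le[OF t v] by linarith
qed

end

lemma time_deriv_imp_weak_time_derivative:
  fixes u :: "real \<Rightarrow> 'a::euclidean_space \<Rightarrow> 'b::euclidean_space"
  assumes H1: "continuous_H1 {a..b} u" and d: "time_deriv_L2_L2 a b u"
  obtains w where "weak_time_derivative a b u w"
proof -
  obtain w :: "real \<Rightarrow> 'a \<Rightarrow> 'b" where w: "(\<lambda>z. w (fst z) (snd z)) \<in> borel_measurable borel"
      "set_integrable lborel ({a<..<b} \<times> UNIV) (\<lambda>z. (norm (w (fst z) (snd z)))\<^sup>2)"
    and weak: "\<And>\<psi>. test_function ({a<..<b} \<times> UNIV) \<psi> \<Longrightarrow>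
      (\<integral>t. (\<integral>x. partial_deriv (1, 0) \<psi> (t, x) *\<^sub>R u t x \<partial>lborel) \<partial>lborel) = - (\<integral>t. (\<integral>x. \<psi> (t, x) *\<^sub>R w t x \<partial>lborel) \<partial>lborel)"
    using d unfolding time_deriv_L2_L2_def
    by (elim exE conjE) (rule that, assumption, assumption, drule spec, erule mp, assumption)
  note [measurable] = borel_pair_arg[OF w(1)]
  let ?w = "\<lambda>t x. indicator {a<..<b} t *\<^sub>R w t x"
  have "weak_time_derivative a b u ?w"
  proof
    show "(\<lambda>z. ?w (fst z) (snd z)) \<in> borel_measurable borel" unfolding borel_prod[symmetric] by measurable
    have "indicator ({a<..<b} \<times> UNIV) z *\<^sub>R (norm (w (fst z) (snd z)))\<^sup>2 = (case z of (t, x) \<Rightarrow> (norm (?w t x))\<^sup>2)" for z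
      by (cases z) (auto simp: indicator_def)
    then show "integrable (lborel \<Otimes>\<^sub>M lborel) (\<lambda>(t, x). (norm (?w t x))\<^sup>2)"
      using w(2) unfolding set_integrable_def lborel_prod by simp
    show "?w t x = 0" if "t \<notin> {a<..<b}" for t x using that by simp
    fix \<theta> and \<rho> :: "'a \<Rightarrow> real" assume \<theta>: "test_function {a<..<b} \<theta>" and \<rho>: "test_function UNIV \<rho>"
    have \<theta>0: "\<theta> t = 0" if "t \<notin> {a<..<b}" for t
      using \<theta> that closure_subset[of "{t. \<theta> t \<noteq> 0}"] unfolding test_function_def by blast
    have eq: "(\<theta> t * \<rho> x) *\<^sub>R w t x = \<theta> t *\<^sub>R (\<rho> x *\<^sub>R ?w t x)" for t x
      using \<theta>0[of t] by (cases "t \<in> {a<..<b}") auto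
    have "(\<integral>t. (\<integral>x. \<theta> t *\<^sub>R (\<rho> x *\<^sub>R ?w t x) \<partial>lborel) \<partial>lborel) = - (\<integral>t. (\<integral>x. partial_deriv 1 \<theta> t *\<^sub>R (\<rho> x *\<^sub>R u t x) \<partial>lborel) \<partial>lborel)"
      using weak[OF test_function_product(1)[OF \<theta> \<rho>]]
      by (simp only: test_function_product(2)[OF \<theta> \<rho>] fst_conv snd_conv eq scaleR_scaleR minus_minus)
    then show "(\<integral>t. partial_deriv 1 \<theta> t *\<^sub>R (\<integral>x. \<rho> x *\<^sub>R u t x \<partial>lborel) \<partial>lborel) = - (\<integral>t. \<theta> t *\<^sub>R (\<integral>x. \<rho> x *\<^sub>R ?w t x \<partial>lborel) \<partial>lborel)"
      by (simp only: integral_scaleR_right minus_minus)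
  qed (rule H1)
  then show thesis by (rule that)
qed

lemma laplacian_norm_le:
  fixes f :: "'a::euclidean_space \<Rightarrow> 'b::euclidean_space"
  assumes f: "sobolev 2 f"
  shows "L2_norm (laplacian f) \<le> real DIM('a) * sobolev_norm 2 f"
proof -
  have le: "L2_norm (weak_deriv i (weak_deriv i f)) \<le> sobolev_norm 2 f" if i: "i \<in> Basis" for i
  proof (rule power2_le_imp_le)
    have "(L2_norm (weak_deriv i (weak_deriv i f)))\<^sup>2 \<le> (\<Sum>j\<in>Basis. (L2_norm (weak_deriv j (weak_deriv i f)))\<^sup>2)"
      by (rule member_le_sum[OF i]) auto
    also have "\<dots> \<le> sobolev_norm_sq 1 (weak_deriv i f)" by simp
    also have "\<dots> \<le> (\<Sum>j\<in>Basis. sobolev_norm_sq 1 (weak_deriv j f))"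
      by (rule member_le_sum[OF i]) (auto intro: sobolev_norm_sq_nonneg simp del: sobolev_norm_sq.simps)
    also have "\<dots> \<le> (sobolev_norm 2 f)\<^sup>2"
      using sobolev_norm_sq.simps(2)[of 1 f] unfolding sobolev_norm_power2 Suc_1 by (simp del: sobolev_norm_sq.simps)
    finally show "(L2_norm (weak_deriv i (weak_deriv i f)))\<^sup>2 \<le> (sobolev_norm 2 f)\<^sup>2" .
  qed simp
  have "L2_norm (laplacian f) \<le> (\<Sum>i\<in>Basis. L2_norm (weak_deriv i (weak_deriv i f)))"
    unfolding laplacian_def[abs_def]
    using L2_sum[of Basis "\<lambda>i. weak_deriv i (weak_deriv i f)"] sobolev_1D(2)[OF sobolev_2D(2)[OF f]] by auto
  also have "\<dots> \<le> (\<Sum>i\<in>(Basis::'a set). sobolev_norm 2 f)" by (rule sum_mono) (rule le)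
  finally show ?thesis by simp
qed

lemma absolutely_integrable_borel_version:
  fixes f :: "real \<Rightarrow> real"
  assumes "f absolutely_integrable_on S"
  obtains g where "integrable lborel g" "AE x in lborel. x \<in> S \<longrightarrow> f x = g x"
proof -
  let ?f = "\<lambda>x. indicator S x *\<^sub>R f x"
  have i: "integrable lebesgue ?f" using assms by (simp add: set_integrable_def)
  then obtain g where g: "g \<in> borel_measurable lborel" "AE x in lborel. ?f x = g x"
    using completion_ex_borel_measurable_real[of ?f lborel] by blast
  have "integrable lebesgue g"
    using i by (rule integrable_cong_AE_imp) (use g in \<open>auto intro: measurable_completion AE_completion elim: eventually_mono\<close>)
  then have "integrable lborel g" using integrable_completion[OF g(1)] by simp
  moreover have "AE x in lborel. x \<in> S \<longrightarrow> f x = g x" using g(2) by eventually_elim auto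
  ultimately show thesis by (rule that)
qed

text \<open>
  The bound in \<open>dirichlet_energy_increment_le\<close> involves the Laplacian at the two end times, hence it holds
  for almost all times only. Averaging turns it into an integral (\<open>AE_increments_imp_increments\<close>); the
  squared \<open>H\<^sup>2\<close> norm, which is Lebesgue measurable in time, is replaced by a Borel version for this.
\<close>

lemma dirichlet_energy_increments:
  fixes u :: "real \<Rightarrow> 'a::euclidean_space \<Rightarrow> 'b::euclidean_space"
  defines "E \<equiv> \<lambda>t. (L2_norm (norm_grad (u t)))\<^sup>2"
  assumes H1: "continuous_H1 {0..T} u" and H2: "L2_H2 0 T u" and d: "time_deriv_L2_L2 0 T u"
  obtains G where "integrable lborel G" "\<And>x. 0 \<le> G x"
    "\<And>a b. 0 < a \<Longrightarrow> a \<le> b \<Longrightarrow> b < T \<Longrightarrow> \<bar>E b - E a\<bar> \<le> (\<integral>x. indicator {a..b} x * G x \<partial>lborel)"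
proof -
  obtain w where "weak_time_derivative 0 T u w" by (rule time_deriv_imp_weak_time_derivative[OF H1 d])
  then interpret weak_time_derivative 0 T u w .
  obtain g where g: "integrable lborel g" "AE t in lborel. t \<in> {0<..<T} \<longrightarrow> (sobolev_norm 2 (u t))\<^sup>2 = g t"
    using H2 absolutely_integrable_borel_version unfolding L2_H2_def by blast
  have "AE t in lborel. t \<in> {0<..<T} \<longrightarrow> sobolev 2 (u t) \<and> (sobolev_norm 2 (u t))\<^sup>2 = g t"
    using H2 g(2) unfolding L2_H2_def by (auto elim: eventually_elim2)
  then obtain Z where Z: "Z \<in> null_sets lborel" "{t \<in> space lborel. \<not> (t \<in> {0<..<T} \<longrightarrow> sobolev 2 (u t) \<and> (sobolev_norm 2 (u t))\<^sup>2 = g t)} \<subseteq> Z"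
    unfolding eventually_ae_filter by blast
  define \<omega> where "\<omega> t = (\<integral>x. (norm (w t x))\<^sup>2 \<partial>lborel) / 2" for t
  define P where "P t = (real DIM('a))\<^sup>2 * \<bar>g t\<bar>" for t
  have i\<omega>: "integrable lborel \<omega>" "0 \<le> \<omega> t" for t
    using lborel_pair.integrable_fst[OF integrable] by (auto simp: \<omega>_def[abs_def])
  have iP: "integrable lborel P" "0 \<le> P t" for t using g(1) by (auto simp: P_def[abs_def])
  have lap: "(L2_norm (laplacian (u t)))\<^sup>2 \<le> P t" "sobolev 2 (u t)" if "0 < t" "t < T" "t \<notin> Z" for t
  proof -
    have t: "sobolev 2 (u t)" "(sobolev_norm 2 (u t))\<^sup>2 = g t" using that Z(2) by auto
    have "(L2_norm (laplacian (u t)))\<^sup>2 \<le> (real DIM('a) * sobolev_norm 2 (u t))\<^sup>2"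
      by (rule power_mono[OF laplacian_norm_le[OF t(1)]]) simp
    also have "\<dots> \<le> P t" using t(2) by (simp add: power_mult_distrib P_def mult_left_mono)
    finally show "(L2_norm (laplacian (u t)))\<^sup>2 \<le> P t" "sobolev 2 (u t)" using t(1) by auto
  qed
  have inc: "\<bar>E t - E r\<bar> \<le> (\<integral>x. indicator {r..t} x * \<omega> x \<partial>lborel) + (t - r) * (P r + P t)"
    if "0 < r" "r < t" "t < T" "r \<notin> Z" "t \<notin> Z" for r t
  proof -
    have "\<bar>E t - E r\<bar> \<le> (\<integral>x. indicator {r<..t} x * (\<integral>y. (norm (w x y))\<^sup>2 \<partial>lborel) \<partial>lborel) / 2
        + (t - r) * ((L2_norm (laplacian (u r)))\<^sup>2 + (L2_norm (laplacian (u t)))\<^sup>2)"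
      unfolding E_def using that lap(2)[of r] lap(2)[of t] by (intro dirichlet_energy_increment_le) auto
    also have "(\<integral>x. indicator {r<..t} x * (\<integral>y. (norm (w x y))\<^sup>2 \<partial>lborel) \<partial>lborel) / 2 = (\<integral>x. indicator {r<..t} x * \<omega> x \<partial>lborel)"
      unfolding \<omega>_def by (subst integral_divide_zero[symmetric]) simp
    also have "\<dots> \<le> (\<integral>x. indicator {r..t} x * \<omega> x \<partial>lborel)"
    proof (rule integral_mono)
      show "integrable lborel (\<lambda>x. indicator {r<..t} x * \<omega> x)" "integrable lborel (\<lambda>x. indicator {r..t} x * \<omega> x)"
        using integrable_mult_indicator[of "{r<..t}" lborel \<omega>] integrable_mult_indicator[of "{r..t}" lborel \<omega>] i\<omega>(1) by simp_all
    qed (auto simp: indicator_def i\<omega>(2))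
    also have "(t - r) * ((L2_norm (laplacian (u r)))\<^sup>2 + (L2_norm (laplacian (u t)))\<^sup>2) \<le> (t - r) * (P r + P t)"
      using that by (intro mult_left_mono add_mono lap) auto
    finally show ?thesis by simp
  qed
  have cont: "continuous_on {0<..<T} E"
    unfolding E_def by (rule continuous_on_subset[OF continuous_dirichlet_energy[OF H1]]) auto
  show thesis
  proof (rule that)
    show "integrable lborel (\<lambda>x. \<omega> x + 2 * P x)" using i\<omega> iP by simp
    show "0 \<le> \<omega> x + 2 * P x" for x using i\<omega>(2)[of x] iP(2)[of x] by simp
    show "\<bar>E b - E a\<bar> \<le> (\<integral>x. indicator {a..b} x * (\<omega> x + 2 * P x) \<partial>lborel)" if "0 < a" "a \<le> b" "b < T" for a b
      by (rule AE_increments_imp_increments[OF cont i\<omega> iP Z(1) inc that])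
  qed
qed

section \<open>A bound for the Dirichlet energy\<close>

text \<open>
  Gronwall's argument in the simplest form: once the remaining mass of \<open>\<Phi>\<close> is below one half, the
  maximum of \<open>E\<close> on \<open>[t\<^sub>0, t]\<close> exceeds \<open>E t\<^sub>0\<close> by at most half of itself.
\<close>

lemma gronwall_near_end:
  fixes E \<Phi> :: "real \<Rightarrow> real"
  assumes T: "0 < Tstar" and cont: "continuous_on {0<..<Tstar} E"
    and inc: "\<And>T. 0 < T \<Longrightarrow> T < Tstar \<Longrightarrow> \<exists>G. integrable lborel G \<and> (\<forall>x. 0 \<le> G x) \<and>
      (\<forall>a b. 0 < a \<longrightarrow> a \<le> b \<longrightarrow> b < T \<longrightarrow> \<bar>E b - E a\<bar> \<le> (\<integral>x. indicator {a..b} x * G x \<partial>lborel))"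
    and \<Phi>: "\<Phi> absolutely_integrable_on {0<..<Tstar}" "\<And>t. 0 \<le> \<Phi> t"
    and E: "\<And>t. 0 \<le> E t"
    and der: "AE t in lborel. t \<in> {0<..<Tstar} \<longrightarrow> (\<exists>D. (E has_real_derivative D) (at t) \<and> D \<le> \<Phi> t * E t)"
  obtains t0 where "0 < t0" "t0 < Tstar" "\<And>t. t0 \<le> t \<Longrightarrow> t < Tstar \<Longrightarrow> E t \<le> 2 * E t0"
proof -
  obtain N where N: "N \<in> null_sets lborel"
      "{t \<in> space lborel. \<not> (t \<in> {0<..<Tstar} \<longrightarrow> (\<exists>D. (E has_real_derivative D) (at t) \<and> D \<le> \<Phi> t * E t))} \<subseteq> N"
    using der unfolding eventually_ae_filter by blast
  have I: "\<Phi> integrable_on {0..Tstar}"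
    using set_lebesgue_integral_eq_integral(1)[OF \<Phi>(1)] by (simp add: integrable_on_Icc_iff_Ioo)
  have "continuous_on {0..Tstar} (\<lambda>x. integral {x..Tstar} \<Phi>)" by (rule indefinite_integral_continuous_1'[OF I])
  then have "((\<lambda>x. integral {x..Tstar} \<Phi>) \<longlongrightarrow> integral {Tstar..Tstar} \<Phi>) (at Tstar within {0..Tstar})"
    unfolding continuous_on_def by (rule bspec) (use T in simp)
  then have "eventually (\<lambda>x. integral {x..Tstar} \<Phi> < 1 / 2) (at Tstar within {0..Tstar})"
    by (rule order_tendstoD) simp
  then obtain \<delta> where \<delta>: "\<delta> > 0" "\<And>x. x \<in> {0..Tstar} \<Longrightarrow> x \<noteq> Tstar \<Longrightarrow> dist x Tstar < \<delta> \<Longrightarrow> integral {x..Tstar} \<Phi> < 1 / 2"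
    unfolding eventually_at by blast
  define t0 where "t0 = max (Tstar / 2) (Tstar - \<delta> / 2)"
  have t0: "0 < t0" "t0 < Tstar" using T \<delta>(1) by (auto simp: t0_def)
  have half: "integral {t0..Tstar} \<Phi> < 1 / 2" using t0 \<delta>(1) by (intro \<delta>(2)) (auto simp: t0_def dist_real_def)
  have "E t \<le> 2 * E t0" if t: "t0 \<le> t" "t < Tstar" for t
  proof -
    have "\<exists>m\<in>{t0..t}. \<forall>x\<in>{t0..t}. E x \<le> E m"
      using t t0 by (intro continuous_attains_sup compact_Icc continuous_on_subset[OF cont]) auto
    then obtain m where m: "t0 \<le> m" "m \<le> t" "\<And>x. t0 \<le> x \<Longrightarrow> x \<le> t \<Longrightarrow> E x \<le> E m" by auto
    obtain G where G: "integrable lborel G" "\<And>x. 0 \<le> G x"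
        "\<And>a b. 0 < a \<Longrightarrow> a \<le> b \<Longrightarrow> b < (m + Tstar) / 2 \<Longrightarrow> \<bar>E b - E a\<bar> \<le> (\<integral>x. indicator {a..b} x * G x \<partial>lborel)"
      using inc[of "(m + Tstar) / 2"] t t0 m by auto
    have Im: "\<Phi> integrable_on {t0..m}" using I by (rule integrable_on_subinterval) (use t0 m t in auto)
    have "E m - E t0 \<le> integral {t0..m} (\<lambda>x. \<Phi> x * E m)"
    proof (rule increment_le_integral[OF m(1) G(1,2) _ N(1)])
      show "\<bar>E d - E c\<bar> \<le> (\<integral>x. indicator {c..d} x * G x \<partial>lborel)" if "t0 \<le> c" "c \<le> d" "d \<le> m" for c d
        using that t0 t m(2) by (intro G(3)) auto
      show "\<exists>D. (E has_real_derivative D) (at x) \<and> D \<le> \<Phi> x * E m" if x: "x \<in> {t0..m}" "x \<notin> N" for x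
      proof -
        have "x \<in> {0<..<Tstar}" using x t0 t m(2) by auto
        then obtain D where D: "(E has_real_derivative D) (at x)" "D \<le> \<Phi> x * E x" using N(2) x(2) by auto
        have "E x \<le> E m" using x m by auto
        then have "D \<le> \<Phi> x * E m" using D(2) mult_left_mono[OF _ \<Phi>(2)[of x], of "E x" "E m"] by linarith
        then show ?thesis using D(1) by blast
      qed
      show "(\<lambda>x. \<Phi> x * E m) integrable_on {t0..m}" by (rule integrable_on_mult_left[OF Im])
    qed
    also have "\<dots> = integral {t0..m} \<Phi> * E m" by simp
    also have "\<dots> \<le> (1 / 2) * E m"
    proof (rule mult_right_mono[OF _ E])
      have "integral {t0..m} \<Phi> \<le> integral {t0..Tstar} \<Phi>"
        by (rule integral_subset_le) (use m t Im integrable_on_subinterval[OF I] t0 \<Phi>(2) in auto)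
      then show "integral {t0..m} \<Phi> \<le> 1 / 2" using half by simp
    qed
    finally show ?thesis using m(3)[of t] t by simp
  qed
  then show thesis using that t0 by blast
qed

text \<open>
  The relation between the exponents says \<open>2/q = 1 - \<sigma>\<close> for \<open>\<sigma> = s + d/p\<close>. For \<open>p = \<infinity>\<close> the quotient \<open>d/p\<close> is
  \<open>0\<close> in the extended reals.
\<close>

lemma critical_exponents:
  fixes s q d :: real and p :: ereal
  assumes s: "0 < s" "s < 1" and d: "1 \<le> d" and p: "ereal (d / (1 - s)) < p"
    and eq: "ereal (2 / q) + ereal d / p = ereal (1 - s)"
  shows "1 \<le> p" and "s + real_of_ereal (ereal d / p) < 1" and "2 / (1 - (s + real_of_ereal (ereal d / p))) = q"
proof -
  have "1 \<le> d / (1 - s)" using s d by simp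
  then have "1 \<le> ereal (d / (1 - s))" by simp
  then show 1: "1 \<le> p" using p by (meson le_less_trans less_imp_le)
  have *: "s + real_of_ereal (ereal d / p) < 1 \<and> 2 / q = 1 - (s + real_of_ereal (ereal d / p))"
  proof (cases p)
    case (real r)
    have r: "d / (1 - s) < r" using p real by simp
    have "0 < r" using 1 real by (simp add: one_ereal_def)
    moreover have "d < r * (1 - s)" using r s by (simp add: pos_divide_less_eq)
    ultimately have "d / r < 1 - s" by (simp add: pos_divide_less_eq mult.commute)
    then show ?thesis using eq real \<open>0 < r\<close> by simp
  next
    case PInf
    then show ?thesis using eq s by simp
  qed (use 1 in simp)
  then show "s + real_of_ereal (ereal d / p) < 1" by simp
  have "2 / (2 / q) = q" by simp
  then show "2 / (1 - (s + real_of_ereal (ereal d / p))) = q" using * by metis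
qed

text \<open>
  For almost every time \<open>absorbed_estimate\<close> applies to \<open>u t\<close>. With the constant of the dissipation as \<open>c\<close> it
  turns the energy inequality into \<open>E' \<le> \<Phi> E\<close> with \<open>\<Phi> = C (1 + n\<^sup>q)\<close>.
\<close>

lemma dirichlet_energy_bounded_near_end:
  fixes chi phi :: "'a::euclidean_space \<Rightarrow> real" and u :: "real \<Rightarrow> 'a \<Rightarrow> 'b::euclidean_space"
  assumes lp: "littlewood_paley chi phi" and reg: "regularity_class 0 Tstar u" and T: "Tstar > 0"
    and s: "0 < s" "s < 1" and p: "ereal (real DIM('a) / (1 - s)) < p"
    and eq: "ereal (2 / q) + ereal (real DIM('a)) / p = ereal (1 - s)"
    and besov: "Lq_besov chi phi q (- s) p 0 Tstar u"
    and c: "c > 0" "c' > 0"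
    and energy: "AE t in lborel. t \<in> {0<..<Tstar} \<longrightarrow>
           (\<exists>D. ((\<lambda>r. (L2_norm (norm_grad (u r)))\<^sup>2) has_real_derivative D) (at t) \<and>
              ereal (D + c * (L2_norm (laplacian (u t)))\<^sup>2) \<le>
              ereal c' * enn2ereal (\<integral>\<^sup>+ x. ennreal ((norm (u t x))\<^sup>2 * (norm_grad (u t) x)\<^sup>2) \<partial>lborel))"
  obtains t0 where "0 < t0" "t0 < Tstar"
    "\<And>t. t0 \<le> t \<Longrightarrow> t < Tstar \<Longrightarrow> (L2_norm (norm_grad (u t)))\<^sup>2 \<le> 2 * (L2_norm (norm_grad (u t0)))\<^sup>2"
proof -
  define E where "E t = (L2_norm (norm_grad (u t)))\<^sup>2" for t
  define n where "n t = enn2real (besov_norm chi phi (- s) p (u t))" for t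
  have d: "1 \<le> real DIM('a)" using DIM_positive[where 'a = 'a] by linarith
  note exps = critical_exponents[OF s d p eq]
  obtain C where C: "C \<ge> 0" and est: "\<And>f::'a \<Rightarrow> 'b. sobolev 2 f \<Longrightarrow> besov_norm chi phi (- s) p f < \<infinity> \<Longrightarrow>
      (\<integral>\<^sup>+ x. ennreal ((norm (f x))\<^sup>2 * (norm_grad f x)\<^sup>2) \<partial>lborel) < \<infinity> \<and>
      c' * enn2real (\<integral>\<^sup>+ x. ennreal ((norm (f x))\<^sup>2 * (norm_grad f x)\<^sup>2) \<partial>lborel) \<le>
      c * (L2_norm (laplacian f))\<^sup>2 + C * (1 + enn2real (besov_norm chi phi (- s) p f) powr q) * (L2_norm (norm_grad f))\<^sup>2"
    using absorbed_estimate[OF lp s(1) exps(1,2) c, where 'b = 'b] unfolding exps(3) by blast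
  have H2: "AE t in lborel. t \<in> {0<..<Tstar} \<longrightarrow> sobolev 2 (u t)"
  proof -
    \<comment> \<open>the regularity is only known on \<open>(0, T)\<close> with \<open>T < Tstar\<close>; countably many \<open>T\<close> exhaust the interval\<close>
    let ?T = "\<lambda>k::nat. Tstar - Tstar / real (k + 2)"
    have "AE t in lborel. \<forall>k. t \<in> {0<..<?T k} \<longrightarrow> sobolev 2 (u t)"
      unfolding AE_all_countable
    proof
      fix k :: nat
      have "Tstar * 1 < Tstar * real (k + 2)" using T by (intro mult_strict_left_mono) auto
      then have "Tstar / real (k + 2) < Tstar" by (subst pos_divide_less_eq) auto
      then have "?T k \<in> {0<..<Tstar}" using T by auto
      then show "AE t in lborel. t \<in> {0<..<?T k} \<longrightarrow> sobolev 2 (u t)"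
        using reg unfolding regularity_class_def L2_H2_def by blast
    qed
    then show ?thesis
    proof eventually_elim
      case (elim t)
      show ?case
      proof
        assume t: "t \<in> {0<..<Tstar}"
        obtain k :: nat where "Tstar / (Tstar - t) < real k" using reals_Archimedean2 by blast
        then have "Tstar / (Tstar - t) < real (k + 2)" by simp
        then have "Tstar / real (k + 2) < Tstar - t" using t by (simp add: field_simps)
        then have "t \<in> {0<..<?T k}" using t by auto
        then show "sobolev 2 (u t)" using elim by blast
      qed
    qed
  qed
  have der: "AE t in lborel. t \<in> {0<..<Tstar} \<longrightarrow>
      (\<exists>D. (E has_real_derivative D) (at t) \<and> D \<le> (C * (1 + n t powr q)) * E t)"
    using energy H2 besov[unfolded Lq_besov_def, THEN conjunct1]
  proof eventually_elim
    case (elim t)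
    show ?case
    proof
      assume t: "t \<in> {0<..<Tstar}"
      let ?I = "\<integral>\<^sup>+ x. ennreal ((norm (u t x))\<^sup>2 * (norm_grad (u t) x)\<^sup>2) \<partial>lborel"
      obtain D where D: "(E has_real_derivative D) (at t)"
          "ereal (D + c * (L2_norm (laplacian (u t)))\<^sup>2) \<le> ereal c' * enn2ereal ?I"
        using elim t unfolding E_def[abs_def] by blast
      have "sobolev 2 (u t)" "besov_norm chi phi (- s) p (u t) < \<infinity>" using elim(2,3) t by blast+
      note I = est[OF this, folded n_def E_def]
      have "enn2ereal ?I = ereal (enn2real ?I)"
        by (subst (1) ennreal_enn2real[OF I[THEN conjunct1, unfolded infinity_ennreal_def], symmetric]) (rule enn2ereal_ennreal[OF enn2real_nonneg])
      then have "D + c * (L2_norm (laplacian (u t)))\<^sup>2 \<le> c' * enn2real ?I" using D(2) by simp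
      then show "\<exists>D. (E has_real_derivative D) (at t) \<and> D \<le> (C * (1 + n t powr q)) * E t" using D(1) I[THEN conjunct2] by (intro exI[of _ D] conjI) linarith+
    qed
  qed
  have \<Phi>: "(\<lambda>t. C * (1 + n t powr q)) absolutely_integrable_on {0<..<Tstar}"
  proof -
    have "(\<lambda>t. n t powr q) absolutely_integrable_on {0<..<Tstar}" using besov by (simp add: Lq_besov_def n_def)
    moreover have "(\<lambda>t. 1 :: real) absolutely_integrable_on {0<..<Tstar}"
      by (intro absolutely_integrable_on_const) auto
    ultimately show ?thesis by (intro set_integrable_mult_right) (rule set_integral_add)
  qed
  have regT: "continuous_H1 {0..T} u" "L2_H2 0 T u" "time_deriv_L2_L2 0 T u" if "0 < T" "T < Tstar" for T
    using reg that by (auto simp: regularity_class_def)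
  have cont: "continuous_on {0<..<Tstar} E"
    unfolding continuous_on_eq_continuous_at[OF open_greaterThanLessThan]
  proof
    fix t assume t: "t \<in> {0<..<Tstar}"
    have "continuous_on {0<..<(t + Tstar) / 2} E"
      unfolding E_def[abs_def]
      by (rule continuous_on_subset[OF continuous_dirichlet_energy[OF regT(1)[of "(t + Tstar) / 2"]]]) (use t in auto)
    then show "isCont E t" by (rule continuous_on_interior) (use t in auto)
  qed
  obtain t0 where "0 < t0" "t0 < Tstar" "\<And>t. t0 \<le> t \<Longrightarrow> t < Tstar \<Longrightarrow> E t \<le> 2 * E t0"
  proof (rule gronwall_near_end[OF T cont _ \<Phi> _ _ der])
    fix T assume "0 < T" "T < Tstar"
    from dirichlet_energy_increments[OF regT[OF this]]
    show "\<exists>G. integrable lborel G \<and> (\<forall>x. 0 \<le> G x) \<and>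
        (\<forall>a b. 0 < a \<longrightarrow> a \<le> b \<longrightarrow> b < T \<longrightarrow> \<bar>E b - E a\<bar> \<le> (\<integral>x. indicator {a..b} x * G x \<partial>lborel))"
      unfolding E_def by metis
  qed (use C in \<open>auto simp: E_def\<close>)
  then show thesis using that unfolding E_def by blast
qed

section \<open>Uniqueness and continuation of solutions\<close>

lemma regularity_class_continuous_H1:
  assumes "regularity_class a b u" "a < b" shows "continuous_H1 {a..<b} u"
  unfolding continuous_H1_def
proof (intro conjI ballI)
  fix t assume t: "t \<in> {a..<b}"
  define T where "T = (t + b) / 2"
  have T: "T \<in> {a<..<b}" "t < T" using t by (auto simp: T_def)
  then have H: "continuous_H1 {a..T} u" using assms(1) unfolding regularity_class_def by blast
  have tT: "t \<in> {a..T}" using t T by auto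
  show "sobolev 1 (u t)" using H tT unfolding continuous_H1_def by blast
  have "at t within {a..T} = at t within {a..<b}"
    by (rule at_within_nhd[of t "{..<T}"]) (use T in auto)
  then show "((\<lambda>r. sobolev_norm 1 (\<lambda>x. u r x - u t x)) \<longlongrightarrow> 0) (at t within {a..<b})"
    using H tT unfolding continuous_H1_def by metis
qed

text \<open>
  The difference \<open>u t - v t\<close> equals \<open>(v r - v t) - (u r - u t)\<close> almost everywhere for \<open>r \<in> J\<close>, and both brackets tend to zero.
\<close>

lemma same_at_limit:
  assumes u: "continuous_H1 I u" and v: "continuous_H1 I v" and t: "t \<in> I"
    and J: "J \<subseteq> I" "same_on J u v" "t islimpt J"
  shows "AE x in lborel. u t x = v t x"
proof -
  have L: "L2 (u r)" "L2 (v r)" if "r \<in> I" for r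
    using u v that sobolev_1D(1) unfolding continuous_H1_def by blast+
  have le: "L2_norm (\<lambda>x. u t x - v t x) \<le> sobolev_norm 1 (\<lambda>x. u r x - u t x) + sobolev_norm 1 (\<lambda>x. v r x - v t x)" if r: "r \<in> J" for r
  proof -
    have rI: "r \<in> I" using r J by auto
    note m = L2_borel[OF L(1)[OF t]] L2_borel[OF L(2)[OF t]] L2_borel[OF L(1)[OF rI]] L2_borel[OF L(2)[OF rI]]
    have "L2_norm (\<lambda>x. u t x - v t x) = L2_norm (\<lambda>x. (v r x - v t x) - (u r x - u t x))"
      unfolding L2_norm_def
      by (intro arg_cong[of _ _ sqrt] integral_cong_AE) (use J(2) r m in \<open>auto simp: same_on_def elim!: eventually_mono\<close>)
    also have "\<dots> \<le> L2_norm (\<lambda>x. v r x - v t x) + L2_norm (\<lambda>x. u r x - u t x)"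
      by (intro L2_diff L L2_diff(1) t rI)
    also have "\<dots> \<le> sobolev_norm 1 (\<lambda>x. v r x - v t x) + sobolev_norm 1 (\<lambda>x. u r x - u t x)"
      by (intro add_mono L2_norm_le_sobolev_norm)
    finally show ?thesis by simp
  qed
  have "((\<lambda>r. sobolev_norm 1 (\<lambda>x. u r x - u t x) + sobolev_norm 1 (\<lambda>x. v r x - v t x)) \<longlongrightarrow> 0 + 0) (at t within J)"
    using u v t unfolding continuous_H1_def by (intro tendsto_add tendsto_within_subset[OF _ J(1)]) blast+
  then have "L2_norm (\<lambda>x. u t x - v t x) \<le> 0 + 0"
  proof (rule tendsto_lowerbound)
    show "\<forall>\<^sub>F r in at t within J. L2_norm (\<lambda>x. u t x - v t x) \<le> sobolev_norm 1 (\<lambda>x. u r x - u t x) + sobolev_norm 1 (\<lambda>x. v r x - v t x)"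
      unfolding eventually_at_filter by (rule always_eventually) (use le in blast)
    show "at t within J \<noteq> bot" using J(3) trivial_limit_within by blast
  qed
  then have "AE x in lborel. u t x - v t x = 0"
    using L2_norm_nonneg[of "\<lambda>x. u t x - v t x"] by (intro L2_norm_eq_0 L2_diff L t) linarith
  then show ?thesis by simp
qed

locale well_posed =
  fixes A :: "('a::euclidean_space \<Rightarrow> 'b::euclidean_space) set" and Sol :: "('a, 'b) solutions"
  assumes problem: "cauchy_problem A Sol" and local: "local_existence A Sol" and joint: "joint_property Sol"
begin

lemma solution:
  assumes "Sol a b u"
  shows "a < b" "regularity_class a b u" "t \<in> {a..<b} \<Longrightarrow> u t \<in> A" "continuous_H1 {a..<b} u"
    "t \<in> {a..<b} \<Longrightarrow> sobolev 1 (u t)"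
    "a \<le> a' \<Longrightarrow> a' < b' \<Longrightarrow> b' \<le> b \<Longrightarrow> Sol a' b' u"
proof -
  have *: "a < b \<and> regularity_class a b u \<and> (\<forall>t\<in>{a..<b}. u t \<in> A) \<and> (\<forall>a' b'. a \<le> a' \<and> a' < b' \<and> b' \<le> b \<longrightarrow> Sol a' b' u)"
    using problem assms unfolding cauchy_problem_def by blast
  then show "a < b" "regularity_class a b u" "t \<in> {a..<b} \<Longrightarrow> u t \<in> A" "a \<le> a' \<Longrightarrow> a' < b' \<Longrightarrow> b' \<le> b \<Longrightarrow> Sol a' b' u"
    by blast+
  show "continuous_H1 {a..<b} u" using * regularity_class_continuous_H1 by blast
  then show "t \<in> {a..<b} \<Longrightarrow> sobolev 1 (u t)" unfolding continuous_H1_def by blast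
qed

text \<open>
  The length \<open>T\<^sub>0(K)\<close> of the interval of local existence for data of norm at most \<open>K\<close>.
\<close>

definition existence_time :: "real \<Rightarrow> real" where
  "existence_time K = (SOME T\<^sub>0. T\<^sub>0 > 0 \<and> (\<forall>a\<ge>0. \<forall>u\<^sub>0\<in>A. sobolev 1 u\<^sub>0 \<and> sobolev_norm 1 u\<^sub>0 \<le> K \<longrightarrow>
     (\<exists>u. solves Sol a (a + T\<^sub>0) u\<^sub>0 u \<and> (\<forall>v. solves Sol a (a + T\<^sub>0) u\<^sub>0 v \<longrightarrow> same_on {a<..<a + T\<^sub>0} v u))))"

lemma existence_time:
  assumes "K > 0"
  shows "existence_time K > 0"
    and "0 \<le> a \<Longrightarrow> u\<^sub>0 \<in> A \<Longrightarrow> sobolev 1 u\<^sub>0 \<Longrightarrow> sobolev_norm 1 u\<^sub>0 \<le> K \<Longrightarrow>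
      \<exists>u. solves Sol a (a + existence_time K) u\<^sub>0 u \<and>
          (\<forall>v. solves Sol a (a + existence_time K) u\<^sub>0 v \<longrightarrow> same_on {a<..<a + existence_time K} v u)"
proof -
  have "\<exists>T\<^sub>0>0. \<forall>a\<ge>0. \<forall>u\<^sub>0\<in>A. sobolev 1 u\<^sub>0 \<and> sobolev_norm 1 u\<^sub>0 \<le> K \<longrightarrow>
      (\<exists>u. solves Sol a (a + T\<^sub>0) u\<^sub>0 u \<and> (\<forall>v. solves Sol a (a + T\<^sub>0) u\<^sub>0 v \<longrightarrow> same_on {a<..<a + T\<^sub>0} v u))"
    using local assms unfolding local_existence_def by (meson)
  from someI_ex[OF this, folded existence_time_def] show "existence_time K > 0"
    and "0 \<le> a \<Longrightarrow> u\<^sub>0 \<in> A \<Longrightarrow> sobolev 1 u\<^sub>0 \<Longrightarrow> sobolev_norm 1 u\<^sub>0 \<le> K \<Longrightarrow>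
      \<exists>u. solves Sol a (a + existence_time K) u\<^sub>0 u \<and>
          (\<forall>v. solves Sol a (a + existence_time K) u\<^sub>0 v \<longrightarrow> same_on {a<..<a + existence_time K} v u)"
    by blast+
qed

text \<open>
  Join \<open>u\<close> at time \<open>c\<close> to the local solution with data \<open>u c\<close>.
\<close>

lemma restart:
  assumes u: "Sol a b u" and c: "0 \<le> a" "a < c" "c < b" and K: "K > 0" "sobolev_norm 1 (u c) \<le> K"
  obtains v where "Sol a (c + existence_time K) v" "\<And>t. t < c \<Longrightarrow> v t = u t"
proof -
  have "c \<in> {a..<b}" using c by auto
  then obtain v where v: "solves Sol c (c + existence_time K) (u c) v"
    using existence_time(2)[OF K(1), of c "u c"] solution(3,5)[OF u] c K by (auto simp del: sobolev.simps)
  have "solves Sol a (c + existence_time K) (u a) (\<lambda>t. if t < c then u t else v t)"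
  proof (rule joint[unfolded joint_property_def, rule_format, OF c(1)], intro conjI)
    show "solves Sol a c (u a) u" using solution(6)[OF u, of a c] c by (simp add: solves_def)
    show "continuous_H1 {a..c} u" using solution(2)[OF u] c by (simp add: regularity_class_def)
    show "continuous_H1 {c..<c + existence_time K} v" using v solution(4) by (simp add: solves_def)
    show "c < c + existence_time K" using existence_time(1)[OF K(1)] by simp
  qed (use c v in auto)
  then show thesis by (intro that[of "\<lambda>t. if t < c then u t else v t"]) (auto simp: solves_def)
qed

text \<open>
  The local uniqueness statement compares solutions on the whole interval of length
  \<open>existence_time K\<close>, which may be longer than the common interval of \<open>u\<close> and \<open>v\<close>. Therefore both are
  first prolonged by restarting them at an intermediate time \<open>c\<close>, with \<open>K\<close> large enough for the
  values at time \<open>c\<close> as well.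
\<close>

lemma locally_unique:
  assumes u: "Sol a b u" and v: "Sol a b v" and a: "0 \<le> a" and eq: "AE x in lborel. u a x = v a x"
  obtains c where "a < c" "c < b" "same_on {a<..<c} u v"
proof -
  define c where "c = (a + b) / 2"
  have c: "a < c" "c < b" using solution(1)[OF u] by (auto simp: c_def)
  define K where "K = 1 + sobolev_norm 1 (u a) + sobolev_norm 1 (u c) + sobolev_norm 1 (v c)"
  have nn: "0 \<le> sobolev_norm 1 (u a)" "0 \<le> sobolev_norm 1 (u c)" "0 \<le> sobolev_norm 1 (v c)" by (rule sobolev_norm_nonneg)+
  then have K: "K > 0" "sobolev_norm 1 (u a) \<le> K" "sobolev_norm 1 (u c) \<le> K" "sobolev_norm 1 (v c) \<le> K"
    unfolding K_def by linarith+
  let ?T = "existence_time K"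
  have T: "?T > 0" by (rule existence_time(1)[OF K(1)])
  obtain u' where u': "Sol a (c + ?T) u'" "\<And>t. t < c \<Longrightarrow> u' t = u t" by (rule restart[OF u a c K(1,3)]) (rule that)
  obtain v' where v': "Sol a (c + ?T) v'" "\<And>t. t < c \<Longrightarrow> v' t = v t" by (rule restart[OF v a c K(1,4)]) (rule that)
  have "a \<in> {a..<b}" using c by auto
  then obtain z where z: "\<And>y. solves Sol a (a + ?T) (u a) y \<Longrightarrow> same_on {a<..<a + ?T} y z"
    using existence_time(2)[OF K(1) a solution(3,5)[OF u] K(2)] by metis
  have "Sol a (a + ?T) u'" "Sol a (a + ?T) v'"
    using solution(6)[OF u'(1), of a "a + ?T"] solution(6)[OF v'(1), of a "a + ?T"] T c by auto
  then have "solves Sol a (a + ?T) (u a) u'" "solves Sol a (a + ?T) (u a) v'"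
    using u'(2)[OF c(1)] v'(2)[OF c(1)] eq by (auto simp: solves_def elim!: eventually_mono)
  then have s: "same_on {a<..<a + ?T} u' z" "same_on {a<..<a + ?T} v' z" by (auto intro: z)
  have "same_on {a<..<min c (a + ?T)} u v"
    unfolding same_on_def
  proof
    fix t assume t: "t \<in> {a<..<min c (a + ?T)}"
    then have "AE x in lborel. u' t x = z t x" "AE x in lborel. v' t x = z t x" using s by (auto simp: same_on_def)
    then show "AE x in lborel. u t x = v t x" using u'(2)[of t] v'(2)[of t] t by (auto elim: eventually_elim2)
  qed
  then show thesis using that[of "min c (a + ?T)"] c T by auto
qed

text \<open>
  Consider the infimum of the times at which \<open>u\<close> and \<open>v\<close> differ. They agree at that time by continuity, hence
  for a short while after it by local uniqueness.
\<close>

lemma solution_unique: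
  assumes u: "Sol a b u" and v: "Sol a b v" and a: "0 \<le> a" and eq: "AE x in lborel. u a x = v a x"
  shows "same_on {a..<b} u v"
proof (rule ccontr)
  define G where "G = {t \<in> {a..<b}. \<not> (AE x in lborel. u t x = v t x)}"
  assume "\<not> same_on {a..<b} u v"
  then have ne: "G \<noteq> {}" by (auto simp: G_def same_on_def)
  have bdd: "bdd_below G" by (rule bdd_belowI[of _ a]) (auto simp: G_def)
  define T where "T = Inf G"
  have Ta: "a \<le> T" unfolding T_def by (rule cInf_greatest[OF ne]) (auto simp: G_def)
  have Tl: "T \<le> t" if "t \<in> G" for t unfolding T_def by (rule cInf_lower[OF that bdd])
  obtain g where "g \<in> G" using ne by blast
  then have Tb: "T < b" using Tl[of g] by (auto simp: G_def)
  have before: "same_on {a..<T} u v"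
    unfolding same_on_def using Tl Tb by (force simp: G_def)
  have at: "AE x in lborel. u T x = v T x"
  proof (cases "T = a")
    case False
    then have aT: "a < T" using Ta by simp
    show ?thesis
    proof (rule same_at_limit[OF solution(4)[OF u] solution(4)[OF v] _ _ before])
      show "T islimpt {a..<T}" using aT by (simp add: islimpt_Ico)
    qed (use Tb Ta in auto)
  qed (use eq in simp)
  have Sols: "Sol T b u" "Sol T b v" using solution(6)[OF u Ta Tb] solution(6)[OF v Ta Tb] by auto
  obtain c where c: "T < c" "c < b" "same_on {T<..<c} u v"
    by (rule locally_unique[OF Sols order_trans[OF a Ta] at])
  have "c \<le> t" if t: "t \<in> G" for t
  proof (rule ccontr)
    assume "\<not> c \<le> t"
    then have "t = T \<or> t \<in> {T<..<c}" using Tl[OF t] by auto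
    then show False using at c(3) t by (auto simp: G_def same_on_def)
  qed
  then have "c \<le> T" unfolding T_def by (intro cInf_greatest[OF ne])
  then show False using c(1) by simp
qed

text \<open>
  Restart from a time \<open>c\<close> with \<open>Tstar - c\<close> at most half of the existence time for the bound \<open>K\<close>. Since
  solutions have values up to the initial time, agreement on the open interval extends to time \<open>0\<close>, from where
  uniqueness carries it to all of the longer interval.
\<close>

lemma continuation:
  assumes u: "Sol 0 Tstar u" and t0: "0 < t0" "t0 < Tstar"
    and bound: "\<And>t. t0 \<le> t \<Longrightarrow> t < Tstar \<Longrightarrow> sobolev_norm 1 (u t) \<le> K"
  shows "\<exists>T>Tstar. \<exists>v. Sol 0 T v \<and> same_on {0<..<Tstar} v u \<and>
           (\<forall>w. Sol 0 T w \<and> same_on {0<..<Tstar} w u \<longrightarrow> same_on {0<..<T} w v)"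
proof -
  let ?T = "existence_time (max K 1)"
  have T: "?T > 0" by (rule existence_time(1)) simp
  define c where "c = max t0 (Tstar - ?T / 2)"
  have c: "t0 \<le> c" "c < Tstar" "Tstar < c + ?T" using t0 T by (auto simp: c_def)
  obtain v where v: "Sol 0 (c + ?T) v" "\<And>t. t < c \<Longrightarrow> v t = u t"
    by (rule restart[OF u order_refl, of c "max K 1"]) (use c t0 bound[of c] in auto)
  have "Sol 0 Tstar v" using solution(6)[OF v(1), of 0 Tstar] c t0 by auto
  then have "same_on {0..<Tstar} v u"
    by (rule solution_unique[OF _ u order_refl]) (use v(2)[of 0] c t0 in simp)
  then have vu: "same_on {0<..<Tstar} v u" by (simp add: same_on_def)
  have "same_on {0<..<c + ?T} w v" if w: "Sol 0 (c + ?T) w" "same_on {0<..<Tstar} w u" for w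
  proof -
    have wv: "same_on {0<..<Tstar} w v"
      unfolding same_on_def
    proof
      fix t assume "t \<in> {0<..<Tstar}"
      then have "AE x in lborel. w t x = u t x" "AE x in lborel. v t x = u t x" using w(2) vu by (auto simp: same_on_def)
      then show "AE x in lborel. w t x = v t x" by (auto elim: eventually_elim2)
    qed
    have "AE x in lborel. w 0 x = v 0 x"
      by (rule same_at_limit[OF solution(4)[OF w(1)] solution(4)[OF v(1)] _ _ wv])
        (use c t0 in \<open>auto simp: islimpt_greaterThanLessThan1\<close>)
    then have "same_on {0..<c + ?T} w v" by (rule solution_unique[OF w(1) v(1) order_refl])
    then show ?thesis by (simp add: same_on_def)
  qed
  then show ?thesis using c(3) v(1) vu by blast
qed

end

theorem theorem1p1:
  fixes chi phi :: "'a::euclidean_space \<Rightarrow> real"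
    and A :: "('a \<Rightarrow> 'b::euclidean_space) set"
    and Sol :: "real \<Rightarrow> real \<Rightarrow> (real \<Rightarrow> 'a \<Rightarrow> 'b) \<Rightarrow> bool"
    and u :: "real \<Rightarrow> 'a \<Rightarrow> 'b"
    and Tstar s q :: real and p :: ereal
  assumes "littlewood_paley chi phi"
    and "cauchy_problem A Sol"
    and "local_existence A Sol"
    and "joint_property Sol"
    and "basic_energy Sol"
    and "first_energy_inequality Sol"
    and "Tstar > 0"
    and "Sol 0 Tstar u"
    and "s \<in> {0<..<1}"
    and "p \<in> {ereal (real DIM('a) / (1 - s))<..\<infinity>}"
    and "ereal (2 / q) + ereal (real DIM('a)) / p = ereal (1 - s)"
    and "Lq_besov chi phi q (- s) p 0 Tstar u"
  shows "\<exists>T>Tstar. \<exists>v. Sol 0 T v \<and> same_on {0<..<Tstar} v u \<and>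
           (\<forall>w. Sol 0 T w \<and> same_on {0<..<Tstar} w u \<longrightarrow> same_on {0<..<T} w v)"
proof -
  interpret well_posed A Sol by unfold_locales (use assms in auto)
  note u = \<open>Sol 0 Tstar u\<close>
  obtain c c' where c: "c > 0" "c' > 0"
    and energy: "\<And>T u. Sol 0 T u \<Longrightarrow> AE t in lborel. t \<in> {0<..<T} \<longrightarrow>
           (\<exists>D. ((\<lambda>r. (L2_norm (norm_grad (u r)))\<^sup>2) has_real_derivative D) (at t) \<and>
              ereal (D + c * (L2_norm (laplacian (u t)))\<^sup>2) \<le>
              ereal c' * enn2ereal (\<integral>\<^sup>+ x. ennreal ((norm (u t x))\<^sup>2 * (norm_grad (u t) x)\<^sup>2) \<partial>lborel))"
    using \<open>first_energy_inequality Sol\<close> unfolding first_energy_inequality_def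
    by (elim exE conjE) (rule that, assumption, assumption, drule spec, drule spec, erule mp, assumption)
  obtain t0 where t0: "0 < t0" "t0 < Tstar"
      "\<And>t. t0 \<le> t \<Longrightarrow> t < Tstar \<Longrightarrow> (L2_norm (norm_grad (u t)))\<^sup>2 \<le> 2 * (L2_norm (norm_grad (u t0)))\<^sup>2"
    by (rule dirichlet_energy_bounded_near_end[OF assms(1) solution(2)[OF u] assms(7) _ _ _ assms(11,12) c energy[OF u]])
      (use assms(9,10) in auto)
  obtain M where M: "mono_on {0..} M" "\<And>t r. t \<in> {0<..<Tstar} \<Longrightarrow> r \<in> {0..t} \<Longrightarrow> L2_norm (u r) \<le> M t"
  proof -
    have s: "solves Sol 0 Tstar (u 0) u" using u by (simp add: solves_def)
    from \<open>basic_energy Sol\<close>[unfolded basic_energy_def, rule_format, of "u 0"] obtain M where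
      M: "continuous_on {0..} M \<and> mono_on {0..} M \<and>
        (\<forall>T v. solves Sol 0 T (u 0) v \<longrightarrow> (\<forall>t\<in>{0<..<T}. \<forall>r\<in>{0..t}. L2_norm (v r) \<le> M t))"
      by (rule exE)
    show thesis
      by (rule that[of M]) (use M s in blast)+
  qed
  define K where "K = sqrt ((M Tstar)\<^sup>2 + 2 * (L2_norm (norm_grad (u t0)))\<^sup>2)"
  have "sobolev_norm 1 (u t) \<le> K" if t: "t0 \<le> t" "t < Tstar" for t
    unfolding K_def
  proof (rule real_le_rsqrt)
    have "L2_norm (u t) \<le> M t" using M(2)[of t t] t t0 by auto
    also have "M t \<le> M Tstar" using t t0 by (intro mono_onD[OF M(1)]) auto
    finally have "(L2_norm (u t))\<^sup>2 \<le> (M Tstar)\<^sup>2" by (rule power_mono) simp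
    moreover have "sobolev 1 (u t)" using solution(5)[OF u, of t] t t0 by auto
    ultimately show "(sobolev_norm 1 (u t))\<^sup>2 \<le> (M Tstar)\<^sup>2 + 2 * (L2_norm (norm_grad (u t0)))\<^sup>2"
      using sobolev_norm_1[of "u t"] t0(3)[OF t] by simp
  qed
  then show ?thesis by (rule continuation[OF u t0(1,2)])
qed

end
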